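(* Let $\mathcal{M}$ be a semifinite von Neumann algebra with faithful normal semifinite trace $\tau_{\mathcal{M}}$, let $a$ be a closed densely defined operator affiliated with $\mathcal{M}$, let $\psi$ be an Orlicz function and let $\varphi_\psi$ be the fundamental function of $L^\psi(\mathbb{R})$ equipped with the Luxemburg norm. Then for every $\epsilon>0$, $$\lambda_\epsilon(a\otimes \varphi_\psi(e^t)) = \tau_{\mathcal{M}}(\psi(|a|/\epsilon)).$$
   Context: An Orlicz function is a convex function $\psi:[0,\infty)\to[0,\infty]$ with $\psi(0)=0$, $\lim_{u\to\infty}\psi(u)=\infty$, neither identically zero nor infinite valued on all of $(0,\infty)$, and left continuous at $b_\psi=\sup\{u>0:\psi(u)<\infty\}$. Put $\psi^{-1}(t)=\sup\{s:\psi(s)\le t\}$. The fundamental function of $L^\psi(\mathbb{R})$ with the Luxemburg norm is $\varphi_\psi(t)=1/\psi^{-1}(1/t)$ for $t>0$, $\varphi_\psi(0)=0$. The crossed product $\mathcal{A}=\mathcal{M}\rtimes\mathbb{R}$ of $\mathcal{M}$ by the modular group of $\tau_{\mathcal{M}}$ is identified (via Fourier transform) with the von Neumann algebra tensor product $\mathcal{M}\otimes L^\infty(\mathbb{R})$, and its canonical trace with $\tau_{\mathcal{A}}=\tau_{\mathcal{M}}\otimes\int_{\mathbb{R}}\cdot\,e^{-t}dt$. For a function $f$ on $(0,\infty)$, $f(e^t)$ denotes (multiplication by) the function $t\mapsto f(e^t)$ on $\mathbb{R}$, so that $a\otimes\varphi_\psi(e^t)$ is an operator affiliated with $\mathcal{M}\otimes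 L^\infty(\mathbb{R})$. The distribution function is $\lambda_\epsilon(x)=\tau_{\mathcal{A}}(\chi_{(\epsilon,\infty)}(|x|))$. The operator $\psi(|a|/\epsilon)$ is understood as an element of the extended positive part of $\mathcal{M}$ (to which $\tau_{\mathcal{M}}$ is canonically extended); both sides may equal $\infty$. *)

theory Defs
  imports "HOL-Analysis.Analysis"
begin

section \<open>Complex Hilbert spaces\<close>

text \<open>The real inner product, norm and topology are those of the library; \<open>cinner_Re\<close> ties them to
  the complex structure. The complex inner product is linear in its second argument.\<close>

class chilbert = real_inner + complete_space +
  fixes scaleC :: "complex \<Rightarrow> 'a \<Rightarrow> 'a" (infixr \<open>*\<^sub>C\<close> 75)
    and cinner :: "'a \<Rightarrow> 'a \<Rightarrow> complex"
  assumes scaleC_add_right: "c *\<^sub>C (x + y) = c *\<^sub>C x + c *\<^sub>C y"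
    and scaleC_add_left: "(c + d) *\<^sub>C x = c *\<^sub>C x + d *\<^sub>C x"
    and scaleC_scaleC: "c *\<^sub>C d *\<^sub>C x = (c * d) *\<^sub>C x"
    and scaleR_scaleC: "r *\<^sub>R x = complex_of_real r *\<^sub>C x"
    and cinner_commute: "cinner x y = cnj (cinner y x)"
    and cinner_add_right: "cinner x (y + z) = cinner x y + cinner x z"
    and cinner_scaleC_right: "cinner x (c *\<^sub>C y) = c * cinner x y"
    and cinner_Re: "Re (cinner x y) = inner x y"

global_interpretation complex_vector: vector_space "scaleC :: complex \<Rightarrow> 'a \<Rightarrow> 'a::chilbert"
  defines csubspace = complex_vector.subspace
    and cspan = complex_vector.span
proof unfold_locales
  fix c d :: complex and x y :: 'a
  show "c *\<^sub>C (x + y) = c *\<^sub>C x + c *\<^sub>C y" by (rule scaleC_add_right)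
  show "(c + d) *\<^sub>C x = c *\<^sub>C x + d *\<^sub>C x" by (rule scaleC_add_left)
  show "c *\<^sub>C d *\<^sub>C x = (c * d) *\<^sub>C x" by (rule scaleC_scaleC)
  show "1 *\<^sub>C x = x" using scaleR_scaleC[of 1 x] by simp
qed

text \<open>The Hilbert space direct sum, in which graphs of operators live.\<close>

instantiation prod :: (chilbert, chilbert) chilbert
begin

definition scaleC_prod_def: "c *\<^sub>C x = (c *\<^sub>C fst x, c *\<^sub>C snd x)"

definition cinner_prod_def: "cinner x y = cinner (fst x) (fst y) + cinner (snd x) (snd y)"

instance
proof
  fix c d :: complex and r :: real and x y z :: "'a \<times> 'b"
  show "c *\<^sub>C (x + y) = c *\<^sub>C x + c *\<^sub>C y"
    by (simp add: scaleC_prod_def scaleC_add_right)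
  show "(c + d) *\<^sub>C x = c *\<^sub>C x + d *\<^sub>C x"
    by (simp add: scaleC_prod_def scaleC_add_left)
  show "c *\<^sub>C d *\<^sub>C x = (c * d) *\<^sub>C x"
    by (simp add: scaleC_prod_def scaleC_scaleC)
  show "r *\<^sub>R x = complex_of_real r *\<^sub>C x"
    by (simp add: scaleC_prod_def scaleR_prod_def scaleR_scaleC)
  show "cinner x y = cnj (cinner y x)"
    by (simp add: cinner_prod_def cinner_commute[of "fst x"] cinner_commute[of "snd x"])
  show "cinner x (y + z) = cinner x y + cinner x z"
    by (simp add: cinner_prod_def cinner_add_right)
  show "cinner x (c *\<^sub>C y) = c * cinner x y"
    by (simp add: cinner_prod_def scaleC_prod_def cinner_scaleC_right distrib_left)
  show "Re (cinner x y) = inner x y"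
    by (simp add: cinner_prod_def inner_prod_def cinner_Re)
qed

end


section \<open>Bounded operators and von Neumann algebras\<close>

type_synonym 'h op = "'h \<Rightarrow> 'h"

definition bounded_clinear :: "'h::chilbert op \<Rightarrow> bool" where
  "bounded_clinear x \<longleftrightarrow> bounded_linear x \<and> (\<forall>c \<xi>. x (c *\<^sub>C \<xi>) = c *\<^sub>C x \<xi>)"

definition cadj :: "'h::chilbert op \<Rightarrow> 'h op" where
  "cadj x = (THE y. \<forall>\<xi> \<eta>. cinner (x \<xi>) \<eta> = cinner \<xi> (y \<eta>))"

definition positive_op :: "'h::chilbert op \<Rightarrow> bool" where
  "positive_op x \<longleftrightarrow> (\<forall>\<xi>. cinner \<xi> (x \<xi>) \<in> \<real>\<^sub>\<ge>\<^sub>0)"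

definition op_le :: "'h::chilbert op \<Rightarrow> 'h op \<Rightarrow> bool" where
  "op_le x y \<longleftrightarrow> positive_op (\<lambda>\<xi>. y \<xi> - x \<xi>)"

definition commutant :: "'h::chilbert op set \<Rightarrow> 'h op set" where
  "commutant S = {y. bounded_clinear y \<and> (\<forall>x\<in>S. y \<circ> x = x \<circ> y)}"

definition von_neumann_algebra :: "'h::chilbert op set \<Rightarrow> bool" where
  "von_neumann_algebra M \<longleftrightarrow>
     (\<forall>x\<in>M. bounded_clinear x) \<and> (\<forall>x\<in>M. cadj x \<in> M) \<and> commutant (commutant M) = M"

definition unitary_op :: "'h::chilbert op \<Rightarrow> bool" where
  "unitary_op u \<longleftrightarrow> bounded_clinear u \<and> cadj u \<circ> u = id \<and> u \<circ> cadj u = id"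

definition projection_op :: "'h::chilbert op \<Rightarrow> bool" where
  "projection_op p \<longleftrightarrow> bounded_clinear p \<and> cadj p = p \<and> p \<circ> p = p"

definition pos_part :: "'h::chilbert op set \<Rightarrow> 'h op set" where
  "pos_part M = {x\<in>M. positive_op x}"


section \<open>Normal weights and traces\<close>

text \<open>Weights are maps on the positive part of \<open>M\<close>; values elsewhere are irrelevant.
  Note that \<open>0 * \<infinity> = 0\<close> in \<^typ>\<open>ennreal\<close>.\<close>

definition weight :: "'h::chilbert op set \<Rightarrow> ('h op \<Rightarrow> ennreal) \<Rightarrow> bool" where
  "weight M \<tau> \<longleftrightarrow>
     (\<forall>x\<in>pos_part M. \<forall>y\<in>pos_part M. \<tau> (\<lambda>\<xi>. x \<xi> + y \<xi>) = \<tau> x + \<tau> y) \<and>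
     (\<forall>x\<in>pos_part M. \<forall>r\<ge>0. \<tau> (\<lambda>\<xi>. r *\<^sub>R x \<xi>) = ennreal r * \<tau> x)"

definition upward_directed :: "'h::chilbert op set \<Rightarrow> bool" where
  "upward_directed D \<longleftrightarrow> D \<noteq> {} \<and> (\<forall>x\<in>D. \<forall>y\<in>D. \<exists>z\<in>D. op_le x z \<and> op_le y z)"

definition is_sup_in :: "'h::chilbert op set \<Rightarrow> 'h op set \<Rightarrow> 'h op \<Rightarrow> bool" where
  "is_sup_in P D s \<longleftrightarrow>
     s \<in> P \<and> (\<forall>x\<in>D. op_le x s) \<and> (\<forall>z\<in>P. (\<forall>x\<in>D. op_le x z) \<longrightarrow> op_le s z)"

definition normal_weight :: "'h::chilbert op set \<Rightarrow> ('h op \<Rightarrow> ennreal) \<Rightarrow> bool" where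
  "normal_weight M \<tau> \<longleftrightarrow> weight M \<tau> \<and>
     (\<forall>D s. D \<subseteq> pos_part M \<and> upward_directed D \<and> is_sup_in (pos_part M) D s
        \<longrightarrow> \<tau> s = (SUP x\<in>D. \<tau> x))"

text \<open>The positive cone of the predual: a positive normal functional is determined by its
  restriction to the positive part, and these restrictions are exactly the finite normal weights.\<close>

definition normal_functional :: "'h::chilbert op set \<Rightarrow> ('h op \<Rightarrow> ennreal) \<Rightarrow> bool" where
  "normal_functional M \<omega> \<longleftrightarrow> normal_weight M \<omega> \<and> (\<forall>x\<in>pos_part M. \<omega> x < \<infinity>)"

definition faithful_weight :: "'h::chilbert op set \<Rightarrow> ('h op \<Rightarrow> ennreal) \<Rightarrow> bool" where
  "faithful_weight M \<tau> \<longleftrightarrow> (\<forall>x\<in>pos_part M. \<tau> x = 0 \<longrightarrow> x = (\<lambda>\<xi>. 0))"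

definition semifinite_weight :: "'h::chilbert op set \<Rightarrow> ('h op \<Rightarrow> ennreal) \<Rightarrow> bool" where
  "semifinite_weight M \<tau> \<longleftrightarrow>
     (\<forall>x\<in>pos_part M. x \<noteq> (\<lambda>\<xi>. 0) \<longrightarrow>
        (\<exists>y\<in>pos_part M. y \<noteq> (\<lambda>\<xi>. 0) \<and> op_le y x \<and> \<tau> y < \<infinity>))"

definition fns_trace :: "'h::chilbert op set \<Rightarrow> ('h op \<Rightarrow> ennreal) \<Rightarrow> bool" where
  "fns_trace M \<tau> \<longleftrightarrow> normal_weight M \<tau> \<and> faithful_weight M \<tau> \<and> semifinite_weight M \<tau> \<and>
     (\<forall>x\<in>M. \<tau> (cadj x \<circ> x) = \<tau> (x \<circ> cadj x))"


section \<open>Unbounded operators\<close>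

text \<open>An unbounded operator is given by its graph.\<close>

type_synonym 'h unbdd = "('h \<times> 'h) set"

definition densely_defined_op :: "'h::chilbert unbdd \<Rightarrow> bool" where
  "densely_defined_op T \<longleftrightarrow> csubspace T \<and> single_valued T \<and> closure (Domain T) = UNIV"

definition closed_densely_defined_op :: "'h::chilbert unbdd \<Rightarrow> bool" where
  "closed_densely_defined_op T \<longleftrightarrow> densely_defined_op T \<and> closed T"

definition adj :: "'h::chilbert unbdd \<Rightarrow> 'h unbdd" where
  "adj T = {(\<eta>, \<zeta>). \<forall>(\<xi>, \<theta>)\<in>T. cinner \<theta> \<eta> = cinner \<xi> \<zeta>}"

definition selfadjoint :: "'h::chilbert unbdd \<Rightarrow> bool" where
  "selfadjoint T \<longleftrightarrow> densely_defined_op T \<and> adj T = T"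

definition positive_selfadjoint :: "'h::chilbert unbdd \<Rightarrow> bool" where
  "positive_selfadjoint T \<longleftrightarrow> selfadjoint T \<and> (\<forall>(\<xi>, \<eta>)\<in>T. cinner \<xi> \<eta> \<in> \<real>\<^sub>\<ge>\<^sub>0)"

text \<open>The modulus is the positive square root of the product of the adjoint with the operator.
  Relational composition applies its left argument first.\<close>

definition modulus :: "'h::chilbert unbdd \<Rightarrow> 'h unbdd" where
  "modulus T = (THE S. positive_selfadjoint S \<and> S O S = T O adj T)"

definition affiliated :: "'h::chilbert op set \<Rightarrow> 'h unbdd \<Rightarrow> bool" where
  "affiliated M T \<longleftrightarrow> (\<forall>u\<in>commutant M. unitary_op u \<longrightarrow> (\<lambda>(\<xi>, \<eta>). (u \<xi>, u \<eta>)) ` T = T)"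


section \<open>Spectral measures\<close>

definition projection_valued_measure :: "(real set \<Rightarrow> 'h::chilbert op) \<Rightarrow> bool" where
  "projection_valued_measure E \<longleftrightarrow>
     (\<forall>B\<in>sets borel. projection_op (E B)) \<and> E UNIV = id \<and>
     (\<forall>B\<in>sets borel. \<forall>C\<in>sets borel. E (B \<inter> C) = E B \<circ> E C) \<and>
     (\<forall>A \<xi>. range A \<subseteq> sets borel \<and> disjoint_family A \<longrightarrow>
        (\<lambda>n::nat. E (A n) \<xi>) sums E (\<Union>n. A n) \<xi>)"

definition scalar_measure :: "('h::chilbert op \<Rightarrow> ennreal) \<Rightarrow> (real set \<Rightarrow> 'h op) \<Rightarrow> real measure" where
  "scalar_measure \<omega> E = measure_of UNIV (sets borel) (\<lambda>B. \<omega> (E B))"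

definition vector_functional :: "'h::chilbert \<Rightarrow> 'h op \<Rightarrow> ennreal" where
  "vector_functional \<xi> x = ennreal (Re (cinner \<xi> (x \<xi>)))"

text \<open>\<open>T\<close> is the integral of the identity function against \<open>E\<close>. For self-adjoint \<open>T\<close>, by
  polarization, this is expressed by the domain and the quadratic form.\<close>

definition is_spectral_measure :: "'h::chilbert unbdd \<Rightarrow> (real set \<Rightarrow> 'h op) \<Rightarrow> bool" where
  "is_spectral_measure T E \<longleftrightarrow> projection_valued_measure E \<and>
     Domain T = {\<xi>. (\<integral>\<^sup>+s. ennreal (s\<^sup>2) \<partial>scalar_measure (vector_functional \<xi>) E) < \<infinity>} \<and>
     (\<forall>(\<xi>, \<eta>)\<in>T. cinner \<xi> \<eta> =
        complex_of_real (\<integral>s. s \<partial>scalar_measure (vector_functional \<xi>) E))"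

text \<open>A choice operator is used only because a spectral measure is a function on all sets, whose
  values outside the Borel sets are not determined.\<close>

definition spectral_measure :: "'h::chilbert unbdd \<Rightarrow> real set \<Rightarrow> 'h op" where
  "spectral_measure T = (SOME E. is_spectral_measure T E)"

definition distribution_function :: "('h::chilbert op \<Rightarrow> ennreal) \<Rightarrow> real \<Rightarrow> 'h unbdd \<Rightarrow> ennreal" where
  "distribution_function \<tau> \<epsilon> T = \<tau> (spectral_measure (modulus T) {\<epsilon><..})"


section \<open>The extended positive part\<close>

text \<open>An element of the extended positive part of \<open>M\<close> is a map from the positive normal functionals
  to \<open>[0, \<infinity>]\<close>. For a self-adjoint \<open>T\<close> affiliated with \<open>M\<close> and a Borel function \<open>f\<close> that is
  nonnegative on the spectrum of \<open>T\<close>, the element \<open>f(T)\<close> takes the functional \<open>\<omega>\<close> to the integral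
  of \<open>f\<close> against \<open>\<omega> \<circ> E\<close>, where \<open>E\<close> is the spectral measure of \<open>T\<close>.\<close>

type_synonym 'h ext_pos = "('h op \<Rightarrow> ennreal) \<Rightarrow> ennreal"

definition ext_fun_calc :: "(real \<Rightarrow> ennreal) \<Rightarrow> 'h::chilbert unbdd \<Rightarrow> 'h ext_pos" where
  "ext_fun_calc f T = (\<lambda>\<omega>. \<integral>\<^sup>+s. f s \<partial>scalar_measure \<omega> (spectral_measure T))"

text \<open>The canonical extension of a normal weight. Every element of the extended positive part is the
  supremum of an increasing sequence of elements of the positive part of \<open>M\<close>, so this is the only
  monotone extension that is continuous along such sequences.\<close>

definition ext_weight :: "'h::chilbert op set \<Rightarrow> ('h op \<Rightarrow> ennreal) \<Rightarrow> 'h ext_pos \<Rightarrow> ennreal" where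
  "ext_weight M \<tau> m = (SUP x\<in>{x\<in>pos_part M. \<forall>\<omega>. normal_functional M \<omega> \<longrightarrow> \<omega> x \<le> m \<omega>}. \<tau> x)"


section \<open>Tensor products with functions on the real line\<close>

definition L2_fun :: "(real \<Rightarrow> complex) set" where
  "L2_fun = {g \<in> borel_measurable borel. integrable lborel (\<lambda>t. (cmod (g t))\<^sup>2)}"

definition Linf_fun :: "(real \<Rightarrow> complex) set" where
  "Linf_fun = {f \<in> borel_measurable borel. bounded (range f)}"

text \<open>\<open>tens \<xi> g\<close> is the elementary tensor of \<open>\<xi>\<close> with the class of \<open>g\<close> in \<open>L\<^sup>2(\<real>)\<close>. The two
  conditions characterize the Hilbert space tensor product up to a unique unitary compatible with
  elementary tensors; they imply bilinearity and that \<open>tens \<xi> g\<close> depends only on the class of \<open>g\<close>.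
  Values for \<open>g\<close> outside \<^term>\<open>L2_fun\<close> are irrelevant.\<close>

definition hilbert_tensor_L2 :: "('h::chilbert \<Rightarrow> (real \<Rightarrow> complex) \<Rightarrow> 'k::chilbert) \<Rightarrow> bool" where
  "hilbert_tensor_L2 tens \<longleftrightarrow>
     (\<forall>\<xi> \<eta>. \<forall>f\<in>L2_fun. \<forall>g\<in>L2_fun.
        cinner (tens \<xi> f) (tens \<eta> g) = cinner \<xi> \<eta> * (\<integral>t. cnj (f t) * g t \<partial>lborel)) \<and>
     closure (cspan {tens \<xi> g | \<xi> g. g \<in> L2_fun}) = UNIV"

text \<open>\<open>y\<close> is the tensor product of \<open>x\<close> with the operator of multiplication by \<open>f\<close>.\<close>

definition is_tensor_op ::
  "('h::chilbert \<Rightarrow> (real \<Rightarrow> complex) \<Rightarrow> 'k::chilbert) \<Rightarrow> 'h op \<Rightarrow> (real \<Rightarrow> complex) \<Rightarrow> 'k op \<Rightarrow> bool" where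
  "is_tensor_op tens x f y \<longleftrightarrow> bounded_clinear y \<and>
     (\<forall>\<xi>. \<forall>g\<in>L2_fun. y (tens \<xi> g) = tens (x \<xi>) (\<lambda>t. f t * g t))"

definition vn_tensor_Linf ::
  "('h::chilbert \<Rightarrow> (real \<Rightarrow> complex) \<Rightarrow> 'k::chilbert) \<Rightarrow> 'h op set \<Rightarrow> 'k op set" where
  "vn_tensor_Linf tens M =
     commutant (commutant {y. \<exists>x\<in>M. \<exists>f\<in>Linf_fun. is_tensor_op tens x f y})"

text \<open>The tensor product of \<open>\<tau>\<close> with the weight \<open>e\<^sup>-\<^sup>t dt\<close>: the unique faithful normal semifinite
  trace on the tensor product algebra with the given values on positive elementary tensors.\<close>

definition is_tensor_trace ::
  "('h::chilbert \<Rightarrow> (real \<Rightarrow> complex) \<Rightarrow> 'k::chilbert) \<Rightarrow> 'h op set \<Rightarrow> ('h op \<Rightarrow> ennreal) \<Rightarrow>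
     ('k op \<Rightarrow> ennreal) \<Rightarrow> bool" where
  "is_tensor_trace tens M \<tau> \<tau>' \<longleftrightarrow> fns_trace (vn_tensor_Linf tens M) \<tau>' \<and>
     (\<forall>x\<in>pos_part M. \<forall>f::real \<Rightarrow> real. \<forall>y.
        f \<in> borel_measurable borel \<and> bounded (range f) \<and> (\<forall>t. 0 \<le> f t) \<and>
        is_tensor_op tens x (\<lambda>t. complex_of_real (f t)) y \<longrightarrow>
        \<tau>' y = \<tau> x * (\<integral>\<^sup>+t. ennreal (f t * exp (- t)) \<partial>lborel))"

text \<open>The tensor product of a closed operator with the (possibly unbounded) operator of
  multiplication by \<open>f\<close> on its maximal domain, i.e. the closure of the algebraic tensor product.\<close>

definition tensor_unbdd ::
  "('h::chilbert \<Rightarrow> (real \<Rightarrow> complex) \<Rightarrow> 'k::chilbert) \<Rightarrow> 'h unbdd \<Rightarrow> (real \<Rightarrow> complex) \<Rightarrow> 'k unbdd" where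
  "tensor_unbdd tens T f = closure (cspan
     {(tens \<xi> g, tens \<eta> (\<lambda>t. f t * g t)) | \<xi> \<eta> g.
        (\<xi>, \<eta>) \<in> T \<and> g \<in> L2_fun \<and> (\<lambda>t. f t * g t) \<in> L2_fun})"


section \<open>Orlicz functions\<close>

text \<open>Only the values on \<open>[0, \<infinity>)\<close> matter.\<close>

definition orlicz_function :: "(real \<Rightarrow> ennreal) \<Rightarrow> bool" where
  "orlicz_function \<psi> \<longleftrightarrow>
     (\<forall>u\<ge>0. \<forall>v\<ge>0. \<forall>r\<in>{0..1}.
        \<psi> ((1 - r) * u + r * v) \<le> ennreal (1 - r) * \<psi> u + ennreal r * \<psi> v) \<and>
     \<psi> 0 = 0 \<and> (\<psi> \<longlongrightarrow> \<infinity>) at_top \<and>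
     (\<exists>u>0. \<psi> u \<noteq> 0) \<and> (\<exists>u>0. \<psi> u < \<infinity>) \<and>
     (let F = {u. 0 < u \<and> \<psi> u < \<infinity>} in
        bdd_above F \<longrightarrow> (\<psi> \<longlongrightarrow> \<psi> (Sup F)) (at_left (Sup F)))"

definition luxemburg_norm :: "(real \<Rightarrow> ennreal) \<Rightarrow> (real \<Rightarrow> real) \<Rightarrow> real" where
  "luxemburg_norm \<psi> f = Inf {k. 0 < k \<and> (\<integral>\<^sup>+t. \<psi> (\<bar>f t\<bar> / k) \<partial>lborel) \<le> 1}"

definition fundamental_function :: "(real \<Rightarrow> ennreal) \<Rightarrow> real \<Rightarrow> real" where
  "fundamental_function \<psi> t = luxemburg_norm \<psi> (indicator {0..t})"

definition orlicz_inverse :: "(real \<Rightarrow> ennreal) \<Rightarrow> real \<Rightarrow> real" where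
  "orlicz_inverse \<psi> t = Sup {s. 0 \<le> s \<and> \<psi> s \<le> ennreal t}"

lemma luxemburg_indicator_set:
  fixes \<psi> :: "real \<Rightarrow> ennreal"
  assumes "\<psi> 0 = 0" "0 < t" "0 < k"
  shows "(\<integral>\<^sup>+s. \<psi> (\<bar>indicator {0..t} s\<bar> / k) \<partial>lborel) \<le> 1 \<longleftrightarrow> \<psi> (1 / k) \<le> ennreal (1 / t)"
proof -
  have "(\<integral>\<^sup>+s. \<psi> (\<bar>indicator {0..t} s\<bar> / k) \<partial>lborel)
      = (\<integral>\<^sup>+s. \<psi> (1 / k) * indicator {0..t} s \<partial>lborel)"
    by (intro nn_integral_cong) (use assms in \<open>auto simp: indicator_def\<close>)
  also have "\<dots> = \<psi> (1 / k) * ennreal t"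
    using assms by (simp add: nn_integral_cmult)
  finally have eq: "(\<integral>\<^sup>+s. \<psi> (\<bar>indicator {0..t} s\<bar> / k) \<partial>lborel) = \<psi> (1 / k) * ennreal t" .
  show ?thesis unfolding eq
  proof (cases "\<psi> (1 / k)")
    case (real r)
    then show "\<psi> (1 / k) * ennreal t \<le> 1 \<longleftrightarrow> \<psi> (1 / k) \<le> ennreal (1 / t)"
      using assms by (simp add: ennreal_mult[symmetric] ennreal_le_1 field_simps)
  next
    case top
    then show "\<psi> (1 / k) * ennreal t \<le> 1 \<longleftrightarrow> \<psi> (1 / k) \<le> ennreal (1 / t)"
      using assms by (simp add: ennreal_top_mult top_unique)
  qed
qed

lemma orlicz_small:
  fixes \<psi> :: "real \<Rightarrow> ennreal"
  assumes "orlicz_function \<psi>" "0 < t"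
  shows "\<exists>s>0. \<psi> s \<le> ennreal t"
proof -
  obtain u where u: "u > 0" "\<psi> u < \<infinity>" and z: "\<psi> 0 = 0"
    using assms(1) unfolding orlicz_function_def by blast
  obtain c where c: "\<psi> u = ennreal c" "c \<ge> 0"
    using u(2) by (cases "\<psi> u") auto
  define r where "r = min 1 (t / (c + 1))"
  have r: "0 < r" "r \<le> 1" "r * c \<le> t"
  proof -
    show "0 < r" "r \<le> 1" using assms(2) c by (auto simp: r_def)
    have "r * c \<le> t / (c + 1) * c" using c by (intro mult_right_mono) (auto simp: r_def)
    also have "\<dots> \<le> t" using c assms(2) by (simp add: field_simps)
    finally show "r * c \<le> t" .
  qed
  have conv: "\<forall>u\<ge>0. \<forall>v\<ge>0. \<forall>r\<in>{0..1}.
      \<psi> ((1 - r) * u + r * v) \<le> ennreal (1 - r) * \<psi> u + ennreal r * \<psi> v"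
    using assms(1) unfolding orlicz_function_def by blast
  have "\<psi> ((1 - r) * 0 + r * u) \<le> ennreal (1 - r) * \<psi> 0 + ennreal r * \<psi> u"
    using conv[rule_format, of 0 u r] u r by auto
  also have "\<dots> = ennreal (r * c)"
    using r c by (simp add: z ennreal_mult)
  also have "\<dots> \<le> ennreal t" using r by (intro ennreal_leI)
  finally show ?thesis using u r by (intro exI[of _ "r * u"]) auto
qed

lemma fundamental_function_eq:
  fixes \<psi> :: "real \<Rightarrow> ennreal"
  assumes "orlicz_function \<psi>" "0 < t"
  shows "fundamental_function \<psi> t = 1 / orlicz_inverse \<psi> (1 / t)"
proof -
  define S where "S = {s. 0 \<le> s \<and> \<psi> s \<le> ennreal (1 / t)}"
  define K where "K = {k. 0 < k \<and> \<psi> (1 / k) \<le> ennreal (1 / t)}"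
  have z: "\<psi> 0 = 0" and lim: "(\<psi> \<longlongrightarrow> \<infinity>) at_top"
    using assms(1) unfolding orlicz_function_def by blast+
  have f: "fundamental_function \<psi> t = Inf K"
    unfolding fundamental_function_def luxemburg_norm_def K_def
    using luxemburg_indicator_set[of \<psi> t, OF z assms(2)] by (intro arg_cong[of _ _ Inf]) auto
  obtain s1 where s1: "s1 > 0" "s1 \<in> S"
    using orlicz_small[OF assms(1), of "1 / t"] assms(2) by (auto simp: S_def)
  have "\<forall>\<^sub>F s in at_top. \<psi> s > ennreal (1 / t)"
    using order_tendstoD(1)[OF lim] by simp
  then obtain N where N: "\<And>s. s \<ge> N \<Longrightarrow> \<psi> s > ennreal (1 / t)"
    by (auto simp: eventually_at_top_linorder)
  have bdd: "bdd_above S"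
  proof (rule bdd_aboveI[of _ N])
    fix s assume "s \<in> S"
    then show "s \<le> N" using N[of s] by (cases "s \<le> N") (auto simp: S_def)
  qed
  define b where "b = Sup S"
  have b: "0 < b" using cSup_upper[OF s1(2) bdd] s1(1) by (simp add: b_def)
  have K_lb: "1 / b \<le> k" if "k \<in> K" for k
  proof -
    have "k > 0" "1 / k \<in> S" using that by (auto simp: K_def S_def)
    then show ?thesis using cSup_upper[OF \<open>1 / k \<in> S\<close> bdd] b
      by (simp add: b_def field_simps)
  qed
  have S_K: "1 / s \<in> K" if "s \<in> S" "0 < s" for s
    using that by (auto simp: K_def S_def)
  have bddK: "bdd_below K" using K_lb by (intro bdd_belowI)
  have ge: "1 / b \<le> Inf K" using S_K[OF s1(2,1)] K_lb by (intro cInf_greatest) auto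
  then have pos: "0 < Inf K" using b by (meson less_le_trans zero_less_divide_1_iff)
  have "b \<le> 1 / Inf K" unfolding b_def
  proof (rule cSup_least)
    show "S \<noteq> {}" using s1 by auto
    fix s assume s: "s \<in> S"
    show "s \<le> 1 / Inf K"
    proof (cases "0 < s")
      case True
      then show ?thesis using cInf_lower[OF S_K[OF s True] bddK] pos by (simp add: field_simps)
    next
      case False
      then show ?thesis using pos by (meson less_imp_le not_le order_trans zero_less_divide_1_iff)
    qed
  qed
  then have "Inf K \<le> 1 / b" using b pos by (simp add: field_simps)
  then show ?thesis using ge f by (simp add: orlicz_inverse_def S_def b_def)
qed

lemma fundamental_function_0:
  fixes \<psi> :: "real \<Rightarrow> ennreal"
  assumes "orlicz_function \<psi>"
  shows "fundamental_function \<psi> 0 = 0"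
proof -
  have z: "\<psi> 0 = 0" using assms unfolding orlicz_function_def by blast
  have "(\<integral>\<^sup>+s. \<psi> (\<bar>indicator {0..0::real} s\<bar> / k) \<partial>lborel) = 0" for k :: real
  proof -
    have "AE s in lborel. s \<noteq> (0::real)" by (rule AE_lborel_singleton)
    then have "AE s in lborel. \<psi> (\<bar>indicator {0..0} (s::real)\<bar> / k) = 0"
      by (rule AE_mp) (simp add: z)
    then have "(\<integral>\<^sup>+s. \<psi> (\<bar>indicator {0..0::real} s\<bar> / k) \<partial>lborel) = (\<integral>\<^sup>+(s::real). 0 \<partial>lborel)"
      by (rule nn_integral_cong_AE)
    then show ?thesis by simp
  qed
  then have "fundamental_function \<psi> 0 = Inf {0<..}"
    by (simp add: fundamental_function_def luxemburg_norm_def greaterThan_def)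
  then show ?thesis by simp
qed

end

theory Submission
  imports Defs "HOL-Probability.Probability"
begin

text \<open>Let \<open>f t = \<phi> (exp t)\<close> and let \<open>b\<close> be the closure of \<open>a \<otimes> f\<close>. Since \<open>1 / u < f t\<close> holds exactly if
  \<open>exp (- t) < \<psi> u\<close>, the set where \<open>f\<close> exceeds \<open>1 / u\<close> has mass \<open>\<psi> u\<close> with respect to \<open>exp (- t) dt\<close>, so the
  theorem is clear if \<open>|a|\<close> is a scalar on finitely many pieces. In general, cut \<open>(0, \<infinity>)\<close> into cells
  \<open>[r\<^sup>k, r\<^sup>k\<^sup>+\<^sup>1)\<close> with \<open>r > 1\<close> and tensor the spectral projection of \<open>|a|\<close> on each cell with the indicator of
  \<open>{f > \<epsilon> / r\<^sup>k}\<close>. These orthogonal projections commute with the spectral projections of \<open>|b|\<close>, and the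
  norm of \<open>b\<close> on their ranges is controlled from both sides; hence their sum lies below the spectral
  projection of \<open>|b|\<close> for \<open>(c, \<infinity>)\<close> if \<open>c < \<epsilon>\<close>, and above it if \<open>c > r \<epsilon>\<close>. The trace of the sum is a Riemann
  sum for the integral of \<open>\<psi> (s / \<epsilon>)\<close> against \<open>\<tau>\<close> composed with the spectral measure of \<open>|a|\<close>. Letting \<open>r\<close>
  tend to 1, normality of the traces and left continuity of \<open>\<psi>\<close> give the claim.

  The spectral measure of the modulus comes from the Hausdorff moment problem for the bounded operator
  \<open>(1 + T\<^sup>* T)\<^sup>-\<^sup>1\<close>.\<close>

section \<open>Hilbert space preliminaries\<close>

text \<open>The bounded operator named last is read off the orthogonal projection onto the closed
  graph, so nothing about the product of the operator with its adjoint has to be known beforehand,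
  and symmetries of the graph pass to it directly. This makes affiliation and reducing subspaces
  usable.

  The obstacle is that \<open>b\<close> is known only as the closure of a span; |b| is never
  identified with a tensor product of |a| and \<open>f\<close>. Only norm inequalities are
  available. They come from identities between Gram matrices of the generating tensors, which
  survive linear combinations and closure. An inequality for \<open>b\<close> on the range of a
  projection commuting with |b| is then played off against a spectral window of |b|, which forces a
  strict gap between the two constants. Hence every comparison carries slack, and only the final
  limit removes it.

  The cells are geometric because on each of them the bounds of the two factors multiply to the same
  constants, \<open>e\<close> from below and \<open>r * e\<close> from above.

  Even membership of the spectral projections of |b| in the tensor product algebra is deduced from
  these comparisons.\<close>

lemma cinner_add_left: "cinner (x + y) z = cinner x z + cinner y (z :: 'a::chilbert)"
  by (metis cinner_add_right cinner_commute complex_cnj_add)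

lemma cinner_scaleC_left: "cinner (c *\<^sub>C x) y = cnj c * cinner x (y :: 'a::chilbert)"
  by (metis cinner_scaleC_right cinner_commute complex_cnj_mult)

lemma cinner_zero_right [simp]: "cinner x 0 = (0 :: complex)" for x :: "'a::chilbert"
  using cinner_add_right[of x 0 0] by simp

lemma cinner_zero_left [simp]: "cinner 0 x = (0 :: complex)" for x :: "'a::chilbert"
  using cinner_add_left[of 0 0 x] by simp

lemma cinner_minus_right: "cinner x (- y) = - cinner x (y :: 'a::chilbert)"
  using cinner_add_right[of x y "- y"] by (simp add: eq_neg_iff_add_eq_0 add.commute)

lemma cinner_minus_left: "cinner (- x) y = - cinner x (y :: 'a::chilbert)"
  using cinner_add_left[of x "- x" y] by (simp add: eq_neg_iff_add_eq_0 add.commute)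

lemma cinner_diff_right: "cinner x (y - z) = cinner x y - cinner x (z :: 'a::chilbert)"
  using cinner_add_right[of x y "- z"] by (simp add: cinner_minus_right)

lemma cinner_diff_left: "cinner (x - y) z = cinner x z - cinner y (z :: 'a::chilbert)"
  using cinner_add_left[of x "- y" z] by (simp add: cinner_minus_left)

lemmas cinner_linear = cinner_add_left cinner_add_right cinner_diff_left cinner_diff_right
  cinner_scaleC_left cinner_scaleC_right cinner_minus_left cinner_minus_right

lemma cinner_scaleR_right: "cinner x (r *\<^sub>R y) = complex_of_real r * cinner x (y :: 'a::chilbert)"
  by (simp add: scaleR_scaleC cinner_scaleC_right)

lemma cinner_scaleR_left: "cinner (r *\<^sub>R x) y = complex_of_real r * cinner x (y :: 'a::chilbert)"
  by (simp add: scaleR_scaleC cinner_scaleC_left)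

lemma cinner_sum_left: "cinner (\<Sum>i\<in>I. x i) y = (\<Sum>i\<in>I. cinner (x i) y)"
  by (induction I rule: infinite_finite_induct) (auto simp: cinner_add_left)

lemma cinner_sum_right: "cinner y (\<Sum>i\<in>I. x i) = (\<Sum>i\<in>I. cinner y (x i))"
  by (induction I rule: infinite_finite_induct) (auto simp: cinner_add_right)

lemma cinner_self: "cinner x x = complex_of_real ((norm (x :: 'a::chilbert))\<^sup>2)"
proof -
  have "Im (cinner x x) = 0"
    using arg_cong[OF cinner_commute[of x x], of Im] by simp
  then show ?thesis
    by (simp add: complex_eq_iff cinner_Re power2_norm_eq_inner)
qed

lemma cinner_self_eq_0 [simp]: "cinner x x = 0 \<longleftrightarrow> x = (0 :: 'a::chilbert)"
  by (simp add: cinner_self)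

lemma norm_scaleC: "norm (c *\<^sub>C x) = cmod c * norm (x :: 'a::chilbert)"
proof -
  have "complex_of_real ((norm (c *\<^sub>C x))\<^sup>2) = complex_of_real ((cmod c * norm x)\<^sup>2)"
    unfolding cinner_self[symmetric] cinner_linear
    by (simp add: cinner_self power_mult_distrib complex_norm_square del: of_real_power)
  then show ?thesis
    by (metis mult_nonneg_nonneg norm_ge_zero of_real_eq_iff power2_eq_iff_nonneg)
qed

lemma cinner_cauchy_schwarz: "cmod (cinner x y) \<le> norm x * norm (y :: 'a::chilbert)"
proof (cases "cinner x y = 0")
  case False
  define c where "c = cnj (cinner x y) / cmod (cinner x y)"
  have "cinner x (c *\<^sub>C y) = complex_of_real (cmod (cinner x y))"
    using False by (simp add: c_def cinner_scaleC_right mult.commute[of "cnj _"]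
        complex_norm_square[symmetric] power2_eq_square)
  then have "cmod (cinner x y) = inner x (c *\<^sub>C y)"
    by (metis Re_complex_of_real cinner_Re)
  also have "\<dots> \<le> norm x * norm (c *\<^sub>C y)" by (rule norm_cauchy_schwarz)
  also have "norm (c *\<^sub>C y) = norm y"
    using False by (simp add: norm_scaleC c_def norm_divide)
  finally show ?thesis .
qed simp

lemma bounded_bilinear_cinner: "bounded_bilinear (cinner :: 'a::chilbert \<Rightarrow> 'a \<Rightarrow> complex)"
proof
  show "\<exists>K. \<forall>a b. cmod (cinner a b) \<le> norm a * norm (b::'a) * K"
    by (intro exI[of _ 1]) (simp add: cinner_cauchy_schwarz)
qed (simp_all add: cinner_linear cinner_scaleR_left cinner_scaleR_right scaleR_conv_of_real)

lemmas tendsto_cinner = bounded_bilinear.tendsto[OF bounded_bilinear_cinner]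
lemmas continuous_on_cinner = bounded_bilinear.continuous_on[OF bounded_bilinear_cinner]

lemma bounded_linear_scaleC: "bounded_linear (\<lambda>x. c *\<^sub>C (x :: 'a::chilbert))"
proof
  show "\<exists>K. \<forall>x. norm (c *\<^sub>C (x::'a)) \<le> norm x * K"
    by (intro exI[of _ "cmod c"]) (simp add: norm_scaleC)
qed (simp_all add: scaleC_add_right scaleR_scaleC scaleC_scaleC mult.commute)

lemmas tendsto_scaleC = bounded_linear.tendsto[OF bounded_linear_scaleC]

lemma cinner_ext:
  assumes "\<And>z. cinner z x = cinner z (y :: 'a::chilbert)"
  shows "x = y"
proof -
  have "cinner (x - y) (x - y) = 0"
    using assms[of "x - y"] by (simp add: cinner_diff_right)
  then show ?thesis by simp
qed

lemma norm_add_sq: "(norm (x + y))\<^sup>2 = (norm x)\<^sup>2 + (norm y)\<^sup>2 + 2 * Re (cinner x (y :: 'a::chilbert))"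
  by (simp add: power2_norm_eq_inner inner_add_left inner_add_right cinner_Re inner_commute)

lemma norm_add_sq_orth:
  "cinner x y = 0 \<Longrightarrow> (norm (x + y))\<^sup>2 = (norm x)\<^sup>2 + (norm (y :: 'a::chilbert))\<^sup>2"
  by (simp add: norm_add_sq)

lemma csubspaceD:
  assumes "csubspace (V :: 'a::chilbert set)"
  shows "0 \<in> V" "\<And>x y. x \<in> V \<Longrightarrow> y \<in> V \<Longrightarrow> x + y \<in> V" "\<And>x y. x \<in> V \<Longrightarrow> y \<in> V \<Longrightarrow> x - y \<in> V"
    "\<And>c x. x \<in> V \<Longrightarrow> c *\<^sub>C x \<in> V" "\<And>r x. x \<in> V \<Longrightarrow> r *\<^sub>R x \<in> V"
  using assms
  by (auto simp: complex_vector.subspace_0 complex_vector.subspace_add complex_vector.subspace_diff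
      complex_vector.subspace_scale scaleR_scaleC)

lemma csubspaceI:
  assumes "0 \<in> V" "\<And>x y. x \<in> V \<Longrightarrow> y \<in> V \<Longrightarrow> x + y \<in> V" "\<And>c x. x \<in> V \<Longrightarrow> c *\<^sub>C x \<in> V"
  shows "csubspace (V :: 'a::chilbert set)"
  unfolding complex_vector.subspace_def using assms by auto

lemma csubspace_cspan: "csubspace (cspan S)" for S :: "'a::chilbert set"
  by (rule complex_vector.subspace_span)

lemma cspan_superset: "S \<subseteq> cspan S" for S :: "'a::chilbert set"
  by (rule complex_vector.span_superset)

lemma cspan_minimal: "S \<subseteq> T \<Longrightarrow> csubspace T \<Longrightarrow> cspan S \<subseteq> T" for S :: "'a::chilbert set"
  by (rule complex_vector.span_minimal)

lemma csubspace_closure: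
  assumes "csubspace (V :: 'a::chilbert set)"
  shows "csubspace (closure V)"
proof (rule csubspaceI)
  show "0 \<in> closure V" using csubspaceD(1)[OF assms] closure_subset by blast
next
  fix x y assume "x \<in> closure V" "y \<in> closure V"
  then obtain f g where "\<And>n. f n \<in> V" "f \<longlonglongrightarrow> x" "\<And>n. g n \<in> V" "g \<longlonglongrightarrow> y"
    by (auto simp: closure_sequential)
  then have "\<And>n. f n + g n \<in> V" "(\<lambda>n. f n + g n) \<longlonglongrightarrow> x + y"
    by (auto intro: csubspaceD[OF assms] tendsto_add)
  then show "x + y \<in> closure V" unfolding closure_sequential by (intro exI[of _ "\<lambda>n. f n + g n"]) auto
next
  fix c x assume "x \<in> closure V"
  then obtain f where "\<And>n. f n \<in> V" "f \<longlonglongrightarrow> x"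
    by (auto simp: closure_sequential)
  then have "\<And>n. c *\<^sub>C f n \<in> V" "(\<lambda>n. c *\<^sub>C f n) \<longlonglongrightarrow> c *\<^sub>C x"
    by (auto intro: csubspaceD[OF assms] tendsto_scaleC)
  then show "c *\<^sub>C x \<in> closure V" unfolding closure_sequential
    by (intro exI[of _ "\<lambda>n. c *\<^sub>C f n"]) auto
qed

section \<open>Orthogonal decomposition and dense subspaces\<close>

lemma closed_subspace_nearest:
  fixes V :: "'a::chilbert set"
  assumes V: "csubspace V" "closed V"
  obtains p where "p \<in> V" "\<And>v. v \<in> V \<Longrightarrow> norm (x - p) \<le> norm (x - v)"
proof -
  define d where "d = (INF v\<in>V. (norm (x - v))\<^sup>2)"
  have bdd: "bdd_below ((\<lambda>v. (norm (x - v))\<^sup>2) ` V)" by (rule bdd_belowI2[of _ 0]) simp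
  have dle: "d \<le> (norm (x - v))\<^sup>2" if "v \<in> V" for v
    unfolding d_def by (rule cINF_lower[OF bdd that])
  have ne: "V \<noteq> {}" using csubspaceD(1)[OF V(1)] by auto
  have "\<exists>v\<in>V. (norm (x - v))\<^sup>2 < d + 1 / Suc n" for n
  proof -
    have "d < d + 1 / Suc n" by simp
    then show ?thesis unfolding d_def by (subst (asm) cINF_less_iff[OF ne bdd]) auto
  qed
  then obtain f where f: "\<And>n. f n \<in> V" "\<And>n. (norm (x - f n))\<^sup>2 < d + 1 / Suc n" by metis
  \<comment> \<open>The midpoint of \<open>f m\<close> and \<open>f n\<close> lies in
    \<open>V\<close>, so its squared distance from \<open>x\<close> is at least \<open>d\<close>;
    the parallelogram law turns this into smallness of \<open>f m - f n\<close>.\<close>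
  have par: "(norm (f m - f n))\<^sup>2 \<le> 2 / Suc m + 2 / Suc n" for m n
  proof -
    have "d \<le> (norm (x - (1/2) *\<^sub>R (f m + f n)))\<^sup>2"
      by (intro dle csubspaceD[OF V(1)] f)
    also have "(norm (x - (1/2) *\<^sub>R (f m + f n)))\<^sup>2 =
        (2 * (norm (x - f m))\<^sup>2 + 2 * (norm (x - f n))\<^sup>2 - (norm (f m - f n))\<^sup>2) / 4"
      by (simp add: power2_norm_eq_inner inner_diff_left inner_diff_right inner_add_left
          inner_add_right inner_commute field_simps)
    finally show ?thesis using f(2)[of m] f(2)[of n] by simp
  qed
  have "Cauchy f"
  proof (rule metric_CauchyI)
    fix e :: real assume "e > 0"
    then obtain N where N: "1 / Suc N < e\<^sup>2 / 4"
      using nat_approx_posE[of "e\<^sup>2 / 4"] by auto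
    have "dist (f m) (f n) < e" if "m \<ge> N" "n \<ge> N" for m n
    proof -
      have "1 / Suc m \<le> 1 / Suc N" "1 / Suc n \<le> 1 / Suc N" using that by (auto simp: field_simps)
      then have "(norm (f m - f n))\<^sup>2 < e\<^sup>2" using par[of m n] N by simp
      then show ?thesis using \<open>e > 0\<close> by (simp add: dist_norm power_less_imp_less_base)
    qed
    then show "\<exists>M. \<forall>m\<ge>M. \<forall>n\<ge>M. dist (f m) (f n) < e" by blast
  qed
  then obtain p where p: "f \<longlonglongrightarrow> p" using Cauchy_convergent convergent_def by blast
  have pV: "p \<in> V" using V(2) f(1) p closed_sequentially by blast
  have "(\<lambda>n. (norm (x - f n))\<^sup>2) \<longlonglongrightarrow> (norm (x - p))\<^sup>2" by (intro tendsto_intros p)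
  moreover have "(\<lambda>n. d + 1 / Suc n) \<longlonglongrightarrow> d + 0"
    using LIMSEQ_inverse_real_of_nat by (intro tendsto_intros) (simp add: inverse_eq_divide)
  ultimately have "(norm (x - p))\<^sup>2 \<le> d"
    using LIMSEQ_le[of _ "(norm (x - p))\<^sup>2" _ d] f(2) by (metis (no_types, lifting) add.right_neutral less_imp_le)
  then have "norm (x - p) \<le> norm (x - v)" if "v \<in> V" for v
    using dle[OF that] by (meson norm_ge_zero order_trans power2_le_imp_le)
  then show ?thesis using that pV by blast
qed

lemma orthogonal_decomposition:
  fixes V :: "'a::chilbert set"
  assumes V: "csubspace V" "closed V"
  obtains p where "p \<in> V" "\<And>v. v \<in> V \<Longrightarrow> cinner v (x - p) = 0"
proof -
  obtain p where p: "p \<in> V" "\<And>v. v \<in> V \<Longrightarrow> norm (x - p) \<le> norm (x - v)"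
    using closed_subspace_nearest[OF V, of x] by metis
  have "cinner v (x - p) = 0" if v: "v \<in> V" for v
  proof (cases "v = 0")
    case False
    \<comment> \<open>This \<open>c\<close> minimises the distance from \<open>x - p\<close> to the
      multiples of \<open>v\<close>; moving \<open>p\<close> by \<open>c *\<^sub>C v\<close> would
      lower the squared distance by the square of \<open>cmod c * norm v\<close>.\<close>
    define c where "c = cinner v (x - p) / complex_of_real ((norm v)\<^sup>2)"
    have "p + c *\<^sub>C v \<in> V" by (intro csubspaceD[OF V(1)] p v)
    then have "(norm (x - p))\<^sup>2 \<le> (norm (x - (p + c *\<^sub>C v)))\<^sup>2" using p(2) by (intro power_mono) auto
    also have "x - (p + c *\<^sub>C v) = (x - p) + - (c *\<^sub>C v)" by simp
    also have "(norm ((x - p) + - (c *\<^sub>C v)))\<^sup>2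
        = (norm (x - p))\<^sup>2 + (cmod c * norm v)\<^sup>2 - 2 * Re (c * cinner (x - p) v)"
      by (subst norm_add_sq) (simp add: norm_scaleC cinner_scaleC_right cinner_minus_right)
    also have "c * cinner (x - p) v = complex_of_real ((cmod c)\<^sup>2 * (norm v)\<^sup>2)"
    proof -
      have "cinner (x - p) v = cnj c * complex_of_real ((norm v)\<^sup>2)"
        using False by (simp add: c_def cinner_commute[of "x - p"])
      then show ?thesis by (simp add: complex_norm_square mult.assoc[symmetric] del: of_real_power)
    qed
    finally have "(cmod c * norm v)\<^sup>2 \<le> 0" by (simp add: power_mult_distrib mult.commute)
    then have "c = 0" using False by simp
    then show ?thesis using False by (simp add: c_def)
  qed simp
  then show ?thesis using that p by blast
qed

lemma dense_subspaceI:
  fixes V :: "'a::chilbert set"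
  assumes "csubspace V" "\<And>x. (\<And>v. v \<in> V \<Longrightarrow> cinner v x = 0) \<Longrightarrow> x = 0"
  shows "closure V = UNIV"
proof -
  have "x \<in> closure V" for x
  proof -
    obtain p where p: "p \<in> closure V" "\<And>v. v \<in> closure V \<Longrightarrow> cinner v (x - p) = 0"
      using orthogonal_decomposition[OF csubspace_closure[OF assms(1)] closed_closure] by metis
    then have "x - p = 0" using assms(2) closure_subset by blast
    then show ?thesis using p by simp
  qed
  then show ?thesis by auto
qed

lemma closure_orthogonal:
  fixes V :: "'a::chilbert set"
  assumes "\<And>v. v \<in> V \<Longrightarrow> cinner v x = 0" "w \<in> closure V"
  shows "cinner w x = 0"
proof -
  obtain f where f: "\<And>n. f n \<in> V" "f \<longlonglongrightarrow> w" using assms(2) by (auto simp: closure_sequential)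
  have "(\<lambda>n. cinner (f n) x) \<longlonglongrightarrow> cinner w x" by (intro tendsto_cinner f tendsto_const)
  then show ?thesis using assms(1) f(1) by (simp add: LIMSEQ_const_iff)
qed

lemma dense_orthogonal:
  fixes V :: "'a::chilbert set"
  assumes "closure V = UNIV" "\<And>v. v \<in> V \<Longrightarrow> cinner v x = 0"
  shows "x = 0"
  using closure_orthogonal[of V x x] assms by auto

lemma cspan_orthogonal:
  fixes S :: "'a::chilbert set"
  assumes "\<And>v. v \<in> S \<Longrightarrow> cinner v x = 0" "w \<in> cspan S"
  shows "cinner w x = 0"
proof -
  have "csubspace {v. cinner v x = 0}" by (rule csubspaceI) (auto simp: cinner_linear)
  then have "cspan S \<subseteq> {v. cinner v x = 0}" using assms by (intro cspan_minimal) auto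
  then show ?thesis using assms by auto
qed

section \<open>Sesquilinear forms, polarization and Riesz representation\<close>

definition sesquilinear_form :: "('a::chilbert \<Rightarrow> 'a \<Rightarrow> complex) \<Rightarrow> bool" where
  "sesquilinear_form s \<longleftrightarrow>
     (\<forall>x y z. s x (y + z) = s x y + s x z) \<and> (\<forall>c x y. s x (c *\<^sub>C y) = c * s x y) \<and>
     (\<forall>x y z. s (x + y) z = s x z + s y z) \<and> (\<forall>c x y. s (c *\<^sub>C x) y = cnj c * s x y)"

lemma sesquilinear_formD:
  assumes "sesquilinear_form s"
  shows "s x (y + z) = s x y + s x z" "s x (c *\<^sub>C y) = c * s x y"
    "s (x + y) z = s x z + s y z" "s (c *\<^sub>C x) y = cnj c * s x y"
    "s x (- y) = - s x y" "s (- x) y = - s x y"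
    "s x (y - z) = s x y - s x z" "s (x - y) z = s x z - s y z"
proof -
  show 1: "s x (y + z) = s x y + s x z" "s x (c *\<^sub>C y) = c * s x y"
    "s (x + y) z = s x z + s y z" "s (c *\<^sub>C x) y = cnj c * s x y" for x y z c
    using assms by (auto simp: sesquilinear_form_def)
  show 2: "s x (- y) = - s x y" "s (- x) y = - s x y" for x y
    using 1(2)[of x "- 1" y] 1(4)[of "- 1" x y] by simp_all
  show "s x (y - z) = s x y - s x z" "s (x - y) z = s x z - s y z"
    using 1(1)[of x y "- z"] 1(3)[of x "- y" z] by (simp_all add: 2)
qed

lemma polarization:
  assumes "sesquilinear_form s"
  shows "4 * s x y = s (x + y) (x + y) - s (x - y) (x - y)
      - \<i> * s (x + \<i> *\<^sub>C y) (x + \<i> *\<^sub>C y) + \<i> * s (x - \<i> *\<^sub>C y) (x - \<i> *\<^sub>C y)"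
  by (simp add: sesquilinear_formD[OF assms] algebra_simps)

text \<open>For unit vectors the four arguments in the polarization identity have norm at most 2, so
  each diagonal term is at most \<open>4 * K\<close>; four of them divided by 4 give the constant.
  Homogeneity does the rest.\<close>

lemma sesquilinear_form_bound:
  assumes s: "sesquilinear_form s" and K: "\<And>v. cmod (s v v) \<le> K * (norm v)\<^sup>2" "0 \<le> K"
  shows "cmod (s x y) \<le> 4 * K * norm x * norm y"
proof -
  have b1: "cmod (s x y) \<le> 4 * K" if "norm x \<le> 1" "norm y \<le> 1" for x y
  proof -
    have i: "cmod (s v v) \<le> 4 * K" if "norm v \<le> 2" for v
    proof -
      have "cmod (s v v) \<le> K * (norm v)\<^sup>2" by (rule K)
      also have "\<dots> \<le> K * 2\<^sup>2" using that K by (intro mult_left_mono power_mono) auto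
      finally show ?thesis by simp
    qed
    have n: "norm (x + y) \<le> 2" "norm (x - y) \<le> 2" "norm (x + \<i> *\<^sub>C y) \<le> 2" "norm (x - \<i> *\<^sub>C y) \<le> 2"
      using that norm_triangle_ineq[of x y] norm_triangle_ineq4[of x y]
        norm_triangle_ineq[of x "\<i> *\<^sub>C y"] norm_triangle_ineq4[of x "\<i> *\<^sub>C y"]
      by (auto simp: norm_scaleC)
    define a b c d where "a = s (x + y) (x + y)" and "b = s (x - y) (x - y)"
      and "c = s (x + \<i> *\<^sub>C y) (x + \<i> *\<^sub>C y)" and "d = s (x - \<i> *\<^sub>C y) (x - \<i> *\<^sub>C y)"
    have abcd: "cmod a \<le> 4 * K" "cmod b \<le> 4 * K" "cmod c \<le> 4 * K" "cmod d \<le> 4 * K"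
      unfolding a_def b_def c_def d_def by (intro i n)+
    have "cmod (4 * s x y) = cmod (a - b - \<i> * c + \<i> * d)"
      unfolding polarization[OF s] a_def b_def c_def d_def ..
    also have "\<dots> \<le> cmod a + cmod b + cmod c + cmod d"
      using norm_triangle_ineq[of "a - b - \<i> * c" "\<i> * d"] norm_triangle_ineq4[of "a - b" "\<i> * c"]
        norm_triangle_ineq4[of a b] by (simp add: norm_mult)
    finally show ?thesis using abcd by (simp add: norm_mult)
  qed
  show ?thesis
  proof (cases "x = 0 \<or> y = 0")
    case True
    then show ?thesis
      using sesquilinear_formD(2)[OF s, of x 0 y] sesquilinear_formD(4)[OF s, of 0 x y] by auto
  next
    case False
    define x' y' where "x' = complex_of_real (1 / norm x) *\<^sub>C x" and "y' = complex_of_real (1 / norm y) *\<^sub>C y"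
    have xy: "x = complex_of_real (norm x) *\<^sub>C x'" "y = complex_of_real (norm y) *\<^sub>C y'"
      using False by (simp_all add: x'_def y'_def scaleC_scaleC)
    have "norm x' = 1" "norm y' = 1" using False by (simp_all add: x'_def y'_def norm_scaleC norm_divide)
    then have "cmod (s x' y') \<le> 4 * K" by (intro b1) auto
    moreover have "s x y = complex_of_real (norm x * norm y) * s x' y'"
      by (subst xy(1), subst xy(2)) (simp add: sesquilinear_formD[OF s])
    ultimately have "cmod (s x y) \<le> (norm x * norm y) * (4 * K)"
      by (simp only: norm_mult norm_of_real abs_mult abs_norm_cancel) (intro mult_left_mono mult_nonneg_nonneg, auto)
    then show ?thesis by (simp add: mult_ac)
  qed
qed

text \<open>A vector orthogonal to the closed kernel, rescaled, represents the functional: every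
  \<open>x\<close> differs from a multiple of it by an element of the kernel.\<close>

lemma riesz_representation:
  fixes f :: "'a::chilbert \<Rightarrow> complex"
  assumes add: "\<And>x y. f (x + y) = f x + f y" and scale: "\<And>c x. f (c *\<^sub>C x) = c * f x"
    and bound: "\<And>x. cmod (f x) \<le> K * norm x"
  obtains z where "\<And>x. f x = cinner z x"
proof (cases "\<forall>x. f x = 0")
  case True
  then show ?thesis using that[of 0] by simp
next
  case False
  then obtain x0 where x0: "f x0 \<noteq> 0" by blast
  define V where "V = {x. f x = 0}"
  have bl: "bounded_linear f"
    using add scale bound
    by (intro bounded_linear_intro[of _ K]) (simp_all add: scaleR_scaleC scaleR_conv_of_real mult.commute)
  have diff: "f (x - y) = f x - f y" for x y by (rule linear_diff[OF bounded_linear.linear[OF bl]])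
  have 0: "f 0 = 0" by (rule linear_0[OF bounded_linear.linear[OF bl]])
  have V: "csubspace V" by (rule csubspaceI) (auto simp: V_def add scale 0)
  have "closed V" unfolding V_def
    by (rule closed_Collect_eq) (auto intro: linear_continuous_on bl)
  then obtain p where p: "p \<in> V" "\<And>v. v \<in> V \<Longrightarrow> cinner v (x0 - p) = 0"
    using orthogonal_decomposition[OF V, of x0] by metis
  define u where "u = x0 - p"
  have fu: "f u \<noteq> 0" using p x0 by (simp add: u_def diff V_def)
  then have u0: "u \<noteq> 0" using 0 by auto
  define z where "z = (cnj (f u) / complex_of_real ((norm u)\<^sup>2)) *\<^sub>C u"
  have "f x = cinner z x" for x
  proof -
    have "x - (f x / f u) *\<^sub>C u \<in> V" using fu by (simp add: V_def diff scale)
    then have "cinner (x - (f x / f u) *\<^sub>C u) u = 0" unfolding u_def by (rule p)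
    then have "cinner u (x - (f x / f u) *\<^sub>C u) = 0" by (metis cinner_commute complex_cnj_zero)
    then have "cinner u x = (f x / f u) * complex_of_real ((norm u)\<^sup>2)"
      by (simp add: cinner_linear cinner_self)
    then show ?thesis using fu u0 by (simp add: z_def cinner_scaleC_left)
  qed
  then show ?thesis by (rule that)
qed

section \<open>Bounded operators, adjoints and projections\<close>

lemma bounded_clinearI:
  assumes "\<And>x y. f (x + y) = f x + f y" "\<And>c x. f (c *\<^sub>C x) = c *\<^sub>C f x"
    "\<And>x. norm (f x) \<le> K * norm x"
  shows "bounded_clinear f"
  unfolding bounded_clinear_def
  using assms by (auto intro!: bounded_linear_intro[of _ K] simp: scaleR_scaleC mult.commute)

lemma bounded_clinearD:
  assumes "bounded_clinear f"
  shows "bounded_linear f" "f (x + y) = f x + f y" "f (c *\<^sub>C x) = c *\<^sub>C f x"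
    "f (x - y) = f x - f y" "f 0 = 0" "f (- x) = - f x" "f (r *\<^sub>R x) = r *\<^sub>R f x"
  using assms by (auto simp: bounded_clinear_def linear_simps)

lemma bounded_clinear_bound:
  assumes "bounded_clinear f"
  obtains K where "K \<ge> 0" "\<And>x. norm (f x) \<le> K * norm x"
  using bounded_linear.nonneg_bounded[OF bounded_clinearD(1)[OF assms]]
  by (metis mult.commute)

lemma bounded_clinear_tendsto:
  "bounded_clinear f \<Longrightarrow> (g \<longlongrightarrow> l) F \<Longrightarrow> ((\<lambda>n. f (g n)) \<longlongrightarrow> f l) F"
  using bounded_linear.tendsto[OF bounded_clinearD(1)] .

lemma sesquilinear_form_operator:
  fixes s :: "'a::chilbert \<Rightarrow> 'a \<Rightarrow> complex"
  assumes s: "sesquilinear_form s" and b: "\<And>x y. cmod (s x y) \<le> K * norm x * norm y"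
  obtains f where "bounded_clinear f" "\<And>x y. cinner x (f y) = s x y"
proof -
  \<comment> \<open>The form is antilinear in its first argument, so its conjugate is a bounded
    linear functional there.\<close>
  have "\<exists>z. \<forall>x. cnj (s x y) = cinner z x" for y
    by (rule riesz_representation[of "\<lambda>x. cnj (s x y)" "K * norm y"])
      (use b[of _ y] in \<open>auto simp: sesquilinear_formD[OF s] algebra_simps\<close>)
  then obtain f where f: "\<And>x y. cnj (s x y) = cinner (f y) x" by metis
  have eq: "cinner x (f y) = s x y" for x y by (metis cinner_commute complex_cnj_cnj f)
  have "bounded_clinear f"
  proof (rule bounded_clinearI)
    show "f (x + y) = f x + f y" "f (c *\<^sub>C x) = c *\<^sub>C f x" for x y c
      by (rule cinner_ext; simp add: eq cinner_linear sesquilinear_formD[OF s])+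
    show "norm (f x) \<le> K * norm x" for x
    proof (cases "f x = 0")
      case False
      have "(norm (f x))\<^sup>2 = cmod (cinner (f x) (f x))"
        by (simp add: cinner_self norm_power del: of_real_power)
      also have "\<dots> \<le> K * norm (f x) * norm x" unfolding eq by (rule b)
      finally show ?thesis using False by (simp add: power2_eq_square mult.commute mult.left_commute)
    next
      case True
      \<comment> \<open>The sign of \<open>K\<close> is not given; for nonzero \<open>x\<close> the
        bound at the pair \<open>x\<close>, \<open>x\<close> supplies it.\<close>
      have "0 \<le> K * norm x"
      proof (cases "x = 0")
        case False
        have "0 \<le> K * norm x * norm x" using b[of x x] norm_ge_zero order_trans by blast
        then show ?thesis using False by (simp add: zero_le_mult_iff)
      qed simp
      then show ?thesis using True by simp
    qed
  qed
  then show ?thesis using that eq by blast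
qed

lemma sesquilinear_cinner:
  assumes "bounded_clinear f"
  shows "sesquilinear_form (\<lambda>x y. cinner x (f y))"
  by (simp add: sesquilinear_form_def bounded_clinearD[OF assms] cinner_linear)

text \<open>Polarization with the factor \<open>\<i>\<close> recovers all matrix coefficients from
  the diagonal ones; over the reals a rotation by a right angle would be a counterexample.\<close>

lemma operator_eqI:
  assumes "bounded_clinear f" "bounded_clinear g" "\<And>x. cinner x (f x) = cinner x (g x)"
  shows "f = g"
proof
  fix y
  show "f y = g y"
  proof (rule cinner_ext)
    fix z
    have "4 * cinner z (f y) = 4 * cinner z (g y)"
      unfolding polarization[OF sesquilinear_cinner[OF assms(1)]]
        polarization[OF sesquilinear_cinner[OF assms(2)]] assms(3) ..
    then show "cinner z (f y) = cinner z (g y)" by simp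
  qed
qed

lemma bounded_clinear_id: "bounded_clinear (id :: 'a::chilbert op)"
  by (rule bounded_clinearI[of _ 1]) auto

lemma bounded_clinear_zero: "bounded_clinear (\<lambda>x :: 'a::chilbert. 0 :: 'a)"
  by (rule bounded_clinearI[of _ 1]) auto

lemma bounded_clinear_comp: "bounded_clinear f \<Longrightarrow> bounded_clinear g \<Longrightarrow> bounded_clinear (f \<circ> g)"
  by (auto simp: bounded_clinear_def o_def intro: bounded_linear_compose)

lemma bounded_clinear_add:
  "bounded_clinear f \<Longrightarrow> bounded_clinear g \<Longrightarrow> bounded_clinear (\<lambda>x. f x + g x)"
  by (auto simp: bounded_clinear_def scaleC_add_right intro: bounded_linear_add)

lemma bounded_clinear_diff:
  "bounded_clinear f \<Longrightarrow> bounded_clinear g \<Longrightarrow> bounded_clinear (\<lambda>x. f x - g x)"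
  by (auto simp: bounded_clinear_def complex_vector.scale_right_diff_distrib intro: bounded_linear_sub)

lemma bounded_clinear_scaleC: "bounded_clinear f \<Longrightarrow> bounded_clinear (\<lambda>x. c *\<^sub>C f x)"
  by (auto simp: bounded_clinear_def scaleC_scaleC mult.commute
      intro: bounded_linear_compose[OF bounded_linear_scaleC])

lemma bounded_clinear_scaleR: "bounded_clinear f \<Longrightarrow> bounded_clinear (\<lambda>x. r *\<^sub>R f x)"
  by (simp add: scaleR_scaleC bounded_clinear_scaleC)

lemma cadj_unique:
  assumes "\<And>x y. cinner (f x) y = cinner x (g y)"
  shows "cadj f = g"
  unfolding cadj_def
proof (rule the_equality)
  show "\<forall>x y. cinner (f x) y = cinner x (g y)" using assms by blast
  fix h assume "\<forall>x y. cinner (f x) y = cinner x (h y)"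
  then show "h = g" using assms by (intro ext cinner_ext) metis
qed

lemma cadj_exists:
  assumes "bounded_clinear f"
  shows "\<exists>g. bounded_clinear g \<and> (\<forall>x y. cinner (f x) y = cinner x (g y))"
proof -
  obtain K where K: "K \<ge> 0" "\<And>x. norm (f x) \<le> K * norm x" using bounded_clinear_bound[OF assms] by metis
  have "cmod (cinner (f x) y) \<le> K * norm x * norm y" for x y
    by (rule order_trans[OF cinner_cauchy_schwarz]) (simp add: K mult_right_mono)
  then show ?thesis
    by (rule sesquilinear_form_operator[of "\<lambda>x y. cinner (f x) y" K, rotated])
      (auto simp: sesquilinear_form_def bounded_clinearD[OF assms] cinner_linear)
qed

lemma cadj:
  assumes "bounded_clinear f"
  shows "bounded_clinear (cadj f)" "cinner (f x) y = cinner x (cadj f y)"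
    "cinner (cadj f x) y = cinner x (f y)"
proof -
  obtain g where g: "bounded_clinear g" "\<And>x y. cinner (f x) y = cinner x (g y)"
    using cadj_exists[OF assms] by blast
  have "cadj f = g" by (rule cadj_unique) (rule g)
  then show "bounded_clinear (cadj f)" and *: "cinner (f x) y = cinner x (cadj f y)" for x y
    using g by auto
  show "cinner (cadj f x) y = cinner x (f y)" by (metis * cinner_commute)
qed

text \<open>A positive operator has real diagonal coefficients, hence the same ones as its adjoint,
  and \<open>operator_eqI\<close> applies.\<close>

lemma positive_op_selfadjoint:
  assumes "bounded_clinear f" "positive_op f"
  shows "cinner (f x) y = cinner x (f y)" "cadj f = f"
proof -
  have "cadj f = f"
  proof (rule operator_eqI[OF cadj(1)[OF assms(1)] assms(1)])
    fix x
    have "cinner x (f x) \<in> \<real>"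
      using assms(2) unfolding positive_op_def by (metis nonneg_Reals_subset_Reals subsetD)
    then have "cinner (f x) x = cinner x (f x)" by (metis Reals_cnj_iff cinner_commute)
    then show "cinner x (cadj f x) = cinner x (f x)" by (simp add: cadj[OF assms(1)])
  qed
  then show "cadj f = f" "cinner (f x) y = cinner x (f y)" using cadj(2)[OF assms(1), of x y] by auto
qed

lemma positive_opI: "(\<And>x. cinner x (f x) = complex_of_real (q x)) \<Longrightarrow> (\<And>x. 0 \<le> q x) \<Longrightarrow> positive_op f"
  by (simp add: positive_op_def complex_nonneg_Reals_iff)

lemma positive_opD:
  assumes "positive_op f"
  shows "0 \<le> Re (cinner x (f x))" "cinner x (f x) = complex_of_real (Re (cinner x (f x)))"
  using assms by (auto simp: positive_op_def complex_nonneg_Reals_iff complex_eq_iff)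

lemma projection_opD:
  assumes "projection_op p"
  shows "bounded_clinear p" "cinner (p x) y = cinner x (p y)" "p (p x) = p x"
    "cinner x (p x) = complex_of_real ((norm (p x))\<^sup>2)" "norm (p x) \<le> norm x"
proof -
  show p: "bounded_clinear p" "p (p x) = p x" for x
    using assms unfolding projection_op_def by (metis o_apply)+
  show sa: "cinner (p x) y = cinner x (p y)" for x y
    using cadj(2)[OF p(1), of x y] assms by (simp add: projection_op_def)
  show *: "cinner x (p x) = complex_of_real ((norm (p x))\<^sup>2)" for x
    by (metis cinner_self p(2) sa)
  have "(norm (p x))\<^sup>2 \<le> norm x * norm (p x)"
    using cinner_cauchy_schwarz[of x "p x"] by (simp add: * norm_power del: of_real_power)
  then show "norm (p x) \<le> norm x"
    by (cases "p x = 0") (auto simp: power2_eq_square)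
qed

lemma projection_op_positive: "projection_op p \<Longrightarrow> positive_op p"
  by (rule positive_opI[of _ "\<lambda>x. (norm (p x))\<^sup>2"]) (auto simp: projection_opD)

lemma projection_opI:
  assumes "bounded_clinear p" "\<And>x y. cinner (p x) y = cinner x (p y)" "\<And>x. p (p x) = p x"
  shows "projection_op p"
  using assms by (auto simp: projection_op_def cadj_unique)

lemma projection_onto_exists:
  fixes V :: "'a::chilbert set"
  assumes V: "csubspace V" "closed V"
  obtains p where "projection_op p" "\<And>x. p x \<in> V" "\<And>x. x \<in> V \<Longrightarrow> p x = x"
    "\<And>x v. v \<in> V \<Longrightarrow> cinner v (x - p x) = 0"
proof -
  have "\<exists>p. p \<in> V \<and> (\<forall>v\<in>V. cinner v (x - p) = 0)" for x
    by (rule orthogonal_decomposition[OF V, of x]) blast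
  then have "\<exists>p. \<forall>x. p x \<in> V \<and> (\<forall>v\<in>V. cinner v (x - p x) = 0)" by (rule choice[OF allI])
  then obtain p where p: "\<And>x. p x \<in> V" "\<And>x v. v \<in> V \<Longrightarrow> cinner v (x - p x) = 0" by blast
  \<comment> \<open>Uniqueness of the decomposition is what yields linearity of \<open>p\<close> and
    \<open>p x = x\<close> on \<open>V\<close>.\<close>
  have uniq: "q = p x" if "q \<in> V" "\<And>v. v \<in> V \<Longrightarrow> cinner v (x - q) = 0" for x q
  proof -
    have m: "q - p x \<in> V" by (intro csubspaceD(3)[OF V(1)] that p)
    have "cinner (q - p x) ((x - p x) - (x - q)) = 0"
      unfolding cinner_diff_right[of _ "x - p x"] p(2)[OF m] that(2)[OF m] by simp
    moreover have "(x - p x) - (x - q) = q - p x" by simp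
    ultimately show ?thesis by (metis cinner_self_eq_0 eq_iff_diff_eq_0)
  qed
  have on: "p x = x" if "x \<in> V" for x
    by (rule uniq[symmetric]) (use that in simp_all)
  have "bounded_clinear p"
  proof (rule bounded_clinearI)
    show "p (x + y) = p x + p y" for x y
    proof (rule uniq[symmetric])
      show "p x + p y \<in> V" by (intro csubspaceD(2)[OF V(1)] p)
      show "cinner v (x + y - (p x + p y)) = 0" if "v \<in> V" for v
        unfolding add_diff_add cinner_add_right p(2)[OF that] by simp
    qed
    show "p (c *\<^sub>C x) = c *\<^sub>C p x" for c x
    proof (rule uniq[symmetric])
      show "c *\<^sub>C p x \<in> V" by (intro csubspaceD(4)[OF V(1)] p)
      show "cinner v (c *\<^sub>C x - c *\<^sub>C p x) = 0" if "v \<in> V" for v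
        unfolding complex_vector.scale_right_diff_distrib[symmetric] cinner_scaleC_right p(2)[OF that]
        by simp
    qed
    show "norm (p x) \<le> 1 * norm x" for x
    proof -
      have "(norm x)\<^sup>2 = (norm (p x + (x - p x)))\<^sup>2" by simp
      also have "\<dots> = (norm (p x))\<^sup>2 + (norm (x - p x))\<^sup>2"
        by (rule norm_add_sq_orth) (rule p)+
      finally have "(norm (p x))\<^sup>2 \<le> (norm x)\<^sup>2"
        using zero_le_power2[of "norm (x - p x)"] by linarith
      then have "norm (p x) \<le> norm x" by (rule power2_le_imp_le) (rule norm_ge_zero)
      then show ?thesis by (metis mult_1)
    qed
  qed
  moreover have "cinner (p x) y = cinner x (p y)" for x y
  proof -
    have "cinner (p x) (y - p y) = 0" "cinner (p y) (x - p x) = 0" using p by auto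
    then have "cinner (p x) (y - p y) = 0" "cinner (x - p x) (p y) = 0"
      using cinner_commute[of "x - p x" "p y"] by auto
    then show ?thesis by (simp add: cinner_linear)
  qed
  ultimately have "projection_op p" by (rule projection_opI) (simp add: on p)
  then show ?thesis using that p on by blast
qed

text \<open>Taking adjoints turns \<open>q \<circ> p = p\<close> into
  \<open>p \<circ> q = p\<close>, so \<open>p x\<close> is the contraction \<open>p\<close> applied
  to \<open>q x\<close>.\<close>

lemma projection_op_leI:
  assumes "projection_op p" "projection_op q" "\<And>x. q (p x) = p x"
  shows "op_le p q"
  unfolding op_le_def
proof (rule positive_opI[of _ "\<lambda>x. (norm (q x))\<^sup>2 - (norm (p x))\<^sup>2"])
  fix x
  show "cinner x (q x - p x) = complex_of_real ((norm (q x))\<^sup>2 - (norm (p x))\<^sup>2)"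
    by (simp add: cinner_diff_right projection_opD[OF assms(1)] projection_opD[OF assms(2)])
  have pq: "p (q x) = p x"
    by (rule cinner_ext) (metis assms projection_opD(2))
  have "norm (p (q x)) \<le> norm (q x)" by (rule projection_opD[OF assms(1)])
  then show "0 \<le> (norm (q x))\<^sup>2 - (norm (p x))\<^sup>2" by (simp add: pq power_mono)
qed

lemma projection_op_commuting:
  assumes "projection_op p" "projection_op q" "\<And>v. p (q v) = q (p v)"
  shows "projection_op (p \<circ> q)"
  using assms(3) projection_opD(1-3)[OF assms(1)] projection_opD(1-3)[OF assms(2)]
  by (intro projection_opI bounded_clinear_comp) auto

lemma projection_op_sum:
  assumes fin: "finite I" and p: "\<And>i. i \<in> I \<Longrightarrow> projection_op (p i)"
    and orth: "\<And>i j v. i \<in> I \<Longrightarrow> j \<in> I \<Longrightarrow> i \<noteq> j \<Longrightarrow> p i (p j v) = 0"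
  shows "projection_op (\<lambda>v. \<Sum>i\<in>I. p i v)"
proof (rule projection_opI)
  note P = projection_opD[OF p]
  have b: "finite J \<Longrightarrow> J \<subseteq> I \<Longrightarrow> bounded_clinear (\<lambda>v. \<Sum>i\<in>J. p i v)" for J
    by (induction J rule: finite_induct) (auto intro: bounded_clinear_zero bounded_clinear_add P(1))
  show bc: "bounded_clinear (\<lambda>v. \<Sum>i\<in>I. p i v)" using b[OF fin] by simp
  show "cinner (\<Sum>i\<in>I. p i x) y = cinner x (\<Sum>i\<in>I. p i y)" for x y
    by (simp add: cinner_sum_left cinner_sum_right P(2))
  show "(\<Sum>i\<in>I. p i (\<Sum>i\<in>I. p i x)) = (\<Sum>i\<in>I. p i x)" for x
  proof (rule sum.cong[OF refl])
    fix i assume i: "i \<in> I"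
    interpret bounded_linear "p i" using P(1)[OF i] by (simp add: bounded_clinear_def)
    have "p i (\<Sum>j\<in>I. p j x) = (\<Sum>j\<in>I. p i (p j x))" by (rule sum)
    also have "\<dots> = (\<Sum>j\<in>I. if i = j then p i x else 0)"
      by (rule sum.cong) (auto simp: orth i P(3))
    also have "\<dots> = p i x" using fin i by simp
    finally show "p i (\<Sum>j\<in>I. p j x) = p i x" .
  qed
qed

subsection \<open>Commutants\<close>

lemma commutantD: "y \<in> commutant S \<Longrightarrow> bounded_clinear y" "y \<in> commutant S \<Longrightarrow> x \<in> S \<Longrightarrow> y (x v) = x (y v)"
  unfolding commutant_def by (auto simp: fun_eq_iff)

lemma commutantI: "bounded_clinear y \<Longrightarrow> (\<And>x v. x \<in> S \<Longrightarrow> y (x v) = x (y v)) \<Longrightarrow> y \<in> commutant S"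
  unfolding commutant_def by (auto simp: fun_eq_iff)

lemma commutant_mult:
  assumes "x \<in> commutant S" "y \<in> commutant S" shows "x \<circ> y \<in> commutant S"
  using assms by (intro commutantI bounded_clinear_comp) (auto simp: commutantD(1), metis commutantD(2))

lemma commutant_linear:
  assumes S: "\<And>x. x \<in> S \<Longrightarrow> bounded_clinear x" and "x \<in> commutant S" "y \<in> commutant S"
  shows "(\<lambda>v. x v + y v) \<in> commutant S" "(\<lambda>v. x v - y v) \<in> commutant S"
  using commutantD[OF assms(2)] commutantD[OF assms(3)]
  by (auto intro!: commutantI bounded_clinear_add bounded_clinear_diff simp: bounded_clinearD[OF S])

lemma commutant_scale:
  assumes S: "\<And>x. x \<in> S \<Longrightarrow> bounded_clinear x" and "x \<in> commutant S"
  shows "(\<lambda>v. c *\<^sub>C x v) \<in> commutant S" "(\<lambda>v. r *\<^sub>R x v) \<in> commutant S"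
  using commutantD[OF assms(2)]
  by (auto intro!: commutantI bounded_clinear_scaleC bounded_clinear_scaleR simp: bounded_clinearD[OF S])

text \<open>An element of \<open>S\<close> can be moved to the first slot of a matrix coefficient as
  its adjoint, so commutation survives weak limits. The filter allows for directed sets that are not
  sequences, as in Vigier's theorem.\<close>

lemma commutant_weak_limit:
  assumes S: "\<And>x. x \<in> S \<Longrightarrow> bounded_clinear x" and F: "F \<noteq> bot"
    and x: "eventually (\<lambda>i. x i \<in> commutant S) F" and y: "bounded_clinear y"
    and lim: "\<And>u v. ((\<lambda>i. cinner u (x i v)) \<longlongrightarrow> cinner u (y v)) F"
  shows "y \<in> commutant S"
proof (rule commutantI[OF y])
  fix z v assume z: "z \<in> S"
  show "y (z v) = z (y v)"
  proof (rule cinner_ext)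
    fix u
    have "eventually (\<lambda>i. cinner (cadj z u) (x i v) = cinner u (x i (z v))) F"
      using x by eventually_elim (metis cadj(3)[OF S[OF z]] commutantD(2)[OF _ z])
    then have "((\<lambda>i. cinner u (x i (z v))) \<longlongrightarrow> cinner (cadj z u) (y v)) F"
      using lim[of "cadj z u" v] by (rule Lim_transform_eventually[rotated])
    then have "cinner u (y (z v)) = cinner (cadj z u) (y v)"
      by (rule tendsto_unique[OF F lim])
    then show "cinner u (y (z v)) = cinner u (z (y v))" by (simp add: cadj[OF S[OF z]])
  qed
qed

section \<open>Dominatedly continuous functionals on bounded Borel functions\<close>

definition bborel :: "(real \<Rightarrow> real) \<Rightarrow> bool" where
  "bborel f \<longleftrightarrow> f \<in> borel_measurable borel \<and> bounded (range f)"

lemma bborelI: "f \<in> borel_measurable borel \<Longrightarrow> (\<And>s. \<bar>f s\<bar> \<le> K) \<Longrightarrow> bborel f"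
  by (auto simp: bborel_def bounded_iff)

lemma bborel_meas [measurable_dest]: "bborel f \<Longrightarrow> f \<in> borel_measurable borel"
  by (simp add: bborel_def)

lemma bborel_bound:
  assumes "bborel f"
  obtains K where "0 \<le> K" "\<And>s. \<bar>f s\<bar> \<le> K"
proof -
  obtain K where "\<And>s. \<bar>f s\<bar> \<le> K" using assms by (auto simp: bborel_def bounded_iff)
  then show ?thesis using that[of K] by (metis abs_ge_zero order_trans)
qed

lemma bborel_const [simp]: "bborel (\<lambda>s. c)"
  by (rule bborelI[of _ "\<bar>c\<bar>"]) auto

lemma bborel_indicator [simp]: "B \<in> sets borel \<Longrightarrow> bborel (indicator B)"
  by (rule bborelI[of _ 1]) (auto simp: indicator_def)

lemma bborel_add: assumes "bborel f" "bborel g" shows "bborel (\<lambda>s. f s + g s)"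
proof -
  obtain K where K: "\<And>s. \<bar>f s\<bar> \<le> K" by (rule bborel_bound[OF assms(1)]) blast
  obtain L where L: "\<And>s. \<bar>g s\<bar> \<le> L" by (rule bborel_bound[OF assms(2)]) blast
  have "\<bar>f s + g s\<bar> \<le> K + L" for s using K[of s] L[of s] by linarith
  then show ?thesis using assms[THEN bborel_meas] by (intro bborelI[where K = "K + L"]) simp_all
qed

lemma bborel_mult: assumes "bborel f" "bborel g" shows "bborel (\<lambda>s. f s * g s)"
proof -
  obtain K where K: "0 \<le> K" "\<And>s. \<bar>f s\<bar> \<le> K" using bborel_bound[OF assms(1)] by blast
  obtain L where L: "0 \<le> L" "\<And>s. \<bar>g s\<bar> \<le> L" using bborel_bound[OF assms(2)] by blast
  have "\<bar>f s * g s\<bar> \<le> K * L" for s unfolding abs_mult using K L by (intro mult_mono) auto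
  then show ?thesis using assms[THEN bborel_meas] by (intro bborelI[where K = "K * L"]) simp_all
qed

lemma bborel_cmult: "bborel f \<Longrightarrow> bborel (\<lambda>s. c * f s)"
  by (rule bborel_mult) auto

lemma bborel_diff: "bborel f \<Longrightarrow> bborel g \<Longrightarrow> bborel (\<lambda>s. f s - g s)"
  using bborel_add[of f "\<lambda>s. (- 1) * g s"] bborel_cmult[of g "- 1"] by simp

lemma bborel_sum: "(\<And>i. i \<in> I \<Longrightarrow> bborel (f i)) \<Longrightarrow> bborel (\<lambda>s. \<Sum>i\<in>I. f i s)"
  by (induction I rule: infinite_finite_induct) (auto intro: bborel_add)

lemma bborel_compose: "bborel f \<Longrightarrow> h \<in> borel_measurable borel \<Longrightarrow> bborel (\<lambda>s. f (h s))"
  by (auto simp: bborel_def bounded_iff)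

lemmas bborel_intros = bborel_add bborel_mult bborel_cmult bborel_diff bborel_sum bborel_const
  bborel_indicator

text \<open>Continuity under bounded pointwise convergence stands in for countable additivity, and
  complex values admit differences of matrix coefficients without splitting them into positive
  measures. Convergence is demanded only on \<open>S\<close>, which makes the functional blind to
  values off \<open>S\<close> (\<open>bfunctional_cong\<close>).\<close>

definition bfunctional :: "real set \<Rightarrow> ((real \<Rightarrow> real) \<Rightarrow> complex) \<Rightarrow> bool" where
  "bfunctional S \<Lambda> \<longleftrightarrow>
     (\<forall>f g. bborel f \<longrightarrow> bborel g \<longrightarrow> \<Lambda> (\<lambda>s. f s + g s) = \<Lambda> f + \<Lambda> g) \<and>
     (\<forall>c f. bborel f \<longrightarrow> \<Lambda> (\<lambda>s. c * f s) = complex_of_real c * \<Lambda> f) \<and>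
     (\<forall>F f K. (\<forall>n. bborel (F n)) \<and> bborel f \<and> (\<forall>n s. \<bar>F n s\<bar> \<le> K) \<and>
        (\<forall>s\<in>S. (\<lambda>n. F n s) \<longlonglongrightarrow> f s) \<longrightarrow> (\<lambda>n::nat. \<Lambda> (F n)) \<longlonglongrightarrow> \<Lambda> f)"

lemma bfunctionalI:
  assumes "\<And>f g. bborel f \<Longrightarrow> bborel g \<Longrightarrow> \<Lambda> (\<lambda>s. f s + g s) = \<Lambda> f + \<Lambda> g"
    "\<And>c f. bborel f \<Longrightarrow> \<Lambda> (\<lambda>s. c * f s) = complex_of_real c * \<Lambda> f"
    "\<And>F f K. (\<And>n. bborel (F n)) \<Longrightarrow> bborel f \<Longrightarrow> (\<And>n s. \<bar>F n s\<bar> \<le> K) \<Longrightarrow>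
        (\<And>s. s \<in> S \<Longrightarrow> (\<lambda>n. F n s) \<longlonglongrightarrow> f s) \<Longrightarrow> (\<lambda>n::nat. \<Lambda> (F n)) \<longlonglongrightarrow> \<Lambda> f"
  shows "bfunctional S \<Lambda>"
  unfolding bfunctional_def
proof (intro conjI allI impI)
  fix F f K
  assume "(\<forall>n. bborel (F n)) \<and> bborel f \<and> (\<forall>n s. \<bar>F n s\<bar> \<le> K) \<and> (\<forall>s\<in>S. (\<lambda>n. F n s) \<longlonglongrightarrow> f s)"
  then show "(\<lambda>n::nat. \<Lambda> (F n)) \<longlonglongrightarrow> \<Lambda> f" by (intro assms(3)[of F f K]) auto
qed (rule assms; assumption)+

lemma bfunctionalD:
  assumes "bfunctional S \<Lambda>"
  shows "bborel f \<Longrightarrow> bborel g \<Longrightarrow> \<Lambda> (\<lambda>s. f s + g s) = \<Lambda> f + \<Lambda> g"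
    "bborel f \<Longrightarrow> \<Lambda> (\<lambda>s. c * f s) = complex_of_real c * \<Lambda> f"
    "(\<And>n. bborel (F n)) \<Longrightarrow> bborel f \<Longrightarrow> (\<And>n s. \<bar>F n s\<bar> \<le> K) \<Longrightarrow>
        (\<And>s. s \<in> S \<Longrightarrow> (\<lambda>n. F n s) \<longlonglongrightarrow> f s) \<Longrightarrow> (\<lambda>n::nat. \<Lambda> (F n)) \<longlonglongrightarrow> \<Lambda> f"
proof -
  note L = assms[unfolded bfunctional_def]
  show "bborel f \<Longrightarrow> bborel g \<Longrightarrow> \<Lambda> (\<lambda>s. f s + g s) = \<Lambda> f + \<Lambda> g" using L by simp
  show "bborel f \<Longrightarrow> \<Lambda> (\<lambda>s. c * f s) = complex_of_real c * \<Lambda> f" using L by simp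
  assume "\<And>n. bborel (F n)" "bborel f" "\<And>n s. \<bar>F n s\<bar> \<le> K" "\<And>s. s \<in> S \<Longrightarrow> (\<lambda>n. F n s) \<longlonglongrightarrow> f s"
  then show "(\<lambda>n::nat. \<Lambda> (F n)) \<longlonglongrightarrow> \<Lambda> f"
    by (intro L[THEN conjunct2, THEN conjunct2, rule_format, of F f K]) auto
qed

text \<open>Convergence on the larger set is the stronger demand on a sequence, so continuity is
  inherited upwards.\<close>

lemma bfunctional_mono:
  assumes L: "bfunctional S \<Lambda>" and S: "S \<subseteq> S'" shows "bfunctional S' \<Lambda>"
proof (rule bfunctionalI)
  fix F f K
  assume *: "\<And>n. bborel (F n)" "bborel f" "\<And>n s. \<bar>F n s\<bar> \<le> K" "\<And>s. s \<in> S' \<Longrightarrow> (\<lambda>n. F n s) \<longlonglongrightarrow> f s"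
  show "(\<lambda>n. \<Lambda> (F n)) \<longlonglongrightarrow> \<Lambda> f"
    by (rule bfunctionalD(3)[OF L *(1-3)]) (use *(4) S in auto)
qed (rule bfunctionalD(1,2)[OF L]; assumption)+

lemma bfunctional_zero: "bfunctional S \<Lambda> \<Longrightarrow> \<Lambda> (\<lambda>s. 0) = 0"
  using bfunctionalD(2)[of S \<Lambda> "\<lambda>s. 0" 0] by simp

lemma bfunctional_sum:
  assumes "bfunctional S \<Lambda>" "\<And>i. i \<in> I \<Longrightarrow> bborel (f i)"
  shows "\<Lambda> (\<lambda>s. \<Sum>i\<in>I. f i s) = (\<Sum>i\<in>I. \<Lambda> (f i))"
  using assms(2)
  by (induction I rule: infinite_finite_induct)
    (simp_all add: bfunctional_zero[OF assms(1)] bfunctionalD(1)[OF assms(1)] bborel_sum)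

lemma bfunctional_cong:
  assumes L: "bfunctional S \<Lambda>" and "bborel f" "bborel g" "\<And>s. s \<in> S \<Longrightarrow> f s = g s"
  shows "\<Lambda> f = \<Lambda> g"
proof -
  obtain K where "\<And>s. \<bar>f s\<bar> \<le> K" using bborel_bound[OF assms(2)] by metis
  then have "(\<lambda>n::nat. \<Lambda> f) \<longlonglongrightarrow> \<Lambda> g"
    using assms by (intro bfunctionalD(3)[OF L, of "\<lambda>_. f" g K]) auto
  then show ?thesis by (simp add: LIMSEQ_const_iff)
qed

text \<open>Dominated convergence needs one bound on the whole line, whereas the approximation is
  uniform only on \<open>S\<close>; vanishing off \<open>S\<close> supplies the bound there.\<close>

lemma bfunctional_uniform_zero:
  assumes L: "bfunctional S \<Lambda>" and f: "bborel f"
    and approx: "\<And>e. e > 0 \<Longrightarrow> \<exists>g K. bborel g \<and> \<Lambda> g = 0 \<and> (\<forall>s\<in>S. \<bar>f s - g s\<bar> \<le> e) \<and> (\<forall>s. s \<notin> S \<longrightarrow> g s = 0)"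
  shows "\<Lambda> f = 0"
proof -
  obtain K where K: "0 \<le> K" "\<And>s. \<bar>f s\<bar> \<le> K" by (rule bborel_bound[OF f]) blast
  have "\<exists>g. bborel g \<and> \<Lambda> g = 0 \<and> (\<forall>s\<in>S. \<bar>f s - g s\<bar> \<le> 1 / Suc n) \<and> (\<forall>s. s \<notin> S \<longrightarrow> g s = 0)" for n
    using approx[of "1 / Suc n"] by auto
  then obtain G where G: "\<And>n. bborel (G n)" "\<And>n. \<Lambda> (G n) = 0"
    "\<And>n s. s \<in> S \<Longrightarrow> \<bar>f s - G n s\<bar> \<le> 1 / Suc n" "\<And>n s. s \<notin> S \<Longrightarrow> G n s = 0" by metis
  have "(\<lambda>n. \<Lambda> (G n)) \<longlonglongrightarrow> \<Lambda> f"
  proof (rule bfunctionalD(3)[OF L, of _ _ "K + 1"])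
    show "\<bar>G n s\<bar> \<le> K + 1" for n s
    proof (cases "s \<in> S")
      case True
      have "1 / real (Suc n) \<le> 1" by simp
      then show ?thesis using G(3)[OF True, of n] K(2)[of s] by linarith
    qed (use K G(4) in auto)
    show "(\<lambda>n. G n s) \<longlonglongrightarrow> f s" if "s \<in> S" for s
    proof (rule LIM_zero_cancel, rule Lim_null_comparison)
      show "\<forall>\<^sub>F n in sequentially. norm (G n s - f s) \<le> 1 / Suc n"
        using G(3)[OF that] by (simp add: abs_minus_commute)
      show "(\<lambda>n. 1 / real (Suc n)) \<longlonglongrightarrow> 0"
        using LIMSEQ_inverse_real_of_nat by (simp add: inverse_eq_divide)
    qed
  qed (use G f in auto)
  then show ?thesis using G(2) by (simp add: LIMSEQ_const_iff)
qed

text \<open>An identity principle: an equation between two such functionals holds for all bounded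
  Borel functions as soon as it holds on \<open>T\<close>. Sesquilinearity of \<open>bform\<close>,
  multiplicativity of the functional calculus and intertwining relations are obtained in this
  way.\<close>

definition determining :: "real set \<Rightarrow> (real \<Rightarrow> real) set \<Rightarrow> bool" where
  "determining S T \<longleftrightarrow> (\<forall>g\<in>T. bborel g) \<and>
     (\<forall>\<Lambda>. bfunctional S \<Lambda> \<longrightarrow> (\<forall>g\<in>T. \<Lambda> g = 0) \<longrightarrow> (\<forall>f. bborel f \<longrightarrow> \<Lambda> f = 0))"

lemma determiningD:
  "determining S T \<Longrightarrow> bfunctional S \<Lambda> \<Longrightarrow> (\<And>g. g \<in> T \<Longrightarrow> \<Lambda> g = 0) \<Longrightarrow> bborel f \<Longrightarrow> \<Lambda> f = 0"
  unfolding determining_def by blast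

lemma determining_indicators: "determining UNIV {indicator B | B. B \<in> sets borel}"
  unfolding determining_def
proof (intro conjI allI impI)
  fix \<Lambda> and f :: "real \<Rightarrow> real"
  assume L: "bfunctional UNIV \<Lambda>" and z: "\<forall>g\<in>{indicator B | B. B \<in> sets borel}. \<Lambda> g = 0"
    and f: "bborel f"
  have [measurable]: "f \<in> borel_measurable borel" using f by (rule bborel_meas)
  obtain K where K: "0 \<le> K" "\<And>s. \<bar>f s\<bar> \<le> K" by (rule bborel_bound[OF f]) blast
  show "\<Lambda> f = 0"
  proof (rule bfunctional_uniform_zero[OF L f])
    fix e :: real assume e: "e > 0"
    \<comment> \<open>\<open>g\<close> rounds \<open>f\<close> down to a multiple of
      \<open>e\<close>; as \<open>f\<close> is bounded, finitely many levels suffice, here with a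
      margin of 1 at either end.\<close>
    define J where "J = {- (\<lceil>K / e\<rceil> + 1) .. \<lceil>K / e\<rceil> + 1}"
    define g where "g s = (\<Sum>k\<in>J. (e * of_int k) * indicator {s. \<lfloor>f s / e\<rfloor> = k} s)" for s
    have inJ: "\<lfloor>f s / e\<rfloor> \<in> J" for s
    proof -
      have "\<bar>f s / e\<bar> \<le> K / e" using K e by (simp add: abs_divide divide_right_mono)
      then have "f s / e \<le> K / e" "- (K / e) \<le> f s / e" by linarith+
      then show ?thesis unfolding J_def by simp linarith
    qed
    have geq: "g s = e * of_int \<lfloor>f s / e\<rfloor>" for s
    proof -
      have "g s = (\<Sum>k\<in>J. if k = \<lfloor>f s / e\<rfloor> then e * of_int k else 0)"
        unfolding g_def by (intro sum.cong) auto
      also have "\<dots> = e * of_int \<lfloor>f s / e\<rfloor>" using inJ by (simp add: J_def)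
      finally show ?thesis .
    qed
    have b: "bborel (\<lambda>s. (e * of_int k) * indicator {s. \<lfloor>f s / e\<rfloor> = k} s)" for k
      by (intro bborel_intros) measurable
    have "\<Lambda> g = 0"
    proof -
      have "\<Lambda> g = (\<Sum>k\<in>J. \<Lambda> (\<lambda>s. (e * of_int k) * indicator {s. \<lfloor>f s / e\<rfloor> = k} s))"
        unfolding g_def by (rule bfunctional_sum[OF L b])
      also have "\<dots> = (\<Sum>k\<in>J. complex_of_real (e * of_int k) * \<Lambda> (indicator {s. \<lfloor>f s / e\<rfloor> = k}))"
        by (intro sum.cong refl bfunctionalD(2)[OF L] bborel_indicator) measurable
      also have "\<dots> = 0"
      proof (intro sum.neutral ballI)
        fix k
        have "{s. \<lfloor>f s / e\<rfloor> = k} \<in> sets borel" by measurable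
        then have "\<Lambda> (indicator {s. \<lfloor>f s / e\<rfloor> = k}) = 0" using z by blast
        then show "complex_of_real (e * of_int k) * \<Lambda> (indicator {s. \<lfloor>f s / e\<rfloor> = k}) = 0" by simp
      qed
      finally show ?thesis .
    qed
    moreover have "bborel g" unfolding g_def by (intro bborel_sum b)
    moreover have "\<bar>f s - g s\<bar> \<le> e" for s
    proof -
      have "f s - g s = e * (f s / e - of_int \<lfloor>f s / e\<rfloor>)" using e by (simp add: geq right_diff_distrib)
      moreover have "\<bar>f s / e - of_int \<lfloor>f s / e\<rfloor>\<bar> \<le> 1" by linarith
      ultimately show ?thesis using e by (simp add: abs_mult mult_left_le)
    qed
    ultimately show "\<exists>g K. bborel g \<and> \<Lambda> g = 0 \<and> (\<forall>s\<in>UNIV. \<bar>f s - g s\<bar> \<le> e) \<and> (\<forall>s. s \<notin> UNIV \<longrightarrow> g s = 0)"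
      by blast
  qed
qed auto

text \<open>The cut-off makes the monomial bounded on the line; in particular \<open>upow 0\<close>
  is the indicator of the unit interval and not the constant 1.\<close>

definition upow :: "nat \<Rightarrow> real \<Rightarrow> real" where
  "upow k s = indicator {0..1} s * s ^ k"

lemma bborel_upow [simp]: "bborel (upow k)"
proof (rule bborelI[of _ 1])
  show "upow k \<in> borel_measurable borel" unfolding upow_def by measurable
  show "\<bar>upow k s\<bar> \<le> 1" for s
    by (auto simp: upow_def indicator_def power_abs power_le_one)
qed

lemma upow_mult: "upow k s * upow l s = upow (k + l) s"
  by (auto simp: upow_def indicator_def power_add)

text \<open>The functional vanishes on continuous functions by Weierstrass approximation, then on
  indicators of rays by approximation with continuous ramps, then on all Borel indicators by a
  Dynkin class argument, and so everywhere by \<open>determining_indicators\<close>.\<close>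

lemma determining_upow: "determining {0..1} (range upow)"
  unfolding determining_def
proof (intro conjI allI impI)
  fix \<Lambda> and f :: "real \<Rightarrow> real"
  assume L: "bfunctional {0..1} \<Lambda>" and z: "\<forall>g\<in>range upow. \<Lambda> g = 0" and f: "bborel f"
  have cont: "\<Lambda> g = 0" if g: "bborel g" "continuous_on UNIV g" for g
  proof (rule bfunctional_uniform_zero[OF L g(1)])
    fix e :: real assume "e > 0"
    then obtain p where p: "real_polynomial_function p" "\<And>x. x \<in> {0..1} \<Longrightarrow> \<bar>g x - p x\<bar> < e"
      using Stone_Weierstrass_real_polynomial_function[of "{0..1::real}" g e] g(2)
        continuous_on_subset by (metis compact_Icc subset_UNIV)
    then obtain a n where a: "p = (\<lambda>x. \<Sum>i\<le>n. a i * x ^ i)"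
      by (auto simp: real_polynomial_function_iff_sum)
    define h where "h = (\<lambda>s. \<Sum>i\<le>n. a i * upow i s)"
    have h: "bborel h" unfolding h_def by (intro bborel_intros bborel_upow)
    have "\<Lambda> h = (\<Sum>i\<le>n. \<Lambda> (\<lambda>s. a i * upow i s))"
      unfolding h_def by (rule bfunctional_sum[OF L]) (intro bborel_intros bborel_upow)
    also have "\<dots> = 0" using z by (intro sum.neutral) (auto simp: bfunctionalD(2)[OF L])
    finally have "\<Lambda> h = 0" .
    moreover have hp: "h s = p s" if "s \<in> {0..1}" for s using that by (simp add: h_def a upow_def)
    moreover have "h s = 0" if "s \<notin> {0..1}" for s using that by (simp add: h_def upow_def)
    ultimately show "\<exists>h K. bborel h \<and> \<Lambda> h = 0 \<and> (\<forall>s\<in>{0..1}. \<bar>g s - h s\<bar> \<le> e) \<and> (\<forall>s. s \<notin> {0..1} \<longrightarrow> h s = 0)"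
      using h p(2) by (intro exI[of _ h]) (auto intro: less_imp_le)
  qed
  have ray: "\<Lambda> (indicator {..a}) = 0" for a
  proof -
    \<comment> \<open>For \<open>n > 0\<close> a continuous ramp, equal to 1 up to \<open>a\<close>
      and dropping to 0 within the distance \<open>1 / n\<close>.\<close>
    define F where "F n s = max 0 (min 1 (1 - real n * (s - a)))" for n s
    have F1: "\<bar>F n s\<bar> \<le> 1" for n s by (auto simp: F_def)
    have Fc: "continuous_on UNIV (F n)" for n unfolding F_def by (intro continuous_intros)
    have Fb: "bborel (F n)" for n
      by (rule bborelI[OF _ F1]) (intro borel_measurable_continuous_onI Fc)
    have lim: "(\<lambda>n. F n s) \<longlonglongrightarrow> indicator {..a} s" for s
    proof (cases "s \<le> a")
      case True
      then have "F n s = 1" for n by (simp add: F_def mult_nonneg_nonpos)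
      then show ?thesis using True by simp
    next
      case False
      then obtain N where N: "1 \<le> real N * (s - a)"
        using reals_Archimedean3[of "s - a"] by (metis diff_gt_0_iff_gt less_imp_le not_le)
      have "F n s = 0" if "n \<ge> N" for n
      proof -
        have "real N * (s - a) \<le> real n * (s - a)" using False that by (intro mult_right_mono) auto
        then show ?thesis using N by (simp add: F_def)
      qed
      then show ?thesis using False
        by (intro tendsto_eventually) (auto simp: eventually_sequentially)
    qed
    have "(\<lambda>n. \<Lambda> (F n)) \<longlonglongrightarrow> \<Lambda> (indicator {..a})"
      by (rule bfunctionalD(3)[OF L, of _ _ 1]) (use Fb F1 lim in auto)
    then show ?thesis using cont[OF Fb Fc] by (simp add: LIMSEQ_const_iff)
  qed
  have one: "\<Lambda> (\<lambda>s. 1) = 0" by (rule cont) auto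
  have ind: "\<Lambda> (indicator B) = 0" if "B \<in> sets borel" for B
  proof -
    have bs: "sets borel = sigma_sets UNIV (range (\<lambda>a::real. {..a}))"
      by (subst borel_eq_atMost) simp
    have st: "Int_stable (range (\<lambda>a::real. {..a}))" by (auto simp: Int_stable_def)
    have sub: "range (\<lambda>a::real. {..a}) \<subseteq> Pow UNIV" by simp
    have "B \<in> sigma_sets UNIV (range (\<lambda>a::real. {..a}))" using that bs by simp
    then show ?thesis
    proof (induction rule: sigma_sets_induct_disjoint[OF st sub, consumes 1, case_names basic empty compl union])
      case (basic A) then show ?case using ray by auto
    next
      case empty
      then show ?case using bfunctional_zero[OF L] by (simp add: indicator_def)
    next
      case (compl A)
      have A: "A \<in> sets borel" using compl bs by simp
      have "indicator (UNIV - A) = (\<lambda>s. 1 + (- 1) * indicator A s :: real)" by (auto simp: indicator_def)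
      then show ?case using A compl one
        by (simp only: bfunctionalD[OF L] bborel_intros) simp
    next
      case (union A)
      have A: "A i \<in> sets borel" for i using union(2) bs by blast
      define F where "F n s = (\<Sum>i<n. indicator (A i) s :: real)" for n s
      have Fu: "F n s = indicator (\<Union>i<n. A i) s" for n s
        unfolding F_def using union(1) by (subst indicator_UN_disjoint) (auto simp: disjoint_family_on_def)
      have "(\<lambda>n. \<Lambda> (F n)) \<longlonglongrightarrow> \<Lambda> (indicator (\<Union>i. A i))"
      proof (rule bfunctionalD(3)[OF L, of _ _ 1])
        show "bborel (F n)" for n unfolding F_def using A by (intro bborel_intros) auto
        show "(\<lambda>n. F n s) \<longlonglongrightarrow> indicator (\<Union>i. A i) s" for s
          unfolding Fu by (rule LIMSEQ_indicator_UN)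
      qed (use A in \<open>auto simp: Fu indicator_def\<close>)
      moreover have "\<Lambda> (F n) = 0" for n
        unfolding F_def using A union by (subst bfunctional_sum[OF L]) auto
      ultimately show ?case by (simp add: LIMSEQ_const_iff)
    qed
  qed
  show "\<Lambda> f = 0"
  proof (rule determiningD[OF determining_indicators _ _ f])
    show "bfunctional UNIV \<Lambda>"
      by (rule bfunctional_mono[OF L]) simp
  qed (use ind in auto)
qed auto

section \<open>The Hausdorff moment problem\<close>

text \<open>A bounded continuous stand-in for the identity on the unit interval, because weak
  convergence is tested on bounded continuous functions.\<close>

definition clip :: "real \<Rightarrow> real" where "clip x = max 0 (min 1 x)"

lemma clip_simps: "0 \<le> clip x" "clip x \<le> 1" "x \<in> {0..1} \<Longrightarrow> clip x = x"
  by (auto simp: clip_def)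

text \<open>\<open>D k j\<close> behaves like the integral of s^k (1 - s)^j, and \<open>rec\<close>
  expresses multiplication by 1 - s. The sum is then the expansion of s^a (s + (1 - s))^n.\<close>

lemma bernstein_total:
  fixes D :: "nat \<Rightarrow> nat \<Rightarrow> real"
  assumes rec: "\<And>k j. D k (Suc j) = D k j - D (Suc k) j"
  shows "(\<Sum>k\<le>n. (n choose k) * D (a + k) (n - k)) = D a 0"
proof (induction n arbitrary: a)
  case (Suc n)
  have "(\<Sum>k\<le>Suc n. (Suc n choose k) * D (a + k) (Suc n - k))
      = D a (Suc n) + (\<Sum>k\<le>n. (Suc n choose Suc k) * D (a + Suc k) (n - k))"
    by (subst sum.atMost_Suc_shift) simp
  also have "\<dots> = D a (Suc n) + (\<Sum>k\<le>n. (n choose Suc k) * D (a + Suc k) (n - k))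
      + (\<Sum>k\<le>n. (n choose k) * D (Suc a + k) (n - k))"
    by (simp add: sum.distrib[symmetric] algebra_simps)
  also have "D a (Suc n) + (\<Sum>k\<le>n. (n choose Suc k) * D (a + Suc k) (n - k))
      = (\<Sum>k\<le>Suc n. (n choose k) * D (a + k) (Suc n - k))"
    by (subst sum.atMost_Suc_shift) simp
  also have "\<dots> = (\<Sum>k\<le>n. (n choose k) * D (a + k) (Suc (n - k)))"
    by (simp add: Suc_diff_le)
  also have "\<dots> = (\<Sum>k\<le>n. (n choose k) * D (a + k) (n - k))
      - (\<Sum>k\<le>n. (n choose k) * D (Suc a + k) (n - k))"
    by (simp add: rec sum_subtractf[symmetric] algebra_simps)
  finally show ?case by (simp add: Suc.IH)
qed simp

text \<open>The sum is the moment of order \<open>r\<close> of the Bernstein measure, which puts the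
  mass \<open>(n choose k) * D k (n - k)\<close> at \<open>k / n\<close>. In the induction one
  factor \<open>k / n\<close> is absorbed by the binomial coefficient and shifts \<open>D\<close>,
  at the price of nodes \<open>Suc j / Suc n\<close> instead of \<open>j / n\<close>.\<close>

lemma bernstein_moments_tendsto:
  fixes D :: "nat \<Rightarrow> nat \<Rightarrow> real"
  assumes "\<And>k j. 0 \<le> D k j" "\<And>k j. D k (Suc j) = D k j - D (Suc k) j"
  shows "(\<lambda>n. \<Sum>k\<le>n. (n choose k) * D k (n - k) * (k / n) ^ r) \<longlonglongrightarrow> D r 0"
  using assms
proof (induction r arbitrary: D)
  case (0 D)
  show ?case using bernstein_total[of D _ 0, OF 0(2)] by simp
next
  case (Suc r D)
  define D' where "D' k = D (Suc k)" for k
  define w where "w n j = (n choose j) * D' j (n - j)" for n j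
  have w0: "0 \<le> w n j" for n j by (simp add: w_def D'_def Suc.prems)
  have IH: "(\<lambda>n. \<Sum>k\<le>n. w n k * (k / n) ^ r) \<longlonglongrightarrow> D' r 0"
    unfolding w_def by (rule Suc.IH) (auto simp: D'_def Suc.prems)
  have eq: "(\<Sum>k\<le>Suc n. (Suc n choose k) * D k (Suc n - k) * (k / Suc n) ^ Suc r)
      = (\<Sum>j\<le>n. w n j * (Suc j / Suc n) ^ r)" for n
  proof -
    have "(Suc n choose Suc j) * (real (Suc j) / real (Suc n)) = (n choose j)" for j
    proof -
      have "real (Suc n choose Suc j) * real (Suc j) = real (n choose j) * real (Suc n)"
        by (metis Suc_times_binomial_eq mult.commute of_nat_mult)
      then show ?thesis by (simp add: field_simps del: binomial_Suc_Suc)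
    qed
    note * = this
    have "(\<Sum>k\<le>Suc n. (Suc n choose k) * D k (Suc n - k) * (k / Suc n) ^ Suc r)
      = (\<Sum>j\<le>n. (Suc n choose Suc j) * D (Suc j) (n - j) * (Suc j / Suc n) ^ Suc r)"
      by (subst sum.atMost_Suc_shift) (simp del: binomial_Suc_Suc)
    also have "\<dots> = (\<Sum>j\<le>n. ((Suc n choose Suc j) * (Suc j / Suc n)) * D' j (n - j) * (Suc j / Suc n) ^ r)"
      by (intro sum.cong refl) (simp add: D'_def del: binomial_Suc_Suc)
    finally show ?thesis unfolding * w_def .
  qed
  \<comment> \<open>Replacing the nodes moves each power by at most \<open>r / Suc n\<close>, and
    the weights have total mass \<open>D' 0 0\<close> independently of \<open>n\<close>.\<close>
  have bnd: "\<bar>(\<Sum>j\<le>n. w n j * (Suc j / Suc n) ^ r) - (\<Sum>j\<le>n. w n j * (j / n) ^ r)\<bar>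
      \<le> D' 0 0 * (r / Suc n)" if "n > 0" for n
  proof -
    have "\<bar>(Suc j / Suc n) ^ r - (j / n) ^ r\<bar> \<le> r / Suc n" if "j \<le> n" for j
    proof -
      have "\<bar>(Suc j / Suc n) ^ r - (j / n) ^ r\<bar> \<le> r * \<bar>Suc j / Suc n - j / n\<bar>"
        using norm_power_diff[of "Suc j / Suc n" "j / n" r] that \<open>n > 0\<close> by simp
      also have "Suc j / Suc n - j / n = (n - j) / n / Suc n"
        using \<open>n > 0\<close> that by (simp add: field_simps of_nat_diff)
      also have "\<bar>(n - j) / n / Suc n\<bar> \<le> 1 / Suc n"
      proof -
        have q: "real (n - j) / n \<le> 1" "0 \<le> real (n - j) / n"
          using \<open>n > 0\<close> that by (auto simp: divide_le_eq_1)
        have "\<bar>real (n - j) / n / Suc n\<bar> = real (n - j) / n / Suc n"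
          by (intro abs_of_nonneg divide_nonneg_nonneg) auto
        also have "\<dots> \<le> 1 / Suc n" by (intro divide_right_mono q) auto
        finally show ?thesis .
      qed
      finally show ?thesis by (simp add: mult_left_mono)
    qed
    note d = this
    have "\<bar>(\<Sum>j\<le>n. w n j * (Suc j / Suc n) ^ r) - (\<Sum>j\<le>n. w n j * (j / n) ^ r)\<bar>
        = \<bar>\<Sum>j\<le>n. w n j * ((Suc j / Suc n) ^ r - (j / n) ^ r)\<bar>"
      by (simp only: sum_subtractf[symmetric] right_diff_distrib)
    also have "\<dots> \<le> (\<Sum>j\<le>n. \<bar>w n j * ((Suc j / Suc n) ^ r - (j / n) ^ r)\<bar>)" by (rule sum_abs)
    also have "\<dots> \<le> (\<Sum>j\<le>n. w n j * (r / Suc n))"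
      unfolding abs_mult using d w0 by (intro sum_mono mult_mono) auto
    also have "\<dots> = D' 0 0 * (r / Suc n)"
      unfolding sum_distrib_right[symmetric]
      using bernstein_total[of D' n 0] by (simp add: w_def D'_def Suc.prems)
    finally show ?thesis .
  qed
  have "(\<lambda>n. real r * inverse (Suc n)) \<longlonglongrightarrow> real r * 0"
    by (intro tendsto_mult tendsto_const LIMSEQ_inverse_real_of_nat)
  then have "(\<lambda>n. D' 0 0 * (r / Suc n)) \<longlonglongrightarrow> 0"
    by (intro tendsto_mult_right_zero) (simp add: divide_inverse)
  then have "(\<lambda>n. (\<Sum>j\<le>n. w n j * (Suc j / Suc n) ^ r) - (\<Sum>j\<le>n. w n j * (j / n) ^ r)) \<longlonglongrightarrow> 0"
  proof (rule Lim_null_comparison[rotated])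
    show "\<forall>\<^sub>F n in sequentially. norm ((\<Sum>j\<le>n. w n j * (Suc j / Suc n) ^ r) - (\<Sum>j\<le>n. w n j * (j / n) ^ r))
        \<le> D' 0 0 * (r / Suc n)"
      using eventually_gt_at_top[of 0] by eventually_elim (simp only: real_norm_def bnd)
  qed
  from tendsto_add[OF this IH] have "(\<lambda>n. \<Sum>j\<le>n. w n j * (Suc j / Suc n) ^ r) \<longlonglongrightarrow> D (Suc r) 0"
    by (simp add: D'_def)
  then have "(\<lambda>n. \<Sum>k\<le>Suc n. (Suc n choose k) * D k (Suc n - k) * (k / Suc n) ^ Suc r) \<longlonglongrightarrow> D (Suc r) 0"
    by (simp only: eq)
  then show ?case by (rule LIMSEQ_imp_Suc)
qed

text \<open>The Bernstein measures sit on the unit interval and are therefore tight; Helly selection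
  gives a limit measure, whose moments are the limits found above.\<close>

lemma hausdorff_moment_prob:
  fixes D :: "nat \<Rightarrow> nat \<Rightarrow> real"
  assumes D: "\<And>k j. 0 \<le> D k j" "\<And>k j. D k (Suc j) = D k j - D (Suc k) j" and one: "D 0 0 = 1"
  shows "\<exists>M. real_distribution M \<and> emeasure M (- {0..1}) = 0 \<and> (\<forall>r. (\<integral>s. upow r s \<partial>M) = D r 0)"
proof -
  define w where "w n k = (n choose k) * D k (n - k)" for n k
  have w0: "0 \<le> w n k" for n k by (simp add: w_def D)
  have w1: "(\<Sum>k\<le>n. w n k) = 1" for n using bernstein_total[of D n 0] D one by (simp add: w_def)
  define P where "P n = point_measure {..n} (\<lambda>k. ennreal (w n k))" for n
  define \<mu> where "\<mu> n = distr (P n) borel (\<lambda>k. real k / real n)" for n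
  have meas: "(\<lambda>k. real k / real n) \<in> measurable (P n) borel" for n by (simp add: P_def)
  have P: "prob_space (P n)" for n
  proof
    show "emeasure (P n) (space (P n)) = 1"
      using w0 w1[of n] by (simp add: P_def space_point_measure emeasure_point_measure_finite)
  qed
  have rd: "real_distribution (\<mu> n)" for n
    unfolding \<mu>_def using prob_space.real_distribution_distr[OF P meas] .
  have int: "(\<integral>s. f s \<partial>\<mu> n) = (\<Sum>k\<le>n. w n k * f (k / n))" if f: "f \<in> borel_measurable borel" for f :: "real \<Rightarrow> real" and n
  proof -
    have "(\<integral>s. f s \<partial>\<mu> n) = (\<integral>k. f (k / n) \<partial>P n)"
      unfolding \<mu>_def by (rule integral_distr[OF meas f])
    also have "\<dots> = (\<Sum>k\<le>n. w n k * f (k / n))"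
      unfolding P_def by (subst lebesgue_integral_point_measure_finite) (auto simp: w0)
    finally show ?thesis .
  qed
  have "tight \<mu>"
    unfolding tight_def
  proof (intro conjI allI impI rd)
    fix e :: real assume "e > 0"
    \<comment> \<open>\<open>tight\<close> asks for a half-open interval, so its left end has to lie
      strictly below the node 0; for \<open>n = 0\<close> the only node is
      \<open>0 / 0 = 0\<close>.\<close>
    have "measure (\<mu> n) {-1<..1} = 1" for n
    proof -
      interpret prob_space "\<mu> n" using rd[of n] by (simp add: real_distribution_def)
      have "AE s in \<mu> n. s \<in> {-1<..1}"
      proof -
        have "-1 < real k / real n" for k
        proof -
          have "0 \<le> real k / real n" by simp
          then show ?thesis by linarith
        qed
        then have "AE k in P n. real k / real n \<in> {-1<..1}"
          by (intro AE_I2) (auto simp: P_def space_point_measure divide_le_eq_1)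
        then show ?thesis unfolding \<mu>_def by (subst AE_distr_iff[OF meas]) auto
      qed
      then show ?thesis by (subst prob_eq_1) (auto simp: \<mu>_def)
    qed
    then show "\<exists>a b. a < b \<and> (\<forall>n. measure (\<mu> n) {a<..b} > 1 - e)"
      using \<open>e > 0\<close> by (intro exI[of _ "-1"] exI[of _ 1]) auto
  qed
  from tight_imp_convergent_subsubsequence[OF this, of id]
  obtain r M where r: "strict_mono r" and M: "real_distribution M" and conv: "weak_conv_m (\<mu> \<circ> r) M"
    by (auto simp: strict_mono_def)
  interpret M: real_distribution M by (rule M)
  have lim: "(\<lambda>n. \<Sum>k\<le>r n. w (r n) k * f (k / r n)) \<longlonglongrightarrow> (\<integral>s. f s \<partial>M)"
    if f: "\<And>x. isCont f x" "\<And>x. \<bar>f x\<bar> \<le> 1" for f :: "real \<Rightarrow> real"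
  proof -
    have "(\<lambda>n. integral\<^sup>L ((\<mu> \<circ> r) n) f) \<longlonglongrightarrow> integral\<^sup>L M f"
      by (rule weak_conv_imp_integral_bdd_continuous_conv[OF _ M conv, of f 1])
        (use f rd in \<open>auto simp: o_def\<close>)
    moreover have "f \<in> borel_measurable borel"
      using f(1) by (intro borel_measurable_continuous_onI continuous_at_imp_continuous_on) auto
    ultimately show ?thesis by (simp add: int)
  qed
  have frac: "real k / real n \<in> {0..1}" if "k \<le> n" for k n using that by (auto simp: divide_le_eq_1)
  have AE: "AE s in M. s \<in> {0..1}"
  proof -
    \<comment> \<open>The distance from the unit interval, truncated at 1. It vanishes at all nodes,
      hence its integral against the limit is 0 and the limit has no mass off the interval.\<close>
    define g where "g = (\<lambda>s. min 1 \<bar>s - clip s\<bar>)"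
    have g: "isCont g x" "\<bar>g x\<bar> \<le> 1" "0 \<le> g x" for x
      unfolding g_def clip_def by (auto intro!: continuous_intros)
    have [measurable]: "g \<in> borel_measurable borel" unfolding g_def clip_def by measurable
    have "(\<Sum>k\<le>n. w n k * g (k / n)) = 0" for n
      by (intro sum.neutral ballI) (use frac in \<open>auto simp: g_def clip_simps(3)\<close>)
    then have "(\<integral>s. g s \<partial>M) = 0" using lim[OF g(1,2)] by (simp add: LIMSEQ_const_iff)
    moreover have "integrable M g"
      by (rule M.integrable_const_bound[of _ 1]) (use g in auto)
    ultimately have "AE s in M. g s = 0" using g(3) by (subst (asm) integral_nonneg_eq_0_iff_AE) auto
    then show ?thesis by eventually_elim (auto simp: g_def clip_def min_def max_def split: if_splits)
  qed
  have "emeasure M (- {0..1}) = 0"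
    using AE_iff_null_sets[of "- {0..1}" M] AE by (auto simp: null_sets_def elim: AE_mp)
  moreover have "(\<integral>s. upow k s \<partial>M) = D k 0" for k
  proof -
    have "(\<integral>s. upow k s \<partial>M) = (\<integral>s. clip s ^ k \<partial>M)"
      using AE by (intro integral_cong_AE) (auto simp: upow_def clip_simps(3) bborel_meas clip_def elim!: AE_mp)
    moreover have "(\<lambda>n. \<Sum>j\<le>r n. w (r n) j * clip (j / r n) ^ k) \<longlonglongrightarrow> (\<integral>s. clip s ^ k \<partial>M)"
      by (rule lim) (auto simp: clip_def power_abs power_le_one intro!: continuous_intros)
    moreover have "(\<Sum>j\<le>n. w n j * clip (j / n) ^ k) = (\<Sum>j\<le>n. (n choose j) * D j (n - j) * (j / n) ^ k)" for n
      by (intro sum.cong refl) (use frac in \<open>auto simp: w_def clip_simps(3)\<close>)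
    moreover have "(\<lambda>n. \<Sum>j\<le>r n. (r n choose j) * D j (r n - j) * (j / r n) ^ k) \<longlonglongrightarrow> D k 0"
      using LIMSEQ_subseq_LIMSEQ[OF bernstein_moments_tendsto[of D k] r] D by (simp add: o_def)
    ultimately show ?thesis by (simp add: LIMSEQ_unique)
  qed
  ultimately show ?thesis using M by blast
qed

lemma integral_scale_measure:
  fixes f :: "'a \<Rightarrow> real"
  assumes "f \<in> borel_measurable M" "0 \<le> c"
  shows "(\<integral>s. f s \<partial>scale_measure (ennreal c) M) = c * (\<integral>s. f s \<partial>M)"
proof -
  have "scale_measure (ennreal c) M = density M (\<lambda>_. ennreal c)"
    by (rule measure_eqI) (auto simp: emeasure_density nn_integral_cmult)
  then show ?thesis using assms by (simp add: integral_density)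
qed

text \<open>After division by \<open>D 0 0\<close> this is the probability case; if
  \<open>D 0 0 = 0\<close>, all moments vanish because they decrease.\<close>

lemma hausdorff_moment:
  fixes D :: "nat \<Rightarrow> nat \<Rightarrow> real"
  assumes D: "\<And>k j. 0 \<le> D k j" "\<And>k j. D k (Suc j) = D k j - D (Suc k) j"
  shows "\<exists>M. sets M = sets borel \<and> finite_measure M \<and> emeasure M (- {0..1}) = 0 \<and>
    (\<forall>r. (\<integral>s. upow r s \<partial>M) = D r 0)"
proof (cases "D 0 0 = 0")
  case True
  have "D k 0 = 0" for k
  proof -
    have "D (Suc k) 0 \<le> D k 0" for k using D(1)[of k "Suc 0"] D(2)[of k 0] by simp
    then have "D k 0 \<le> D 0 0" by (rule lift_Suc_antimono_le) simp
    then show ?thesis using D(1)[of k 0] True by simp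
  qed
  then show ?thesis
    by (intro exI[of _ "null_measure borel"]) (auto intro!: finite_measureI)
next
  case False
  define c where "c = D 0 0"
  have c: "c > 0" using False D(1)[of 0 0] by (simp add: c_def)
  obtain M where M: "real_distribution M" "emeasure M (- {0..1}) = 0"
      "\<And>r. (\<integral>s. upow r s \<partial>M) = D r 0 / c"
    using hausdorff_moment_prob[of "\<lambda>k j. D k j / c"] D c
    by (auto simp: diff_divide_distrib c_def[symmetric])
  interpret M: real_distribution M by (rule M)
  show ?thesis
  proof (intro exI[of _ "scale_measure (ennreal c) M"] conjI allI)
    show "finite_measure (scale_measure (ennreal c) M)"
      by (rule finite_measureI) (simp add: ennreal_mult_eq_top_iff M.emeasure_eq_measure)
    show "(\<integral>s. upow r s \<partial>scale_measure (ennreal c) M) = D r 0" for r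
      by (subst integral_scale_measure) (use c M bborel_meas[OF bborel_upow] in auto)
  qed (simp_all add: M)
qed

section \<open>Operators from families of measures\<close>

lemma bfunctional_add:
  assumes "bfunctional S \<Lambda>" "bfunctional S \<Lambda>'" shows "bfunctional S (\<lambda>g. \<Lambda> g + \<Lambda>' g)"
  by (rule bfunctionalI)
    (auto simp: bfunctionalD(1,2)[OF assms(1)] bfunctionalD(1,2)[OF assms(2)] distrib_left
      intro!: tendsto_add bfunctionalD(3)[OF assms(1)] bfunctionalD(3)[OF assms(2)])

lemma bfunctional_cmult:
  assumes "bfunctional S \<Lambda>" shows "bfunctional S (\<lambda>g. c * \<Lambda> g)"
  by (rule bfunctionalI)
    (auto simp: bfunctionalD(1,2)[OF assms(1)] algebra_simps
      intro!: tendsto_mult_left bfunctionalD(3)[OF assms(1)])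

lemma bfunctional_diff:
  assumes "bfunctional S \<Lambda>" "bfunctional S \<Lambda>'" shows "bfunctional S (\<lambda>g. \<Lambda> g - \<Lambda>' g)"
  using bfunctional_add[OF assms(1) bfunctional_cmult[OF assms(2), of "- 1"]] by simp

lemma bfunctional_times:
  assumes L: "bfunctional S \<Lambda>" and h: "bborel h" shows "bfunctional S (\<lambda>g. \<Lambda> (\<lambda>s. g s * h s))"
proof (rule bfunctionalI)
  show "\<Lambda> (\<lambda>s. (f s + g s) * h s) = \<Lambda> (\<lambda>s. f s * h s) + \<Lambda> (\<lambda>s. g s * h s)"
    if "bborel f" "bborel g" for f g
    unfolding distrib_right by (intro bfunctionalD(1)[OF L] bborel_mult that h)
  show "\<Lambda> (\<lambda>s. c * f s * h s) = complex_of_real c * \<Lambda> (\<lambda>s. f s * h s)" if "bborel f" for c f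
    unfolding mult.assoc by (intro bfunctionalD(2)[OF L] bborel_mult that h)
  fix F f K
  assume *: "\<And>n. bborel (F n)" "bborel f" "\<And>n s. \<bar>F n s\<bar> \<le> K" "\<And>s. s \<in> S \<Longrightarrow> (\<lambda>n. F n s) \<longlonglongrightarrow> f s"
  obtain H where H: "0 \<le> H" "\<And>s. \<bar>h s\<bar> \<le> H" by (rule bborel_bound[OF h]) blast
  have K: "0 \<le> K" using *(3)[of 0 0] abs_ge_zero order_trans by blast
  show "(\<lambda>n. \<Lambda> (\<lambda>s. F n s * h s)) \<longlonglongrightarrow> \<Lambda> (\<lambda>s. f s * h s)"
  proof (rule bfunctionalD(3)[OF L, of _ _ "K * H"])
    show "\<bar>F n s * h s\<bar> \<le> K * H" for n s
      unfolding abs_mult using * H K by (intro mult_mono) auto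
    show "(\<lambda>n. F n s * h s) \<longlonglongrightarrow> f s * h s" if "s \<in> S" for s
      using *(4)[OF that] by (intro tendsto_mult tendsto_const)
  qed (use * h in \<open>auto intro: bborel_mult\<close>)
qed

definition measure_on :: "real set \<Rightarrow> real measure \<Rightarrow> bool" where
  "measure_on S M \<longleftrightarrow> sets M = sets borel \<and> finite_measure M \<and> emeasure M (- S) = 0 \<and> S \<in> sets borel"

lemma measure_on_AE:
  assumes "measure_on S M" shows "AE s in M. s \<in> S"
proof -
  have "S \<in> sets borel" "sets M = sets borel" "emeasure M (- S) = 0"
    using assms by (simp_all only: measure_on_def)
  then have "- S \<in> null_sets M" by (intro null_setsI) (simp_all only: borel_comp)
  from AE_not_in[OF this] show ?thesis by simp
qed

lemma measure_on_integrable: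
  assumes "measure_on S M" "bborel f" shows "integrable M f"
proof -
  interpret finite_measure M using assms by (simp add: measure_on_def)
  have "sets M = sets borel" using assms by (simp add: measure_on_def)
  then have "f \<in> borel_measurable M"
    using bborel_meas[OF assms(2)] by (subst measurable_cong_sets[OF _ refl])
  moreover obtain K where "\<And>s. \<bar>f s\<bar> \<le> K" by (rule bborel_bound[OF assms(2)]) blast
  ultimately show ?thesis by (intro integrable_const_bound[of _ K] AE_I2) simp_all
qed

lemma measure_on_abs_integral:
  assumes M: "measure_on S M" and f: "\<And>s. \<bar>f s\<bar> \<le> K" "bborel f"
  shows "\<bar>\<integral>s. f s \<partial>M\<bar> \<le> K * measure M UNIV"
proof -
  interpret finite_measure M using M by (simp add: measure_on_def)
  have sp: "space M = UNIV" using M sets_eq_imp_space_eq[of M borel] by (simp add: measure_on_def)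
  have "\<bar>\<integral>s. f s \<partial>M\<bar> \<le> (\<integral>s. \<bar>f s\<bar> \<partial>M)" by (rule integral_abs_bound)
  also have "\<dots> \<le> (\<integral>s. K \<partial>M)"
    by (intro integral_mono) (use measure_on_integrable[OF M f(2)] f in auto)
  finally show ?thesis by (simp add: sp mult.commute)
qed

lemma bfunctional_integral:
  assumes M: "measure_on S M"
  shows "bfunctional S (\<lambda>g. complex_of_real (\<integral>s. g s \<partial>M))"
proof (rule bfunctionalI)
  note int = measure_on_integrable[OF M]
  show "complex_of_real (\<integral>s. f s + g s \<partial>M) = complex_of_real (\<integral>s. f s \<partial>M) + complex_of_real (\<integral>s. g s \<partial>M)"
    if "bborel f" "bborel g" for f g using that int by simp
  show "complex_of_real (\<integral>s. c * f s \<partial>M) = complex_of_real c * complex_of_real (\<integral>s. f s \<partial>M)" for c f by simp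
  fix F f K
  assume *: "\<And>n. bborel (F n)" "bborel f" "\<And>n s. \<bar>F n s\<bar> \<le> K" "\<And>s. s \<in> S \<Longrightarrow> (\<lambda>n. F n s) \<longlonglongrightarrow> f s"
  have "(\<lambda>n. \<integral>s. F n s \<partial>M) \<longlonglongrightarrow> (\<integral>s. f s \<partial>M)"
  proof (rule integral_dominated_convergence[where w = "\<lambda>_. K"])
    show "AE s in M. (\<lambda>n. F n s) \<longlonglongrightarrow> f s"
      using measure_on_AE[OF M] by eventually_elim (rule *)
  qed (use int * in \<open>auto intro: borel_measurable_integrable\<close>)
  then show "(\<lambda>n. complex_of_real (\<integral>s. F n s \<partial>M)) \<longlonglongrightarrow> complex_of_real (\<integral>s. f s \<partial>M)"
    by (rule tendsto_of_real)
qed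

text \<open>With \<open>\<mu> x\<close> in the role of the diagonal spectral measure at
  \<open>x\<close>, this is the polarized integral of \<open>g\<close>, with signs as in
  \<open>polarization\<close>.\<close>

definition bform :: "('h::chilbert \<Rightarrow> real measure) \<Rightarrow> 'h \<Rightarrow> 'h \<Rightarrow> (real \<Rightarrow> real) \<Rightarrow> complex" where
  "bform \<mu> x y g = (1 / 4) * (complex_of_real (\<integral>s. g s \<partial>\<mu> (x + y)) - complex_of_real (\<integral>s. g s \<partial>\<mu> (x - y))
     - \<i> * complex_of_real (\<integral>s. g s \<partial>\<mu> (x + \<i> *\<^sub>C y)) + \<i> * complex_of_real (\<integral>s. g s \<partial>\<mu> (x - \<i> *\<^sub>C y)))"

definition represents :: "'h::chilbert op \<Rightarrow> ('h \<Rightarrow> real measure) \<Rightarrow> (real \<Rightarrow> real) \<Rightarrow> bool" where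
  "represents f \<mu> g \<longleftrightarrow> bounded_clinear f \<and> (\<forall>x. cinner x (f x) = complex_of_real (\<integral>s. g s \<partial>\<mu> x))"

lemma represents_unique: "represents f \<mu> g \<Longrightarrow> represents f' \<mu> g \<Longrightarrow> f = f'"
  unfolding represents_def by (intro operator_eqI) auto

lemma represents_bform:
  assumes "represents f \<mu> g" shows "bform \<mu> x y g = cinner x (f y)"
proof -
  have "4 * cinner x (f y) = 4 * bform \<mu> x y g"
    using assms by (subst polarization[of "\<lambda>x y. cinner x (f y)"]) (auto simp: represents_def bform_def sesquilinear_cinner)
  then show ?thesis by simp
qed

text \<open>Only the functions of \<open>T\<close> are known to come from operators. As
  \<open>T\<close> is determining, this makes the measures depend quadratically on the vector and
  extends the correspondence to all bounded Borel functions; the bound on the mass makes the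
  resulting forms bounded.\<close>

definition quadratic_measures :: "real set \<Rightarrow> (real \<Rightarrow> real) set \<Rightarrow> ('h::chilbert \<Rightarrow> real measure) \<Rightarrow> bool" where
  "quadratic_measures S T \<mu> \<longleftrightarrow> (\<forall>x. measure_on S (\<mu> x) \<and> measure (\<mu> x) UNIV \<le> (norm x)\<^sup>2) \<and>
     determining S T \<and> (\<forall>g\<in>T. \<exists>f. represents f \<mu> g)"

lemma represents_exists:
  assumes q: "quadratic_measures S T \<mu>" and g: "bborel g"
  shows "\<exists>f. represents f \<mu> g"
proof -
  have M: "measure_on S (\<mu> x)" "measure (\<mu> x) UNIV \<le> (norm x)\<^sup>2" for x
    using q by (auto simp: quadratic_measures_def)
  have det: "determining S T" using q by (simp add: quadratic_measures_def)
  have T: "\<exists>f. represents f \<mu> g" if "g \<in> T" for g using q that by (simp add: quadratic_measures_def)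
  note bi = bfunctional_integral[OF M(1)]
  have bf: "bfunctional S (bform \<mu> x y)" for x y
    unfolding bform_def by (intro bfunctional_cmult bfunctional_add bfunctional_diff bi)
  let ?s = "\<lambda>x y. bform \<mu> x y g"
  \<comment> \<open>Each axiom of a sesquilinear form for \<open>bform\<close>, and the agreement
    with the integrals on the diagonal, is the vanishing of such a functional; for functions
    represented by an operator it is linear algebra.\<close>
  have z: "\<Lambda> g = 0" if "bfunctional S \<Lambda>" "\<And>g f. represents f \<mu> g \<Longrightarrow> \<Lambda> g = 0" for \<Lambda>
    using determiningD[OF det that(1) _ g] that(2) T by blast
  have 1: "?s x (y + z) - ?s x y - ?s x z = 0" for x y z
    by (rule z, (intro bfunctional_diff bfunctional_cmult bf)[])
      (auto simp: represents_bform, simp add: represents_def bounded_clinearD cinner_linear)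
  have 2: "?s x (c *\<^sub>C y) - c * ?s x y = 0" for x y c
    by (rule z, (intro bfunctional_diff bfunctional_cmult bf)[])
      (auto simp: represents_bform, simp add: represents_def bounded_clinearD cinner_linear)
  have 3: "?s (x + y) z - ?s x z - ?s y z = 0" for x y z
    by (rule z, (intro bfunctional_diff bfunctional_cmult bf)[])
      (auto simp: represents_bform, simp add: represents_def bounded_clinearD cinner_linear)
  have 4: "?s (c *\<^sub>C x) y - cnj c * ?s x y = 0" for x y c
    by (rule z, (intro bfunctional_diff bfunctional_cmult bf)[])
      (auto simp: represents_bform, simp add: represents_def bounded_clinearD cinner_linear)
  have 5: "?s x x - complex_of_real (\<integral>s. g s \<partial>\<mu> x) = 0" for x
    by (rule z, (intro bfunctional_diff bfunctional_cmult bf bi)[])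
      (auto simp: represents_bform, simp add: represents_def)
  have s: "sesquilinear_form ?s"
    using 1 2 3 4 unfolding sesquilinear_form_def by (simp add: algebra_simps)
  obtain K where K: "0 \<le> K" "\<And>s. \<bar>g s\<bar> \<le> K" by (rule bborel_bound[OF g]) blast
  have b: "cmod (?s x y) \<le> 4 * K * norm x * norm y" for x y
  proof (rule sesquilinear_form_bound[OF s _ K(1)])
    fix v
    have "cmod (?s v v) \<le> K * measure (\<mu> v) UNIV"
      using measure_on_abs_integral[OF M(1) K(2) g] 5[of v] by simp
    also have "\<dots> \<le> K * (norm v)\<^sup>2" using M K by (intro mult_left_mono) auto
    finally show "cmod (?s v v) \<le> K * (norm v)\<^sup>2" .
  qed
  obtain f where f: "bounded_clinear f" "\<And>x y. cinner x (f y) = ?s x y"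
    using sesquilinear_form_operator[OF s b] by blast
  then have "represents f \<mu> g" using 5 by (simp add: represents_def)
  then show ?thesis by blast
qed

text \<open>The Borel functional calculus of the family. A representing operator is unique by
  \<open>represents_unique\<close>, so the choice is only apparent.\<close>

definition qop :: "('h::chilbert \<Rightarrow> real measure) \<Rightarrow> (real \<Rightarrow> real) \<Rightarrow> 'h op" where
  "qop \<mu> g = (SOME f. represents f \<mu> g)"

lemma qop_eqI: "represents f \<mu> g \<Longrightarrow> qop \<mu> g = f"
  unfolding qop_def by (metis represents_unique someI)

context
  fixes S T and \<mu> :: "'h::chilbert \<Rightarrow> real measure"
  assumes q: "quadratic_measures S T \<mu>"
begin

lemma qop_represents: "bborel g \<Longrightarrow> represents (qop \<mu> g) \<mu> g"
  using represents_exists[OF q] qop_eqI by metis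

lemma qop_clinear: "bborel g \<Longrightarrow> bounded_clinear (qop \<mu> g)"
  using qop_represents by (simp add: represents_def)

lemma qop_form: "bborel g \<Longrightarrow> cinner x (qop \<mu> g x) = complex_of_real (\<integral>s. g s \<partial>\<mu> x)"
  using qop_represents by (simp add: represents_def)

lemma quadratic_measuresD: "measure_on S (\<mu> x)" "measure (\<mu> x) UNIV \<le> (norm x)\<^sup>2"
  using q by (auto simp: quadratic_measures_def)

lemma qop_bfunctional: "bfunctional S (\<lambda>g. cinner x (qop \<mu> g y))"
proof -
  have "bfunctional S (bform \<mu> x y)"
    unfolding bform_def by (intro bfunctional_cmult bfunctional_add bfunctional_diff bfunctional_integral quadratic_measuresD)
  then show ?thesis
    unfolding bfunctional_def using represents_bform[OF qop_represents]
    by (simp add: bborel_add bborel_cmult)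
qed

lemma qop_adjoint: "bborel g \<Longrightarrow> cinner (qop \<mu> g x) y = cinner x (qop \<mu> g y)"
proof -
  assume g: "bborel g"
  have "cadj (qop \<mu> g) = qop \<mu> g"
  proof (rule operator_eqI)
    fix x
    have "cinner (qop \<mu> g x) x = cinner x (qop \<mu> g x)"
      by (subst cinner_commute) (simp add: qop_form[OF g])
    then show "cinner x (cadj (qop \<mu> g) x) = cinner x (qop \<mu> g x)"
      by (simp add: cadj[OF qop_clinear[OF g]])
  qed (simp_all add: qop_clinear[OF g] cadj)
  then show ?thesis using cadj(2)[OF qop_clinear[OF g], of x y] by simp
qed

lemma qop_add: "bborel f \<Longrightarrow> bborel g \<Longrightarrow> qop \<mu> (\<lambda>s. f s + g s) v = qop \<mu> f v + qop \<mu> g v"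
  by (rule cinner_ext) (simp add: bfunctionalD(1)[OF qop_bfunctional] cinner_add_right)

lemma qop_cmult: "bborel f \<Longrightarrow> qop \<mu> (\<lambda>s. c * f s) v = c *\<^sub>R qop \<mu> f v"
  by (rule cinner_ext) (simp add: bfunctionalD(2)[OF qop_bfunctional] cinner_scaleR_right)

lemma qop_diff: "bborel f \<Longrightarrow> bborel g \<Longrightarrow> qop \<mu> (\<lambda>s. f s - g s) v = qop \<mu> f v - qop \<mu> g v"
  using qop_add[of f "\<lambda>s. (- 1) * g s" v] qop_cmult[of g "- 1" v] bborel_cmult[of g "- 1"] by simp

lemma qop_sum:
  "(\<And>i. i \<in> I \<Longrightarrow> bborel (f i)) \<Longrightarrow> qop \<mu> (\<lambda>s. \<Sum>i\<in>I. f i s) v = (\<Sum>i\<in>I. qop \<mu> (f i) v)"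
proof (induction I rule: infinite_finite_induct)
  case (insert i I)
  then show ?case by (simp add: qop_add bborel_sum)
qed (use qop_cmult[of "\<lambda>s. 0" 0 v] in auto)

lemma qop_cong:
  "bborel f \<Longrightarrow> bborel g \<Longrightarrow> (\<And>s. s \<in> S \<Longrightarrow> f s = g s) \<Longrightarrow> qop \<mu> f = qop \<mu> g"
  by (rule ext, rule cinner_ext, rule bfunctional_cong[OF qop_bfunctional]) auto

text \<open>The assertion is bilinear, so the identity principle is applied twice: in
  \<open>f\<close> with the right factor in \<open>T\<close>, then in \<open>g\<close> after moving
  \<open>f\<close> to the other side of the inner product.\<close>

lemma qop_mult_determining:
  assumes mult: "\<And>u v x. u \<in> T \<Longrightarrow> v \<in> T \<Longrightarrow> qop \<mu> u (qop \<mu> v x) = qop \<mu> (\<lambda>s. u s * v s) x"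
    and f: "bborel f" and g: "bborel g"
  shows "qop \<mu> f (qop \<mu> g x) = qop \<mu> (\<lambda>s. f s * g s) x"
proof -
  have det: "determining S T" using q by (simp add: quadratic_measures_def)
  have Tb: "bborel v" if "v \<in> T" for v using det that by (simp add: determining_def)
  have 1: "cinner y (qop \<mu> f (qop \<mu> v x)) - cinner y (qop \<mu> (\<lambda>s. f s * v s) x) = 0"
    if f: "bborel f" and v: "v \<in> T" for f v x y
  proof (rule determiningD[OF det _ _ f])
    show "bfunctional S (\<lambda>f. cinner y (qop \<mu> f (qop \<mu> v x)) - cinner y (qop \<mu> (\<lambda>s. f s * v s) x))"
      by (intro bfunctional_diff qop_bfunctional bfunctional_times[OF qop_bfunctional] Tb v)
  qed (simp add: mult v)
  show ?thesis
  proof (rule cinner_ext)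
    fix y
    have "cinner (qop \<mu> f y) (qop \<mu> g x) - cinner y (qop \<mu> (\<lambda>s. g s * f s) x) = 0"
    proof (rule determiningD[OF det _ _ g])
      show "bfunctional S (\<lambda>g. cinner (qop \<mu> f y) (qop \<mu> g x) - cinner y (qop \<mu> (\<lambda>s. g s * f s) x))"
        by (intro bfunctional_diff qop_bfunctional bfunctional_times[OF qop_bfunctional] f)
    next
      fix v assume "v \<in> T"
      from 1[OF f this] show "cinner (qop \<mu> f y) (qop \<mu> v x) - cinner y (qop \<mu> (\<lambda>s. v s * f s) x) = 0"
        by (simp add: qop_adjoint[OF f] mult.commute[of "v _"])
    qed
    then show "cinner y (qop \<mu> f (qop \<mu> g x)) = cinner y (qop \<mu> (\<lambda>s. f s * g s) x)"
      by (simp add: qop_adjoint[OF f] mult.commute[of "g _"])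
  qed
qed

end

definition multiplicative_measures :: "real set \<Rightarrow> ('h::chilbert \<Rightarrow> real measure) \<Rightarrow> bool" where
  "multiplicative_measures S \<mu> \<longleftrightarrow> (\<exists>T. quadratic_measures S T \<mu>) \<and>
     (\<forall>x. measure (\<mu> x) UNIV = (norm x)\<^sup>2) \<and>
     (\<forall>f g x. bborel f \<longrightarrow> bborel g \<longrightarrow> qop \<mu> f (qop \<mu> g x) = qop \<mu> (\<lambda>s. f s * g s) x)"

context
  fixes S and \<mu> :: "'h::chilbert \<Rightarrow> real measure"
  assumes m: "multiplicative_measures S \<mu>"
begin

lemma multiplicative_measures_quadratic: obtains T where "quadratic_measures S T \<mu>"
  using m by (auto simp: multiplicative_measures_def)

lemma multiplicative_mult: "bborel f \<Longrightarrow> bborel g \<Longrightarrow> qop \<mu> f (qop \<mu> g x) = qop \<mu> (\<lambda>s. f s * g s) x"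
  using m by (simp add: multiplicative_measures_def)

lemma multiplicative_norm: "bborel f \<Longrightarrow> complex_of_real ((norm (qop \<mu> f x))\<^sup>2) = complex_of_real (\<integral>s. (f s)\<^sup>2 \<partial>\<mu> x)"
proof (rule multiplicative_measures_quadratic)
  fix T assume f: "bborel f" and q: "quadratic_measures S T \<mu>"
  have "cinner (qop \<mu> f x) (qop \<mu> f x) = cinner x (qop \<mu> (\<lambda>s. f s * f s) x)"
    using f by (simp add: qop_adjoint[OF q] multiplicative_mult)
  also have "\<dots> = complex_of_real (\<integral>s. f s * f s \<partial>\<mu> x)"
    using f by (intro qop_form[OF q] bborel_mult)
  finally show ?thesis by (simp add: cinner_self power2_eq_square)
qed

lemma multiplicative_one: "qop \<mu> (\<lambda>s. 1) x = x"
proof (rule multiplicative_measures_quadratic)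
  fix T assume q: "quadratic_measures S T \<mu>"
  have "represents id \<mu> (\<lambda>s. 1)"
    using m quadratic_measuresD(1)[OF q] sets_eq_imp_space_eq[of "\<mu> _" borel]
    by (auto simp: represents_def bounded_clinear_id cinner_self multiplicative_measures_def measure_on_def)
  then show ?thesis by (simp add: qop_eqI)
qed

text \<open>Multiplicativity upgrades weak to strong convergence: the squared norm of the difference
  is the integral of the squared difference.\<close>

lemma multiplicative_measures_tendsto:
  assumes "\<And>n. bborel (F n)" "bborel f" "\<And>n s. \<bar>F n s\<bar> \<le> K" "\<And>s. s \<in> S \<Longrightarrow> (\<lambda>n. F n s) \<longlonglongrightarrow> f s"
  shows "(\<lambda>n. qop \<mu> (F n) x) \<longlonglongrightarrow> qop \<mu> f x"
proof (rule multiplicative_measures_quadratic)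
  fix T assume q: "quadratic_measures S T \<mu>"
  obtain L where L: "0 \<le> L" "\<And>s. \<bar>f s\<bar> \<le> L" by (rule bborel_bound[OF assms(2)]) blast
  have K: "0 \<le> K" using assms(3)[of 0 0] abs_ge_zero order_trans by blast
  have b: "bborel (\<lambda>s. F n s - f s)" for n by (intro bborel_diff assms)
  have "(\<lambda>n. complex_of_real (\<integral>s. (F n s - f s)\<^sup>2 \<partial>\<mu> x)) \<longlonglongrightarrow> complex_of_real (\<integral>s. 0 \<partial>\<mu> x)"
  proof (rule bfunctionalD(3)[OF bfunctional_integral[OF quadratic_measuresD(1)[OF q]], of _ _ "(K + L)\<^sup>2"])
    show "bborel (\<lambda>s. (F n s - f s)\<^sup>2)" for n unfolding power2_eq_square by (intro bborel_mult b)
    show "\<bar>(F n s - f s)\<^sup>2\<bar> \<le> (K + L)\<^sup>2" for n s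
    proof -
      have "\<bar>F n s - f s\<bar> \<le> K + L" using assms(3)[of n s] L(2)[of s] by linarith
      then show ?thesis by (simp add: abs_le_square_iff[symmetric] K L)
    qed
    show "(\<lambda>n. (F n s - f s)\<^sup>2) \<longlonglongrightarrow> 0" if "s \<in> S" for s
      using tendsto_power[OF LIM_zero[OF assms(4)[OF that]], of 2] by simp
  qed auto
  then have "(\<lambda>n. complex_of_real ((norm (qop \<mu> (\<lambda>s. F n s - f s) x))\<^sup>2)) \<longlonglongrightarrow> 0"
    by (simp only: multiplicative_norm[OF b]) simp
  then have "(\<lambda>n. (norm (qop \<mu> (F n) x - qop \<mu> f x))\<^sup>2) \<longlonglongrightarrow> 0"
    by (simp add: qop_diff[OF q assms(1,2)] tendsto_of_real_iff[of _ 0, simplified] del: of_real_power)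
  then have "(\<lambda>n. norm (qop \<mu> (F n) x - qop \<mu> f x)) \<longlonglongrightarrow> 0"
    using tendsto_real_sqrt by fastforce
  then show ?thesis by (simp add: LIM_zero_iff tendsto_norm_zero_iff)
qed

lemma multiplicative_pvm:
  defines "E \<equiv> \<lambda>B. qop \<mu> (indicator B)"
  shows "projection_valued_measure E" "scalar_measure (vector_functional x) E = \<mu> x"
proof -
  obtain T where q: "quadratic_measures S T \<mu>" by (rule multiplicative_measures_quadratic)
  have mult: "E B (E C x) = E (B \<inter> C) x" if "B \<in> sets borel" "C \<in> sets borel" for B C x
    unfolding E_def using that by (simp add: multiplicative_mult indicator_inter_arith[symmetric])
  show "projection_valued_measure E"
    unfolding projection_valued_measure_def
  proof (intro conjI ballI allI impI)
    show "projection_op (E B)" if "B \<in> sets borel" for B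
      using mult[OF that that] that unfolding E_def
      by (intro projection_opI) (simp_all add: qop_clinear[OF q] qop_adjoint[OF q])
    show "E UNIV = id" unfolding E_def using multiplicative_one by (auto simp: fun_eq_iff)
    show "E (B \<inter> C) = E B \<circ> E C" if "B \<in> sets borel" "C \<in> sets borel" for B C
      using mult[OF that] by (auto simp: fun_eq_iff)
    fix A :: "nat \<Rightarrow> real set" and x
    assume A: "range A \<subseteq> sets borel \<and> disjoint_family A"
    have "(\<lambda>n. qop \<mu> (\<lambda>s. \<Sum>i<n. indicator (A i) s) x) \<longlonglongrightarrow> qop \<mu> (indicator (\<Union>i. A i)) x"
    proof (rule multiplicative_measures_tendsto[where K = 1])
      have eq: "(\<Sum>i<n. indicator (A i) s) = (indicator (\<Union>i<n. A i) s :: real)" for n s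
        using A by (subst indicator_UN_disjoint) (auto simp: disjoint_family_on_def)
      show "bborel (\<lambda>s. \<Sum>i<n. indicator (A i) s)" for n using A by (intro bborel_intros) auto
      show "bborel (indicator (\<Union>i. A i))" using A by (intro bborel_indicator) auto
      show "\<bar>\<Sum>i<n. indicator (A i) s :: real\<bar> \<le> 1" for n s unfolding eq by (simp add: indicator_def)
      show "(\<lambda>n. \<Sum>i<n. indicator (A i) s) \<longlonglongrightarrow> (indicator (\<Union>i. A i) s :: real)" for s
        unfolding eq by (rule LIMSEQ_indicator_UN)
    qed
    then show "(\<lambda>n. E (A n) x) sums E (\<Union>n. A n) x"
      unfolding sums_def E_def using A by (subst (asm) qop_sum[OF q]) auto
  qed
  have fin: "measure_on S (\<mu> x)" by (rule quadratic_measuresD[OF q])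
  interpret finite_measure "\<mu> x" using fin by (simp add: measure_on_def)
  have sets: "sets (\<mu> x) = sets borel" using fin by (simp add: measure_on_def)
  have "vector_functional x (E B) = emeasure (\<mu> x) B" if "B \<in> sets borel" for B
  proof -
    have "vector_functional x (E B) = ennreal (\<integral>s. indicator B s \<partial>\<mu> x)"
      unfolding vector_functional_def E_def using that by (simp add: qop_form[OF q])
    also have "\<dots> = emeasure (\<mu> x) B"
      using that sets sets_eq_imp_space_eq[OF sets] by (simp add: emeasure_eq_measure)
    finally show ?thesis .
  qed
  then have "scalar_measure (vector_functional x) E = measure_of UNIV (sets borel) (emeasure (\<mu> x))"
    unfolding scalar_measure_def by (intro measure_of_eq) (auto simp: sets.sigma_sets_eq[of borel, simplified])
  also have "\<dots> = \<mu> x"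
    using measure_of_of_measure[of "\<mu> x"] sets sets_eq_imp_space_eq[OF sets] by simp
  finally show "scalar_measure (vector_functional x) E = \<mu> x" .
qed

end

section \<open>Calculus of projection-valued measures\<close>

abbreviation spm :: "(real set \<Rightarrow> 'h::chilbert op) \<Rightarrow> 'h \<Rightarrow> real measure" where
  "spm E x \<equiv> scalar_measure (vector_functional x) E"

abbreviation pint :: "(real set \<Rightarrow> 'h::chilbert op) \<Rightarrow> (real \<Rightarrow> real) \<Rightarrow> 'h op" where
  "pint E g \<equiv> qop (spm E) g"

definition supported_pvm :: "real set \<Rightarrow> (real set \<Rightarrow> 'h::chilbert op) \<Rightarrow> bool" where
  "supported_pvm S E \<longleftrightarrow> projection_valued_measure E \<and> S \<in> sets borel \<and> E (- S) = (\<lambda>x. 0)"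

text \<open>Valid for every \<omega>, additive or not, since \<open>measure_of\<close> fixes the
  sigma-algebra in advance.\<close>

lemma sets_spm [simp]: "sets (scalar_measure \<omega> E) = sets borel"
  unfolding scalar_measure_def using sigma_algebra.sets_measure_of_eq[OF sets.sigma_algebra_axioms[of borel]]
  by (simp add: sets.sigma_sets_eq[of borel, simplified])

lemma space_spm [simp]: "space (scalar_measure \<omega> E) = UNIV"
  unfolding scalar_measure_def by (simp add: space_measure_of_conv)

lemma sets_borel_scalar [measurable_cong]: "sets (scalar_measure \<omega> E) = sets borel"
  by simp

context
  fixes E :: "real set \<Rightarrow> 'h::chilbert op"
  assumes E: "projection_valued_measure E"
begin

lemma pvm_projection: "B \<in> sets borel \<Longrightarrow> projection_op (E B)"
  and pvm_UNIV: "E UNIV = id"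
  and pvm_Int: "B \<in> sets borel \<Longrightarrow> C \<in> sets borel \<Longrightarrow> E B (E C x) = E (B \<inter> C) x"
  and pvm_sums: "range A \<subseteq> sets borel \<Longrightarrow> disjoint_family A \<Longrightarrow> (\<lambda>n::nat. E (A n) x) sums E (\<Union>n. A n) x"
  using E unfolding projection_valued_measure_def by (auto simp: fun_eq_iff)

lemma pvm_empty: "E {} x = 0"
proof -
  have "(\<lambda>n::nat. E {} x) sums E (\<Union>n::nat. {}) x" by (rule pvm_sums) (auto simp: disjoint_family_on_def)
  then have "(\<lambda>n::nat. E {} x) \<longlonglongrightarrow> 0" by (intro summable_LIMSEQ_zero) (auto simp: summable_def)
  then show ?thesis by (simp add: LIMSEQ_const_iff)
qed

lemma emeasure_spm:
  assumes "B \<in> sets borel"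
  shows "emeasure (spm E x) B = ennreal ((norm (E B x))\<^sup>2)"
proof -
  have vf: "vector_functional x (E B) = ennreal ((norm (E B x))\<^sup>2)" if "B \<in> sets borel" for B
    using that by (simp add: vector_functional_def projection_opD(4)[OF pvm_projection] del: of_real_power)
  have "emeasure (spm E x) B = vector_functional x (E B)"
  proof (rule emeasure_measure_of[OF scalar_measure_def])
    show "positive (sets (spm E x)) (\<lambda>B. vector_functional x (E B))"
      by (simp add: positive_def vf pvm_empty)
    show "countably_additive (sets (spm E x)) (\<lambda>B. vector_functional x (E B))"
    proof (rule countably_additiveI)
      fix A :: "nat \<Rightarrow> real set"
      assume A: "range A \<subseteq> sets (spm E x)" "disjoint_family A" "(\<Union>i. A i) \<in> sets (spm E x)"
      have Ai: "A i \<in> sets borel" for i using A by auto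
      have "(\<lambda>n. E (A n) x) sums E (\<Union>n. A n) x" using A by (intro pvm_sums) auto
      then have "(\<lambda>n. inner x (E (A n) x)) sums inner x (E (\<Union>n. A n) x)"
        by (rule bounded_linear.sums[OF bounded_linear_inner_right])
      then have "(\<lambda>n. (norm (E (A n) x))\<^sup>2) sums (norm (E (\<Union>n. A n) x))\<^sup>2"
        using Ai A(3) by (simp add: cinner_Re[symmetric] projection_opD(4)[OF pvm_projection] del: of_real_power)
      then show "(\<Sum>i. vector_functional x (E (A i))) = vector_functional x (E (\<Union>i. A i))"
        using Ai A(3) by (simp add: vf suminf_ennreal2 sums_iff)
    qed
  qed (use assms in auto)
  then show ?thesis using vf assms by simp
qed

lemma measure_spm: "B \<in> sets borel \<Longrightarrow> measure (spm E x) B = (norm (E B x))\<^sup>2"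
  by (simp add: measure_def emeasure_spm)

lemma finite_measure_spm: "finite_measure (spm E x)"
  by (rule finite_measureI) (simp add: emeasure_spm)

end

lemma supported_pvm_UNIV: "projection_valued_measure E \<Longrightarrow> supported_pvm UNIV E"
  by (auto simp: supported_pvm_def pvm_empty)

text \<open>With the indicators as determining family, every projection-valued measure inherits the
  functional calculus built from families of measures.\<close>

lemma pvm_multiplicative:
  assumes "supported_pvm S E"
  shows "quadratic_measures S {indicator B | B. B \<in> sets borel} (spm E)"
    and "multiplicative_measures S (spm E)"
    and "B \<in> sets borel \<Longrightarrow> pint E (indicator B) = E B"
    and "measure_on S (spm E x)"
proof -
  have E: "projection_valued_measure E" and S: "S \<in> sets borel" "E (- S) = (\<lambda>x. 0)"
    using assms by (auto simp: supported_pvm_def)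
  have rep: "represents (E B) (spm E) (indicator B)" if "B \<in> sets borel" for B
    using that by (simp add: represents_def measure_spm[OF E] projection_opD(1,4)[OF pvm_projection[OF E]])
  show Mo: "measure_on S (spm E x)" for x
    unfolding measure_on_def using S borel_comp[OF S(1)]
    by (simp add: finite_measure_spm[OF E] emeasure_spm[OF E])
  have n: "measure (spm E x) UNIV = (norm x)\<^sup>2" for x
    by (simp add: measure_spm[OF E] pvm_UNIV[OF E])
  have "determining S {indicator B | B. B \<in> sets borel}"
    unfolding determining_def
  proof (intro conjI allI impI)
    fix \<Lambda> and f :: "real \<Rightarrow> real"
    assume L: "bfunctional S \<Lambda>" and *: "\<forall>g\<in>{indicator B | B. B \<in> sets borel}. \<Lambda> g = 0" "bborel f"
    have "bfunctional UNIV \<Lambda>" by (rule bfunctional_mono[OF L]) simp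
    then show "\<Lambda> f = 0" by (rule determiningD[OF determining_indicators]) (use * in auto)
  qed auto
  then show q: "quadratic_measures S {indicator B | B. B \<in> sets borel} (spm E)"
    unfolding quadratic_measures_def using Mo n rep by auto
  show ind: "pint E (indicator B) = E B" if "B \<in> sets borel" for B
    using rep[OF that] by (rule qop_eqI)
  have "pint E f (pint E g x) = pint E (\<lambda>s. f s * g s) x" if "bborel f" "bborel g" for f g x
  proof (rule qop_mult_determining[OF q _ that])
    fix u v :: "real \<Rightarrow> real" and x
    assume "u \<in> {indicator B | B. B \<in> sets borel}" "v \<in> {indicator B | B. B \<in> sets borel}"
    then show "pint E u (pint E v x) = pint E (\<lambda>s. u s * v s) x"
      by (auto simp: ind pvm_Int[OF E] indicator_inter_arith[symmetric])
  qed
  then show "multiplicative_measures S (spm E)"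
    unfolding multiplicative_measures_def using q n by blast
qed

context
  fixes S and E :: "real set \<Rightarrow> 'h::chilbert op"
  assumes E: "supported_pvm S E"
begin

lemma pint_clinear: "bborel g \<Longrightarrow> bounded_clinear (pint E g)"
  by (rule qop_clinear[OF pvm_multiplicative(1)[OF E]])

lemma pint_form: "bborel g \<Longrightarrow> cinner x (pint E g x) = complex_of_real (\<integral>s. g s \<partial>spm E x)"
  by (rule qop_form[OF pvm_multiplicative(1)[OF E]])

lemma pint_adjoint: "bborel g \<Longrightarrow> cinner (pint E g x) y = cinner x (pint E g y)"
  by (rule qop_adjoint[OF pvm_multiplicative(1)[OF E]])

lemma pint_add: "bborel f \<Longrightarrow> bborel g \<Longrightarrow> pint E (\<lambda>s. f s + g s) x = pint E f x + pint E g x"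
  by (rule qop_add[OF pvm_multiplicative(1)[OF E]])

lemma pint_diff: "bborel f \<Longrightarrow> bborel g \<Longrightarrow> pint E (\<lambda>s. f s - g s) x = pint E f x - pint E g x"
  by (rule qop_diff[OF pvm_multiplicative(1)[OF E]])

lemma pint_cmult: "bborel f \<Longrightarrow> pint E (\<lambda>s. c * f s) x = c *\<^sub>R pint E f x"
  by (rule qop_cmult[OF pvm_multiplicative(1)[OF E]])

lemma pint_cong:
  "bborel f \<Longrightarrow> bborel g \<Longrightarrow> (\<And>s. s \<in> S \<Longrightarrow> f s = g s) \<Longrightarrow> pint E f = pint E g"
  by (rule qop_cong[OF pvm_multiplicative(1)[OF E]])

lemma pint_mult: "bborel f \<Longrightarrow> bborel g \<Longrightarrow> pint E f (pint E g x) = pint E (\<lambda>s. f s * g s) x"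
  by (rule multiplicative_mult[OF pvm_multiplicative(2)[OF E]])

lemma pint_one: "pint E (\<lambda>s. 1) x = x"
  by (rule multiplicative_one[OF pvm_multiplicative(2)[OF E]])

lemma pint_norm: "bborel f \<Longrightarrow> (norm (pint E f x))\<^sup>2 = (\<integral>s. (f s)\<^sup>2 \<partial>spm E x)"
  using multiplicative_norm[OF pvm_multiplicative(2)[OF E], of f x] of_real_eq_iff by blast

lemma pint_tendsto:
  assumes "\<And>n. bborel (F n)" "bborel f" "\<And>n s. \<bar>F n s\<bar> \<le> K" "\<And>s. s \<in> S \<Longrightarrow> (\<lambda>n. F n s) \<longlonglongrightarrow> f s"
  shows "(\<lambda>n. pint E (F n) x) \<longlonglongrightarrow> pint E f x"
  by (rule multiplicative_measures_tendsto[OF pvm_multiplicative(2)[OF E] assms])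

lemma pint_indicator: "B \<in> sets borel \<Longrightarrow> pint E (indicator B) = E B"
  by (rule pvm_multiplicative(3)[OF E])

lemma pint_bfunctional: "bfunctional S (\<lambda>g. cinner x (pint E g y))"
  by (rule qop_bfunctional[OF pvm_multiplicative(1)[OF E]])

lemma spm_measure_on: "measure_on S (spm E x)"
  by (rule pvm_multiplicative(4)[OF E])

lemma spm_norm: "measure (spm E x) UNIV = (norm x)\<^sup>2"
  using E measure_spm[of E UNIV x] pvm_UNIV[of E] by (simp add: supported_pvm_def)

lemma pvm_Un:
  assumes "B \<in> sets borel" "C \<in> sets borel" "B \<inter> C = {}"
  shows "E (B \<union> C) x = E B x + E C x"
proof -
  have "pint E (indicator (B \<union> C)) x = pint E (\<lambda>s. indicator B s + indicator C s) x"
    using assms(3) by (intro arg_cong[of _ _ "\<lambda>f. pint E f x"]) (auto simp: indicator_def fun_eq_iff)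
  then show ?thesis using assms by (simp add: pint_add pint_indicator sets.Un)
qed

lemma pint_positive:
  assumes "bborel f" "\<And>s. s \<in> S \<Longrightarrow> 0 \<le> f s"
  shows "positive_op (pint E f)"
proof (rule positive_opI[of _ "\<lambda>x. \<integral>s. f s \<partial>spm E x"])
  show "cinner x (pint E f x) = complex_of_real (\<integral>s. f s \<partial>spm E x)" for x by (rule pint_form) (rule assms)
  show "0 \<le> (\<integral>s. f s \<partial>spm E x)" for x
    by (rule integral_nonneg_AE) (use measure_on_AE[OF spm_measure_on[of x]] assms(2) in \<open>auto elim: AE_mp\<close>)
qed

end

lemma bfunctional_compose:
  assumes L: "bfunctional S \<Lambda>" and h: "h \<in> borel_measurable borel" "\<And>s. s \<in> S \<Longrightarrow> h s \<in> S'"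
  shows "bfunctional S' (\<lambda>g. \<Lambda> (\<lambda>s. g (h s)))"
proof (rule bfunctionalI)
  fix F f K
  assume *: "\<And>n. bborel (F n)" "bborel f" "\<And>n s. \<bar>F n s\<bar> \<le> K" "\<And>s. s \<in> S' \<Longrightarrow> (\<lambda>n. F n s) \<longlonglongrightarrow> f s"
  show "(\<lambda>n. \<Lambda> (\<lambda>s. F n (h s))) \<longlonglongrightarrow> \<Lambda> (\<lambda>s. f (h s))"
    by (rule bfunctionalD(3)[OF L, of _ _ K]) (use * h in \<open>auto intro: bborel_compose\<close>)
qed (simp_all add: bfunctionalD(1,2)[OF L] bborel_compose h)

text \<open>On \<open>S\<close> every \<open>g\<close> is a function of \<open>h\<close>, namely
  \<open>g \<circ> k \<circ> h\<close>, and powers determine functions on the unit interval; so the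
  relation for the single function \<open>h\<close> is enough. With \<open>E = F\<close> this gives
  commutation results, with \<open>x = id\<close> uniqueness.\<close>

lemma pint_intertwine:
  assumes E: "supported_pvm S E" and F: "supported_pvm S F" and x: "bounded_clinear x"
    and h: "bborel h" "\<And>s. s \<in> S \<Longrightarrow> h s \<in> {0..1}"
    and k: "k \<in> borel_measurable borel" "\<And>s. s \<in> S \<Longrightarrow> k (h s) = s"
    and comm: "\<And>v. x (pint E h v) = pint F h (x v)"
    and g: "bborel g"
  shows "x (pint E g v) = pint F g (x v)"
proof (rule cinner_ext)
  fix y
  have hm: "h \<in> borel_measurable borel" using h(1) by (rule bborel_meas)
  let ?L = "\<lambda>g. cinner (cadj x y) (pint E (\<lambda>s. g (h s)) v) - cinner y (pint F (\<lambda>s. g (h s)) (x v))"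
  have L: "bfunctional {0..1} ?L"
    by (intro bfunctional_diff bfunctional_compose[OF pint_bfunctional[OF E] hm h(2)]
        bfunctional_compose[OF pint_bfunctional[OF F] hm h(2)])
  have pow: "bborel (\<lambda>s. h s ^ n)" for n
    by (induction n) (auto intro: bborel_mult h)
  have pows: "x (pint E (\<lambda>s. h s ^ n) w) = pint F (\<lambda>s. h s ^ n) (x w)" for n w
  proof (induction n arbitrary: w)
    case 0 then show ?case by (simp add: pint_one[OF E] pint_one[OF F])
  next
    case (Suc n)
    then show ?case
      by (simp add: pint_mult[OF E h(1) pow, symmetric] pint_mult[OF F h(1) pow, symmetric] comm)
  qed
  have "?L g = 0" if g: "bborel g" for g
  proof (rule determiningD[OF determining_upow L _ g])
    fix u assume "u \<in> range upow"
    then obtain n where u: "u = upow n" by auto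
    have "pint E (\<lambda>s. upow n (h s)) = pint E (\<lambda>s. h s ^ n)"
      by (rule pint_cong[OF E bborel_compose[OF bborel_upow hm] pow]) (use h(2) in \<open>auto simp: upow_def\<close>)
    moreover have "pint F (\<lambda>s. upow n (h s)) = pint F (\<lambda>s. h s ^ n)"
      by (rule pint_cong[OF F bborel_compose[OF bborel_upow hm] pow]) (use h(2) in \<open>auto simp: upow_def\<close>)
    ultimately show "?L u = 0" unfolding u by (simp add: cadj[OF x] pows)
  qed
  from this[OF bborel_compose[OF g k(1)]]
  have "?L (\<lambda>s. g (k s)) = 0" .
  moreover have "pint E (\<lambda>s. g (k (h s))) = pint E g"
    by (rule pint_cong[OF E]) (use k(2) g in \<open>auto intro: bborel_compose bborel_compose[OF _ k(1)] hm\<close>)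
  moreover have "pint F (\<lambda>s. g (k (h s))) = pint F g"
    by (rule pint_cong[OF F]) (use k(2) g in \<open>auto intro: bborel_compose bborel_compose[OF _ k(1)] hm\<close>)
  ultimately show "cinner y (x (pint E g v)) = cinner y (pint F g (x v))" by (simp add: cadj[OF x])
qed

section \<open>Spectral theorem for positive contractions\<close>

lemma funpow_clinear: "bounded_clinear R \<Longrightarrow> bounded_clinear (R ^^ n)"
  by (induction n) (auto intro: bounded_clinear_comp simp: bounded_clinear_id[unfolded id_def] id_def)

text \<open>Hausdorff's positivity condition for the moments of \<open>R\<close>, at a stage where
  operator square roots do not yet exist. Pairs of equal factors are moved to the two sides of the
  inner product until both exponents are at most 1.\<close>

lemma contraction_powers_positive:
  fixes R :: "'h::chilbert op"
  assumes R: "bounded_clinear R" and pos: "positive_op R" "positive_op (\<lambda>x. x - R x)"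
  defines "C \<equiv> \<lambda>x. x - R x"
  shows "0 \<le> Re (cinner x ((R ^^ k) ((C ^^ j) x)))"
proof -
  have C: "bounded_clinear C" unfolding C_def
    by (intro bounded_clinear_diff R bounded_clinear_id[unfolded id_def])
  have sa: "cinner (R x) y = cinner x (R y)" "cinner (C x) y = cinner x (C y)" for x y
    using positive_op_selfadjoint(1)[OF R pos(1)] by (simp_all add: C_def cinner_linear)
  have RC: "R (C x) = C (R x)" for x by (simp add: C_def bounded_clinearD[OF R])
  have CpowR: "(C ^^ j) (R x) = R ((C ^^ j) x)" for j x by (induction j) (auto simp: RC)
  have RpowC: "(R ^^ k) (C x) = C ((R ^^ k) x)" for k x by (induction k) (auto simp: RC)
  have posR: "0 \<le> Re (cinner x (R x))" and posC: "0 \<le> Re (cinner x (C x))" for x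
    using positive_opD(1)[OF pos(1)] positive_opD(1)[OF pos(2)] by (auto simp: C_def)
  show ?thesis
  proof (induction "k + j" arbitrary: k j x rule: less_induct)
    case less
    consider (k) k' where "k = Suc (Suc k')" | (j) j' where "j = Suc (Suc j')" | (0) "k \<in> {0, 1}" "j \<in> {0, 1}"
      by (cases k; cases "k - 1"; cases j; cases "j - 1") auto
    then show ?case
    proof cases
      case k
      have "cinner x ((R ^^ k) ((C ^^ j) x)) = cinner (R x) ((R ^^ k') ((C ^^ j) (R x)))"
        by (simp add: k sa CpowR funpow_swap1)
      then show ?thesis using less[of k' j "R x"] k by simp
    next
      case j
      have "cinner x ((R ^^ k) ((C ^^ j) x)) = cinner (C x) ((R ^^ k) ((C ^^ j') (C x)))"
      proof -
        have "(C ^^ j) x = C ((C ^^ j') (C x))" by (simp add: j funpow_swap1)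
        then show ?thesis by (simp only: RpowC sa)
      qed
      then show ?thesis using less[of k j' "C x"] j by simp
    next
      case 0
      \<comment> \<open>The one mixed case:
        \<open>R \<circ> C = R \<circ> C \<circ> R + C \<circ> R \<circ> C\<close>, because
        \<open>R\<close> and \<open>C\<close> commute and add up to the identity. Both summands are
        positive.\<close>
      have "cinner x (R (C x)) = cinner (R x) (C (R x)) + cinner (C x) (R (C x))"
      proof -
        have "R (C x) = R (C (R x + C x))" by (simp add: C_def)
        also have "\<dots> = R (C (R x)) + C (R (C x))"
          by (simp add: bounded_clinearD[OF R] bounded_clinearD[OF C] RC)
        finally have e: "R (C x) = R (C (R x)) + C (R (C x))" .
        show ?thesis by (subst e) (simp only: sa cinner_add_right)
      qed
      then have "0 \<le> Re (cinner x (R (C x)))" using posR[of "C x"] posC[of "R x"] by simp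
      then show ?thesis using 0 posR posC by (auto simp: cinner_self)
    qed
  qed
qed

text \<open>The diagonal coefficients of R^k (1 - R)^j satisfy the hypotheses of
  \<open>hausdorff_moment\<close>; the measures so obtained represent the powers of
  \<open>R\<close>, and powers determine functions on the unit interval.\<close>

theorem contraction_spectral_theorem:
  fixes R :: "'h::chilbert op"
  assumes R: "bounded_clinear R" and pos: "positive_op R" "positive_op (\<lambda>x. x - R x)"
  shows "\<exists>E. supported_pvm {0..1} E \<and> pint E (upow 1) = R"
proof -
  define C where "C = (\<lambda>x. x - R x)"
  define D where "D x k j = Re (cinner x ((R ^^ k) ((C ^^ j) x)))" for x k j
  have Rk: "bounded_clinear (R ^^ k)" for k by (rule funpow_clinear[OF R])
  have C: "bounded_clinear C" unfolding C_def
    by (intro bounded_clinear_diff R bounded_clinear_id[unfolded id_def])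
  have D0: "0 \<le> D x k j" for x k j
    using contraction_powers_positive[OF R pos] by (simp add: D_def C_def)
  have CpowR: "(C ^^ j) (R x) = R ((C ^^ j) x)" for j x
    by (induction j) (auto simp: C_def bounded_clinearD[OF R])
  have Drec: "D x k (Suc j) = D x k j - D x (Suc k) j" for x k j
  proof -
    have "(R ^^ k) ((C ^^ Suc j) x) = (R ^^ k) ((C ^^ j) x) - (R ^^ Suc k) ((C ^^ j) x)"
      unfolding funpow_Suc_right[of k R] by (simp add: C_def bounded_clinearD[OF Rk])
    then show ?thesis by (simp add: D_def cinner_diff_right)
  qed
  have "\<forall>x. \<exists>M. sets M = sets borel \<and> finite_measure M \<and> emeasure M (- {0..1}) = 0 \<and>
      (\<forall>r. (\<integral>s. upow r s \<partial>M) = D x r 0)"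
    by (intro allI hausdorff_moment D0 Drec)
  from choice[OF this] obtain M where M: "\<And>x. sets (M x) = sets borel" "\<And>x. finite_measure (M x)"
      "\<And>x. emeasure (M x) (- {0..1}) = 0" "\<And>x r. (\<integral>s. upow r s \<partial>M x) = D x r 0"
    by blast
  have Mo: "measure_on {0..1} (M x)" for x using M by (simp add: measure_on_def)
  have n: "measure (M x) UNIV = (norm x)\<^sup>2" for x
  proof -
    interpret finite_measure "M x" by (rule M)
    have sp: "space (M x) = UNIV" using M(1) sets_eq_imp_space_eq[of "M x" borel] by simp
    have "(\<integral>s. upow 0 s \<partial>M x) = (\<integral>s. 1 \<partial>M x)"
    proof (rule integral_cong_AE)
      show "AE s in M x. upow 0 s = 1" using measure_on_AE[OF Mo] by eventually_elim (simp add: upow_def)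
    qed (use measure_on_integrable[OF Mo] in \<open>auto intro: borel_measurable_integrable\<close>)
    then show ?thesis using M(4)[of x 0] by (simp add: sp D_def cinner_self)
  qed
  have rep: "represents (R ^^ k) M (upow k)" for k
  proof -
    have sa: "cinner (R x) y = cinner x (R y)" for x y
      using positive_op_selfadjoint(1)[OF R pos(1)] .
    have "cinner ((R ^^ k) x) y = cinner x ((R ^^ k) y)" for x y
    proof (induction k arbitrary: y)
      case (Suc k)
      have "R ((R ^^ k) y) = (R ^^ k) (R y)" by (rule funpow_swap1)
      then show ?case by (simp add: sa Suc)
    qed simp
    then have "cinner x ((R ^^ k) x) = cnj (cinner x ((R ^^ k) x))" for x
      by (metis cinner_commute)
    then have "Im (cinner x ((R ^^ k) x)) = 0" for x
      by (metis Reals_cnj_iff complex_is_Real_iff)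
    then show ?thesis
      by (simp add: represents_def Rk M D_def complex_eq_iff)
  qed
  have q: "quadratic_measures {0..1} (range upow) M"
    unfolding quadratic_measures_def using Mo n rep determining_upow by auto
  have up: "qop M (upow k) = R ^^ k" for k by (rule qop_eqI[OF rep])
  have "qop M f (qop M g x) = qop M (\<lambda>s. f s * g s) x" if "bborel f" "bborel g" for f g x
  proof (rule qop_mult_determining[OF q _ that])
    fix u v x assume "u \<in> range upow" "v \<in> range upow"
    then show "qop M u (qop M v x) = qop M (\<lambda>s. u s * v s) x"
      by (auto simp: up upow_mult funpow_add)
  qed
  then have mm: "multiplicative_measures {0..1} M"
    unfolding multiplicative_measures_def using q n by blast
  define E where "E = (\<lambda>B. qop M (indicator B))"
  have E: "projection_valued_measure E" "spm E = M"
    unfolding E_def using multiplicative_pvm[OF mm] by auto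
  have "E (- {0..1}) = (\<lambda>x. 0)"
  proof -
    have "qop M (indicator (- {0..1})) = qop M (\<lambda>s. 0)"
      by (rule qop_cong[OF q]) auto
    also have "\<dots> = (\<lambda>x. 0)"
      by (rule qop_eqI) (simp add: represents_def bounded_clinear_zero)
    finally show ?thesis by (simp add: E_def)
  qed
  then have "supported_pvm {0..1} E" using E by (simp add: supported_pvm_def)
  then show ?thesis using up[of 1] E by (intro exI[of _ E]) simp
qed

section \<open>Unbounded operators\<close>

lemma adj_iff: "(\<eta>, \<zeta>) \<in> adj T \<longleftrightarrow> (\<forall>\<xi> \<theta>. (\<xi>, \<theta>) \<in> T \<longrightarrow> cinner \<theta> \<eta> = cinner \<xi> \<zeta>)"
  by (auto simp: adj_def)

lemma csubspace_pairD:
  assumes "csubspace (T :: ('a::chilbert \<times> 'a) set)"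
  shows "(0, 0) \<in> T" "(a, b) \<in> T \<Longrightarrow> (c, d) \<in> T \<Longrightarrow> (a + c, b + d) \<in> T"
    "(a, b) \<in> T \<Longrightarrow> (c, d) \<in> T \<Longrightarrow> (a - c, b - d) \<in> T"
    "(a, b) \<in> T \<Longrightarrow> (k *\<^sub>C a, k *\<^sub>C b) \<in> T"
  using csubspaceD[OF assms] by (auto simp: scaleC_prod_def zero_prod_def plus_prod_def minus_prod_def)

lemma csubspace_pairI:
  assumes "(0, 0) \<in> T" "\<And>a b c d. (a, b) \<in> T \<Longrightarrow> (c, d) \<in> T \<Longrightarrow> (a + c, b + d) \<in> T"
    "\<And>a b k. (a, b) \<in> T \<Longrightarrow> (k *\<^sub>C a, k *\<^sub>C b) \<in> (T :: ('a::chilbert \<times> 'a) set)"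
  shows "csubspace T"
  by (rule csubspaceI) (use assms in \<open>auto simp: scaleC_prod_def zero_prod_def plus_prod_def\<close>)

lemma csubspace_adj: "csubspace (adj T)"
  by (rule csubspace_pairI) (auto simp: adj_iff cinner_linear)

lemma closed_adj: "closed (adj T)"
proof -
  have "adj T = (\<Inter>(\<xi>, \<theta>)\<in>T. {p. cinner \<theta> (fst p) = cinner \<xi> (snd p)})"
    by (auto simp: adj_def)
  also have "closed \<dots>"
    by (auto intro!: closed_INT closed_Collect_eq continuous_on_cinner continuous_intros)
  finally show ?thesis .
qed

text \<open>The operator (1 + T' T)^-1 with T' the adjoint: T x = y and T' y = w - x together say
  that w = x + T' T x.\<close>

definition zop :: "'h::chilbert unbdd \<Rightarrow> 'h op" where
  "zop T w = (SOME x. \<exists>y. (x, y) \<in> T \<and> (y, w - x) \<in> adj T)"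

context
  fixes T :: "'h::chilbert unbdd"
  assumes T: "csubspace T" "closed T"
begin

text \<open>Project \<open>(w, 0)\<close> onto the closed graph: orthogonality of the remainder
  \<open>(w - x, - y)\<close> to the graph is exactly membership of \<open>(y, w - x)\<close> in the
  adjoint.\<close>

lemma zop_exists: "\<exists>x y. (x, y) \<in> T \<and> (y, w - x) \<in> adj T"
proof -
  obtain p where p: "p \<in> T" "\<And>v. v \<in> T \<Longrightarrow> cinner v ((w, 0) - p) = 0"
    using orthogonal_decomposition[OF T, of "(w, 0)"] by blast
  obtain x y where xy: "p = (x, y)" by (cases p)
  have "cinner \<theta> y = cinner \<xi> (w - x)" if "(\<xi>, \<theta>) \<in> T" for \<xi> \<theta>
    using p(2)[OF that] by (simp add: xy cinner_prod_def cinner_linear)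
  then have "(y, w - x) \<in> adj T" by (simp add: adj_iff)
  then show ?thesis using p(1) xy by blast
qed

lemma zop_unique:
  assumes "(x, y) \<in> T" "(y, w - x) \<in> adj T" "(x', y') \<in> T" "(y', w - x') \<in> adj T"
  shows "x = x'" "y = y'"
proof -
  have 1: "(x - x', y - y') \<in> T" using assms csubspace_pairD[OF T(1)] by blast
  have "(y - y', (w - x) - (w - x')) \<in> adj T"
    using assms csubspace_pairD[OF csubspace_adj] by blast
  \<comment> \<open>The adjoint relation equates the squared norm of \<open>y - y'\<close> with
    minus the squared norm of \<open>x - x'\<close>, so both vanish.\<close>
  with 1 have "cinner (y - y') (y - y') = cinner (x - x') ((w - x) - (w - x'))"
    unfolding adj_iff by blast
  also have "(w - x) - (w - x') = - (x - x')" by simp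
  finally have "complex_of_real ((norm (y - y'))\<^sup>2 + (norm (x - x'))\<^sup>2) = 0"
    by (simp only: cinner_minus_right cinner_self of_real_add) simp
  then have "(norm (y - y'))\<^sup>2 + (norm (x - x'))\<^sup>2 = 0" by (simp only: of_real_eq_0_iff)
  then show "x = x'" "y = y'" by (simp_all add: add_nonneg_eq_0_iff)
qed

lemma zop_eqI: "(x, y) \<in> T \<Longrightarrow> (y, w - x) \<in> adj T \<Longrightarrow> zop T w = x"
  unfolding zop_def using zop_unique by (metis (mono_tags, lifting) someI_ex)

lemma zop_pair: obtains y where "(zop T w, y) \<in> T" "(y, w - zop T w) \<in> adj T"
  using zop_exists[of w] zop_eqI by metis

lemma zop_clinear: "bounded_clinear (zop T)"
proof (rule bounded_clinearI)
  fix u v c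
  obtain a where a: "(zop T u, a) \<in> T" "(a, u - zop T u) \<in> adj T" by (rule zop_pair)
  obtain b where b: "(zop T v, b) \<in> T" "(b, v - zop T v) \<in> adj T" by (rule zop_pair)
  show "zop T (u + v) = zop T u + zop T v"
    using csubspace_pairD(2)[OF csubspace_adj a(2) b(2)]
    by (intro zop_eqI[OF csubspace_pairD(2)[OF T(1) a(1) b(1)]]) (simp add: add_diff_add)
  show "zop T (c *\<^sub>C u) = c *\<^sub>C zop T u"
    using csubspace_pairD(4)[OF csubspace_adj a(2), of c]
    by (intro zop_eqI[OF csubspace_pairD(4)[OF T(1) a(1)]])
      (simp add: complex_vector.scale_right_diff_distrib)
  have "cinner a a = cinner (zop T u) (u - zop T u)" using a by (simp add: adj_iff)
  then have "complex_of_real ((norm a)\<^sup>2 + (norm (zop T u))\<^sup>2) = cinner (zop T u) u"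
    by (simp add: cinner_diff_right cinner_self)
  then have "\<bar>(norm a)\<^sup>2 + (norm (zop T u))\<^sup>2\<bar> = cmod (cinner (zop T u) u)"
    by (metis norm_of_real)
  also have "\<dots> \<le> norm (zop T u) * norm u" by (rule cinner_cauchy_schwarz)
  finally have "(norm (zop T u))\<^sup>2 \<le> norm (zop T u) * norm u"
    using zero_le_power2[of "norm a"] by linarith
  then show "norm (zop T u) \<le> 1 * norm u"
    by (cases "zop T u = 0") (auto simp: power2_eq_square)
qed

lemma zop_positive: "positive_op (zop T)" "positive_op (\<lambda>x. x - zop T x)"
proof -
  have *: "\<exists>a::'h. cinner w (zop T w) = complex_of_real ((norm (zop T w))\<^sup>2 + (norm a)\<^sup>2) \<and>
     cinner w (w - zop T w) = complex_of_real ((norm (w - zop T w))\<^sup>2 + (norm a)\<^sup>2)" for w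
  proof -
    obtain a where a: "(zop T w, a) \<in> T" "(a, w - zop T w) \<in> adj T" by (rule zop_pair)
    have e: "cinner (zop T w) (w - zop T w) = complex_of_real ((norm a)\<^sup>2)"
      using a unfolding adj_iff cinner_self[symmetric] by metis
    then have e': "cinner (w - zop T w) (zop T w) = complex_of_real ((norm a)\<^sup>2)"
      by (subst cinner_commute) simp
    have "cinner w (zop T w) = cinner (w - zop T w) (zop T w) + cinner (zop T w) (zop T w)"
      "cinner w (w - zop T w) = cinner (w - zop T w) (w - zop T w) + cinner (zop T w) (w - zop T w)"
      by (simp_all add: cinner_linear)
    then show ?thesis by (intro exI[of _ a] conjI) (simp_all add: e e' cinner_self)
  qed
  show "positive_op (zop T)" "positive_op (\<lambda>x. x - zop T x)"
    unfolding positive_op_def complex_nonneg_Reals_iff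
    using * by (metis Re_complex_of_real Im_complex_of_real add_nonneg_nonneg zero_le_power2)+
qed

lemma zop_injective:
  assumes "single_valued T" "closure (Domain T) = UNIV" "zop T w = 0"
  shows "w = 0"
proof -
  obtain a where a: "(zop T w, a) \<in> T" "(a, w - zop T w) \<in> adj T" by (rule zop_pair)
  have "a = 0" using a(1) assms csubspace_pairD(1)[OF T(1)] by (metis single_valuedD)
  then have "cinner \<xi> w = 0" if "\<xi> \<in> Domain T" for \<xi>
    using a(2) that assms(3) by (auto simp: adj_iff)
  then show ?thesis by (rule dense_orthogonal[OF assms(2)])
qed

text \<open>\<open>x\<close> acts on the domain side and \<open>y\<close> on the range side, and the
  two may differ. Their adjoints \<open>x'\<close> and \<open>y'\<close> also preserve the graph,
  which makes \<open>y\<close> and \<open>x\<close> respect the adjoint of \<open>T\<close>.\<close>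

lemma zop_intertwine:
  assumes x: "\<And>u v. (u, v) \<in> T \<Longrightarrow> (x u, y v) \<in> T" "\<And>u v. (u, v) \<in> T \<Longrightarrow> (x' u, y' v) \<in> T"
    and adj: "\<And>u v. cinner (x' u) v = cinner u (x v)" "\<And>u v. cinner (y' u) v = cinner u (y v)"
    and lin: "\<And>u v. x (u - v) = x u - x v"
  shows "zop T (x w) = x (zop T w)"
proof -
  obtain a where a: "(zop T w, a) \<in> T" "(a, w - zop T w) \<in> adj T" by (rule zop_pair)
  have "(y a, x w - x (zop T w)) \<in> adj T"
    using a(2) x(2) unfolding adj_iff by (metis adj lin)
  then show ?thesis using x(1)[OF a(1)] by (intro zop_eqI)
qed

text \<open>The graph of T' T is parametrised by \<open>zop T\<close> alone, and by
  \<open>range_pair_eq\<close> it determines \<open>zop T\<close> in turn. This reduces questions on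
  the modulus to bounded operators.\<close>

lemma comp_adj_eq: "T O adj T = range (\<lambda>w. (zop T w, w - zop T w))"
proof (intro set_eqI iffI)
  fix p assume "p \<in> T O adj T"
  then obtain x y z where p: "p = (x, z)" "(x, y) \<in> T" "(y, z) \<in> adj T" by auto
  then have "zop T (x + z) = x" by (intro zop_eqI) auto
  then show "p \<in> range (\<lambda>w. (zop T w, w - zop T w))" using p by (intro image_eqI[of _ _ "x + z"]) auto
next
  fix p assume "p \<in> range (\<lambda>w. (zop T w, w - zop T w))"
  then obtain w where "p = (zop T w, w - zop T w)" by auto
  then show "p \<in> T O adj T" using zop_pair[of w] by blast
qed

end

lemma pvm_image:
  assumes F: "supported_pvm S F" and k: "k \<in> borel_measurable borel" "\<And>s. s \<in> S \<Longrightarrow> k s \<in> S'"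
    and S': "S' \<in> sets borel"
  defines "E \<equiv> \<lambda>B. F (k -` B)"
  shows "supported_pvm S' E" "bborel g \<Longrightarrow> pint E g = pint F (\<lambda>s. g (k s))"
proof -
  have vim: "k -` B \<in> sets borel" if "B \<in> sets borel" for B
    using measurable_sets[OF k(1) that] by simp
  have P: "projection_valued_measure F" and FS: "S \<in> sets borel" "F (- S) = (\<lambda>x. 0)"
    using F by (auto simp: supported_pvm_def)
  have E: "projection_valued_measure E"
    unfolding projection_valued_measure_def E_def
  proof (intro conjI ballI allI impI)
    fix A :: "nat \<Rightarrow> real set" and x assume A: "range A \<subseteq> sets borel \<and> disjoint_family A"
    have "(\<lambda>n. F (k -` A n) x) sums F (\<Union>n. k -` A n) x"
      using A by (intro pvm_sums[OF P]) (auto intro!: vim simp: disjoint_family_on_def)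
    then show "(\<lambda>n. F (k -` A n) x) sums F (k -` (\<Union>n. A n)) x" by (simp add: vimage_UN)
  qed (auto simp: fun_eq_iff pvm_Int[OF P] vim pvm_projection[OF P] pvm_UNIV[OF P])
  have "E (- S') x = 0" for x
  proof -
    have "k -` (- S') = k -` (- S') \<inter> - S" using k(2) by auto
    then have "F (k -` (- S')) x = F (k -` (- S')) (F (- S) x)"
      using pvm_Int[OF P vim[OF borel_comp[OF S']] borel_comp[OF FS(1)], of x] by simp
    then show ?thesis
      using projection_opD(1)[OF pvm_projection[OF P vim[OF borel_comp[OF S']]]]
      by (simp add: E_def FS bounded_clinearD(5))
  qed
  then show s: "supported_pvm S' E" using E S' by (auto simp: supported_pvm_def)
  have "spm E x = distr (spm F x) borel k" for x
  proof (rule measure_eqI)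
    fix B assume "B \<in> sets (spm E x)"
    then have B: "B \<in> sets borel" by simp
    have km: "k \<in> measurable (spm F x) borel" using k(1) by measurable
    show "emeasure (spm E x) B = emeasure (distr (spm F x) borel k) B"
      using B by (simp add: emeasure_distr[OF km] emeasure_spm[OF E] emeasure_spm[OF P] vim) (simp add: E_def)
  qed simp
  note eq = this
  assume g: "bborel g"
  show "pint E g = pint F (\<lambda>s. g (k s))"
  proof (rule qop_eqI)
    have km: "k \<in> measurable (spm F x) borel" for x using k(1) by measurable
    show "represents (pint F (\<lambda>s. g (k s))) (spm E) g"
      unfolding represents_def eq
      using g k(1) by (auto simp: integral_distr[OF km bborel_meas[OF g]] pint_form[OF F] pint_clinear[OF F] bborel_compose)
  qed
qed

text \<open>Injectivity removes the atom at 0 from the spectral measure of \<open>R\<close>, which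
  then lives on \<open>{0<..1}\<close> and is transported by \<open>k\<close> to the half-line,
  where \<open>h\<close> becomes the function representing \<open>R\<close>.\<close>

lemma contraction_pvm:
  fixes R :: "'h::chilbert op"
  assumes R: "bounded_clinear R" and pos: "positive_op R" "positive_op (\<lambda>x. x - R x)"
    and inj: "\<And>x. R x = 0 \<Longrightarrow> x = 0"
    and k: "k \<in> borel_measurable borel" "\<And>s. s \<in> {0<..1} \<Longrightarrow> k s \<in> {0..}"
    and h: "bborel h" "\<And>s. s \<in> {0<..1} \<Longrightarrow> h (k s) = s"
  shows "\<exists>E. supported_pvm {0..} E \<and> pint E h = R"
proof -
  obtain F where F: "supported_pvm {0..1} F" and FR: "pint F (upow 1) = R"
    using contraction_spectral_theorem[OF R pos] by blast
  have P: "projection_valued_measure F" and F01: "F (- {0..1}) x = 0" for x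
    using F by (auto simp: supported_pvm_def)
  have F0: "F {0} x = 0" for x
  proof (rule inj)
    have "R (F {0} x) = pint F (upow 1) (pint F (indicator {0}) x)"
      by (subst FR, subst pint_indicator[OF F]) auto
    also have "\<dots> = pint F (\<lambda>s. upow 1 s * indicator {0} s) x" by (rule pint_mult[OF F]) auto
    also have "(\<lambda>s. upow 1 s * indicator {0} s) = (\<lambda>s. 0 * 1)" by (auto simp: upow_def indicator_def)
    also have "pint F (\<lambda>s. 0 * 1) x = 0" using pint_cmult[OF F, of "\<lambda>s. 1" 0 x] by simp
    finally show "R (F {0} x) = 0" .
  qed
  have "F (- {0<..1}) x = 0" for x
  proof -
    have "- {0<..1} = - {0..1} \<union> {0::real}" by auto
    then show ?thesis using pvm_Un[OF F, of "- {0..1}" "{0}" x] F0 F01 by simp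
  qed
  then have F': "supported_pvm {0<..1} F" using P by (auto simp: supported_pvm_def)
  have hk: "bborel (\<lambda>s. h (k s))" by (rule bborel_compose[OF h(1) k(1)])
  have "pint F (\<lambda>s. h (k s)) = pint F (upow 1)"
    by (rule pint_cong[OF F' hk bborel_upow]) (auto simp: h(2) upow_def)
  then show ?thesis
    using pvm_image[OF F' k] h(1) FR by (metis atLeast_borel)
qed

section \<open>The spectral measure of the modulus\<close>

text \<open>A positive self-adjoint operator \<open>S\<close> is encoded through its resolvent: the graph of \<open>S\<close> is
  the range of \<open>((1 + S)\<^sup>-\<^sup>1, S (1 + S)\<^sup>-\<^sup>1)\<close>. The absolute values only serve to make the
  functions bounded on the whole line.\<close>

definition resA :: "real \<Rightarrow> real" where "resA s = 1 / (1 + \<bar>s\<bar>)"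
definition resB :: "real \<Rightarrow> real" where "resB s = \<bar>s\<bar> / (1 + \<bar>s\<bar>)"
definition resZ :: "real \<Rightarrow> real" where "resZ s = 1 / (1 + s\<^sup>2)"

definition spec_op :: "(real set \<Rightarrow> 'h::chilbert op) \<Rightarrow> 'h unbdd" where
  "spec_op E = range (\<lambda>w. (pint E resA w, pint E resB w))"

lemma bborel_res [simp]: "bborel resA" "bborel resB" "bborel resZ"
proof -
  have "s\<^sup>2 + 1 > 0" for s :: real by (simp add: add_nonneg_pos)
  moreover have "resA \<in> borel_measurable borel" "resB \<in> borel_measurable borel" "resZ \<in> borel_measurable borel"
    unfolding resA_def[abs_def] resB_def[abs_def] resZ_def[abs_def] by measurable
  ultimately show "bborel resA" "bborel resB" "bborel resZ"
    by (auto intro!: bborelI[of _ 1] simp: resA_def resB_def resZ_def divide_le_eq_1 abs_divide add.commute)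
qed

lemma one_plus_sq_pos: "0 < 1 + (s::real)\<^sup>2"
  by (simp add: add_pos_nonneg)

lemma spm_pint:
  assumes E: "supported_pvm S E" and f: "bborel f"
  shows "spm E (pint E f x) = density (spm E x) (\<lambda>s. ennreal ((f s)\<^sup>2))"
proof (rule measure_eqI)
  have P: "projection_valued_measure E" using E by (simp add: supported_pvm_def)
  fix B assume "B \<in> sets (spm E (pint E f x))"
  then have B: "B \<in> sets borel" by simp
  have fm [measurable]: "f \<in> borel_measurable borel" using f by (rule bborel_meas)
  have b: "bborel (\<lambda>s. indicator B s * f s)" by (intro bborel_intros B f)
  have "emeasure (spm E (pint E f x)) B = ennreal ((norm (E B (pint E f x)))\<^sup>2)"
    by (rule emeasure_spm[OF P B])
  also have "E B (pint E f x) = pint E (\<lambda>s. indicator B s * f s) x"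
    using pint_mult[OF E bborel_indicator[OF B] f, of x] by (simp add: pint_indicator[OF E B])
  also have "(norm (pint E (\<lambda>s. indicator B s * f s) x))\<^sup>2 = (\<integral>s. (indicator B s * f s)\<^sup>2 \<partial>spm E x)"
    by (rule pint_norm[OF E b])
  also have "ennreal (\<integral>s. (indicator B s * f s)\<^sup>2 \<partial>spm E x) = (\<integral>\<^sup>+s. ennreal ((indicator B s * f s)\<^sup>2) \<partial>spm E x)"
    using bborel_mult[OF b b]
    by (intro nn_integral_eq_integral[symmetric] measure_on_integrable[OF spm_measure_on[OF E]])
      (auto simp: power2_eq_square)
  also have "\<dots> = (\<integral>\<^sup>+s. ennreal ((f s)\<^sup>2) * indicator B s \<partial>spm E x)"
    by (intro nn_integral_cong) (auto simp: indicator_def)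
  also have "\<dots> = emeasure (density (spm E x) (\<lambda>s. ennreal ((f s)\<^sup>2))) B"
    using B by (subst emeasure_density) (auto simp: measurable_cong_sets[OF sets_spm refl])
  finally show "emeasure (spm E (pint E f x)) B = emeasure (density (spm E x) (\<lambda>s. ennreal ((f s)\<^sup>2))) B" .
qed simp

context
  fixes E :: "real set \<Rightarrow> 'h::chilbert op"
  assumes E: "supported_pvm {0..} E"
begin

lemma pint_resA_resB: "pint E resB w = w - pint E resA w"
proof -
  have "pint E (\<lambda>s. 1 - resA s) = pint E resB"
    by (rule pint_cong[OF E bborel_diff[OF bborel_const bborel_res(1)] bborel_res(2)])
      (auto simp: resA_def resB_def field_simps)
  then show ?thesis using pint_diff[OF E bborel_const bborel_res(1), of 1 w] pint_one[OF E, of w] by simp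
qed

lemma resA_injective: assumes "pint E resA w = 0" shows "w = 0"
proof -
  have "cinner w (pint E resA w) = complex_of_real (\<integral>s. resA s \<partial>spm E w)" by (rule pint_form[OF E]) simp
  then have "(\<integral>s. resA s \<partial>spm E w) = 0" using assms by simp
  moreover have "integrable (spm E w) resA" by (rule measure_on_integrable[OF spm_measure_on[OF E]]) simp
  ultimately have "AE s in spm E w. resA s = 0"
    by (subst (asm) integral_nonneg_eq_0_iff_AE) (auto simp: resA_def)
  then have "AE s in spm E w. False" by eventually_elim (simp add: resA_def)
  then have "emeasure (spm E w) UNIV = 0"
    using AE_iff_measurable[of UNIV "spm E w" "\<lambda>_. False"] by simp
  then have "measure (spm E w) UNIV = 0" by (simp add: measure_def)
  then show ?thesis using spm_norm[OF E, of w] by simp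
qed

lemma csubspace_spec_op: "csubspace (spec_op E)"
proof (rule csubspace_pairI)
  note lin = bounded_clinearD[OF pint_clinear[OF E bborel_res(1)]] bounded_clinearD[OF pint_clinear[OF E bborel_res(2)]]
  show "(0, 0) \<in> spec_op E" unfolding spec_op_def by (rule image_eqI[of _ _ 0]) (simp_all add: lin)
  show "(a + c, b + d) \<in> spec_op E" if "(a, b) \<in> spec_op E" "(c, d) \<in> spec_op E" for a b c d
  proof -
    from that obtain u v where "a = pint E resA u" "b = pint E resB u" "c = pint E resA v" "d = pint E resB v"
      by (auto simp: spec_op_def)
    then show ?thesis unfolding spec_op_def by (intro image_eqI[of _ _ "u + v"]) (simp_all add: lin)
  qed
  show "(k *\<^sub>C a, k *\<^sub>C b) \<in> spec_op E" if "(a, b) \<in> spec_op E" for a b k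
  proof -
    from that obtain u where "a = pint E resA u" "b = pint E resB u" by (auto simp: spec_op_def)
    then show ?thesis unfolding spec_op_def by (intro image_eqI[of _ _ "k *\<^sub>C u"]) (simp_all add: lin)
  qed
qed

lemma spec_op_dense: "closure (Domain (spec_op E)) = UNIV"
proof (rule dense_subspaceI)
  note lin = bounded_clinearD[OF pint_clinear[OF E bborel_res(1)]]
  have D: "Domain (spec_op E) = range (pint E resA)" by (auto simp: spec_op_def)
  show "csubspace (Domain (spec_op E))"
  proof (rule csubspaceI)
    show "0 \<in> Domain (spec_op E)" unfolding D by (rule image_eqI[of _ _ 0]) (simp_all add: lin)
    fix x y c assume "x \<in> Domain (spec_op E)"
    then obtain u where u: "x = pint E resA u" by (auto simp: D)
    show "c *\<^sub>C x \<in> Domain (spec_op E)" unfolding D u lin(3)[symmetric] by simp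
    assume "y \<in> Domain (spec_op E)"
    then obtain v where v: "y = pint E resA v" by (auto simp: D)
    show "x + y \<in> Domain (spec_op E)" unfolding D u v lin(2)[symmetric] by simp
  qed
  fix x assume *: "\<And>v. v \<in> Domain (spec_op E) \<Longrightarrow> cinner v x = 0"
  have "pint E resA x = 0"
  proof (rule cinner_ext)
    fix z show "cinner z (pint E resA x) = cinner z 0"
      using *[of "pint E resA z"] by (simp add: D pint_adjoint[OF E])
  qed
  then show "x = 0" by (rule resA_injective)
qed

lemma spec_op_positive_selfadjoint: "positive_selfadjoint (spec_op E)"
  unfolding positive_selfadjoint_def selfadjoint_def densely_defined_op_def
proof (intro conjI)
  show "csubspace (spec_op E)" by (rule csubspace_spec_op)
  show "closure (Domain (spec_op E)) = UNIV" by (rule spec_op_dense)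
  show "single_valued (spec_op E)"
  proof (rule single_valuedI)
    fix x y z assume "(x, y) \<in> spec_op E" "(x, z) \<in> spec_op E"
    then obtain u v where uv: "x = pint E resA u" "y = pint E resB u" "x = pint E resA v" "z = pint E resB v"
      unfolding spec_op_def by blast
    have "pint E resA (u - v) = 0" using uv by (simp add: bounded_clinearD[OF pint_clinear[OF E bborel_res(1)]])
    then have "u = v" using resA_injective by fastforce
    then show "y = z" using uv by simp
  qed
  show "adj (spec_op E) = spec_op E"
  proof (intro set_eqI iffI)
    fix p assume "p \<in> adj (spec_op E)"
    moreover obtain y z where p: "p = (y, z)" by (cases p)
    ultimately have *: "cinner (pint E resB w) y = cinner (pint E resA w) z" for w
      unfolding adj_iff p spec_op_def by blast
    \<comment> \<open>Since \<open>pint E resA\<close> and \<open>pint E resB\<close> add up to the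
      identity, this equation says that \<open>y\<close> and \<open>z\<close> are the images of
      \<open>y + z\<close> under the two operators.\<close>
    have "pint E resB y = pint E resA z"
      by (rule cinner_ext) (use * in \<open>simp add: pint_adjoint[OF E]\<close>)
    then have "y - pint E resA y = pint E resA z" using pint_resA_resB[of y] by metis
    then have 1: "pint E resA (y + z) = y"
      unfolding bounded_clinearD(2)[OF pint_clinear[OF E bborel_res(1)]] by (metis add_diff_cancel_left' diff_add_cancel add.commute)
    then have "pint E resB (y + z) = z" by (simp add: pint_resA_resB)
    note 1 this
    then show "p \<in> spec_op E" unfolding p spec_op_def by (intro image_eqI[of _ _ "y + z"]) auto
  next
    fix p assume "p \<in> spec_op E"
    then obtain w where p: "p = (pint E resA w, pint E resB w)" by (auto simp: spec_op_def)
    have "cinner (pint E resB v) (pint E resA w) = cinner (pint E resA v) (pint E resB w)" for v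
      by (simp add: pint_adjoint[OF E] pint_mult[OF E]) (simp add: mult.commute)
    then show "p \<in> adj (spec_op E)" unfolding p adj_iff by (auto simp: spec_op_def)
  qed
  have "positive_op (pint E (\<lambda>s. resA s * resB s))"
    by (rule pint_positive[OF E bborel_mult[OF bborel_res(1,2)]]) (simp add: resA_def resB_def)
  then show "\<forall>(\<xi>, \<eta>)\<in>spec_op E. cinner \<xi> \<eta> \<in> \<real>\<^sub>\<ge>\<^sub>0"
    by (auto simp: spec_op_def positive_op_def pint_adjoint[OF E] pint_mult[OF E])
qed

lemma spec_op_square:
  "spec_op E O spec_op E = range (\<lambda>w. (pint E resZ w, w - pint E resZ w))"
proof (intro set_eqI iffI)
  note lin = bounded_clinearD[OF pint_clinear[OF E bborel_res(1)]] bounded_clinearD[OF pint_clinear[OF E bborel_res(3)]]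
  \<comment> \<open>Up to absolute values, \<open>?c\<close> is (1 + s) / (1 + s^2) and
    \<open>?d\<close> is s times that. Applied to \<open>w\<close> they give the parameters of the
    two links (x, S x) and (S x, S^2 x) with x = (1 + S^2)^-1 w.\<close>
  let ?c = "\<lambda>s. (1 + \<bar>s\<bar>) / (1 + s\<^sup>2)" and ?d = "\<lambda>s. \<bar>s\<bar> * (1 + \<bar>s\<bar>) / (1 + s\<^sup>2)"
  have ab: "\<bar>s\<bar> \<le> 1 + s\<^sup>2" for s :: real
    using sum_squares_ge_zero[of "\<bar>s\<bar> - 1" 0] zero_le_power2[of s]
    by (simp add: power2_eq_square algebra_simps abs_if split: if_splits)
  have cd: "bborel ?c" "bborel ?d"
  proof -
    have "1 + \<bar>s\<bar> \<le> 2 * (1 + s\<^sup>2)" "\<bar>s\<bar> * (1 + \<bar>s\<bar>) \<le> 2 * (1 + s\<^sup>2)" for s :: real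
    proof -
      have e: "\<bar>s\<bar> * (1 + \<bar>s\<bar>) = \<bar>s\<bar> + s\<^sup>2" by (simp add: distrib_left power2_eq_square)
      show "\<bar>s\<bar> * (1 + \<bar>s\<bar>) \<le> 2 * (1 + s\<^sup>2)"
        unfolding e using ab[of s] by (simp add: add_increasing2)
      show "1 + \<bar>s\<bar> \<le> 2 * (1 + s\<^sup>2)"
        using ab[of s] zero_le_power2[of s] by (smt (verit))
    qed
    then show "bborel ?c" "bborel ?d"
      using one_plus_sq_pos by (auto intro!: bborelI[of _ 2] simp: abs_divide divide_le_eq abs_of_pos)
  qed
  have nz: "1 + s\<^sup>2 \<noteq> 0" "1 + \<bar>s\<bar> \<noteq> 0" "\<bar>s\<bar> * \<bar>s\<bar> = s\<^sup>2" for s :: real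
    using one_plus_sq_pos[of s] by (auto simp: power2_eq_square)
  fix p
  {
    assume "p \<in> range (\<lambda>w. (pint E resZ w, w - pint E resZ w))"
    then obtain w where p: "p = (pint E resZ w, w - pint E resZ w)" by auto
    have e: "resA s * ?c s = resZ s" "resB s * ?c s = resA s * ?d s" "resB s * ?d s = 1 - resZ s" for s
      using nz[of s] unfolding resA_def resB_def resZ_def by (simp_all add: divide_simps)
    have 1: "pint E resA (pint E ?c w) = pint E resZ w"
      unfolding pint_mult[OF E bborel_res(1) cd(1)] e ..
    have 2: "pint E resB (pint E ?c w) = pint E resA (pint E ?d w)"
      unfolding pint_mult[OF E bborel_res(2) cd(1)] pint_mult[OF E bborel_res(1) cd(2)] e ..
    have 3: "pint E resB (pint E ?d w) = w - pint E resZ w"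
      unfolding pint_mult[OF E bborel_res(2) cd(2)] e pint_diff[OF E bborel_const bborel_res(3)] pint_one[OF E] ..
    have m: "(pint E resA v, pint E resB v) \<in> spec_op E" for v by (simp add: spec_op_def)
    have "(pint E resZ w, pint E resA (pint E ?d w)) \<in> spec_op E"
      using m[of "pint E ?c w"] by (simp only: 1 2)
    moreover have "(pint E resA (pint E ?d w), w - pint E resZ w) \<in> spec_op E"
      using m[of "pint E ?d w"] by (simp only: 3)
    ultimately
show "p \<in> spec_op E O spec_op E" using p by blast
  next
    assume "p \<in> spec_op E O spec_op E"
    then obtain u v where p: "p = (pint E resA u, pint E resB v)" and uv: "pint E resB u = pint E resA v"
      by (auto simp: spec_op_def)
    \<comment> \<open>Exchanges \<open>resZ * resB\<close> for a multiple of \<open>resA\<close>, so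
      that the matching condition \<open>uv\<close> between the two links can be used.\<close>
    let ?f = "\<lambda>s. \<bar>s\<bar> / (1 + s\<^sup>2)"
    have f: "bborel ?f"
      using one_plus_sq_pos ab by (auto intro!: bborelI[of _ 1] simp: abs_divide divide_le_eq abs_of_pos)
    have e: "resZ s * resB s = ?f s * resA s" "resZ s * resA s + ?f s * resB s = resA s" for s
      using nz[of s] unfolding resA_def resB_def resZ_def
      by (simp_all add: divide_simps)
    have "pint E resZ (pint E resA u + pint E resB v) = pint E resZ (pint E resA u) + pint E resZ (pint E resB v)"
      by (simp add: lin)
    also have "pint E resZ (pint E resB v) = pint E ?f (pint E resA v)"
      unfolding pint_mult[OF E bborel_res(3,2)] pint_mult[OF E f bborel_res(1)] e(1) ..
    also have "\<dots> = pint E ?f (pint E resB u)" using uv by simp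
    also have "pint E resZ (pint E resA u) + pint E ?f (pint E resB u) = pint E (\<lambda>s. resZ s * resA s + ?f s * resB s) u"
      unfolding pint_mult[OF E bborel_res(3,1)] pint_mult[OF E f bborel_res(2)]
      by (rule pint_add[OF E bborel_mult[OF bborel_res(3,1)] bborel_mult[OF f bborel_res(2)], symmetric])
    also have "\<dots> = pint E resA u" unfolding e(2) ..
    finally have "pint E resZ (pint E resA u + pint E resB v) = pint E resA u" .
    then show "p \<in> range (\<lambda>w. (pint E resZ w, w - pint E resZ w))"
      unfolding p by (intro image_eqI[of _ _ "pint E resA u + pint E resB v"]) auto
  }
qed

text \<open>The truncations of 1 + S, applied to a vector with finite second moment, form a Cauchy
  sequence because the tails of the integral of (1 + |s|)^2 tend to 0. In
  \<open>spec_op_domain\<close> the limit serves as the preimage of \<open>x\<close> under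
  \<open>pint E resA\<close>.\<close>

lemma pint_truncated_converges:
  assumes fin: "(\<integral>\<^sup>+s. ennreal (s\<^sup>2) \<partial>spm E x) < \<infinity>"
  defines "F \<equiv> \<lambda>(n::nat) s. (1 + \<bar>s\<bar>) * indicator {-real n..real n} s"
  shows "convergent (\<lambda>n. pint E (F n) x)"
proof -
  let ?w = "\<lambda>s::real. (1 + \<bar>s\<bar>)\<^sup>2"
  interpret finite_measure "spm E x" using spm_measure_on[OF E] by (simp add: measure_on_def)
  have bF: "bborel (F n)" for n
    by (rule bborelI[of _ "1 + real n"]) (auto simp: F_def indicator_def)
  have "integrable (spm E x) (\<lambda>s. s\<^sup>2)"
    using fin by (intro integrableI_nonneg) auto
  then have "integrable (spm E x) (\<lambda>s. 2 + 2 * s\<^sup>2)"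
    by (auto intro!: Bochner_Integration.integrable_add)
  then have iw: "integrable (spm E x) ?w"
  proof (rule Bochner_Integration.integrable_bound)
    have "(1 + \<bar>s\<bar>)\<^sup>2 \<le> 2 + 2 * s\<^sup>2" for s :: real
      using zero_le_power2[of "\<bar>s\<bar> - 1"] by (simp add: power2_eq_square algebra_simps)
    then show "AE s in spm E x. norm ((1 + \<bar>s\<bar>)\<^sup>2) \<le> norm (2 + 2 * s\<^sup>2)" by simp
  qed measurable
  have "(\<lambda>N. \<integral>s. ?w s * indicator (- {-real N..real N}) s \<partial>spm E x) \<longlonglongrightarrow> (\<integral>s. 0 \<partial>spm E x)"
  proof (rule integral_dominated_convergence[where w = ?w])
    show "AE s in spm E x. (\<lambda>N. ?w s * indicator (- {-real N..real N}) s) \<longlonglongrightarrow> 0"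
    proof (rule AE_I2)
      fix s
      obtain N0 where "\<bar>s\<bar> \<le> real N0" using real_arch_simple by blast
      then have "\<forall>n\<ge>N0. ?w s * indicator (- {-real n..real n}) s = 0" by (auto simp: indicator_def)
      then show "(\<lambda>N. ?w s * indicator (- {-real N..real N}) s) \<longlonglongrightarrow> 0"
        by (intro tendsto_eventually) (auto simp: eventually_sequentially)
    qed
    show "AE s in spm E x. norm (?w s * indicator (- {-real n..real n}) s) \<le> ?w s" for n
      by (auto simp: indicator_def)
  qed (use iw in auto)
  then have lim: "(\<lambda>N. \<integral>s. ?w s * indicator (- {-real N..real N}) s \<partial>spm E x) \<longlonglongrightarrow> 0" by simp
  have "Cauchy (\<lambda>n. pint E (F n) x)"
  proof (rule metric_CauchyI)
    fix e :: real assume e: "e > 0"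
    then obtain N where N: "(\<integral>s. ?w s * indicator (- {-real N..real N}) s \<partial>spm E x) < e\<^sup>2"
      using order_tendstoD(2)[OF lim, of "e\<^sup>2"] by (auto simp: eventually_sequentially)
    have "dist (pint E (F m) x) (pint E (F n) x) < e" if "m \<ge> N" "n \<ge> N" for m n
    proof -
      have "(norm (pint E (F m) x - pint E (F n) x))\<^sup>2 = (\<integral>s. (F m s - F n s)\<^sup>2 \<partial>spm E x)"
        unfolding pint_diff[OF E bF bF, symmetric] by (rule pint_norm[OF E bborel_diff[OF bF bF]])
      also have "\<dots> \<le> (\<integral>s. ?w s * indicator (- {-real N..real N}) s \<partial>spm E x)"
      proof (rule integral_mono)
        show "integrable (spm E x) (\<lambda>s. (F m s - F n s)\<^sup>2)"
          unfolding power2_eq_square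
          by (intro measure_on_integrable[OF spm_measure_on[OF E]] bborel_mult bborel_diff bF)
        show "integrable (spm E x) (\<lambda>s. ?w s * indicator (- {-real N..real N}) s)"
          using iw by (rule Bochner_Integration.integrable_bound) (auto simp: indicator_def)
        show "(F m s - F n s)\<^sup>2 \<le> ?w s * indicator (- {-real N..real N}) s" for s
        proof -
          have e: "F m s - F n s = (1 + \<bar>s\<bar>) * (indicator {-real m..real m} s - indicator {-real n..real n} s)"
            by (simp add: F_def right_diff_distrib)
          show ?thesis unfolding e power_mult_distrib
            by (intro mult_left_mono) (use that in \<open>auto simp: indicator_def\<close>)
        qed
      qed
      finally have "(norm (pint E (F m) x - pint E (F n) x))\<^sup>2 < e\<^sup>2" using N by linarith
      then show ?thesis unfolding dist_norm by (rule power_less_imp_less_base) (use e in simp)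
    qed
    then show "\<exists>M. \<forall>m\<ge>M. \<forall>n\<ge>M. dist (pint E (F m) x) (pint E (F n) x) < e" by blast
  qed
  then show ?thesis by (rule Cauchy_convergent)
qed

lemma spec_op_domain: "Domain (spec_op E) = {x. (\<integral>\<^sup>+s. ennreal (s\<^sup>2) \<partial>spm E x) < \<infinity>}"
proof (intro set_eqI iffI CollectI)
  fix x assume "x \<in> Domain (spec_op E)"
  then obtain w where x: "x = pint E resA w" by (auto simp: spec_op_def)
  interpret finite_measure "spm E w" using spm_measure_on[OF E] by (simp add: measure_on_def)
  have [measurable]: "resA \<in> borel_measurable borel" by (rule bborel_meas) simp
  have "(\<integral>\<^sup>+s. ennreal (s\<^sup>2) \<partial>spm E x) = (\<integral>\<^sup>+s. ennreal ((resA s)\<^sup>2) * ennreal (s\<^sup>2) \<partial>spm E w)"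
    unfolding x spm_pint[OF E bborel_res(1)] by (rule nn_integral_density) auto
  also have "\<dots> \<le> (\<integral>\<^sup>+s. 1 \<partial>spm E w)"
  proof (rule nn_integral_mono)
    fix s
    have "(resA s * s)\<^sup>2 \<le> 1"
    proof -
      have "0 < 1 + \<bar>s\<bar>" by linarith
      then show ?thesis by (simp add: resA_def abs_square_le_1 abs_mult)
    qed
    then show "ennreal ((resA s)\<^sup>2) * ennreal (s\<^sup>2) \<le> 1"
      by (simp add: ennreal_mult[symmetric] power_mult_distrib)
  qed
  also have "\<dots> < \<infinity>" by (simp add: emeasure_eq_measure)
  finally show "(\<integral>\<^sup>+s. ennreal (s\<^sup>2) \<partial>spm E x) < \<infinity>" .
next
  fix x assume "x \<in> {x. (\<integral>\<^sup>+s. ennreal (s\<^sup>2) \<partial>spm E x) < \<infinity>}"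
  then have "(\<integral>\<^sup>+s. ennreal (s\<^sup>2) \<partial>spm E x) < \<infinity>" by simp
  from pint_truncated_converges[OF this] obtain w
    where w: "(\<lambda>n. pint E (\<lambda>s. (1 + \<bar>s\<bar>) * indicator {-real n..real n} s) x) \<longlonglongrightarrow> w"
    by (auto simp: convergent_def)
  have b: "bborel (\<lambda>s. (1 + \<bar>s\<bar>) * indicator {-real n..real n} s)" for n
    by (rule bborelI[of _ "1 + real n"]) (auto simp: indicator_def)
  have *: "resA s * ((1 + \<bar>s\<bar>) * indicator {-real n..real n} s) = indicator {-real n..real n} s" for s n
    by (simp add: resA_def)
  then have "pint E resA (pint E (\<lambda>s. (1 + \<bar>s\<bar>) * indicator {-real n..real n} s) x)
      = pint E (indicator {-real n..real n}) x" for n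
    by (subst pint_mult[OF E bborel_res(1) b]) (simp only: *)
  then have "(\<lambda>n. pint E (indicator {-real n..real n}) x) \<longlonglongrightarrow> pint E resA w"
    using bounded_clinear_tendsto[OF pint_clinear[OF E bborel_res(1)] w] by simp
  moreover have "(\<lambda>n. pint E (indicator {-real n..real n}) x) \<longlonglongrightarrow> pint E (\<lambda>s. 1) x"
  proof (rule pint_tendsto[OF E, of _ _ 1])
    fix s
    obtain N0 where "\<bar>s\<bar> \<le> real N0" using real_arch_simple by blast
    then have "\<forall>n\<ge>N0. indicator {-real n..real n} s = (1::real)" by (auto simp: indicator_def)
    then show "(\<lambda>n. indicator {-real n..real n} s :: real) \<longlonglongrightarrow> 1"
      by (intro tendsto_eventually) (auto simp: eventually_sequentially)
  qed (auto split: split_indicator)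
  ultimately have "pint E resA w = pint E (\<lambda>s. 1) x" by (rule LIMSEQ_unique)
  then have "pint E resA w = x" by (simp only: pint_one[OF E])
  then show "x \<in> Domain (spec_op E)" by (auto simp: spec_op_def)
qed

lemma spec_op_spectral_measure: "is_spectral_measure (spec_op E) E"
  unfolding is_spectral_measure_def
proof (intro conjI)
  show "projection_valued_measure E" using E by (simp add: supported_pvm_def)
  show "Domain (spec_op E) = {x. (\<integral>\<^sup>+s. ennreal (s\<^sup>2) \<partial>spm E x) < \<infinity>}" by (rule spec_op_domain)
  have [measurable]: "resA \<in> borel_measurable borel" by (rule bborel_meas) simp
  have "cinner (pint E resA w) (pint E resB w) = complex_of_real (\<integral>s. s \<partial>spm E (pint E resA w))" for w
  proof -
    have "cinner (pint E resA w) (pint E resB w) = complex_of_real (\<integral>s. resA s * resB s \<partial>spm E w)"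
      by (simp add: pint_adjoint[OF E] pint_mult[OF E] pint_form[OF E] bborel_mult)
    also have "(\<integral>s. resA s * resB s \<partial>spm E w) = (\<integral>s. (resA s)\<^sup>2 * s \<partial>spm E w)"
    proof (rule integral_cong_AE)
      show "AE s in spm E w. resA s * resB s = (resA s)\<^sup>2 * s"
        using measure_on_AE[OF spm_measure_on[OF E]]
        by eventually_elim (simp add: resA_def resB_def power2_eq_square)
    qed (use bborel_meas[OF bborel_res(2)] in auto)
    also have "\<dots> = (\<integral>s. s \<partial>spm E (pint E resA w))"
      unfolding spm_pint[OF E bborel_res(1)] by (subst integral_density) auto
    finally show ?thesis .
  qed
  then show "\<forall>(\<xi>, \<eta>)\<in>spec_op E. cinner \<xi> \<eta> = complex_of_real (\<integral>s. s \<partial>spm E \<xi>)"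
    by (auto simp: spec_op_def)
qed

end

lemma resZ_inverse:
  "s \<in> {0..} \<Longrightarrow> resZ s \<in> {0..1}" "s \<in> {0..} \<Longrightarrow> sqrt (1 / resZ s - 1) = s"
  "s \<in> {0<..1} \<Longrightarrow> resZ (sqrt (1 / s - 1)) = s" "s \<in> {0<..1} \<Longrightarrow> sqrt (1 / s - 1) \<in> {0..}"
  using one_plus_sq_pos[of s] by (auto simp: resZ_def divide_le_eq_1)

text \<open>\<open>resZ\<close> is injective on the half-line with inverse
  \<open>sqrt (1 / s - 1)\<close>, so \<open>pint_intertwine\<close> applies with the identity
  operator.\<close>

lemma spec_op_determined:
  assumes E: "supported_pvm {0..} E" and F: "supported_pvm {0..} F" and eq: "pint E resZ = pint F resZ"
  shows "bborel g \<Longrightarrow> pint E g = pint F g"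
proof
  fix v assume g: "bborel g"
  have "id (pint E g v) = pint F g (id v)"
  proof (rule pint_intertwine[OF E F bounded_clinear_id bborel_res(3) resZ_inverse(1) _ resZ_inverse(2) _ g])
    show "(\<lambda>s. sqrt (1 / s - 1)) \<in> borel_measurable borel" by measurable
  qed (simp_all add: eq)
  then show "pint E g v = pint F g v" by simp
qed

lemma positive_selfadjoint_closed:
  assumes "positive_selfadjoint S" shows "csubspace S" "closed S" "single_valued S" "closure (Domain S) = UNIV"
  using assms closed_adj[of S]
  by (auto simp: positive_selfadjoint_def selfadjoint_def densely_defined_op_def)

text \<open>Surjectivity of 1 + S. Positivity gives |x|^2 + |S x|^2 \<le> |x + S x|^2, so the range
  is closed; a vector z orthogonal to it satisfies S z = - z by self-adjointness, and positivity
  forces z = 0.\<close>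

lemma positive_selfadjoint_resolvent:
  assumes S: "positive_selfadjoint S"
  shows "\<exists>x y. (x, y) \<in> S \<and> w = x + y"
proof -
  note c = positive_selfadjoint_closed[OF S]
  have adj: "adj S = S" and pos: "\<And>x y. (x, y) \<in> S \<Longrightarrow> cinner x y \<in> \<real>\<^sub>\<ge>\<^sub>0"
    using S by (auto simp: positive_selfadjoint_def selfadjoint_def)
  define V where "V = (\<lambda>(x, y). x + y) ` S"
  have sub: "csubspace V"
  proof (rule csubspaceI)
    show "0 \<in> V" unfolding V_def using csubspace_pairD(1)[OF c(1)] by force
    fix u v k assume "u \<in> V"
    then obtain x y where 1: "(x, y) \<in> S" "u = x + y" by (auto simp: V_def)
    show "k *\<^sub>C u \<in> V" unfolding V_def
      by (rule image_eqI[OF _ csubspace_pairD(4)[OF c(1) 1(1), of k]]) (simp add: 1 scaleC_add_right)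
    assume "v \<in> V"
    then obtain x' y' where 2: "(x', y') \<in> S" "v = x' + y'" by (auto simp: V_def)
    show "u + v \<in> V" unfolding V_def
      by (rule image_eqI[OF _ csubspace_pairD(2)[OF c(1) 1(1) 2(1)]]) (simp add: 1 2)
  qed
  have bound: "norm (x, y) \<le> norm (x + y)" if "(x, y) \<in> S" for x y
  proof -
    have "0 \<le> Re (cinner x y)" using pos[OF that] by (simp add: complex_nonneg_Reals_iff)
    then have "(norm x)\<^sup>2 + (norm y)\<^sup>2 \<le> (norm (x + y))\<^sup>2" by (simp add: norm_add_sq)
    then show ?thesis by (simp add: norm_Pair real_le_lsqrt)
  qed
  have "closed V"
    unfolding closed_sequential_limits
  proof (intro allI impI, elim conjE)
    fix f l assume f: "\<forall>n. f n \<in> V" "f \<longlonglongrightarrow> l"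
    then have "\<forall>n. \<exists>p. p \<in> S \<and> f n = fst p + snd p" by (force simp: V_def)
    from choice[OF this] obtain p where p: "\<And>n. p n \<in> S" "\<And>n. f n = fst (p n) + snd (p n)" by blast
    have "Cauchy p"
    proof (rule metric_CauchyI)
      fix e :: real assume "e > 0"
      then obtain N where N: "\<And>m n. m \<ge> N \<Longrightarrow> n \<ge> N \<Longrightarrow> dist (f m) (f n) < e"
        using LIMSEQ_imp_Cauchy[OF f(2)] unfolding Cauchy_def by blast
      have "dist (p m) (p n) \<le> dist (f m) (f n)" for m n
      proof -
        have "p m - p n \<in> S" by (rule csubspaceD(3)[OF c(1)]) (rule p)+
        then have "norm (p m - p n) \<le> norm (fst (p m - p n) + snd (p m - p n))"
          using bound[of "fst (p m - p n)" "snd (p m - p n)"] by (simp only: prod.collapse)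
        also have "fst (p m - p n) + snd (p m - p n) = f m - f n" by (simp add: p)
        finally show ?thesis by (simp add: dist_norm)
      qed
      then show "\<exists>M. \<forall>m\<ge>M. \<forall>n\<ge>M. dist (p m) (p n) < e" using N by (meson order_le_less_trans)
    qed
    then obtain q where q: "p \<longlonglongrightarrow> q" using Cauchy_convergent convergent_def by blast
    then have "q \<in> S" using c(2) p(1) closed_sequentially by blast
    moreover have "(\<lambda>n. fst (p n) + snd (p n)) \<longlonglongrightarrow> fst q + snd q"
      by (intro tendsto_add tendsto_fst tendsto_snd q)
    then have "f \<longlonglongrightarrow> fst q + snd q" using p(2) by presburger
    then have "l = fst q + snd q" by (rule LIMSEQ_unique[OF f(2)])
    ultimately show "l \<in> V" unfolding V_def by (intro image_eqI[of _ _ q]) (auto simp: case_prod_unfold)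
  qed
  obtain q where q: "q \<in> V" "\<And>v. v \<in> V \<Longrightarrow> cinner v (w - q) = 0"
    using orthogonal_decomposition[OF sub \<open>closed V\<close>, of w] by blast
  have "cinner y (w - q) = cinner x (- (w - q))" if "(x, y) \<in> S" for x y
  proof -
    have "x + y \<in> V" unfolding V_def by (rule image_eqI[OF _ that]) simp
    then have "cinner x (w - q) + cinner y (w - q) = 0" using q(2) by (simp only: cinner_add_left[symmetric])
    then show ?thesis by (simp only: cinner_minus_right) (simp add: add_eq_0_iff)
  qed
  then have "(w - q, - (w - q)) \<in> S" using adj by (metis adj_iff)
  then have "cinner (w - q) (- (w - q)) \<in> \<real>\<^sub>\<ge>\<^sub>0" by (rule pos)
  then have "w - q = 0"
    by (simp only: cinner_minus_right cinner_self complex_nonneg_Reals_iff) simp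
  then show ?thesis using q(1) by (auto simp: V_def)
qed

lemma positive_selfadjoint_spec_op:
  assumes S: "positive_selfadjoint S"
  shows "\<exists>E. supported_pvm {0..} E \<and> S = spec_op E"
proof -
  note c = positive_selfadjoint_closed[OF S]
  have pos: "\<And>x y. (x, y) \<in> S \<Longrightarrow> cinner x y \<in> \<real>\<^sub>\<ge>\<^sub>0"
    using S by (auto simp: positive_selfadjoint_def selfadjoint_def)
  have uniq: "x = x'" if "(x, w - x) \<in> S" "(x', w - x') \<in> S" for x x' w
  proof -
    have "(x - x', (w - x) - (w - x')) \<in> S" by (rule csubspace_pairD(3)[OF c(1) that])
    then have "cinner (x - x') (- (x - x')) \<in> \<real>\<^sub>\<ge>\<^sub>0" using pos[of "x - x'" "- (x - x')"] by simp
    then have "x - x' = 0"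
      by (simp only: cinner_minus_right cinner_self complex_nonneg_Reals_iff) simp
    then show ?thesis by simp
  qed
  have "\<exists>x. (x, w - x) \<in> S" for w
  proof -
    obtain x y where "(x, y) \<in> S" "w = x + y" using positive_selfadjoint_resolvent[OF S, of w] by blast
    then have "(x, w - x) \<in> S" by simp
    then show ?thesis ..
  qed
  then obtain A where A: "\<And>w. (A w, w - A w) \<in> S" by metis
  have Ai: "A w = x" if "(x, w - x) \<in> S" for x w using uniq[OF A that] .
  \<comment> \<open>With A = (1 + S)^-1, the inner product of \<open>A w\<close> and
    \<open>w - A w\<close> is that of a vector x of the domain and S x. Its positivity makes both
    \<open>A\<close> and 1 - A positive.\<close>
  have f: "cinner w (A w) = complex_of_real ((norm (A w))\<^sup>2 + Re (cinner (A w) (w - A w)))"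
    "cinner w (w - A w) = complex_of_real ((norm (w - A w))\<^sup>2 + Re (cinner (A w) (w - A w)))"
    "0 \<le> Re (cinner (A w) (w - A w))" for w
  proof -
    have p: "cinner (A w) (w - A w) = complex_of_real (Re (cinner (A w) (w - A w)))" "0 \<le> Re (cinner (A w) (w - A w))"
      using pos[OF A[of w]] by (auto simp: complex_nonneg_Reals_iff complex_eq_iff)
    then have p': "cinner (w - A w) (A w) = complex_of_real (Re (cinner (A w) (w - A w)))"
      by (metis cinner_commute complex_cnj_complex_of_real)
    show "0 \<le> Re (cinner (A w) (w - A w))" by (rule p)
    have "cinner w (A w) = cinner (w - A w) (A w) + cinner (A w) (A w)"
      "cinner w (w - A w) = cinner (w - A w) (w - A w) + cinner (A w) (w - A w)"
      by (simp_all add: cinner_linear)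
    then show "cinner w (A w) = complex_of_real ((norm (A w))\<^sup>2 + Re (cinner (A w) (w - A w)))"
      "cinner w (w - A w) = complex_of_real ((norm (w - A w))\<^sup>2 + Re (cinner (A w) (w - A w)))"
      by (simp_all only: p' cinner_self of_real_add add.commute) (metis p(1) add.commute)
  qed
  have "bounded_clinear A"
  proof (rule bounded_clinearI)
    fix u v k
    show "A (u + v) = A u + A v"
      using csubspace_pairD(2)[OF c(1) A[of u] A[of v]] by (intro Ai) (simp add: add_diff_add)
    show "A (k *\<^sub>C u) = k *\<^sub>C A u"
      using csubspace_pairD(4)[OF c(1) A[of u], of k] by (intro Ai) (simp add: complex_vector.scale_right_diff_distrib)
    have "cmod (cinner u (A u)) = (norm (A u))\<^sup>2 + Re (cinner (A u) (u - A u))"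
      unfolding f(1)[of u] norm_of_real using f(3)[of u] by simp
    then have "(norm (A u))\<^sup>2 \<le> norm u * norm (A u)"
      using f(3)[of u] cinner_cauchy_schwarz[of u "A u"] by linarith
    then show "norm (A u) \<le> 1 * norm u" by (cases "A u = 0") (auto simp: power2_eq_square)
  qed
  moreover have "positive_op A" "positive_op (\<lambda>x. x - A x)"
    by (rule positive_opI[OF f(1)], simp add: f(3)) (rule positive_opI[OF f(2)], simp add: f(3))
  moreover have "w = 0" if "A w = 0" for w
    using A[of w] csubspace_pairD(1)[OF c(1)] c(3) that by (metis diff_zero single_valuedD)
  moreover have "(\<lambda>s. \<bar>1 / s - 1\<bar>) \<in> borel_measurable (borel :: real measure)" by measurable
  moreover have "resA \<bar>1 / s - 1\<bar> = s" if "s \<in> {0<..1}" for s :: real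
    using that by (simp add: resA_def)
  ultimately obtain E where E: "supported_pvm {0..} E" "pint E resA = A"
    using contraction_pvm[of A "\<lambda>s. \<bar>1 / s - 1\<bar>" resA] by auto
  have "spec_op E = range (\<lambda>w. (A w, w - A w))"
    unfolding spec_op_def by (simp add: E pint_resA_resB[OF E(1)])
  also have "\<dots> = S"
  proof (intro set_eqI iffI)
    fix p assume "p \<in> S"
    moreover obtain x y where p: "p = (x, y)" by (cases p)
    ultimately have "A (x + y) = x" by (intro Ai) auto
    then show "p \<in> range (\<lambda>w. (A w, w - A w))" unfolding p by (intro image_eqI[of _ _ "x + y"]) auto
  qed (use A in auto)
  finally show ?thesis using E by blast
qed

text \<open>Adding the two components recovers the parameter, so a graph of this form determines its
  function.\<close>

lemma range_pair_eq:
  assumes "range (\<lambda>w. (f w, w - f w)) = range (\<lambda>w. (g w, w - g w))"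
  shows "f = (g :: 'a \<Rightarrow> 'a::ab_group_add)"
proof
  fix w
  have "(f w, w - f w) \<in> range (\<lambda>w. (g w, w - g w))" using assms by blast
  then obtain v where "f w = g v" "w - f w = v - g v" by auto
  then show "f w = g w" by simp
qed

text \<open>For existence, the spectral measure of \<open>zop T\<close> is transported by s
  \<mapsto> sqrt (1 / s - 1). For uniqueness, any positive square root is itself a
  \<open>spec_op\<close>, its \<open>resZ\<close> is forced by its square, and \<open>resZ\<close>
  determines the operator. Both are required before \<open>THE\<close> denotes anything.\<close>

lemma modulus_spec_op:
  assumes T: "closed_densely_defined_op T"
  shows "\<exists>E. supported_pvm {0..} E \<and> pint E resZ = zop T \<and> modulus T = spec_op E"
proof -
  have c: "csubspace T" "closed T" "single_valued T" "closure (Domain T) = UNIV"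
    using T by (auto simp: closed_densely_defined_op_def densely_defined_op_def)
  note cc = c(1,2)
  obtain E where E: "supported_pvm {0..} E" "pint E resZ = zop T"
    using contraction_pvm[OF zop_clinear[OF cc] zop_positive[OF cc] zop_injective[OF cc c(3,4)], of "\<lambda>s. sqrt (1 / s - 1)" resZ]
      resZ_inverse(3,4) by auto
  have "modulus T = spec_op E"
    unfolding modulus_def
  proof (rule the_equality)
    show "positive_selfadjoint (spec_op E) \<and> spec_op E O spec_op E = T O adj T"
      using spec_op_positive_selfadjoint[OF E(1)] spec_op_square[OF E(1)] comp_adj_eq[OF cc] E(2) by simp
    fix S assume S: "positive_selfadjoint S \<and> S O S = T O adj T"
    then obtain F where F: "supported_pvm {0..} F" "S = spec_op F"
      using positive_selfadjoint_spec_op by blast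
    have "pint F resZ = zop T"
      using S spec_op_square[OF F(1)] comp_adj_eq[OF cc] F(2) by (intro range_pair_eq) simp
    then have "pint E g = pint F g" if "bborel g" for g
      using spec_op_determined[OF E(1) F(1) _ that] E(2) by simp
    then show "S = spec_op E" unfolding F(2) spec_op_def by simp
  qed
  then show ?thesis using E by blast
qed

text \<open>\<open>is_spectral_measure\<close> prescribes only the domain and the quadratic form, so
  the measure picked by \<open>SOME\<close> might a priori charge the negative axis or belong to
  another operator. Both are excluded here.\<close>

lemma spectral_measure_spec_op:
  fixes E :: "real set \<Rightarrow> 'h::chilbert op"
  assumes E: "supported_pvm {0..} E" and F: "is_spectral_measure (spec_op E) F"
  shows "supported_pvm {0..} F" "spec_op F = spec_op E"
proof -
  let ?S = "spec_op E"
  have P: "projection_valued_measure F" using F by (simp add: is_spectral_measure_def)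
  have dom: "Domain ?S = {\<xi>. (\<integral>\<^sup>+s. ennreal (s\<^sup>2) \<partial>spm F \<xi>) < \<infinity>}"
    and form: "\<And>x y. (x, y) \<in> ?S \<Longrightarrow> cinner x y = complex_of_real (\<integral>s. s \<partial>spm F x)"
    using F by (auto simp: is_spectral_measure_def)
  have pos: "positive_selfadjoint ?S" by (rule spec_op_positive_selfadjoint[OF E])
  note FU = supported_pvm_UNIV[OF P]
  \<comment> \<open>Vectors in the range of \<open>F\<close> for a bounded negative window lie in
    the domain. There the form is nonnegative and at the same time an integral of negative numbers,
    so the window carries no mass.\<close>
  have neg: "F {-real n..<0} x = 0" for n x
  proof -
    let ?B = "{-real n..<0}"
    let ?x = "pint F (indicator ?B) x"
    interpret finite_measure "spm F x" by (rule finite_measure_spm[OF P])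
    have b: "bborel (indicator ?B)" by simp
    have "(\<integral>\<^sup>+s. ennreal (s\<^sup>2) \<partial>spm F ?x) = (\<integral>\<^sup>+s. ennreal ((indicator ?B s)\<^sup>2) * ennreal (s\<^sup>2) \<partial>spm F x)"
      unfolding spm_pint[OF FU b] by (rule nn_integral_density) auto
    also have "\<dots> \<le> (\<integral>\<^sup>+s. ennreal ((real n)\<^sup>2) \<partial>spm F x)"
    proof (rule nn_integral_mono)
      fix s
      have "s\<^sup>2 \<le> (real n)\<^sup>2" if "s \<in> ?B" using that by (auto simp: abs_le_square_iff[symmetric])
      then show "ennreal ((indicator ?B s)\<^sup>2) * ennreal (s\<^sup>2) \<le> ennreal ((real n)\<^sup>2)"
        by (auto simp: indicator_def intro: ennreal_leI)
    qed
    also have "\<dots> < \<infinity>" by (simp add: emeasure_eq_measure ennreal_mult[symmetric])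
    finally obtain y where y: "(?x, y) \<in> ?S" using dom by blast
    then have "cinner ?x y \<in> \<real>\<^sub>\<ge>\<^sub>0" using pos by (auto simp: positive_selfadjoint_def)
    then have "0 \<le> (\<integral>s. s \<partial>spm F ?x)" by (simp add: form[OF y])
    also have "(\<integral>s. s \<partial>spm F ?x) = (\<integral>s. (indicator ?B s)\<^sup>2 * s \<partial>spm F x)"
      unfolding spm_pint[OF FU b] by (subst integral_density) auto
    finally have "(\<integral>s. - ((indicator ?B s)\<^sup>2 * s) \<partial>spm F x) \<le> 0" by simp
    moreover have i: "integrable (spm F x) (\<lambda>s. - ((indicator ?B s)\<^sup>2 * s))"
      by (rule integrable_const_bound[of _ "real n"]) (auto simp: indicator_def)
    moreover have nn: "0 \<le> - ((indicator ?B s)\<^sup>2 * s)" for s :: real by (auto simp: indicator_def)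
    moreover have "0 \<le> (\<integral>s. - ((indicator ?B s)\<^sup>2 * s) \<partial>spm F x)" using nn by (intro integral_nonneg_AE) auto
    ultimately have "(\<integral>s. - ((indicator ?B s)\<^sup>2 * s) \<partial>spm F x) = 0" by linarith
    then have "AE s in spm F x. - ((indicator ?B s)\<^sup>2 * s) = 0"
      using integral_nonneg_eq_0_iff_AE[OF i] nn by simp
    then have "AE s in spm F x. s \<notin> ?B" by eventually_elim (auto simp: indicator_def)
    then have "emeasure (spm F x) ?B = 0"
    proof -
      have e: "{s \<in> space (spm F x). \<not> s \<notin> ?B} = ?B" by auto
      show ?thesis using \<open>AE s in spm F x. s \<notin> ?B\<close> AE_iff_measurable[OF _ e] by simp
    qed
    then show ?thesis by (simp add: emeasure_spm[OF P])
  qed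
  have "F (- {0..}) x = 0" for x
  proof -
    have u: "- {0..} = (\<Union>n::nat. {-real n..<0})"
    proof (intro set_eqI iffI)
      fix s :: real assume "s \<in> - {0..}"
      moreover obtain n where "- s \<le> real n" using real_arch_simple by blast
      ultimately show "s \<in> (\<Union>n::nat. {-real n..<0})" by (auto intro!: exI[of _ n])
    qed auto
    have "emeasure (spm F x) (\<Union>n::nat. {-real n..<0}) = 0"
      by (rule emeasure_UN_eq_0) (auto simp: emeasure_spm[OF P] neg)
    then show ?thesis unfolding u by (subst (asm) emeasure_spm[OF P]) auto
  qed
  then show F0: "supported_pvm {0..} F" using P by (auto simp: supported_pvm_def)
  have FS: "is_spectral_measure (spec_op F) F" by (rule spec_op_spectral_measure[OF F0])
  have dom': "Domain (spec_op F) = Domain ?S" using FS dom by (simp add: is_spectral_measure_def)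
  have form': "\<And>x y. (x, y) \<in> spec_op F \<Longrightarrow> cinner x y = complex_of_real (\<integral>s. s \<partial>spm F x)"
    using FS by (auto simp: is_spectral_measure_def)
  \<comment> \<open>The graph of the difference of the two operators on their common domain. Its
    quadratic form vanishes, so by polarization and density the difference is 0.\<close>
  define \<Delta> where "\<Delta> = {(x, y - z) | x y z. (x, y) \<in> ?S \<and> (x, z) \<in> spec_op F}"
  note cE = csubspace_pairD[OF csubspace_spec_op[OF E]] and cF = csubspace_pairD[OF csubspace_spec_op[OF F0]]
  have q: "cinner x d = 0" if "(x, d) \<in> \<Delta>" for x d
    using that form form' by (auto simp: \<Delta>_def cinner_diff_right)
  have dlin: "(x + k *\<^sub>C x', d + k *\<^sub>C d') \<in> \<Delta>" if xd: "(x, d) \<in> \<Delta>" "(x', d') \<in> \<Delta>" for x d x' d' k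
  proof -
    obtain y z where 1: "d = y - z" "(x, y) \<in> ?S" "(x, z) \<in> spec_op F" using xd(1) by (auto simp: \<Delta>_def)
    obtain y' z' where 2: "d' = y' - z'" "(x', y') \<in> ?S" "(x', z') \<in> spec_op F" using xd(2) by (auto simp: \<Delta>_def)
    have "(x + k *\<^sub>C x', y + k *\<^sub>C y') \<in> ?S" by (intro cE(2) cE(4) 1 2)
    moreover have "(x + k *\<^sub>C x', z + k *\<^sub>C z') \<in> spec_op F" by (intro cF(2) cF(4) 1 2)
    moreover have "d + k *\<^sub>C d' = (y + k *\<^sub>C y') - (z + k *\<^sub>C z')"
      by (simp add: 1 2 complex_vector.scale_right_diff_distrib)
    ultimately show ?thesis unfolding \<Delta>_def by blast
  qed
  have z: "d = 0" if d: "(x, d) \<in> \<Delta>" for x d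
  proof (rule dense_orthogonal[OF spec_op_dense[OF E]])
    fix v assume "v \<in> Domain ?S"
    then obtain e where e: "(v, e) \<in> \<Delta>" using dom' unfolding \<Delta>_def by (auto simp: set_eq_iff Domain_iff) blast
    have "cinner (v + k *\<^sub>C x) (e + k *\<^sub>C d) = 0" for k by (rule q[OF dlin[OF e d]])
    from this[of 1] this[of \<i>] have "cinner v d + cinner x e = 0" "cinner v d - cinner x e = 0"
      using q[OF e] q[OF d] by (simp_all add: cinner_linear algebra_simps)
    then show "cinner v d = 0" by simp
  qed
  have sub: "y = z" if "(x, y) \<in> ?S" "(x, z) \<in> spec_op F" for x y z
    using z[of x "y - z"] that by (auto simp: \<Delta>_def)
  show "spec_op F = spec_op E"
  proof (intro set_eqI iffI)
    fix p assume p: "p \<in> spec_op F"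
    then have "fst p \<in> Domain ?S" using dom' by (cases p) auto
    then obtain y where "(fst p, y) \<in> ?S" by auto
    with sub[OF this, of "snd p"] p show "p \<in> ?S" by (cases p) auto
  next
    fix p assume p: "p \<in> ?S"
    then have "fst p \<in> Domain (spec_op F)" using dom' by (cases p) auto
    then obtain y where "(fst p, y) \<in> spec_op F" by auto
    with sub[OF _ this, of "snd p"] p show "p \<in> spec_op F" by (cases p) auto
  qed
qed

text \<open>From here on the modulus enters only through these two facts.\<close>

theorem spectral_measure_modulus:
  fixes T :: "'h::chilbert unbdd"
  assumes T: "closed_densely_defined_op T"
  defines "E \<equiv> spectral_measure (modulus T)"
  shows "supported_pvm {0..} E" "pint E resZ = zop T"
proof -
  obtain F where F: "supported_pvm {0..} F" "pint F resZ = zop T" "modulus T = spec_op F"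
    using modulus_spec_op[OF T] by blast
  have "is_spectral_measure (modulus T) E"
    unfolding E_def spectral_measure_def
    by (rule someI[of "is_spectral_measure (modulus T)" F]) (simp add: F(3) spec_op_spectral_measure[OF F(1)])
  then have E: "supported_pvm {0..} E" "spec_op E = spec_op F"
    using spectral_measure_spec_op[OF F(1)] by (simp_all add: F(3))
  show "supported_pvm {0..} E" by (rule E)
  have "pint E resZ = pint F resZ"
    using spec_op_square[OF E(1)] spec_op_square[OF F(1)] E(2) by (intro range_pair_eq) simp
  then show "pint E resZ = zop T" by (simp add: F)
qed

section \<open>Spectral measures and von Neumann algebras\<close>

lemma modulus_pint_commute:
  assumes T: "closed_densely_defined_op T" and x: "bounded_clinear x"
    and comm: "\<And>v. x (zop T v) = zop T (x v)" and g: "bborel g"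
  shows "x (pint (spectral_measure (modulus T)) g v) = pint (spectral_measure (modulus T)) g (x v)"
proof -
  note E = spectral_measure_modulus[OF T]
  show ?thesis
  proof (rule pint_intertwine[OF E(1) E(1) x bborel_res(3) resZ_inverse(1) _ resZ_inverse(2) _ g])
    show "(\<lambda>s. sqrt (1 / s - 1)) \<in> borel_measurable borel" by measurable
  qed (simp_all add: E(2) comm)
qed

lemma contraction_pint_commute:
  assumes E: "supported_pvm {0..1} E" "pint E (upow 1) = R" and x: "bounded_clinear x"
    and comm: "\<And>v. x (R v) = R (x v)" and g: "bborel g"
  shows "x (pint E g v) = pint E g (x v)"
  by (rule pint_intertwine[OF E(1) E(1) x bborel_upow[of 1] _ measurable_ident _ _ g])
    (simp_all add: E(2)[simplified] comm, simp_all add: upow_def)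

lemma unitary_opD:
  assumes "unitary_op u"
  shows "bounded_clinear u" "cadj u (u v) = v" "u (cadj u v) = v"
  using assms by (auto simp: unitary_op_def fun_eq_iff)

text \<open>The affine map s \<mapsto> (1 + s / K) / 2 carries [-K, K] to the unit interval and so
  brings a self-adjoint operator within reach of the spectral theorem for contractions.\<close>

lemma selfadjoint_half_contraction:
  assumes y: "bounded_clinear y" and sa: "\<And>u v. cinner (y u) v = cinner u (y v)"
    and K: "K > 0" "\<And>v. norm (y v) \<le> K * norm v"
  defines "R \<equiv> \<lambda>v. (1/2) *\<^sub>R (v + (1 / K) *\<^sub>R y v)"
  shows "bounded_clinear R" "positive_op R" "positive_op (\<lambda>v. v - R v)"
proof -
  show "bounded_clinear R" unfolding R_def
    by (intro bounded_clinear_scaleR bounded_clinear_add y bounded_clinear_id[unfolded id_def])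
  have im: "cinner v (y v) = complex_of_real (Re (cinner v (y v)))" for v
  proof -
    have "cnj (cinner v (y v)) = cinner v (y v)" by (metis cinner_commute sa)
    then show ?thesis by (metis Reals_cnj_iff of_real_Re)
  qed
  have b: "\<bar>Re (cinner v (y v))\<bar> \<le> K * (norm v)\<^sup>2" for v
  proof -
    have "\<bar>Re (cinner v (y v))\<bar> \<le> cmod (cinner v (y v))" by (rule abs_Re_le_cmod)
    also have "\<dots> \<le> norm v * norm (y v)" by (rule cinner_cauchy_schwarz)
    also have "\<dots> \<le> norm v * (K * norm v)" by (intro mult_left_mono K) simp
    finally show ?thesis by (simp add: power2_eq_square mult_ac)
  qed
  define q where "q v = Re (cinner v (y v)) / K" for v
  have b': "\<bar>q v\<bar> \<le> (norm v)\<^sup>2" for v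
    unfolding q_def using b[of v] K(1) by (simp add: abs_divide divide_le_eq mult.commute)
  show "positive_op R"
  proof (rule positive_opI)
    show "cinner v (R v) = complex_of_real ((1/2) * ((norm v)\<^sup>2 + q v))" for v
      unfolding R_def q_def by (simp add: cinner_scaleR_right cinner_add_right cinner_self) (subst im, simp)
    show "0 \<le> (1/2) * ((norm v)\<^sup>2 + q v)" for v using b'[of v] by simp
  qed
  show "positive_op (\<lambda>v. v - R v)"
  proof (rule positive_opI)
    show "cinner v (v - R v) = complex_of_real ((1/2) * ((norm v)\<^sup>2 - q v))" for v
      unfolding R_def q_def
      by (simp add: cinner_scaleR_right cinner_add_right cinner_diff_right cinner_self) (subst im, simp add: field_simps)
    show "0 \<le> (1/2) * ((norm v)\<^sup>2 - q v)" for v using b'[of v] by simp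
  qed
qed

text \<open>A self-adjoint contraction \<open>c\<close> is the real part of the unitary \<open>c + \<i> sqrt (1 - c\<^sup>2)\<close>.\<close>

lemma selfadjoint_commute_unitaries:
  assumes y: "y \<in> commutant S" and S: "\<And>x. x \<in> S \<Longrightarrow> bounded_clinear x"
    and sa: "\<And>u v. cinner (y u) v = cinner u (y v)"
    and z: "bounded_clinear z" "\<And>u v. u \<in> commutant S \<Longrightarrow> unitary_op u \<Longrightarrow> z (u v) = u (z v)"
  shows "z (y v) = y (z v)"
proof -
  have yb: "bounded_clinear y" using y by (rule commutantD)
  obtain K0 where K0: "K0 \<ge> 0" "\<And>v. norm (y v) \<le> K0 * norm v"
    by (rule bounded_clinear_bound[OF yb]) blast
  define K where "K = K0 + 1"
  have K: "K > 0" "norm (y v) \<le> K * norm v" for v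
    using K0(1) order_trans[OF K0(2), of v "K * norm v"] by (auto simp: K_def distrib_right)
  define R where "R = (\<lambda>v. (1/2) *\<^sub>R (v + (1 / K) *\<^sub>R y v))"
  have R: "bounded_clinear R" "positive_op R" "positive_op (\<lambda>v. v - R v)"
    unfolding R_def by (rule selfadjoint_half_contraction[OF yb sa K])+
  obtain E where E: "supported_pvm {0..1} E" "pint E (upow 1) = R"
    using contraction_spectral_theorem[OF R] by blast
  have inS: "pint E g \<in> commutant S" if g: "bborel g" for g
  proof (rule commutantI[OF pint_clinear[OF E(1) g]])
    fix x v assume x: "x \<in> S"
    have "x (pint E g v) = pint E g (x v)"
      by (rule contraction_pint_commute[OF E S[OF x] _ g])
        (simp add: R_def bounded_clinearD[OF S[OF x]] commutantD(2)[OF y x])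
    then show "pint E g (x v) = x (pint E g v)" ..
  qed
  \<comment> \<open>On the unit interval \<open>?a\<close> is 2 s - 1, which undoes the affine map
    in \<open>R\<close>, and the squares of \<open>?a\<close> and \<open>?b\<close> add up to
    1.\<close>
  let ?a = "\<lambda>s. 2 * upow 1 s - upow 0 s" and ?b = "\<lambda>s. sqrt (1 - (2 * upow 1 s - upow 0 s)\<^sup>2)"
  have a1: "\<bar>?a s\<bar> \<le> 1" for s by (auto simp: upow_def indicator_def)
  have ba: "bborel ?a" by (intro bborel_diff bborel_cmult bborel_upow)
  have bb: "bborel ?b"
  proof (rule bborelI[of _ 1])
    show "\<bar>?b s\<bar> \<le> 1" for s
      using a1[of s] by (simp add: abs_square_le_1 real_sqrt_le_1_iff)
    have [measurable]: "upow k \<in> borel_measurable borel" for k by (rule bborel_meas) simp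
    show "?b \<in> borel_measurable borel" by measurable
  qed
  define A B where "A = pint E ?a" and "B = pint E ?b"
  have AB: "A \<in> commutant S" "B \<in> commutant S" unfolding A_def B_def by (intro inS ba bb)+
  note Al = bounded_clinearD[OF commutantD(1)[OF AB(1)]] and Bl = bounded_clinearD[OF commutantD(1)[OF AB(2)]]
  have sq: "A (A v) + B (B v) = v" for v
  proof -
    have "A (A v) + B (B v) = pint E (\<lambda>s. ?a s * ?a s + ?b s * ?b s) v"
      unfolding A_def B_def by (simp only: pint_mult[OF E(1)] ba bb pint_add[OF E(1)] bborel_mult)
    also have "(\<lambda>s. ?a s * ?a s + ?b s * ?b s) = (\<lambda>s. 1)"
      using a1 by (auto simp: fun_eq_iff abs_square_le_1 power2_eq_square[symmetric])
    finally show ?thesis by (simp add: pint_one[OF E(1)])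
  qed
  have com: "A (B v) = B (A v)" for v
    unfolding A_def B_def by (simp only: pint_mult[OF E(1)] ba bb) (simp add: mult.commute)
  have sA: "cinner (A u) v = cinner u (A v)" "cinner (B u) v = cinner u (B v)" for u v
    unfolding A_def B_def by (simp_all only: pint_adjoint[OF E(1)] ba bb)
  define U where "U c = (\<lambda>v. A v + c *\<^sub>C B v)" for c
  have Ub: "bounded_clinear (U c)" for c
    unfolding U_def by (intro bounded_clinear_add bounded_clinear_scaleC commutantD(1)[OF AB(1)] commutantD(1)[OF AB(2)])
  have Uadj: "cadj (U c) = U (cnj c)" for c
    by (rule cadj_unique) (simp add: U_def cinner_linear sA)
  have Umul: "U c (U d v) = v" if "c * d = 1" "d = - c" for c d v
  proof -
    have "U c (U d v) = A (A v) + (c * d) *\<^sub>C B (B v) + (c + d) *\<^sub>C A (B v)"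
      by (simp add: U_def Al Bl com scaleC_add_right scaleC_scaleC scaleC_add_left algebra_simps)
    moreover have "c + d = 0" using that(2) by simp
    ultimately show ?thesis using that(1) by (simp only:) (simp add: sq)
  qed
  have Uu: "unitary_op (U c)" if "c = \<i> \<or> c = - \<i>" for c
    unfolding unitary_op_def Uadj using that Umul[of \<i> "- \<i>"] Umul[of "- \<i>" \<i>]
    by (auto simp: Ub fun_eq_iff)
  have UM: "U c \<in> commutant S" for c
    unfolding U_def by (intro commutant_linear commutant_scale S AB)
  have zl: "z (u + v) = z u + z v" "z (k *\<^sub>R v) = k *\<^sub>R z v" "z (u - v) = z u - z v" for u v k
    using bounded_clinearD[OF z(1)] by auto
  have A: "(2::real) *\<^sub>R A v = U \<i> v + U (- \<i>) v" for v by (simp add: U_def scaleR_2)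
  have "z (2 *\<^sub>R A v) = 2 *\<^sub>R A (z v)" for v
    unfolding A zl by (simp only: z(2) UM Uu simp_thms)
  then have zA: "z (A v) = A (z v)" for v unfolding zl(2) by simp
  have AR: "A v = (1 / K) *\<^sub>R y v" for v
  proof -
    have "A v = 2 *\<^sub>R R v - pint E (upow 0) v"
      unfolding A_def by (simp add: pint_diff[OF E(1)] pint_cmult[OF E(1)] bborel_cmult E(2)[simplified])
    also have "pint E (upow 0) = pint E (\<lambda>s. 1)" by (rule pint_cong[OF E(1)]) (auto simp: upow_def)
    finally show ?thesis by (simp add: pint_one[OF E(1)] R_def)
  qed
  have "y v = K *\<^sub>R A v" "y (z v) = K *\<^sub>R A (z v)" using K by (simp_all add: AR)
  then show ?thesis by (simp add: zl zA)
qed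

text \<open>Affiliation speaks of unitaries of the commutant only. The Cartesian decomposition into
  \<open>a\<close> and \<open>b\<close> reduces a general element to self-adjoint ones, which are
  combinations of unitaries.\<close>

lemma commute_unitaries:
  assumes y: "y \<in> commutant S" and S: "\<And>x. x \<in> S \<Longrightarrow> bounded_clinear x" "\<And>x. x \<in> S \<Longrightarrow> cadj x \<in> S"
    and z: "bounded_clinear z" "\<And>u v. u \<in> commutant S \<Longrightarrow> unitary_op u \<Longrightarrow> z (u v) = u (z v)"
  shows "z (y v) = y (z v)"
proof -
  have yb: "bounded_clinear y" using y by (rule commutantD)
  have y': "cadj y \<in> commutant S"
  proof (rule commutantI[OF cadj(1)[OF yb]])
    fix x v assume x: "x \<in> S"
    show "cadj y (x v) = x (cadj y v)"
    proof (rule cinner_ext)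
      fix u
      have "cinner u (cadj y (x v)) = cinner (cadj x (y u)) v" by (simp add: cadj[OF yb] cadj[OF S(1)[OF x]])
      also have "cadj x (y u) = y (cadj x u)" using commutantD(2)[OF y S(2)[OF x]] by simp
      finally show "cinner u (cadj y (x v)) = cinner u (x (cadj y v))"
        by (simp add: cadj[OF yb] cadj[OF S(1)[OF x]])
    qed
  qed
  define a b where "a = (\<lambda>v. y v + cadj y v)" and "b = (\<lambda>v. \<i> *\<^sub>C (y v - cadj y v))"
  have ab: "a \<in> commutant S" "b \<in> commutant S"
    unfolding a_def b_def
    by (rule commutant_linear(1)[OF S(1) y y'], assumption)
      (rule commutant_scale(1)[OF S(1) commutant_linear(2)[OF S(1) y y']]; assumption)
  have "cinner (a u) v = cinner u (a v)" "cinner (b u) v = cinner u (b v)" for u v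
    by (simp_all add: a_def b_def cinner_linear cadj[OF yb] algebra_simps)
  then have "z (a v) = a (z v)" "z (b v) = b (z v)"
    using selfadjoint_commute_unitaries[OF ab(1) S(1) _ z] selfadjoint_commute_unitaries[OF ab(2) S(1) _ z] by blast+
  moreover have "(2::real) *\<^sub>R y v = a v - \<i> *\<^sub>C b v" for v
    by (simp add: a_def b_def scaleC_scaleC scaleR_2)
  ultimately have "2 *\<^sub>R z (y v) = (2::real) *\<^sub>R y (z v)"
    by (metis bounded_clinearD(3,4,7)[OF z(1)])
  then show ?thesis by simp
qed

lemma von_neumann_algebraD:
  assumes "von_neumann_algebra M"
  shows "x \<in> M \<Longrightarrow> bounded_clinear x" "x \<in> M \<Longrightarrow> cadj x \<in> M" "M = commutant (commutant M)"
  using assms by (auto simp: von_neumann_algebra_def)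

text \<open>A unitary of the commutant preserves the graph, hence commutes with
  \<open>zop T\<close>. So does then the whole commutant, first with \<open>zop T\<close> and then
  with all functions of the modulus; the double commutant finishes.\<close>

lemma affiliated_pint:
  assumes M: "von_neumann_algebra M" and T: "closed_densely_defined_op T" and aff: "affiliated M T"
    and g: "bborel g"
  shows "pint (spectral_measure (modulus T)) g \<in> M"
proof -
  note E = spectral_measure_modulus[OF T]
  have c: "csubspace T" "closed T"
    using T by (auto simp: closed_densely_defined_op_def densely_defined_op_def)
  have "pint (spectral_measure (modulus T)) g \<in> commutant (commutant M)"
  proof (rule commutantI[OF pint_clinear[OF E(1) g]])
    fix y v assume y: "y \<in> commutant M"
    have "zop T (y w) = y (zop T w)" for w
    proof (rule commute_unitaries[OF y von_neumann_algebraD(1,2)[OF M] zop_clinear[OF c]])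
      fix u w assume u: "u \<in> commutant M" "unitary_op u"
      note ud = unitary_opD[OF u(2)]
      have uT: "(\<lambda>(\<xi>, \<eta>). (u \<xi>, u \<eta>)) ` T = T" using aff u by (simp add: affiliated_def)
      show "zop T (u w) = u (zop T w)"
      proof (rule zop_intertwine[OF c, where x' = "cadj u" and y' = "cadj u" and y = u])
        show "(u a, u b) \<in> T" if "(a, b) \<in> T" for a b using uT that by force
        show "(cadj u a, cadj u b) \<in> T" if "(a, b) \<in> T" for a b
        proof -
          have "(a, b) \<in> (\<lambda>(\<xi>, \<eta>). (u \<xi>, u \<eta>)) ` T" using that uT by simp
          then obtain \<xi> \<eta> where "(\<xi>, \<eta>) \<in> T" "a = u \<xi>" "b = u \<eta>" by auto
          then show ?thesis by (simp add: ud)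
        qed
      qed (simp_all add: cadj[OF ud(1)] bounded_clinearD[OF ud(1)])
    qed auto
    then have "y (pint (spectral_measure (modulus T)) g v) = pint (spectral_measure (modulus T)) g (y v)"
      by (intro modulus_pint_commute[OF T commutantD(1)[OF y] _ g]) simp
    then show "pint (spectral_measure (modulus T)) g (y v) = y (pint (spectral_measure (modulus T)) g v)" ..
  qed
  then show ?thesis using von_neumann_algebraD(3)[OF M] by simp
qed

text \<open>Writes a positive operator as \<open>z \<circ> z\<close> inside the algebra, so that the
  trace property can be applied to it.\<close>

lemma positive_sqrt:
  assumes M: "M = commutant S" "\<And>x. x \<in> S \<Longrightarrow> bounded_clinear x" and x: "x \<in> pos_part M"
  obtains z where "z \<in> M" "cadj z = z" "z \<circ> z = x"
proof -
  have xM: "x \<in> commutant S" "positive_op x" using x M by (auto simp: pos_part_def)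
  have xb: "bounded_clinear x" using xM(1) by (rule commutantD)
  obtain K0 where K0: "K0 \<ge> 0" "\<And>v. norm (x v) \<le> K0 * norm v"
    by (rule bounded_clinear_bound[OF xb]) blast
  define K where "K = K0 + 1"
  have K: "K > 0" "norm (x v) \<le> K * norm v" for v
    using K0(1) order_trans[OF K0(2), of v "K * norm v"] by (auto simp: K_def distrib_right)
  define R where "R = (\<lambda>v. (1 / K) *\<^sub>R x v)"
  have R: "bounded_clinear R" unfolding R_def by (intro bounded_clinear_scaleR xb)
  have c: "Re (cinner v (x v)) \<le> K * (norm v)\<^sup>2" for v
  proof -
    have "Re (cinner v (x v)) \<le> cmod (cinner v (x v))" by (rule complex_Re_le_cmod)
    also have "\<dots> \<le> norm v * norm (x v)" by (rule cinner_cauchy_schwarz)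
    also have "\<dots> \<le> norm v * (K * norm v)" by (intro mult_left_mono K) simp
    finally show ?thesis by (simp add: power2_eq_square mult_ac)
  qed
  have p1: "positive_op R"
  proof (rule positive_opI)
    show "cinner v (R v) = complex_of_real (Re (cinner v (x v)) / K)" for v
      unfolding R_def cinner_scaleR_right by (subst positive_opD(2)[OF xM(2)]) simp
    show "0 \<le> Re (cinner v (x v)) / K" for v using positive_opD(1)[OF xM(2)] K(1) by simp
  qed
  have p2: "positive_op (\<lambda>v. v - R v)"
  proof (rule positive_opI)
    show "cinner v (v - R v) = complex_of_real ((norm v)\<^sup>2 - Re (cinner v (x v)) / K)" for v
      unfolding R_def cinner_scaleR_right cinner_diff_right cinner_self by (subst positive_opD(2)[OF xM(2)]) simp
    show "0 \<le> (norm v)\<^sup>2 - Re (cinner v (x v)) / K" for v using c[of v] K(1) by (simp add: divide_le_eq mult.commute)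
  qed
  obtain E where E: "supported_pvm {0..1} E" "pint E (upow 1) = R"
    using contraction_spectral_theorem[OF R p1 p2] by blast
  let ?f = "\<lambda>s. sqrt (upow 1 s)"
  have bf: "bborel ?f"
  proof (rule bborelI[of _ 1])
    have [measurable]: "upow k \<in> borel_measurable borel" for k by (rule bborel_meas) simp
    show "?f \<in> borel_measurable borel" by measurable
  qed (auto simp: upow_def indicator_def)
  have "pint E ?f \<in> commutant S"
  proof (rule commutantI[OF pint_clinear[OF E(1) bf]])
    fix y v assume y: "y \<in> S"
    have "y (pint E ?f v) = pint E ?f (y v)"
      by (rule contraction_pint_commute[OF E M(2)[OF y] _ bf])
        (simp add: R_def bounded_clinearD[OF M(2)[OF y]] commutantD(2)[OF xM(1) y])
    then show "pint E ?f (y v) = y (pint E ?f v)" ..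
  qed
  then have zM: "(\<lambda>v. sqrt K *\<^sub>R pint E ?f v) \<in> M" unfolding M(1) by (intro commutant_scale M(2))
  have ff: "(\<lambda>s. ?f s * ?f s) = upow 1" by (auto simp: upow_def indicator_def)
  have "(\<lambda>v. sqrt K *\<^sub>R pint E ?f v) \<circ> (\<lambda>v. sqrt K *\<^sub>R pint E ?f v) = x"
  proof
    fix v
    have "sqrt K *\<^sub>R pint E ?f (sqrt K *\<^sub>R pint E ?f v) = (sqrt K * sqrt K) *\<^sub>R pint E ?f (pint E ?f v)"
      by (simp only: bounded_clinearD[OF pint_clinear[OF E(1) bf]] scaleR_scaleR)
    also have "\<dots> = K *\<^sub>R R v" using K(1) by (simp only: pint_mult[OF E(1) bf bf] ff E(2)) simp
    also have "\<dots> = x v" using K(1) by (simp add: R_def)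
    finally show "((\<lambda>v. sqrt K *\<^sub>R pint E ?f v) \<circ> (\<lambda>v. sqrt K *\<^sub>R pint E ?f v)) v = x v" by simp
  qed
  moreover have "cadj (\<lambda>v. sqrt K *\<^sub>R pint E ?f v) = (\<lambda>v. sqrt K *\<^sub>R pint E ?f v)"
    by (rule cadj_unique) (simp only: cinner_scaleR_left cinner_scaleR_right pint_adjoint[OF E(1) bf])
  ultimately show ?thesis using that zM by blast
qed

section \<open>Normal weights\<close>

lemma positive_op_tendsto:
  assumes "F \<noteq> bot" "eventually (\<lambda>i. positive_op (x i)) F" "\<And>v. ((\<lambda>i. cinner v (x i v)) \<longlongrightarrow> cinner v (y v)) F"
  shows "positive_op y"
  unfolding positive_op_def
proof
  fix v
  show "cinner v (y v) \<in> \<real>\<^sub>\<ge>\<^sub>0"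
  proof (rule Lim_in_closed_set[OF closed_nonneg_Reals_complex _ assms(1,3)])
    show "\<forall>\<^sub>F i in F. cinner v (x i v) \<in> \<real>\<^sub>\<ge>\<^sub>0"
      using assms(2) by eventually_elim (simp add: positive_op_def)
  qed
qed

lemma positive_op_add: "positive_op x \<Longrightarrow> positive_op y \<Longrightarrow> positive_op (\<lambda>v. x v + y v)"
  by (simp add: positive_op_def cinner_add_right)

lemma op_le_trans: "op_le x y \<Longrightarrow> op_le y z \<Longrightarrow> op_le x z"
  unfolding op_le_def using positive_op_add[of "\<lambda>v. y v - x v" "\<lambda>v. z v - y v"] by (simp add: algebra_simps)

lemma op_le_refl: "op_le x x"
  by (simp add: op_le_def positive_op_def)

lemma op_leI:
  assumes "positive_op x" "positive_op y" "\<And>v. Re (cinner v (x v)) \<le> Re (cinner v (y v))"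
  shows "op_le x y"
  unfolding op_le_def
proof (rule positive_opI)
  show "cinner v (y v - x v) = complex_of_real (Re (cinner v (y v)) - Re (cinner v (x v)))" for v
    using positive_opD(2)[OF assms(1), of v] positive_opD(2)[OF assms(2), of v]
    by (simp add: cinner_diff_right complex_eq_iff)
qed (use assms in auto)

lemma op_leD: "op_le x y \<Longrightarrow> Re (cinner v (x v)) \<le> Re (cinner v (y v))"
  using positive_opD(1)[of "\<lambda>v. y v - x v" v] by (simp add: op_le_def cinner_diff_right)

lemma pos_partD: "x \<in> pos_part M \<Longrightarrow> x \<in> M" "x \<in> pos_part M \<Longrightarrow> positive_op x"
  by (auto simp: pos_part_def)

lemma pos_partI: "x \<in> M \<Longrightarrow> positive_op x \<Longrightarrow> x \<in> pos_part M"
  by (auto simp: pos_part_def)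

context
  fixes M S :: "'h::chilbert op set" and \<tau> :: "'h op \<Rightarrow> ennreal"
  assumes M: "M = commutant S" and S: "\<forall>x\<in>S. bounded_clinear x"
    and w: "normal_weight M \<tau>"
begin

lemma normal_weight_add: "x \<in> pos_part M \<Longrightarrow> y \<in> pos_part M \<Longrightarrow> \<tau> (\<lambda>v. x v + y v) = \<tau> x + \<tau> y"
  using w by (simp add: normal_weight_def weight_def)

lemma normal_weight_scale: "x \<in> pos_part M \<Longrightarrow> 0 \<le> r \<Longrightarrow> \<tau> (\<lambda>v. r *\<^sub>R x v) = ennreal r * \<tau> x"
  using w by (simp add: normal_weight_def weight_def)

lemma zero_in_pos_part: "(\<lambda>v. 0) \<in> pos_part M"
  by (rule pos_partI) (auto simp: M positive_op_def bounded_clinearD S[rule_format] intro!: commutantI bounded_clinear_zero)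

lemma normal_weight_zero: "\<tau> (\<lambda>v. 0) = 0"
  using normal_weight_scale[OF zero_in_pos_part, of 0] by simp

lemma normal_weight_mono:
  assumes "x \<in> pos_part M" "y \<in> pos_part M" "op_le x y" shows "\<tau> x \<le> \<tau> y"
proof -
  have "(\<lambda>v. y v - x v) \<in> pos_part M"
    using assms by (intro pos_partI) (auto simp: op_le_def M pos_part_def intro: commutant_linear S[rule_format])
  then have "\<tau> (\<lambda>v. x v + (y v - x v)) = \<tau> x + \<tau> (\<lambda>v. y v - x v)" by (rule normal_weight_add[OF assms(1)])
  then show ?thesis by simp
qed

text \<open>Normality is stated for directed suprema. Positivity passes to strong limits, so the
  limit of an increasing sequence is its least upper bound among the positive elements of
  \<open>M\<close>.\<close>

lemma normal_weight_seq:
  assumes x: "\<And>n. x n \<in> pos_part M" "\<And>n. op_le (x n) (x (Suc n))"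
    and lim: "\<And>v. (\<lambda>n. x n v) \<longlonglongrightarrow> s v" and s: "s \<in> M"
  shows "\<tau> s = (SUP n. \<tau> (x n))"
proof -
  have mono: "op_le (x m) (x n)" if "m \<le> n" for m n
    using that by (induction rule: dec_induct) (auto intro: op_le_refl op_le_trans x)
  have clim: "(\<lambda>n. cinner v (x n v)) \<longlonglongrightarrow> cinner v (s v)" for v
    by (intro tendsto_cinner tendsto_const lim)
  have sp: "s \<in> pos_part M"
    by (rule pos_partI[OF s], rule positive_op_tendsto[OF _ _ clim])
      (auto intro!: always_eventually pos_partD(2)[OF x(1)])
  have "is_sup_in (pos_part M) (range x) s"
    unfolding is_sup_in_def
  proof (intro conjI ballI impI sp)
    fix y assume "y \<in> range x"
    then obtain m where y: "y = x m" by auto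
    have "(\<lambda>n. cinner v (x n v - x m v)) \<longlonglongrightarrow> cinner v (s v - x m v)" for v
      by (intro tendsto_cinner tendsto_const tendsto_diff lim)
    then show "op_le y s" unfolding op_le_def y
      by (rule positive_op_tendsto[rotated 2])
        (use mono in \<open>auto simp: eventually_sequentially op_le_def\<close>)
  next
    fix z assume "z \<in> pos_part M" and z: "\<forall>y\<in>range x. op_le y z"
    have "(\<lambda>n. cinner v (z v - x n v)) \<longlonglongrightarrow> cinner v (z v - s v)" for v
      by (intro tendsto_cinner tendsto_const tendsto_diff lim)
    then show "op_le s z" unfolding op_le_def
      by (rule positive_op_tendsto[rotated 2]) (use z in \<open>auto simp: op_le_def\<close>)
  qed
  moreover have "upward_directed (range x)"
    unfolding upward_directed_def
  proof (intro conjI ballI)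
    fix y z assume "y \<in> range x" "z \<in> range x"
    then obtain m n where "y = x m" "z = x n" by auto
    then show "\<exists>u\<in>range x. op_le y u \<and> op_le z u"
      using mono[of m "max m n"] mono[of n "max m n"] by auto
  qed auto
  moreover have "range x \<subseteq> pos_part M" using x by auto
  ultimately have "\<tau> s = (SUP y\<in>range x. \<tau> y)"
    using w unfolding normal_weight_def by blast
  then show ?thesis by (simp add: image_image)
qed

lemma normal_weight_sum:
  assumes "finite I" "\<And>i. i \<in> I \<Longrightarrow> x i \<in> pos_part M"
  shows "(\<lambda>v. \<Sum>i\<in>I. x i v) \<in> pos_part M \<and> \<tau> (\<lambda>v. \<Sum>i\<in>I. x i v) = (\<Sum>i\<in>I. \<tau> (x i))"
  using assms
proof (induction I rule: finite_induct)
  case empty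
  then show ?case by (simp add: zero_in_pos_part normal_weight_zero)
next
  case (insert i I)
  then have 1: "x i \<in> pos_part M" "(\<lambda>v. \<Sum>i\<in>I. x i v) \<in> pos_part M" by auto
  then have "(\<lambda>v. x i v + (\<Sum>i\<in>I. x i v)) \<in> pos_part M"
    by (intro pos_partI positive_op_add) (auto simp: M pos_part_def intro: commutant_linear S[rule_format])
  then show ?case using insert normal_weight_add[OF 1] by simp
qed

lemma normal_weight_countable_sum:
  assumes x: "\<And>n. x n \<in> pos_part M" and lim: "\<And>v. (\<lambda>n. x n v) sums s v" and s: "s \<in> M"
  shows "\<tau> s = (\<Sum>n. \<tau> (x n))"
proof -
  have "\<tau> s = (SUP n. \<tau> (\<lambda>v. \<Sum>i<n. x i v))"
  proof (rule normal_weight_seq[OF _ _ _ s])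
    show "(\<lambda>v. \<Sum>i<n. x i v) \<in> pos_part M" for n using normal_weight_sum[of "{..<n}" x] x by auto
    show "op_le (\<lambda>v. \<Sum>i<n. x i v) (\<lambda>v. \<Sum>i<Suc n. x i v)" for n
      using pos_partD(2)[OF x[of n]] by (simp add: op_le_def)
    show "(\<lambda>n. \<Sum>i<n. x i v) \<longlonglongrightarrow> s v" for v using lim by (simp add: sums_def)
  qed
  also have "\<dots> = (SUP n. \<Sum>i<n. \<tau> (x i))" using normal_weight_sum[of "{..<_}" x] x by simp
  also have "\<dots> = (\<Sum>n. \<tau> (x n))" by (rule suminf_eq_SUP[symmetric])
  finally show ?thesis .
qed

context
  fixes S0 E
  assumes E: "supported_pvm S0 E" and inM: "\<forall>g. bborel g \<longrightarrow> pint E g \<in> M"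
begin

lemma pint_pos_part: "bborel g \<Longrightarrow> (\<And>s. s \<in> S0 \<Longrightarrow> 0 \<le> g s) \<Longrightarrow> pint E g \<in> pos_part M"
  by (intro pos_partI inM[rule_format] pint_positive[OF E])

lemma pvm_pos_part: "B \<in> sets borel \<Longrightarrow> E B \<in> pos_part M"
  using pint_pos_part[of "indicator B"] by (simp add: pint_indicator[OF E])

lemma emeasure_scalar_measure:
  assumes "B \<in> sets borel"
  shows "emeasure (scalar_measure \<tau> E) B = \<tau> (E B)"
proof (rule emeasure_measure_of[OF scalar_measure_def])
  have P: "projection_valued_measure E" using E by (simp add: supported_pvm_def)
  have "E {} = (\<lambda>v. 0)" using pvm_empty[OF P] by auto
  then show "positive (sets (scalar_measure \<tau> E)) (\<lambda>B. \<tau> (E B))"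
    by (simp add: positive_def normal_weight_zero)
  show "countably_additive (sets (scalar_measure \<tau> E)) (\<lambda>B. \<tau> (E B))"
  proof (rule countably_additiveI)
    fix A :: "nat \<Rightarrow> real set"
    assume A: "range A \<subseteq> sets (scalar_measure \<tau> E)" "disjoint_family A" "(\<Union>i. A i) \<in> sets (scalar_measure \<tau> E)"
    have UA: "(\<Union>i. A i) \<in> sets borel" using A(3) by simp
    have "\<tau> (E (\<Union>i. A i)) = (\<Sum>i. \<tau> (E (A i)))"
      by (rule normal_weight_countable_sum[OF _ pvm_sums[OF P] pos_partD(1)[OF pvm_pos_part[OF UA]]])
        (use A pvm_pos_part in auto)
    then show "(\<Sum>i. \<tau> (E (A i))) = \<tau> (E (\<Union>i. A i))" ..
  qed
qed (use assms in auto)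

lemma scalar_measure_AE: "AE s in scalar_measure \<tau> E. s \<in> S0"
proof -
  have S0: "S0 \<in> sets borel" "E (- S0) = (\<lambda>v. 0)" using E by (auto simp: supported_pvm_def)
  have "emeasure (scalar_measure \<tau> E) (- S0) = \<tau> (E (- S0))"
    by (rule emeasure_scalar_measure) (simp only: borel_comp S0)
  also have "\<dots> = 0" by (simp add: S0 normal_weight_zero)
  finally have "- S0 \<in> null_sets (scalar_measure \<tau> E)" using borel_comp[OF S0(1)] by (intro null_setsI) auto
  from AE_not_in[OF this] show ?thesis by simp
qed

text \<open>Both sides agree on indicators, are additive and homogeneous, and are continuous along
  increasing sequences of functions.\<close>

lemma normal_weight_pint:
  assumes "bborel g" "\<And>s. 0 \<le> g s"
  shows "\<tau> (pint E g) = (\<integral>\<^sup>+s. ennreal (g s) \<partial>scalar_measure \<tau> E)"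
proof -
  have bb: "bborel u" if "u \<in> borel_measurable borel" "\<And>s. 0 \<le> u s" "\<And>s. u s \<le> g s" for u
  proof -
    obtain K where "\<And>s. \<bar>g s\<bar> \<le> K" by (rule bborel_bound[OF assms(1)]) blast
    then have "\<bar>u s\<bar> \<le> K" for s using that(2)[of s] that(3)[of s] by (smt (verit))
    then show ?thesis using that(1) by (intro bborelI) auto
  qed
  have meas: "g \<in> borel_measurable borel" by (rule bborel_meas[OF assms(1)])
  \<comment> \<open>The induction rule does not keep track of boundedness, which is therefore
    carried as a premise inside the statement.\<close>
  from meas assms(2) have "bborel g \<longrightarrow> \<tau> (pint E g) = (\<integral>\<^sup>+s. ennreal (g s) \<partial>scalar_measure \<tau> E)"
  proof (induction rule: borel_measurable_induct_real)
    case (set A)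
    then show ?case by (simp add: pint_indicator[OF E] emeasure_scalar_measure ennreal_indicator)
  next
    case (mult u c)
    show ?case
    proof (cases "c = 0")
      case True
      have "pint E (\<lambda>s. 0) = (\<lambda>v. 0)" using pint_cmult[OF E, of "\<lambda>s. 0" 0] by auto
      then show ?thesis using True normal_weight_zero by simp
    next
      case False
      show ?thesis
      proof
        assume b: "bborel (\<lambda>x. c * u x)"
        have bu: "bborel u" using bborel_cmult[OF b, of "1 / c"] False by simp
        have "pint E (\<lambda>x. c * u x) = (\<lambda>v. c *\<^sub>R pint E u v)" using pint_cmult[OF E bu] by auto
        then show "\<tau> (pint E (\<lambda>x. c * u x)) = (\<integral>\<^sup>+x. ennreal (c * u x) \<partial>scalar_measure \<tau> E)"
          using mult bu normal_weight_scale[OF pint_pos_part[OF bu]]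
          by (simp add: ennreal_mult nn_integral_cmult)
      qed
    qed
  next
    case (add u v)
    show ?case
    proof
      assume "bborel (\<lambda>x. v x + u x)"
      then obtain K where K: "\<And>s. \<bar>v s + u s\<bar> \<le> K" by (rule bborel_bound) blast
      have nn: "0 \<le> u s" "0 \<le> v s" for s using add by auto
      have "\<bar>v s\<bar> \<le> K \<and> \<bar>u s\<bar> \<le> K" for s using K[of s] nn[of s] by linarith
      moreover have "u \<in> borel_measurable borel" "v \<in> borel_measurable borel" using add by auto
      ultimately have b: "bborel u" "bborel v" by (auto intro: bborelI[where K = K])
      have "pint E (\<lambda>x. v x + u x) = (\<lambda>w. pint E v w + pint E u w)" using pint_add[OF E b(2,1)] by auto
      then show "\<tau> (pint E (\<lambda>x. v x + u x)) = (\<integral>\<^sup>+x. ennreal (v x + u x) \<partial>scalar_measure \<tau> E)"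
        using add b normal_weight_add[OF pint_pos_part[OF b(2)] pint_pos_part[OF b(1)]]
        by (simp add: nn_integral_add)
    qed
  next
    case (seq U)
    show ?case
    proof
      assume g: "bborel g"
      obtain K where K: "\<And>s. \<bar>g s\<bar> \<le> K" by (rule bborel_bound[OF g]) blast
      have lim: "(\<lambda>i. U i s) \<longlonglongrightarrow> g s" for s using seq by simp
      have inc: "incseq U" by fact
      then have inc': "incseq (\<lambda>i. U i s)" for s by (simp add: incseq_def le_fun_def)
      have le: "U i s \<le> g s" for i s by (rule incseq_le[OF inc' lim])
      have Ub: "\<bar>U i s\<bar> \<le> K" for i s using le[of i s] K[of s] seq(2)[of i s] by linarith
      have bU: "bborel (U i)" for i using seq(1) Ub by (intro bborelI) auto
      have "\<tau> (pint E g) = (SUP i. \<tau> (pint E (U i)))"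
      proof (rule normal_weight_seq[OF _ _ _ inM[rule_format, OF g]])
        show "pint E (U i) \<in> pos_part M" for i by (rule pint_pos_part[OF bU seq(2)])
        show "(\<lambda>i. pint E (U i) v) \<longlonglongrightarrow> pint E g v" for v
          by (rule pint_tendsto[OF E bU g Ub lim])
        show "op_le (pint E (U i)) (pint E (U (Suc i)))" for i
        proof -
          have "positive_op (pint E (\<lambda>s. U (Suc i) s - U i s))"
            using inc by (intro pint_positive[OF E bborel_diff[OF bU bU]]) (simp add: incseq_Suc_iff le_fun_def)
          then show ?thesis by (simp only: op_le_def pint_diff[OF E bU bU, symmetric])
        qed
      qed
      also have "\<dots> = (SUP i. \<integral>\<^sup>+x. ennreal (U i x) \<partial>scalar_measure \<tau> E)" using seq bU by simp
      also have "\<dots> = (\<integral>\<^sup>+x. (SUP i. ennreal (U i x)) \<partial>scalar_measure \<tau> E)"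
        using inc seq(1) by (intro nn_integral_monotone_convergence_SUP[symmetric])
          (auto simp: incseq_def le_fun_def intro: ennreal_leI)
      also have "\<dots> = (\<integral>\<^sup>+x. ennreal (g x) \<partial>scalar_measure \<tau> E)"
      proof (intro nn_integral_cong)
        fix s
        have "(\<lambda>i. ennreal (U i s)) \<longlonglongrightarrow> (SUP i. ennreal (U i s))"
          using inc by (intro LIMSEQ_SUP) (auto simp: incseq_def le_fun_def intro: ennreal_leI)
        moreover have "(\<lambda>i. ennreal (U i s)) \<longlonglongrightarrow> ennreal (g s)" by (intro tendsto_ennrealI lim)
        ultimately show "(SUP i. ennreal (U i s)) = ennreal (g s)" by (rule LIMSEQ_unique)
      qed
      finally show "\<tau> (pint E g) = (\<integral>\<^sup>+x. ennreal (g x) \<partial>scalar_measure \<tau> E)" .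
    qed
  qed
  then show ?thesis using assms(1) by simp
qed

end

end

text \<open>Vigier's theorem, phrased for the least upper bound in the positive part of a commutant:
  it is the limit of the net in the weak operator topology.\<close>

lemma vector_functional_directed_sup:
  fixes M S :: "'h::chilbert op set"
  assumes M: "M = commutant S" and S: "\<And>x. x \<in> S \<Longrightarrow> bounded_clinear x"
    and D: "D \<subseteq> pos_part M" "upward_directed D" and sup: "is_sup_in (pos_part M) D s"
  shows "vector_functional \<xi> s = (SUP x\<in>D. vector_functional \<xi> x)"
proof -
  have s: "s \<in> pos_part M" "\<And>x. x \<in> D \<Longrightarrow> op_le x s"
    "\<And>z. z \<in> pos_part M \<Longrightarrow> (\<And>x. x \<in> D \<Longrightarrow> op_le x z) \<Longrightarrow> op_le s z"
    using sup by (auto simp: is_sup_in_def)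
  have Dx: "bounded_clinear x" "positive_op x" "x \<in> commutant S" if "x \<in> D" for x
    using D(1) that M commutantD(1) by (auto simp: pos_part_def)
  have sb: "bounded_clinear s" using s(1) M commutantD(1) by (auto simp: pos_part_def)
  have Dne: "D \<noteq> {}" using D(2) by (simp add: upward_directed_def)
  \<comment> \<open>The filter of tails of the directed set, so that limits along the net become
    filter limits.\<close>
  define F where "F = (INF x\<in>D. principal {y \<in> D. op_le x y})"
  have ev: "eventually P F \<longleftrightarrow> (\<exists>x\<in>D. \<forall>y\<in>D. op_le x y \<longrightarrow> P y)" for P
    unfolding F_def
  proof (subst eventually_INF_base[OF Dne])
    fix x y assume "x \<in> D" "y \<in> D"
    then obtain z where "z \<in> D" "op_le x z" "op_le y z" using D(2) by (auto simp: upward_directed_def)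
    then show "\<exists>z\<in>D. principal {w \<in> D. op_le z w} \<le> inf (principal {w \<in> D. op_le x w}) (principal {w \<in> D. op_le y w})"
      by (intro bexI[of _ z]) (auto intro: op_le_trans)
  qed (auto simp: eventually_principal)
  have Fne: "F \<noteq> bot"
    unfolding trivial_limit_def ev using op_le_refl by auto
  have evD: "eventually (\<lambda>x. x \<in> D) F" using Dne by (auto simp: ev)
  define q where "q v = (SUP x\<in>D. Re (cinner v (x v)))" for v
  have bdd: "bdd_above ((\<lambda>x. Re (cinner v (x v))) ` D)" for v
    by (rule bdd_aboveI2[of _ _ "Re (cinner v (s v))"]) (rule op_leD[OF s(2)])
  have qs: "q v \<le> Re (cinner v (s v))" for v
    unfolding q_def by (rule cSUP_least[OF Dne op_leD[OF s(2)]])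
  have xq: "Re (cinner v (x v)) \<le> q v" if "x \<in> D" for x v
    unfolding q_def by (rule cSUP_upper[OF that bdd])
  have q0: "0 \<le> q v" for v
    using Dne xq positive_opD(1)[OF Dx(2)] order_trans by (metis ex_in_conv)
  have limR: "((\<lambda>x. Re (cinner v (x v))) \<longlongrightarrow> q v) F" for v
  proof (rule order_tendstoI)
    fix a assume "a < q v"
    then obtain x where x: "x \<in> D" "a < Re (cinner v (x v))"
      unfolding q_def by (subst (asm) less_cSUP_iff[OF Dne bdd]) auto
    then show "\<forall>\<^sub>F x in F. a < Re (cinner v (x v))"
      unfolding ev using op_leD order_less_le_trans by blast
  next
    fix a assume "q v < a"
    then show "\<forall>\<^sub>F x in F. Re (cinner v (x v)) < a"
      by (intro eventually_mono[OF evD]) (rule order_le_less_trans[OF xq])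
  qed
  have limC: "((\<lambda>x. cinner v (x v)) \<longlongrightarrow> complex_of_real (q v)) F" for v
  proof (rule Lim_transform_eventually[OF tendsto_of_real[OF limR]])
    show "\<forall>\<^sub>F x in F. complex_of_real (Re (cinner v (x v))) = cinner v (x v)"
      using evD by eventually_elim (rule positive_opD(2)[OF Dx(2), symmetric])
  qed
  \<comment> \<open>The limit of the matrix coefficients, built by polarization because only the
    diagonal ones are monotone along the net.\<close>
  define r where "r u v = (1/4) * (complex_of_real (q (u + v)) - complex_of_real (q (u - v))
      - \<i> * complex_of_real (q (u + \<i> *\<^sub>C v)) + \<i> * complex_of_real (q (u - \<i> *\<^sub>C v)))" for u v
  have lim: "((\<lambda>x. cinner u (x v)) \<longlongrightarrow> r u v) F" for u v
  proof (rule Lim_transform_eventually)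
    show "((\<lambda>x. (1/4) * (cinner (u + v) (x (u + v)) - cinner (u - v) (x (u - v))
      - \<i> * cinner (u + \<i> *\<^sub>C v) (x (u + \<i> *\<^sub>C v)) + \<i> * cinner (u - \<i> *\<^sub>C v) (x (u - \<i> *\<^sub>C v)))) \<longlongrightarrow> r u v) F"
      unfolding r_def by (intro tendsto_intros limC)
    show "\<forall>\<^sub>F x in F. (1/4) * (cinner (u + v) (x (u + v)) - cinner (u - v) (x (u - v))
      - \<i> * cinner (u + \<i> *\<^sub>C v) (x (u + \<i> *\<^sub>C v)) + \<i> * cinner (u - \<i> *\<^sub>C v) (x (u - \<i> *\<^sub>C v))) = cinner u (x v)"
      using evD by eventually_elim (simp only: polarization[OF sesquilinear_cinner[OF Dx(1)], symmetric], simp)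
  qed
  have uniq: "r u v = c" if "((\<lambda>x. cinner u (x v)) \<longlongrightarrow> c) F" for u v c
    by (rule tendsto_unique[OF Fne lim that])
  have evc: "((\<lambda>x. f x) \<longlongrightarrow> c) F" if "(g \<longlongrightarrow> c) F" "\<And>x. x \<in> D \<Longrightarrow> g x = f x" for f g and c :: complex
    using that(1) by (rule Lim_transform_eventually) (use evD that(2) in \<open>auto elim: eventually_mono\<close>)
  have sesq: "sesquilinear_form r"
    unfolding sesquilinear_form_def
  proof (intro conjI allI)
    fix u v w and c
    show "r u (v + w) = r u v + r u w"
      by (rule uniq, rule evc[OF tendsto_add[OF lim lim]]) (simp add: bounded_clinearD[OF Dx(1)] cinner_linear)
    show "r u (c *\<^sub>C v) = c * r u v"
      by (rule uniq, rule evc[OF tendsto_mult_left[OF lim]]) (simp add: bounded_clinearD[OF Dx(1)] cinner_linear)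
    show "r (u + v) w = r u w + r v w"
      by (rule uniq, rule evc[OF tendsto_add[OF lim lim]]) (simp add: cinner_linear)
    show "r (c *\<^sub>C u) v = cnj c * r u v"
      by (rule uniq, rule evc[OF tendsto_mult_left[OF lim]]) (simp add: cinner_linear)
  qed
  have rq: "r v v = complex_of_real (q v)" for v by (rule uniq[OF limC])
  obtain K where K: "K \<ge> 0" "\<And>v. norm (s v) \<le> K * norm v" by (rule bounded_clinear_bound[OF sb]) blast
  have "cmod (r v v) \<le> K * (norm v)\<^sup>2" for v
  proof -
    have "q v \<le> norm v * norm (s v)"
      using qs[of v] complex_Re_le_cmod[of "cinner v (s v)"] cinner_cauchy_schwarz[of v "s v"] by linarith
    also have "\<dots> \<le> norm v * (K * norm v)" by (intro mult_left_mono K) simp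
    finally show ?thesis using q0[of v] by (simp add: rq power2_eq_square mult_ac)
  qed
  from sesquilinear_form_bound[OF sesq this K(1)]
  obtain t where t: "bounded_clinear t" "\<And>u v. cinner u (t v) = r u v"
    by (rule sesquilinear_form_operator[OF sesq]) blast
  have "t \<in> commutant S"
  proof (rule commutant_weak_limit[OF S Fne _ t(1)])
    show "\<forall>\<^sub>F x in F. x \<in> commutant S" using evD by eventually_elim (rule Dx(3))
    show "((\<lambda>x. cinner u (x v)) \<longlongrightarrow> cinner u (t v)) F" for u v unfolding t(2) by (rule lim)
  qed
  moreover have tp: "positive_op t" by (rule positive_opI[of _ q]) (simp_all add: t(2) rq q0)
  ultimately have "t \<in> pos_part M" using M by (intro pos_partI) auto
  moreover have "op_le x t" if "x \<in> D" for x
    using xq[OF that] by (intro op_leI[OF Dx(2)[OF that] tp]) (simp add: t(2) rq)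
  \<comment> \<open>The weak limit \<open>t\<close> is an upper bound within \<open>M\<close>, so
    the least upper bound lies below it; together with \<open>qs\<close> this makes the diagonal
    coefficients of the two equal.\<close>
  ultimately have "op_le s t" by (rule s(3))
  then have "Re (cinner \<xi> (s \<xi>)) \<le> q \<xi>" using op_leD[of s t \<xi>] by (simp add: t(2) rq)
  then have eq: "Re (cinner \<xi> (s \<xi>)) = q \<xi>" using qs[of \<xi>] by simp
  show ?thesis
  proof (rule antisym)
    have "((\<lambda>x. vector_functional \<xi> x) \<longlongrightarrow> vector_functional \<xi> s) F"
      unfolding vector_functional_def eq by (intro tendsto_ennrealI limR)
    then show "vector_functional \<xi> s \<le> (SUP x\<in>D. vector_functional \<xi> x)"
    proof (rule tendsto_upperbound[OF _ _ Fne])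
      show "\<forall>\<^sub>F x in F. vector_functional \<xi> x \<le> (SUP x\<in>D. vector_functional \<xi> x)"
        using evD by eventually_elim (rule SUP_upper)
    qed
    show "(SUP x\<in>D. vector_functional \<xi> x) \<le> vector_functional \<xi> s"
      unfolding vector_functional_def by (intro SUP_least ennreal_leI op_leD s(2))
  qed
qed

text \<open>Admits vector functionals as test functionals in \<open>ext_weight\<close>, so that the
  domination required there becomes an inequality of quadratic forms.\<close>

lemma vector_functional_normal:
  fixes M S :: "'h::chilbert op set"
  assumes M: "M = commutant S" and S: "\<And>x. x \<in> S \<Longrightarrow> bounded_clinear x"
  shows "normal_functional M (vector_functional \<xi>)"
  unfolding normal_functional_def normal_weight_def weight_def
proof (intro conjI ballI allI impI)
  fix x y and r :: real assume x: "x \<in> pos_part M"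
  note px = positive_opD(1)[OF pos_partD(2)[OF x], of \<xi>]
  show "vector_functional \<xi> (\<lambda>v. r *\<^sub>R x v) = ennreal r * vector_functional \<xi> x" if "0 \<le> r"
    using that px by (simp add: vector_functional_def cinner_scaleR_right ennreal_mult)
  assume y: "y \<in> pos_part M"
  show "vector_functional \<xi> (\<lambda>v. x v + y v) = vector_functional \<xi> x + vector_functional \<xi> y"
    using px positive_opD(1)[OF pos_partD(2)[OF y], of \<xi>]
    by (simp add: vector_functional_def cinner_add_right)
next
  fix D s assume "D \<subseteq> pos_part M \<and> upward_directed D \<and> is_sup_in (pos_part M) D s"
  then show "vector_functional \<xi> s = (SUP x\<in>D. vector_functional \<xi> x)"
    using vector_functional_directed_sup[OF M S] by blast
qed (simp add: vector_functional_def)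

lemma compose_selfadjoint_positive:
  assumes "positive_op x" "\<And>u v. cinner (z u) v = cinner u (z v)"
  shows "positive_op (\<lambda>v. z (x (z v)))"
  using assms(1) unfolding positive_op_def by (simp add: assms(2)[symmetric])

text \<open>For one inequality, bounded truncations of \<open>f\<close> are admissible in the
  supremum. For the other, an admissible \<open>x\<close> is compared with f(E) after cutting down
  by the spectral projections of the sets where \<open>f\<close> is at most \<open>n\<close>; the
  trace property links this cut to a sequence increasing to \<open>x\<close>.\<close>

lemma ext_weight_fun_calc:
  fixes M :: "'h::chilbert op set" and f :: "real \<Rightarrow> ennreal"
  assumes M: "von_neumann_algebra M" and \<tau>: "fns_trace M \<tau>"
    and E: "supported_pvm S0 E" and inM: "\<forall>g. bborel g \<longrightarrow> pint E g \<in> M"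
    and f [measurable]: "f \<in> borel_measurable borel"
  shows "ext_weight M \<tau> (\<lambda>\<omega>. \<integral>\<^sup>+s. f s \<partial>scalar_measure \<omega> E) = (\<integral>\<^sup>+s. f s \<partial>scalar_measure \<tau> E)"
proof (rule antisym)
  have M': "M = commutant (commutant M)" by (rule von_neumann_algebraD(3)[OF M])
  have S: "\<forall>x\<in>commutant M. bounded_clinear x" by (blast intro: commutantD)
  have nw: "normal_weight M \<tau>" using \<tau> by (simp add: fns_trace_def)
  have P: "projection_valued_measure E" using E by (simp add: supported_pvm_def)
    note int = normal_weight_pint[OF M' S _ E inM]
  have fm: "f \<in> borel_measurable (scalar_measure \<omega> E)" for \<omega> by measurable
  show "(\<integral>\<^sup>+s. f s \<partial>scalar_measure \<tau> E) \<le> ext_weight M \<tau> (\<lambda>\<omega>. \<integral>\<^sup>+s. f s \<partial>scalar_measure \<omega> E)"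
  proof -
    define g where "g n s = enn2real (min (f s) (of_nat n))" for n s
    have gm: "g n \<in> borel_measurable borel" for n unfolding g_def by measurable
    have ge: "ennreal (g n s) = min (f s) (of_nat n)" for n s
      unfolding g_def by (rule ennreal_enn2real) (simp add: min_less_iff_disj of_nat_less_top)
    have gb: "\<bar>g n s\<bar> \<le> real n" for n s
    proof -
      have "ennreal (g n s) \<le> ennreal (real n)" unfolding ge by (simp add: ennreal_of_nat_eq_real_of_nat)
      moreover have "0 \<le> g n s" by (simp add: g_def)
      ultimately show ?thesis by (simp add: ennreal_le_iff)
    qed
    have b: "bborel (g n)" for n by (rule bborelI[OF gm gb])
    have g0: "0 \<le> g n s" for n s by (simp add: g_def)
    have sup: "(SUP n. min (f s) (of_nat n)) = f s" for s
    proof -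
      have "f s \<le> (SUP n. min (f s) (of_nat n))"
      proof (cases "f s")
        case (real r)
        obtain N where "r \<le> real N" using real_arch_simple by blast
        then have "f s \<le> min (f s) (of_nat N)"
          using real by (simp add: ennreal_of_nat_eq_real_of_nat ennreal_leI)
        then show ?thesis by (rule order_trans) (rule SUP_upper, simp)
      next
        case top
        then show ?thesis by (simp add: ennreal_SUP_of_nat_eq_top)
      qed
      then show ?thesis by (intro antisym SUP_least) simp_all
    qed
    have "(\<integral>\<^sup>+s. f s \<partial>scalar_measure \<tau> E) = (\<integral>\<^sup>+s. (SUP n. min (f s) (of_nat n)) \<partial>scalar_measure \<tau> E)"
      by (simp add: sup)
    also have "\<dots> = (SUP n. \<integral>\<^sup>+s. min (f s) (of_nat n) \<partial>scalar_measure \<tau> E)"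
      by (intro nn_integral_monotone_convergence_SUP)
        (auto simp: incseq_def le_fun_def intro: min.coboundedI2)
    also have "\<dots> = (SUP n. \<tau> (pint E (g n)))"
      by (simp add: int[OF nw b g0] ge)
    also have "\<dots> \<le> ext_weight M \<tau> (\<lambda>\<omega>. \<integral>\<^sup>+s. f s \<partial>scalar_measure \<omega> E)"
      unfolding ext_weight_def
    proof (rule SUP_mono, rule bexI, rule order_refl)
      fix n
      show "pint E (g n) \<in> {x \<in> pos_part M. \<forall>\<omega>. normal_functional M \<omega> \<longrightarrow> \<omega> x \<le> \<integral>\<^sup>+s. f s \<partial>scalar_measure \<omega> E}"
      proof (intro CollectI conjI allI impI)
        show "pint E (g n) \<in> pos_part M" by (intro pos_partI inM[rule_format] b pint_positive[OF E] g0)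
        fix \<omega> assume "normal_functional M \<omega>"
        then have nw: "normal_weight M \<omega>" by (simp add: normal_functional_def)
        show "\<omega> (pint E (g n)) \<le> (\<integral>\<^sup>+s. f s \<partial>scalar_measure \<omega> E)"
          unfolding int[OF nw b g0] ge by (intro nn_integral_mono) simp
      qed
    qed
    finally show ?thesis .
  qed
  show "ext_weight M \<tau> (\<lambda>\<omega>. \<integral>\<^sup>+s. f s \<partial>scalar_measure \<omega> E) \<le> (\<integral>\<^sup>+s. f s \<partial>scalar_measure \<tau> E)"
    unfolding ext_weight_def
  proof (rule SUP_least)
    fix x assume "x \<in> {x \<in> pos_part M. \<forall>\<omega>. normal_functional M \<omega> \<longrightarrow> \<omega> x \<le> \<integral>\<^sup>+s. f s \<partial>scalar_measure \<omega> E}"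
    then have x: "x \<in> pos_part M"
      and le: "\<And>\<omega>. normal_functional M \<omega> \<Longrightarrow> \<omega> x \<le> (\<integral>\<^sup>+s. f s \<partial>scalar_measure \<omega> E)" by auto
    let ?Q = "{s. f s = \<infinity>}"
    have Q: "?Q \<in> sets borel" by measurable
    note em = emeasure_scalar_measure[OF M' S nw E inM]
    \<comment> \<open>If \<open>f\<close> is infinite on a set of positive trace, so is the
      integral. Otherwise faithfulness kills the projection of that set, and the projections of the
      sets \<open>B n\<close> converge to the identity.\<close>
    show "\<tau> x \<le> (\<integral>\<^sup>+s. f s \<partial>scalar_measure \<tau> E)"
    proof (cases "\<tau> (E ?Q) = 0")
      case False
      have "\<infinity> = \<infinity> * \<tau> (E ?Q)" using False by (simp add: ennreal_top_mult)
      also have "\<dots> = (\<integral>\<^sup>+s. \<infinity> * indicator ?Q s \<partial>scalar_measure \<tau> E)"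
        using Q em[OF Q] by (simp add: nn_integral_cmult_indicator)
      also have "\<dots> \<le> (\<integral>\<^sup>+s. f s \<partial>scalar_measure \<tau> E)"
        by (intro nn_integral_mono) (auto simp: indicator_def)
      finally show ?thesis by (simp add: top_unique)
    next
      case True
      have EQ: "E ?Q = (\<lambda>v. 0)"
        using \<tau> True pvm_pos_part[OF M' S nw E inM Q] unfolding fns_trace_def faithful_weight_def by blast
      define B where "B n = {s. f s \<le> of_nat n}" for n :: nat
      have B: "B n \<in> sets borel" for n unfolding B_def by measurable
      have vn: "normal_functional M (vector_functional u)" for u
        by (rule vector_functional_normal[OF M']) (use S in blast)
      note pr = projection_opD[OF pvm_projection[OF P B]]
      have Plim: "(\<lambda>n. E (B n) v) \<longlonglongrightarrow> v" for v
      proof -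
        have "(\<lambda>n. pint E (indicator (B n)) v) \<longlonglongrightarrow> pint E (indicator (- ?Q)) v"
        proof (rule pint_tendsto[OF E, of _ _ 1])
          fix s
          show "(\<lambda>n. indicator (B n) s :: real) \<longlonglongrightarrow> indicator (- ?Q) s"
          proof (cases "f s = \<infinity>")
            case True
            then show ?thesis by (simp add: B_def top_unique)
          next
            case False
            then obtain r where r: "f s = ennreal r" "0 \<le> r" by (cases "f s") auto
            obtain N where "r \<le> real N" using real_arch_simple by blast
            then have "indicator (B n) s = (1::real)" if "n \<ge> N" for n
              using that r by (auto simp: B_def indicator_def ennreal_of_nat_eq_real_of_nat intro!: ennreal_leI)
            then show ?thesis using False
              by (intro tendsto_eventually) (auto simp: eventually_sequentially)
          qed
        qed (use B Q in \<open>auto split: split_indicator\<close>)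
        moreover have "E (- ?Q) v = v"
          using pvm_Un[OF E Q borel_comp[OF Q], of v] EQ by (simp add: pvm_UNIV[OF P] Compl_partition)
        ultimately show ?thesis using B Q by (simp add: pint_indicator[OF E])
      qed
      obtain z where z: "z \<in> M" "cadj z = z" "z \<circ> z = x"
        by (rule positive_sqrt[OF M' _ x]) (use S in blast)+
      have zb: "bounded_clinear z" by (rule von_neumann_algebraD(1)[OF M z(1)])
      have zsa: "cinner (z u) v = cinner u (z v)" for u v using cadj(2)[OF zb, of u v] z(2) by simp
      have zz: "z (z v) = x v" for v using z(3) by (auto simp: fun_eq_iff)
      have EM: "E (B n) \<in> M" for n using inM[rule_format, OF bborel_indicator[OF B]] by (simp add: pint_indicator[OF E B])
      have mulM: "u \<circ> v \<in> M" if "u \<in> M" "v \<in> M" for u v using commutant_mult[of u "commutant M" v] M' that by simp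
      \<comment> \<open>The projection sits between the two factors of \<open>x\<close>, so
        \<open>y n\<close> increases to \<open>x\<close>; compressions of \<open>x\<close> from
        outside need not be monotone in \<open>n\<close>.\<close>
      define y where "y n = (\<lambda>v. z (E (B n) (z v)))" for n
      have "y n = z \<circ> (E (B n) \<circ> z)" for n by (auto simp: y_def)
      then have yM: "y n \<in> M" for n by (simp add: mulM z EM)
      have yp: "y n \<in> pos_part M" for n
        by (intro pos_partI yM) (auto simp: y_def intro: compose_selfadjoint_positive[OF projection_op_positive[OF pvm_projection[OF P B]] zsa])
      have "\<tau> x = (SUP n. \<tau> (y n))"
      proof (rule normal_weight_seq[OF M' S nw])
        show "op_le (y n) (y (Suc n))" for n
        proof (rule op_leI[OF pos_partD(2)[OF yp] pos_partD(2)[OF yp]])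
          fix v
          have "B n \<subseteq> B (Suc n)" by (auto simp: B_def intro: order_trans)
          then have "B (Suc n) \<inter> B n = B n" by auto
          then have "op_le (E (B n)) (E (B (Suc n)))"
            using pvm_Int[OF P B B, of "Suc n" n]
            by (intro projection_op_leI pvm_projection[OF P B]) simp
          from op_leD[OF this, of "z v"]
          show "Re (cinner v (y n v)) \<le> Re (cinner v (y (Suc n) v))"
            by (simp add: y_def zsa)
        qed
        show "(\<lambda>n. y n v) \<longlonglongrightarrow> x v" for v
          unfolding y_def zz[symmetric] by (rule bounded_clinear_tendsto[OF zb Plim])
      qed (use yp x in \<open>auto simp: pos_part_def\<close>)
      also have "\<dots> \<le> (\<integral>\<^sup>+s. f s \<partial>scalar_measure \<tau> E)"
      proof (rule SUP_least)
        fix n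
        let ?p = "E (B n)"
        define g where "g s = enn2real (f s) * indicator (B n) s" for s
        have ge: "ennreal (g s) = f s * indicator (B n) s" for s
        proof (cases "s \<in> B n")
          case True
          then have "f s \<le> of_nat n" by (simp add: B_def)
          then have "f s < \<infinity>" using of_nat_less_top[of n] by (simp add: order_le_less_trans)
          then show ?thesis using True by (simp add: g_def)
        qed (simp add: g_def)
        have g0: "0 \<le> g s" for s by (simp add: g_def)
        have b: "bborel g"
        proof (rule bborelI[of _ "real n"])
          have [measurable]: "B n \<in> sets borel" by (rule B)
          show "g \<in> borel_measurable borel" unfolding g_def by measurable
          have "ennreal (g s) \<le> ennreal (real n)" for s
            unfolding ge by (auto simp: B_def indicator_def ennreal_of_nat_eq_real_of_nat)
          then show "\<bar>g s\<bar> \<le> real n" for s using g0 by (simp add: ennreal_le_iff)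
        qed
        define w where "w = (\<lambda>v. ?p (x (?p v)))"
        have wM: "w \<in> M"
        proof -
          have "w = ?p \<circ> (x \<circ> ?p)" by (auto simp: w_def)
          then show ?thesis using mulM EM pos_partD(1)[OF x] by simp
        qed
        have wp: "w \<in> pos_part M"
          using compose_selfadjoint_positive[OF pos_partD(2)[OF x] pr(2)] wM by (intro pos_partI) (auto simp: w_def)
        \<comment> \<open>\<open>y n\<close> and \<open>w\<close> are the two products of
          \<open>?u\<close> with its adjoint, so the trace does not distinguish the monotone version
          from the compression, and the compression is what compares with f(E).\<close>
        have "\<tau> (y n) = \<tau> w"
        proof -
          let ?u = "z \<circ> ?p"
          have "cadj ?u = ?p \<circ> z"
            by (rule cadj_unique) (simp add: zsa pr(2))
          then have "cadj ?u \<circ> ?u = w" "?u \<circ> cadj ?u = y n"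
            by (auto simp: fun_eq_iff w_def y_def zz pr(3))
          moreover have "\<tau> (cadj ?u \<circ> ?u) = \<tau> (?u \<circ> cadj ?u)"
            using \<tau> mulM[OF z(1) EM] unfolding fns_trace_def by blast
          ultimately show ?thesis by simp
        qed
        also have "\<tau> w \<le> \<tau> (pint E g)"
        proof (rule normal_weight_mono[OF M' S nw wp pint_pos_part[OF M' S nw E inM b g0]])
          show "op_le w (pint E g)"
          proof (rule op_leI[OF pos_partD(2)[OF wp] pint_positive[OF E b g0]])
            fix v
            have v: "?p v = pint E (indicator (B n)) v" by (simp add: pint_indicator[OF E B])
            have "ennreal (Re (cinner (?p v) (x (?p v)))) \<le> (\<integral>\<^sup>+s. f s \<partial>spm E (?p v))"
              using le[OF vn, of "?p v"] by (simp add: vector_functional_def)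
            also have "\<dots> = (\<integral>\<^sup>+s. ennreal ((indicator (B n) s)\<^sup>2) * f s \<partial>spm E v)"
              unfolding v spm_pint[OF E bborel_indicator[OF B]]
              using B by (intro nn_integral_density) auto
            also have "\<dots> = (\<integral>\<^sup>+s. ennreal (g s) \<partial>spm E v)"
              unfolding ge by (intro nn_integral_cong) (auto simp: indicator_def)
            also have "\<dots> = ennreal (\<integral>s. g s \<partial>spm E v)"
              using g0 by (intro nn_integral_eq_integral measure_on_integrable[OF spm_measure_on[OF E] b]) auto
            finally have "Re (cinner (?p v) (x (?p v))) \<le> (\<integral>s. g s \<partial>spm E v)"
              using g0 by (subst (asm) ennreal_le_iff) (auto intro: integral_nonneg_AE)
            then show "Re (cinner v (w v)) \<le> Re (cinner v (pint E g v))"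
              by (simp add: pint_form[OF E b] w_def pr(2))
          qed
        qed
        also have "\<tau> (pint E g) = (\<integral>\<^sup>+s. f s * indicator (B n) s \<partial>scalar_measure \<tau> E)"
          by (simp add: int[OF nw b g0] ge)
        also have "\<dots> \<le> (\<integral>\<^sup>+s. f s \<partial>scalar_measure \<tau> E)"
          by (intro nn_integral_mono) (auto simp: indicator_def)
        finally show "\<tau> (y n) \<le> (\<integral>\<^sup>+s. f s \<partial>scalar_measure \<tau> E)" .
      qed
      finally show ?thesis .
    qed
  qed
qed

section \<open>Tensor products of projections\<close>

lemma projection_eqI:
  assumes p: "projection_op p" "\<And>x. p x \<in> V" and v: "p v = v" "\<And>w. w \<in> V \<Longrightarrow> cinner w (x - v) = 0"
  shows "p x = v"
proof -
  have "cinner (p (x - v)) (p (x - v)) = cinner (p (x - v)) (x - v)"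
    using projection_opD(2,3)[OF p(1)] by metis
  also have "\<dots> = 0" by (rule v(2)[OF p(2)])
  finally have "p (x - v) = 0" by simp
  then show ?thesis using v(1) by (simp add: bounded_clinearD[OF projection_opD(1)[OF p(1)]])
qed

section \<open>Square-integrable functions on the line\<close>

lemma L2_fun_iff: "g \<in> L2_fun \<longleftrightarrow> g \<in> borel_measurable borel \<and> integrable lborel (\<lambda>t. (cmod (g t))\<^sup>2)"
  by (simp add: L2_fun_def)

lemma L2_fun_meas: "g \<in> L2_fun \<Longrightarrow> g \<in> borel_measurable borel"
  by (simp add: L2_fun_iff)

lemma L2_fun_dominated:
  assumes g: "g \<in> L2_fun" and h: "h \<in> borel_measurable borel" "\<And>t. cmod (h t) \<le> cmod (g t)"
  shows "h \<in> L2_fun"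
  unfolding L2_fun_iff
proof
  show "integrable lborel (\<lambda>t. (cmod (h t))\<^sup>2)"
  proof (rule Bochner_Integration.integrable_bound)
    show "integrable lborel (\<lambda>t. (cmod (g t))\<^sup>2)" using g by (simp add: L2_fun_iff)
    show "(\<lambda>t. (cmod (h t))\<^sup>2) \<in> borel_measurable lborel" using h(1) by measurable
    show "AE t in lborel. norm ((cmod (h t))\<^sup>2) \<le> norm ((cmod (g t))\<^sup>2)"
      using h(2) by (intro AE_I2) (simp add: power_mono)
  qed
qed (rule h)

lemma L2_fun_bounded_mult:
  assumes g: "g \<in> L2_fun" and m: "m \<in> borel_measurable borel" "\<And>t. cmod (m t) \<le> K"
  shows "(\<lambda>t. m t * g t) \<in> L2_fun"
  unfolding L2_fun_iff
proof
  have [measurable]: "g \<in> borel_measurable borel" using g by (rule L2_fun_meas)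
  show "(\<lambda>t. m t * g t) \<in> borel_measurable borel" using m(1) by measurable
  have K: "0 \<le> K" using m(2)[of 0] norm_ge_zero order_trans by blast
  show "integrable lborel (\<lambda>t. (cmod (m t * g t))\<^sup>2)"
  proof (rule Bochner_Integration.integrable_bound)
    show "integrable lborel (\<lambda>t. K\<^sup>2 * (cmod (g t))\<^sup>2)" using g by (simp add: L2_fun_iff)
    show "(\<lambda>t. (cmod (m t * g t))\<^sup>2) \<in> borel_measurable lborel" using m(1) by measurable
    show "AE t in lborel. norm ((cmod (m t * g t))\<^sup>2) \<le> norm (K\<^sup>2 * (cmod (g t))\<^sup>2)"
    proof (rule AE_I2)
      fix t
      have "(cmod (m t))\<^sup>2 \<le> K\<^sup>2" using m(2) by (intro power_mono) auto
      then show "norm ((cmod (m t * g t))\<^sup>2) \<le> norm (K\<^sup>2 * (cmod (g t))\<^sup>2)"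
        by (simp add: norm_mult power_mult_distrib mult_right_mono)
    qed
  qed
qed

lemma L2_fun_indicator:
  "g \<in> L2_fun \<Longrightarrow> Q \<in> sets borel \<Longrightarrow> (\<lambda>t. indicator Q t * g t) \<in> L2_fun"
  by (rule L2_fun_bounded_mult[of _ _ 1]) (auto simp: indicator_def)

lemma L2_fun_integrable:
  assumes "f \<in> L2_fun" "g \<in> L2_fun"
  shows "integrable lborel (\<lambda>t. cnj (f t) * g t)"
proof (rule Bochner_Integration.integrable_bound)
  show "integrable lborel (\<lambda>t. (cmod (f t))\<^sup>2 + (cmod (g t))\<^sup>2)"
    using assms by (intro Bochner_Integration.integrable_add) (auto simp: L2_fun_iff)
  have [measurable]: "f \<in> borel_measurable borel" "g \<in> borel_measurable borel" using assms by (auto intro: L2_fun_meas)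
  have "cnj \<in> borel_measurable borel" by (intro borel_measurable_continuous_onI continuous_intros)
  then have [measurable]: "(\<lambda>t. cnj (f t)) \<in> borel_measurable borel" by (rule measurable_compose[rotated]) measurable
  show "(\<lambda>t. cnj (f t) * g t) \<in> borel_measurable lborel" by measurable
  have "norm (cnj (f t) * g t) \<le> (cmod (f t))\<^sup>2 + (cmod (g t))\<^sup>2" for t
  proof -
    have "0 \<le> (cmod (f t) - cmod (g t))\<^sup>2" by simp
    then have "2 * (cmod (f t) * cmod (g t)) \<le> (cmod (f t))\<^sup>2 + (cmod (g t))\<^sup>2"
      by (simp add: power2_eq_square algebra_simps)
    moreover have "0 \<le> cmod (f t) * cmod (g t)" by simp
    ultimately have "cmod (f t) * cmod (g t) \<le> (cmod (f t))\<^sup>2 + (cmod (g t))\<^sup>2" by linarith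
    then show ?thesis by (simp add: norm_mult)
  qed
  then show "AE t in lborel. norm (cnj (f t) * g t) \<le> norm ((cmod (f t))\<^sup>2 + (cmod (g t))\<^sup>2)"
    by (intro AE_I2) (metis abs_ge_self order_trans real_norm_def)
qed

lemma L2_fun_add:
  assumes "f \<in> L2_fun" "g \<in> L2_fun" shows "(\<lambda>t. f t + g t) \<in> L2_fun"
  unfolding L2_fun_iff
proof
  have [measurable]: "f \<in> borel_measurable borel" "g \<in> borel_measurable borel" using assms by (auto intro: L2_fun_meas)
  show "(\<lambda>t. f t + g t) \<in> borel_measurable borel" by measurable
  show "integrable lborel (\<lambda>t. (cmod (f t + g t))\<^sup>2)"
  proof (rule Bochner_Integration.integrable_bound)
    show "integrable lborel (\<lambda>t. 2 * (cmod (f t))\<^sup>2 + 2 * (cmod (g t))\<^sup>2)"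
      using assms by (intro Bochner_Integration.integrable_add) (auto simp: L2_fun_iff)
    show "(\<lambda>t. (cmod (f t + g t))\<^sup>2) \<in> borel_measurable lborel" by measurable
    have "(cmod (f t + g t))\<^sup>2 \<le> 2 * (cmod (f t))\<^sup>2 + 2 * (cmod (g t))\<^sup>2" for t
    proof -
      have "(cmod (f t + g t))\<^sup>2 \<le> (cmod (f t) + cmod (g t))\<^sup>2"
        by (intro power_mono norm_triangle_ineq) simp
      also have "\<dots> \<le> 2 * (cmod (f t))\<^sup>2 + 2 * (cmod (g t))\<^sup>2"
        using zero_le_power2[of "cmod (f t) - cmod (g t)"] by (simp add: power2_eq_square algebra_simps)
      finally show ?thesis .
    qed
    then show "AE t in lborel. norm ((cmod (f t + g t))\<^sup>2) \<le> norm (2 * (cmod (f t))\<^sup>2 + 2 * (cmod (g t))\<^sup>2)"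
      by (intro AE_I2) simp
  qed
qed

section \<open>Elementary tensors and operators determined by them\<close>

context
  fixes tens :: "'h::chilbert \<Rightarrow> (real \<Rightarrow> complex) \<Rightarrow> 'k::chilbert"
  assumes tens: "hilbert_tensor_L2 tens"
begin

lemma tens_inner:
  "f \<in> L2_fun \<Longrightarrow> g \<in> L2_fun \<Longrightarrow> cinner (tens \<xi> f) (tens \<eta> g) = cinner \<xi> \<eta> * (\<integral>t. cnj (f t) * g t \<partial>lborel)"
  using tens by (simp add: hilbert_tensor_L2_def)

lemma tens_dense: "closure (cspan {tens \<xi> g | \<xi> g. g \<in> L2_fun}) = UNIV"
  using tens by (simp add: hilbert_tensor_L2_def)

lemma tens_zeroI:
  assumes "\<And>\<zeta> h. h \<in> L2_fun \<Longrightarrow> cinner (tens \<zeta> h) x = 0" shows "x = 0"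
proof (rule dense_orthogonal[OF tens_dense])
  fix v assume v: "v \<in> cspan {tens \<xi> g | \<xi> g. g \<in> L2_fun}"
  show "cinner v x = 0" by (rule cspan_orthogonal[OF _ v]) (use assms in blast)
qed

lemma tens_ext:
  assumes "\<And>\<zeta> h. h \<in> L2_fun \<Longrightarrow> cinner (tens \<zeta> h) x = cinner (tens \<zeta> h) y" shows "x = y"
proof -
  have "x - y = 0" by (rule tens_zeroI) (simp add: cinner_diff_right assms)
  then show ?thesis by simp
qed

text \<open>Bilinearity is contained in the inner product formula: elementary tensors are total, so
  vectors are compared through their inner products with them.\<close>

lemma tens_add_left: "g \<in> L2_fun \<Longrightarrow> tens (\<xi> + \<eta>) g = tens \<xi> g + tens \<eta> g"
  by (rule tens_ext) (simp add: cinner_add_right tens_inner algebra_simps)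

lemma tens_diff_left: "g \<in> L2_fun \<Longrightarrow> tens (\<xi> - \<eta>) g = tens \<xi> g - tens \<eta> g"
  by (rule tens_ext) (simp add: cinner_diff_right tens_inner algebra_simps)

lemma tens_add_right:
  assumes "f \<in> L2_fun" "g \<in> L2_fun" shows "tens \<xi> (\<lambda>t. f t + g t) = tens \<xi> f + tens \<xi> g"
proof (rule tens_ext)
  fix \<zeta> h assume h: "h \<in> L2_fun"
  have "(\<integral>t. cnj (h t) * (f t + g t) \<partial>lborel) = (\<integral>t. cnj (h t) * f t \<partial>lborel) + (\<integral>t. cnj (h t) * g t \<partial>lborel)"
    unfolding distrib_left by (intro Bochner_Integration.integral_add L2_fun_integrable assms h)
  then show "cinner (tens \<zeta> h) (tens \<xi> (\<lambda>t. f t + g t)) = cinner (tens \<zeta> h) (tens \<xi> f + tens \<xi> g)"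
    using assms h by (simp add: cinner_add_right tens_inner L2_fun_add distrib_left)
qed

lemma norm_tens:
  assumes "g \<in> L2_fun" shows "norm (tens \<xi> g) = norm \<xi> * sqrt (\<integral>t. (cmod (g t))\<^sup>2 \<partial>lborel)"
proof -
  have "(\<integral>t. cnj (g t) * g t \<partial>lborel) = complex_of_real (\<integral>t. (cmod (g t))\<^sup>2 \<partial>lborel)"
    unfolding integral_complex_of_real[symmetric]
    by (intro Bochner_Integration.integral_cong) (auto simp: complex_norm_square mult.commute simp del: of_real_power)
  then have "complex_of_real ((norm (tens \<xi> g))\<^sup>2) = complex_of_real ((norm \<xi>)\<^sup>2 * (\<integral>t. (cmod (g t))\<^sup>2 \<partial>lborel))"
    using tens_inner[OF assms assms, of \<xi> \<xi>] by (simp add: cinner_self)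
  then have "(norm (tens \<xi> g))\<^sup>2 = (norm \<xi>)\<^sup>2 * (\<integral>t. (cmod (g t))\<^sup>2 \<partial>lborel)" by (simp only: of_real_eq_iff)
  then have "norm (tens \<xi> g) = sqrt ((norm \<xi>)\<^sup>2 * (\<integral>t. (cmod (g t))\<^sup>2 \<partial>lborel))" by (metis norm_ge_zero real_sqrt_unique)
  then show ?thesis by (simp add: real_sqrt_mult)
qed

lemma tens_tendsto_left:
  assumes "g \<in> L2_fun" "(\<xi> \<longlongrightarrow> \<eta>) F" shows "((\<lambda>n. tens (\<xi> n) g) \<longlongrightarrow> tens \<eta> g) F"
proof -
  have "((\<lambda>n. norm (\<xi> n - \<eta>) * sqrt (\<integral>t. (cmod (g t))\<^sup>2 \<partial>lborel)) \<longlongrightarrow> 0 * sqrt (\<integral>t. (cmod (g t))\<^sup>2 \<partial>lborel)) F"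
    using assms(2) by (intro tendsto_mult tendsto_const) (simp add: LIM_zero_iff tendsto_norm_zero_iff)
  then have "((\<lambda>n. norm (tens (\<xi> n) g - tens \<eta> g)) \<longlongrightarrow> 0) F"
    using assms(1) by (simp add: tens_diff_left[symmetric] norm_tens)
  then show ?thesis by (simp add: LIM_zero_iff tendsto_norm_zero_iff)
qed

lemma tens_tendsto_indicator:
  assumes g: "g \<in> L2_fun" and Q: "\<And>n::nat. Q n \<in> sets borel" "\<And>t. eventually (\<lambda>n. t \<in> Q n) sequentially"
  shows "(\<lambda>n. tens \<xi> (\<lambda>t. indicator (Q n) t * g t)) \<longlonglongrightarrow> tens \<xi> g"
proof -
  have gi: "(\<lambda>t. indicator (Q n) t * g t) \<in> L2_fun" "(\<lambda>t. indicator (- Q n) t * g t) \<in> L2_fun" for n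
    using Q(1) by (auto intro!: L2_fun_indicator g)
  have gm [measurable]: "g \<in> borel_measurable borel" "\<And>n. Q n \<in> sets borel" using L2_fun_meas[OF g] Q by auto
  have "tens \<xi> g = tens \<xi> (\<lambda>t. indicator (Q n) t * g t) + tens \<xi> (\<lambda>t. indicator (- Q n) t * g t)" for n
  proof -
    have "(\<lambda>t. indicator (Q n) t * g t + indicator (- Q n) t * g t) = g" by (auto simp: indicator_def)
    then show ?thesis using tens_add_right[OF gi(1)[of n] gi(2)[of n], of \<xi>] by simp
  qed
  then have eq: "norm (tens \<xi> (\<lambda>t. indicator (Q n) t * g t) - tens \<xi> g)
      = norm \<xi> * sqrt (\<integral>t. (cmod (indicator (- Q n) t * g t))\<^sup>2 \<partial>lborel)" for n
    by (metis add_diff_cancel_left' gi(2) norm_minus_commute norm_tens)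
  have "(\<lambda>n. \<integral>t. (cmod (indicator (- Q n) t * g t))\<^sup>2 \<partial>lborel) \<longlonglongrightarrow> integral\<^sup>L (lborel :: real measure) (\<lambda>t. 0)"
  proof (rule integral_dominated_convergence[where w = "\<lambda>t. (cmod (g t))\<^sup>2"])
    show "integrable lborel (\<lambda>t. (cmod (g t))\<^sup>2)" using g by (simp add: L2_fun_iff)
    show "AE t in lborel. (\<lambda>n. (cmod (indicator (- Q n) t * g t))\<^sup>2) \<longlonglongrightarrow> 0"
    proof (rule AE_I2)
      fix t
      show "(\<lambda>n. (cmod (indicator (- Q n) t * g t))\<^sup>2) \<longlonglongrightarrow> 0"
        using Q(2)[of t] by (intro tendsto_eventually) (auto elim!: eventually_mono)
    qed
    show "AE t in lborel. norm ((cmod (indicator (- Q n) t * g t))\<^sup>2) \<le> (cmod (g t))\<^sup>2" for n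
      by (auto simp: indicator_def)
  qed auto
  then have "(\<lambda>n. norm \<xi> * sqrt (\<integral>t. (cmod (indicator (- Q n) t * g t))\<^sup>2 \<partial>lborel)) \<longlonglongrightarrow> norm \<xi> * sqrt 0"
    by (intro tendsto_mult tendsto_const tendsto_real_sqrt) simp
  then have "(\<lambda>n. norm (tens \<xi> (\<lambda>t. indicator (Q n) t * g t) - tens \<xi> g)) \<longlonglongrightarrow> 0"
    unfolding eq by simp
  then show ?thesis by (simp add: LIM_zero_iff tendsto_norm_zero_iff)
qed

lemma tens_operator_ext:
  assumes "bounded_clinear x" "bounded_clinear y" "\<And>\<xi> g. g \<in> L2_fun \<Longrightarrow> x (tens \<xi> g) = y (tens \<xi> g)"
  shows "x = y"
proof
  fix u
  have "cadj x v = cadj y v" for v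
    by (rule tens_ext) (simp add: cadj(2)[OF assms(1), symmetric] cadj(2)[OF assms(2), symmetric] assms(3))
  then show "x u = y u"
    by (intro cinner_ext) (metis cadj(3)[OF assms(1)] cadj(3)[OF assms(2)])
qed

lemma tens_operator_tendsto:
  assumes x: "\<And>n. bounded_clinear (x n)" "\<And>n u. norm (x n u) \<le> norm u" and y: "bounded_clinear y"
    and lim: "\<And>\<xi> g. g \<in> L2_fun \<Longrightarrow> (\<lambda>n. x n (tens \<xi> g)) \<longlonglongrightarrow> y (tens \<xi> g)"
  shows "(\<lambda>n::nat. x n u) \<longlonglongrightarrow> y u"
proof -
  let ?V = "{u. (\<lambda>n. x n u) \<longlonglongrightarrow> y u}"
  have "csubspace ?V"
    by (rule csubspaceI) (auto simp: bounded_clinearD[OF x(1)] bounded_clinearD[OF y] intro: tendsto_add tendsto_scaleC)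
  then have sp: "cspan {tens \<xi> g | \<xi> g. g \<in> L2_fun} \<subseteq> ?V" using lim by (intro cspan_minimal) auto
  obtain K where K: "0 \<le> K" "\<And>v. norm (y v) \<le> K * norm v" by (rule bounded_clinear_bound[OF y]) blast
  show ?thesis
  proof (rule metric_LIMSEQ_I)
    fix e :: real assume e: "e > 0"
    have "u \<in> closure (cspan {tens \<xi> g | \<xi> g. g \<in> L2_fun})" using tens_dense by simp
    then obtain v where v: "v \<in> cspan {tens \<xi> g | \<xi> g. g \<in> L2_fun}" "dist v u < e / (2 * (K + 1))"
    proof -
      have "0 < e / (2 * (K + 1))" using e K(1) by simp
      then show ?thesis using that \<open>u \<in> closure _\<close> unfolding closure_approachable by blast
    qed
    have "(\<lambda>n. x n v) \<longlonglongrightarrow> y v" using sp v(1) by auto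
    then obtain N where N: "\<And>n. n \<ge> N \<Longrightarrow> dist (x n v) (y v) < e / 2"
      using metric_LIMSEQ_D[of _ _ "e / 2"] e by (metis half_gt_zero)
    have "dist (x n u) (y u) < e" if "n \<ge> N" for n
    proof -
      have "norm (x n u - y u) \<le> norm (x n (u - v)) + norm (x n v - y v) + norm (y (v - u))"
      proof -
        have "x n u - y u = x n (u - v) + (x n v - y v) + y (v - u)"
          by (simp add: bounded_clinearD[OF x(1)] bounded_clinearD[OF y])
        then show ?thesis using norm_triangle_ineq[of "x n (u - v) + (x n v - y v)" "y (v - u)"]
            norm_triangle_ineq[of "x n (u - v)" "x n v - y v"] by simp
      qed
      also have "\<dots> \<le> norm (u - v) + norm (x n v - y v) + K * norm (v - u)"
        by (intro add_mono x K order_refl)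
      also have "\<dots> = (K + 1) * norm (v - u) + norm (x n v - y v)"
        by (simp add: norm_minus_commute distrib_right)
      also have "\<dots> < (K + 1) * (e / (2 * (K + 1))) + e / 2"
        using v(2) N[OF that] K by (intro add_strict_mono mult_strict_left_mono) (auto simp: dist_norm)
      also have "\<dots> = e" using K by (simp add: field_simps)
      finally show ?thesis by (simp add: dist_norm)
    qed
    then show "\<exists>N. \<forall>n\<ge>N. dist (x n u) (y u) < e" by blast
  qed
qed

text \<open>Obtained as the orthogonal projection onto the closed span of the tensors with first
  factor in the range of \<open>p\<close> and second factor supported in \<open>Q\<close>, which
  makes boundedness automatic.\<close>

lemma tproj_exists:
  assumes p: "projection_op p" and Q: "Q \<in> sets borel"
  shows "\<exists>y. projection_op y \<and> is_tensor_op tens p (indicator Q) y"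
proof -
  let ?W = "{tens (p \<xi>) (\<lambda>t. indicator Q t * g t) | \<xi> g. g \<in> L2_fun}"
  let ?V = "closure (cspan ?W)"
  have V: "csubspace ?V" "closed ?V" by (auto intro: csubspace_closure csubspace_cspan)
  obtain y where y: "projection_op y" "\<And>x. y x \<in> ?V" "\<And>x. x \<in> ?V \<Longrightarrow> y x = x"
    "\<And>x v. v \<in> ?V \<Longrightarrow> cinner v (x - y x) = 0"
    using projection_onto_exists[OF V] by blast
  have "y (tens \<xi> g) = tens (p \<xi>) (\<lambda>t. indicator Q t * g t)" if g: "g \<in> L2_fun" for \<xi> g
  proof -
    let ?v = "tens (p \<xi>) (\<lambda>t. indicator Q t * g t)"
    let ?d = "tens \<xi> g - ?v"
    have v: "?v \<in> ?V" using g cspan_superset[of ?W] closure_subset[of "cspan ?W"] by blast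
    have w0: "cinner w ?d = 0" if "w \<in> ?W" for w
    proof -
      obtain \<eta> h where w: "w = tens (p \<eta>) (\<lambda>t. indicator Q t * h t)" "h \<in> L2_fun" using \<open>w \<in> ?W\<close> by blast
      have "(\<integral>t. cnj (indicator Q t * h t) * (indicator Q t * g t) \<partial>lborel) = (\<integral>t. cnj (indicator Q t * h t) * g t \<partial>lborel)"
        by (intro Bochner_Integration.integral_cong) (auto simp: indicator_def)
      then have "cinner w ?v = cinner w (tens \<xi> g)"
        unfolding w(1) tens_inner[OF L2_fun_indicator[OF w(2) Q] L2_fun_indicator[OF g Q]]
          tens_inner[OF L2_fun_indicator[OF w(2) Q] g]
        by (simp only: projection_opD(2)[OF p] projection_opD(3)[OF p])
      then show ?thesis by (simp add: cinner_diff_right)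
    qed
    have orth: "cinner w ?d = 0" if "w \<in> ?V" for w
    proof (rule closure_orthogonal[OF _ that])
      show "cinner v ?d = 0" if "v \<in> cspan ?W" for v
        by (rule cspan_orthogonal[OF _ that]) (rule w0)
    qed
    show ?thesis by (rule projection_eqI[OF y(1,2) y(3)[OF v] orth])
  qed
  then show ?thesis using y(1) projection_opD(1)[OF y(1)] by (auto simp: is_tensor_op_def)
qed

definition tproj :: "'h op \<Rightarrow> real set \<Rightarrow> 'k op" where
  "tproj p Q = (SOME y. projection_op y \<and> is_tensor_op tens p (indicator Q) y)"

lemma tproj:
  assumes "projection_op p" "Q \<in> sets borel"
  shows "projection_op (tproj p Q)" "is_tensor_op tens p (indicator Q) (tproj p Q)"
    "g \<in> L2_fun \<Longrightarrow> tproj p Q (tens \<xi> g) = tens (p \<xi>) (\<lambda>t. indicator Q t * g t)"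
    "bounded_clinear (tproj p Q)"
proof -
  show 1: "projection_op (tproj p Q)" "is_tensor_op tens p (indicator Q) (tproj p Q)"
    using someI_ex[OF tproj_exists[OF assms]] unfolding tproj_def by blast+
  then show "g \<in> L2_fun \<Longrightarrow> tproj p Q (tens \<xi> g) = tens (p \<xi>) (\<lambda>t. indicator Q t * g t)"
    by (simp add: is_tensor_op_def)
  show "bounded_clinear (tproj p Q)" by (rule projection_opD[OF 1(1)])
qed

end

section \<open>Spectral subspaces of a closed operator\<close>

text \<open>If A times the Gram matrix of the \<open>v i\<close> minus C times that of the
  \<open>u i\<close> is itself a Gram matrix, it is positive semidefinite, and the inequality
  follows for all linear combinations. Negative constants are allowed; they produce upper
  bounds.\<close>

lemma gram_inequality:
  fixes u v :: "'i \<Rightarrow> 'k::chilbert" and r :: "'i \<Rightarrow> 'l::chilbert" and A C :: real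
  assumes gram: "\<And>i j. i \<in> I \<Longrightarrow> j \<in> I \<Longrightarrow>
      complex_of_real A * cinner (v i) (v j) = complex_of_real C * cinner (u i) (u j) + cinner (r i) (r j)"
    and x: "x \<in> cspan ((\<lambda>i. (u i, v i)) ` I)"
  shows "C * (norm (fst x))\<^sup>2 \<le> A * (norm (snd x))\<^sup>2"
proof -
  \<comment> \<open>The remainders are carried along as a third component: an element of the span
    does not determine its coefficients, but it lifts to a combination of triples.\<close>
  let ?W = "cspan ((\<lambda>i. ((u i, v i), r i)) ` I)"
  note W = csubspaceD[OF csubspace_cspan[of "(\<lambda>i. ((u i, v i), r i)) ` I"]]
  have "csubspace {x. \<exists>w. (x, w) \<in> ?W}"
  proof (rule csubspaceI)
    show "0 \<in> {x. \<exists>w. (x, w) \<in> ?W}" using W(1) by (auto simp: zero_prod_def)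
    fix x y c assume "x \<in> {x. \<exists>w. (x, w) \<in> ?W}"
    then obtain w where w: "(x, w) \<in> ?W" by blast
    show "c *\<^sub>C x \<in> {x. \<exists>w. (x, w) \<in> ?W}" using W(4)[OF w, of c] by (auto simp: scaleC_prod_def)
    assume "y \<in> {x. \<exists>w. (x, w) \<in> ?W}"
    then obtain z where z: "(y, z) \<in> ?W" by blast
    show "x + y \<in> {x. \<exists>w. (x, w) \<in> ?W}" using W(2)[OF w z] by auto
  qed
  moreover have "(\<lambda>i. (u i, v i)) ` I \<subseteq> {x. \<exists>w. (x, w) \<in> ?W}"
    using cspan_superset[of "(\<lambda>i. ((u i, v i), r i)) ` I"] by blast
  ultimately have "cspan ((\<lambda>i. (u i, v i)) ` I) \<subseteq> {x. \<exists>w. (x, w) \<in> ?W}" by (rule cspan_minimal[rotated])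
  then obtain w where w: "(x, w) \<in> ?W" using x by blast
  let ?P = "\<lambda>y z. complex_of_real A * cinner (snd (fst y)) (snd (fst z)) =
      complex_of_real C * cinner (fst (fst y)) (fst (fst z)) + cinner (snd y) (snd z)"
  have sub1: "csubspace {z. ?P y z}" for y
    by (rule csubspaceI) (auto simp: cinner_linear scaleC_prod_def algebra_simps)
  have sub2: "csubspace {y. ?P y z}" for z
    by (rule csubspaceI) (auto simp: cinner_linear scaleC_prod_def algebra_simps)
  have 1: "?P ((u i, v i), r i) z" if "i \<in> I" "z \<in> ?W" for i z
  proof -
    have "?W \<subseteq> {z. ?P ((u i, v i), r i) z}"
      by (rule cspan_minimal[OF _ sub1]) (use gram[OF that(1)] in auto)
    then show ?thesis using that(2) by blast
  qed
  have "?P y z" if "y \<in> ?W" "z \<in> ?W" for y z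
  proof -
    have "?W \<subseteq> {y. ?P y z}"
      by (rule cspan_minimal[OF _ sub2]) (use 1[OF _ that(2)] in auto)
    then show ?thesis using that(1) by blast
  qed
  from this[OF w w]
  have "complex_of_real (A * (norm (snd x))\<^sup>2) = complex_of_real (C * (norm (fst x))\<^sup>2 + (norm w)\<^sup>2)"
    by (simp add: cinner_self)
  then have "A * (norm (snd x))\<^sup>2 = C * (norm (fst x))\<^sup>2 + (norm w)\<^sup>2" by (simp only: of_real_eq_iff)
  then show ?thesis by simp
qed

context
  fixes T :: "'h::chilbert unbdd" and E
  assumes T: "closed_densely_defined_op T"
  defines "E \<equiv> spectral_measure (modulus T)"
begin

lemma cdd_props: "csubspace T" "closed T" "single_valued T" "closure (Domain T) = UNIV"
  using T by (auto simp: closed_densely_defined_op_def densely_defined_op_def)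

lemma modulus_spectral_pvm: "supported_pvm {0..} E" "pint E resZ = zop T"
  unfolding E_def by (rule spectral_measure_modulus[OF T])+

lemma bborel_sq_indicator:
  assumes "B \<in> sets borel" "B \<subseteq> {0..real n}"
  shows "bborel (\<lambda>s. s\<^sup>2 * indicator B s)"
proof (rule bborelI[of _ "(real n)\<^sup>2"])
  have [measurable]: "B \<in> sets borel" by (rule assms)
  show "(\<lambda>s. s\<^sup>2 * indicator B s) \<in> borel_measurable borel" by measurable
  show "\<bar>s\<^sup>2 * indicator B s\<bar> \<le> (real n)\<^sup>2" for s
    using assms(2) by (auto simp: indicator_def intro!: power_mono)
qed

text \<open>For bounded \<open>B\<close> the range of \<open>E B\<close> lies in the domain of T' T,
  with T' the adjoint, and T' T acts there as multiplication by s^2.\<close>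

lemma spectral_subspace_domain:
  assumes B: "B \<in> sets borel" "B \<subseteq> {0..real n}"
  shows "\<exists>\<eta>. (E B \<xi>, \<eta>) \<in> T \<and> (\<eta>, pint E (\<lambda>s. s\<^sup>2 * indicator B s) \<xi>) \<in> adj T"
proof -
  note b2 = bborel_sq_indicator[OF B]
  \<comment> \<open>The indicator times 1 + s^2, so that \<open>zop T\<close> maps
    \<open>pint E ?g \<xi>\<close> to \<open>E B \<xi>\<close>.\<close>
  let ?g = "\<lambda>s. indicator B s + s\<^sup>2 * indicator B s"
  have g: "bborel ?g" by (intro bborel_add b2 bborel_indicator B)
  have "zop T (pint E ?g \<xi>) = pint E (\<lambda>s. resZ s * ?g s) \<xi>"
    unfolding modulus_spectral_pvm(2)[symmetric] by (rule pint_mult[OF modulus_spectral_pvm(1) bborel_res(3) g])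
  also have "(\<lambda>s. resZ s * ?g s) = indicator B"
    using one_plus_sq_pos by (auto simp: resZ_def indicator_def fun_eq_iff add.commute add_nonneg_eq_0_iff)
  also have "pint E (indicator B) \<xi> = E B \<xi>" by (simp add: pint_indicator[OF modulus_spectral_pvm(1) B(1)])
  finally have z: "zop T (pint E ?g \<xi>) = E B \<xi>" .
  have "pint E ?g \<xi> = E B \<xi> + pint E (\<lambda>s. s\<^sup>2 * indicator B s) \<xi>"
    using pint_add[OF modulus_spectral_pvm(1) bborel_indicator[OF B(1)] b2, of \<xi>] by (simp add: pint_indicator[OF modulus_spectral_pvm(1) B(1)])
  then have d: "pint E ?g \<xi> - E B \<xi> = pint E (\<lambda>s. s\<^sup>2 * indicator B s) \<xi>" by simp
  obtain y where "(zop T (pint E ?g \<xi>), y) \<in> T" "(y, pint E ?g \<xi> - zop T (pint E ?g \<xi>)) \<in> adj T"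
    by (rule zop_pair[OF cdd_props(1,2)])
  then show ?thesis unfolding z d by blast
qed

text \<open>The squared norm of the image is the integral of s^2 over \<open>B\<close> against
  \<open>spm E \<xi>\<close>, and s lies between \<open>l\<close> and \<open>h\<close>
  there.\<close>

lemma spectral_subspace_norm:
  assumes B: "B \<in> sets borel" "B \<subseteq> {l..h}" "0 \<le> l"
  shows "\<exists>\<eta>. (E B \<xi>, \<eta>) \<in> T \<and> l\<^sup>2 * (norm (E B \<xi>))\<^sup>2 \<le> (norm \<eta>)\<^sup>2 \<and> (norm \<eta>)\<^sup>2 \<le> h\<^sup>2 * (norm (E B \<xi>))\<^sup>2"
proof -
  obtain n where "h \<le> real n" using real_arch_simple by blast
  then have B': "B \<subseteq> {0..real n}" using B by force
  note b2 = bborel_sq_indicator[OF B(1) B']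
  obtain \<eta> where e: "(E B \<xi>, \<eta>) \<in> T" "(\<eta>, pint E (\<lambda>s. s\<^sup>2 * indicator B s) \<xi>) \<in> adj T"
    using spectral_subspace_domain[OF B(1) B'] by blast
  have pr: "projection_op (E B)" using modulus_spectral_pvm(1) B(1) by (auto simp: supported_pvm_def intro: pvm_projection)
  have "cinner \<eta> \<eta> = cinner (E B \<xi>) (pint E (\<lambda>s. s\<^sup>2 * indicator B s) \<xi>)"
    using e unfolding adj_iff by blast
  also have "\<dots> = cinner \<xi> (E B (pint E (\<lambda>s. s\<^sup>2 * indicator B s) \<xi>))" by (rule projection_opD[OF pr])
  also have "E B (pint E (\<lambda>s. s\<^sup>2 * indicator B s) \<xi>) = pint E (\<lambda>s. indicator B s * (s\<^sup>2 * indicator B s)) \<xi>"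
    using pint_mult[OF modulus_spectral_pvm(1) bborel_indicator[OF B(1)] b2, of \<xi>] by (simp add: pint_indicator[OF modulus_spectral_pvm(1) B(1)])
  also have "(\<lambda>s. indicator B s * (s\<^sup>2 * indicator B s)) = (\<lambda>s. s\<^sup>2 * indicator B s)" by (auto simp: indicator_def)
  also have "cinner \<xi> (pint E (\<lambda>s. s\<^sup>2 * indicator B s) \<xi>) = complex_of_real (\<integral>s. s\<^sup>2 * indicator B s \<partial>spm E \<xi>)"
    by (rule pint_form[OF modulus_spectral_pvm(1) b2])
  finally have "complex_of_real ((norm \<eta>)\<^sup>2) = complex_of_real (\<integral>s. s\<^sup>2 * indicator B s \<partial>spm E \<xi>)"
    by (simp only: cinner_self)
  then have n: "(norm \<eta>)\<^sup>2 = (\<integral>s. s\<^sup>2 * indicator B s \<partial>spm E \<xi>)" by (simp only: of_real_eq_iff)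
  have m: "(norm (E B \<xi>))\<^sup>2 = (\<integral>s. indicator B s \<partial>spm E \<xi>)"
    using modulus_spectral_pvm(1) B(1) by (simp add: measure_spm[of E B \<xi>, symmetric] supported_pvm_def)
  note int = measure_on_integrable[OF spm_measure_on[OF modulus_spectral_pvm(1)]]
  have 1: "l\<^sup>2 * indicator B s \<le> s\<^sup>2 * indicator B s" "s\<^sup>2 * indicator B s \<le> h\<^sup>2 * indicator B s" for s :: real
    using B(2,3) by (auto simp: indicator_def intro!: power_mono)
  have "l\<^sup>2 * (norm (E B \<xi>))\<^sup>2 \<le> (norm \<eta>)\<^sup>2"
    unfolding n m integral_mult_right_zero[symmetric]
    by (intro integral_mono int 1 b2 bborel_cmult bborel_indicator B(1))
  moreover have "(norm \<eta>)\<^sup>2 \<le> h\<^sup>2 * (norm (E B \<xi>))\<^sup>2"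
    unfolding n m integral_mult_right_zero[symmetric]
    by (intro integral_mono int 1 b2 bborel_cmult bborel_indicator B(1))
  ultimately show ?thesis using e(1) by blast
qed

text \<open>The companion of \<open>E B\<close> on the range side is the projection onto \<open>T (range (E B))\<close>; no polar
  decomposition is needed.\<close>

lemma spectral_subspace_reduces:
  assumes B: "B \<in> sets borel" "B \<subseteq> {0..real n}"
  shows "\<exists>p'. projection_op p' \<and> (\<forall>\<xi> \<eta>. (\<xi>, \<eta>) \<in> T \<longrightarrow> (E B \<xi>, p' \<eta>) \<in> T)"
proof -
  have P: "projection_valued_measure E" using modulus_spectral_pvm(1) by (simp add: supported_pvm_def)
  note pr = projection_opD[OF pvm_projection[OF P B(1)]]
  note lin = bounded_clinearD[OF pr(1)]
  note Tl = csubspace_pairD[OF cdd_props(1)]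
  define V where "V = {\<eta>. \<exists>\<xi>. (\<xi>, \<eta>) \<in> T \<and> E B \<xi> = \<xi>}"
  have "csubspace V"
  proof (rule csubspaceI)
    show "0 \<in> V" using Tl(1) lin(5) by (auto simp: V_def)
    fix x y c assume "x \<in> V"
    then obtain a where a: "(a, x) \<in> T" "E B a = a" by (auto simp: V_def)
    show "c *\<^sub>C x \<in> V" using Tl(4)[OF a(1), of c] lin(3)[of c a] a(2) by (auto simp: V_def)
    assume "y \<in> V"
    then obtain d where d: "(d, y) \<in> T" "E B d = d" by (auto simp: V_def)
    have "E B (a + d) = a + d" by (simp only: lin(2) a(2) d(2))
    then show "x + y \<in> V" using Tl(2)[OF a(1) d(1)] unfolding V_def by blast
  qed
  then have cV: "csubspace (closure V)" "closed (closure V)" by (auto intro: csubspace_closure)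
  obtain p' where p': "projection_op p'" "\<And>x. p' x \<in> closure V" "\<And>x. x \<in> closure V \<Longrightarrow> p' x = x"
    by (rule projection_onto_exists[OF cV], erule that) simp_all
  have "(E B \<xi>, p' \<eta>) \<in> T" if T1: "(\<xi>, \<eta>) \<in> T" for \<xi> \<eta>
  proof -
    obtain \<eta>1 where e1: "(E B \<xi>, \<eta>1) \<in> T" using spectral_subspace_domain[OF B] by blast
    have "\<eta>1 \<in> V" using e1 pr(3) by (auto simp: V_def)
    then have on: "p' \<eta>1 = \<eta>1" using p'(3) closure_subset by blast
    \<comment> \<open>T' T, with T' the adjoint, maps the range of \<open>E B\<close> into itself,
      so the image \<eta> - \<eta>1 of a vector orthogonal to that range is orthogonal to
      \<open>V\<close>.\<close>
    have "cinner v (\<eta> - \<eta>1) = 0" if v: "v \<in> V" for v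
    proof -
      obtain \<xi>' where x: "(\<xi>', v) \<in> T" "E B \<xi>' = \<xi>'" using v by (auto simp: V_def)
      obtain v' where v': "(E B \<xi>', v') \<in> T" "(v', pint E (\<lambda>s. s\<^sup>2 * indicator B s) \<xi>') \<in> adj T"
        using spectral_subspace_domain[OF B] by blast
      have "v' = v" using v'(1) x cdd_props(3) by (metis single_valuedD)
      let ?z = "pint E (\<lambda>s. s\<^sup>2 * indicator B s) \<xi>'"
      have z: "E B ?z = ?z"
      proof -
        have "E B ?z = pint E (\<lambda>s. indicator B s * (s\<^sup>2 * indicator B s)) \<xi>'"
          using pint_mult[OF modulus_spectral_pvm(1) bborel_indicator[OF B(1)] bborel_sq_indicator[OF B], of \<xi>']
          by (simp add: pint_indicator[OF modulus_spectral_pvm(1) B(1)])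
        also have "(\<lambda>s. indicator B s * (s\<^sup>2 * indicator B s)) = (\<lambda>s. s\<^sup>2 * indicator B s)" by (auto simp: indicator_def)
        finally show ?thesis .
      qed
      have "cinner (\<eta> - \<eta>1) v = cinner (\<xi> - E B \<xi>) ?z"
        using v'(2) Tl(3)[OF T1 e1] \<open>v' = v\<close> unfolding adj_iff by blast
      also have "\<dots> = cinner (\<xi> - E B \<xi>) (E B ?z)" by (simp only: z)
      also have "\<dots> = cinner (E B (\<xi> - E B \<xi>)) ?z" by (simp only: pr(2))
      also have "\<dots> = 0" by (simp add: lin(4) pr(3))
      finally show ?thesis by (subst cinner_commute) simp
    qed
    then have "cinner w (\<eta> - \<eta>1) = 0" if "w \<in> closure V" for w by (rule closure_orthogonal[OF _ that])
    then have "p' \<eta> = \<eta>1" by (rule projection_eqI[OF p'(1,2) on])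
    then show ?thesis using e1 by simp
  qed
  then show ?thesis using p'(1) by blast
qed

text \<open>For \<open>x\<close> orthogonal to the domain of the adjoint, project
  \<open>(0, x)\<close> onto the graph. The remainder yields an element of the adjoint; its pairings
  force \<open>(0, x)\<close> into the graph, and single-valuedness gives
  \<open>x = 0\<close>.\<close>

lemma adjoint_dense: "closure (Domain (adj T)) = UNIV"
proof (rule dense_subspaceI)
  note A = csubspace_pairD[OF csubspace_adj[of T]]
  show "csubspace (Domain (adj T))"
    by (rule csubspaceI) (use A in blast)+
  fix x assume x: "\<And>v. v \<in> Domain (adj T) \<Longrightarrow> cinner v x = 0"
  obtain q where q: "q \<in> T" "\<And>v. v \<in> T \<Longrightarrow> cinner v ((0, x) - q) = 0"
    using orthogonal_decomposition[OF cdd_props(1,2), of "(0, x)"] by blast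
  obtain u v where uv: "q = (u, v)" by (cases q)
  have "cinner \<theta> (x - v) = cinner \<xi> u" if "(\<xi>, \<theta>) \<in> T" for \<xi> \<theta>
    using q(2)[OF that] by (simp add: uv cinner_prod_def cinner_linear algebra_simps)
  then have a: "(x - v, u) \<in> adj T" by (simp add: adj_iff)
  have 1: "cinner (x - v) x = 0" by (rule x) (use a in blast)
  have 2: "cinner v (x - v) = cinner u u" using a q(1) unfolding uv adj_iff by blast
  have "cinner (x - v) (x - v) = cinner (x - v) x - cnj (cinner v (x - v))"
    by (metis cinner_commute cinner_diff_right)
  then have "complex_of_real ((norm (x - v))\<^sup>2 + (norm u)\<^sup>2) = 0"
    using 1 2 by (simp add: cinner_self)
  then have "(norm (x - v))\<^sup>2 + (norm u)\<^sup>2 = 0" by (simp only: of_real_eq_0_iff)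
  then have "x = v" "u = 0" by (simp_all add: add_nonneg_eq_0_iff)
  then have "(0, x) \<in> T" using q(1) uv by simp
  then show "x = 0" using csubspace_pairD(1)[OF cdd_props(1)] cdd_props(3) by (metis single_valuedD)
qed

end

section \<open>Tensor products of closed operators with multiplication operators\<close>

definition mulf :: "(real \<Rightarrow> real) \<Rightarrow> (real \<Rightarrow> complex) \<Rightarrow> real \<Rightarrow> complex" where
  "mulf f g = (\<lambda>t. complex_of_real (f t) * g t)"

definition tensor_gen ::
  "('h::chilbert \<Rightarrow> (real \<Rightarrow> complex) \<Rightarrow> 'k::chilbert) \<Rightarrow> 'h unbdd \<Rightarrow> (real \<Rightarrow> real) \<Rightarrow> 'k unbdd" where
  "tensor_gen tens a f = {(tens \<xi> g, tens \<eta> (mulf f g)) | \<xi> \<eta> g. (\<xi>, \<eta>) \<in> a \<and> g \<in> L2_fun \<and> mulf f g \<in> L2_fun}"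

lemma tensor_unbdd_gen:
  "tensor_unbdd tens a (\<lambda>t. complex_of_real (f t)) = closure (cspan (tensor_gen tens a f))"
  by (simp add: tensor_unbdd_def tensor_gen_def mulf_def)

lemma mulf_indicator: "mulf f (\<lambda>t. indicator Q t * g t) = (\<lambda>t. indicator Q t * mulf f g t)"
  by (auto simp: mulf_def)

lemma mulf_L2:
  assumes "f \<in> borel_measurable borel" "g \<in> L2_fun" "\<And>t. g t \<noteq> 0 \<Longrightarrow> \<bar>f t\<bar> \<le> K" "0 \<le> K"
  shows "mulf f g \<in> L2_fun"
proof (rule L2_fun_dominated)
  have [measurable]: "g \<in> borel_measurable borel" "f \<in> borel_measurable borel" using assms by (auto intro: L2_fun_meas)
  have "(\<lambda>t. complex_of_real K * g t) \<in> L2_fun"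
    by (rule L2_fun_bounded_mult[OF assms(2), of _ K]) (use assms(4) in auto)
  then show "(\<lambda>t. complex_of_real K * g t) \<in> L2_fun" .
  show "mulf f g \<in> borel_measurable borel" unfolding mulf_def by measurable
  show "cmod (mulf f g t) \<le> cmod (complex_of_real K * g t)" for t
    using assms(3)[of t] assms(4) by (cases "g t = 0") (auto simp: mulf_def norm_mult mult_right_mono)
qed

context
  fixes tens :: "'h::chilbert \<Rightarrow> (real \<Rightarrow> complex) \<Rightarrow> 'k::chilbert" and a :: "'h unbdd" and f :: "real \<Rightarrow> real" and b
  assumes tens: "hilbert_tensor_L2 tens" and a: "closed_densely_defined_op a"
    and f: "f \<in> borel_measurable borel"
  defines "b \<equiv> closure (cspan (tensor_gen tens a f))"
begin

lemma tensor_csubspace: "csubspace b" "closed b"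
  unfolding b_def by (auto intro: csubspace_closure csubspace_cspan)

lemma tensor_genI:
  "(\<xi>, \<eta>) \<in> a \<Longrightarrow> g \<in> L2_fun \<Longrightarrow> mulf f g \<in> L2_fun \<Longrightarrow> (tens \<xi> g, tens \<eta> (mulf f g)) \<in> tensor_gen tens a f"
  unfolding tensor_gen_def by blast

lemma tensor_gen_subset: "tensor_gen tens a f \<subseteq> b"
  unfolding b_def using cspan_superset closure_subset by blast

lemma tensor_minimal:
  assumes "csubspace V" "closed V" "\<And>\<xi> \<eta> g. (\<xi>, \<eta>) \<in> a \<Longrightarrow> g \<in> L2_fun \<Longrightarrow> mulf f g \<in> L2_fun \<Longrightarrow>
    (tens \<xi> g, tens \<eta> (mulf f g)) \<in> V"
  shows "b \<subseteq> V"
proof -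
  have "tensor_gen tens a f \<subseteq> V" using assms(3) by (auto simp: tensor_gen_def)
  then show ?thesis unfolding b_def by (intro closure_minimal cspan_minimal assms)
qed

text \<open>\<open>f\<close> may be unbounded, so \<open>mulf f g\<close> can leave L^2. Restricting
  \<open>g\<close> to the sets where |f| is at most \<open>n\<close> gives admissible functions that
  still approximate it.\<close>

lemma truncated_L2:
  assumes g: "g \<in> L2_fun"
  defines "Q \<equiv> \<lambda>n::nat. {t. \<bar>f t\<bar> \<le> real n}"
  shows "(\<lambda>t. indicator (Q n) t * g t) \<in> L2_fun" "mulf f (\<lambda>t. indicator (Q n) t * g t) \<in> L2_fun"
    "(\<lambda>n. tens \<xi> (\<lambda>t. indicator (Q n) t * g t)) \<longlonglongrightarrow> tens \<xi> g"
proof -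
  have Q: "Q n \<in> sets borel" for n unfolding Q_def using f by measurable
  show 1: "(\<lambda>t. indicator (Q n) t * g t) \<in> L2_fun" by (rule L2_fun_indicator[OF g Q])
  show "mulf f (\<lambda>t. indicator (Q n) t * g t) \<in> L2_fun"
    by (rule mulf_L2[OF f 1, of "real n"]) (auto simp: Q_def indicator_def split: if_splits)
  show "(\<lambda>n. tens \<xi> (\<lambda>t. indicator (Q n) t * g t)) \<longlonglongrightarrow> tens \<xi> g"
  proof (rule tens_tendsto_indicator[OF tens g Q])
    fix t
    obtain N where "\<bar>f t\<bar> \<le> real N" using real_arch_simple by blast
    then show "\<forall>\<^sub>F n in sequentially. t \<in> Q n"
      by (auto simp: Q_def eventually_sequentially intro!: exI[of _ N])
  qed
qed

lemma tens_dense_zeroI: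
  assumes D: "closure D = UNIV"
    and z: "\<And>\<xi> g. \<xi> \<in> D \<Longrightarrow> g \<in> L2_fun \<Longrightarrow> mulf f g \<in> L2_fun \<Longrightarrow> cinner (tens \<xi> g) x = 0"
  shows "x = 0"
proof (rule tens_zeroI[OF tens])
  fix \<xi> g assume g: "g \<in> L2_fun"
  have 1: "cinner (tens \<zeta> g) x = 0" if "\<zeta> \<in> D" for \<zeta>
  proof -
    have "(\<lambda>n. cinner (tens \<zeta> (\<lambda>t. indicator {t. \<bar>f t\<bar> \<le> real n} t * g t)) x) \<longlonglongrightarrow> cinner (tens \<zeta> g) x"
      by (intro tendsto_cinner tendsto_const truncated_L2 g)
    then show ?thesis using z[OF that truncated_L2(1,2)[OF g]] by (simp add: LIMSEQ_const_iff)
  qed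
  obtain u where u: "\<And>n. u n \<in> D" "u \<longlonglongrightarrow> \<xi>" using D closure_sequential[of \<xi> D] by auto
  have "(\<lambda>n. cinner (tens (u n) g) x) \<longlonglongrightarrow> cinner (tens \<xi> g) x"
    by (intro tendsto_cinner tendsto_const tens_tendsto_left[OF tens g] u)
  then show "cinner (tens \<xi> g) x = 0" using 1[OF u(1)] by (simp add: LIMSEQ_const_iff)
qed

lemma integral_mulf:
  "(\<integral>t. cnj (mulf f g t) * h t \<partial>lborel) = (\<integral>t. cnj (g t) * mulf f h t \<partial>lborel)"
  by (intro Bochner_Integration.integral_cong) (auto simp: mulf_def)

text \<open>Closability comes from the adjoint: admissible elementary tensors with first factor in
  the domain of \<open>adj a\<close> are total and pair with \<open>b\<close> like elements of the
  domain of its adjoint, so \<open>(0, v)\<close> is in the closure only for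
  \<open>v = 0\<close>.\<close>

lemma tensor_closed_densely_defined: "closed_densely_defined_op b"
  unfolding closed_densely_defined_op_def densely_defined_op_def
proof (intro conjI tensor_csubspace)
  note c = cdd_props[OF a]
  have adj: "cinner v (tens \<eta> h) = cinner u (tens \<zeta> (mulf f h))"
    if "(u, v) \<in> b" and e: "(\<eta>, \<zeta>) \<in> adj a" "h \<in> L2_fun" "mulf f h \<in> L2_fun" for u v \<eta> \<zeta> h
  proof -
    let ?V = "{x. cinner (snd x) (tens \<eta> h) = cinner (fst x) (tens \<zeta> (mulf f h))}"
    have "b \<subseteq> ?V"
    proof (rule tensor_minimal)
      show "csubspace ?V" by (rule csubspaceI) (auto simp: cinner_linear scaleC_prod_def)
      show "closed ?V" by (intro closed_Collect_eq continuous_on_cinner continuous_intros)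
      fix \<xi> \<theta> g assume g: "(\<xi>, \<theta>) \<in> a" "g \<in> L2_fun" "mulf f g \<in> L2_fun"
      have "cinner \<theta> \<eta> = cinner \<xi> \<zeta>" using e(1) g(1) unfolding adj_iff by blast
      then show "(tens \<xi> g, tens \<theta> (mulf f g)) \<in> ?V"
        using g e by (simp add: tens_inner[OF tens] integral_mulf)
    qed
    then show ?thesis using that(1) by auto
  qed
  show "single_valued b"
  proof (rule single_valuedI)
    fix u v w assume "(u, v) \<in> b" "(u, w) \<in> b"
    then have 0: "(0, v - w) \<in> b" using csubspace_pairD(3)[OF tensor_csubspace(1), of u v u w] by simp
    have "v - w = 0"
    proof (rule tens_dense_zeroI[OF adjoint_dense[OF a]])
      fix \<eta> h assume "\<eta> \<in> Domain (adj a)" and h: "h \<in> L2_fun" "mulf f h \<in> L2_fun"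
      then obtain \<zeta> where "(\<eta>, \<zeta>) \<in> adj a" by blast
      from adj[OF 0 this h] show "cinner (tens \<eta> h) (v - w) = 0" by (subst cinner_commute) simp
    qed
    then show "v = w" by simp
  qed
  show "closure (Domain b) = UNIV"
  proof (rule dense_subspaceI)
    note B = csubspace_pairD[OF tensor_csubspace(1)]
    show "csubspace (Domain b)" by (rule csubspaceI) (use B in blast)+
    fix x assume x: "\<And>v. v \<in> Domain b \<Longrightarrow> cinner v x = 0"
    show "x = 0"
    proof (rule tens_dense_zeroI[OF c(4)])
      fix \<xi> g assume "\<xi> \<in> Domain a" and g: "g \<in> L2_fun" "mulf f g \<in> L2_fun"
      then obtain \<eta> where "(\<xi>, \<eta>) \<in> a" by blast
      from tensor_genI[OF this g] show "cinner (tens \<xi> g) x = 0" using tensor_gen_subset by (intro x) blast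
    qed
  qed
qed

context
  fixes B Q :: "real set" and n :: nat and E :: "real set \<Rightarrow> 'h op" and F :: "real set \<Rightarrow> 'k op"
  defines "E \<equiv> spectral_measure (modulus a)" and "F \<equiv> spectral_measure (modulus b)"
  assumes B: "B \<in> sets borel" "B \<subseteq> {0..real n}" and Q: "Q \<in> sets borel"
begin

lemma EB_projection: "projection_op (E B)"
  using modulus_spectral_pvm(1)[OF a] B(1) by (auto simp: E_def supported_pvm_def intro: pvm_projection)

text \<open>The companion on the range side is the companion of \<open>E B\<close> tensored with the
  same indicator. The last clause keeps the estimates within the algebraic span before the closure
  is taken.\<close>

lemma tensor_reduces:
  "\<exists>P'. bounded_clinear P' \<and> (\<forall>u v. cinner (P' u) v = cinner u (P' v)) \<and>
    (\<forall>u v. (u, v) \<in> b \<longrightarrow> (tproj tens (E B) Q u, P' v) \<in> b) \<and>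
    (\<forall>x\<in>cspan (tensor_gen tens a f). (tproj tens (E B) Q (fst x), P' (snd x)) \<in>
      cspan {(tens \<xi> g, tens \<eta> (mulf f g)) | \<xi> \<eta> g. (\<xi>, \<eta>) \<in> a \<and> E B \<xi> = \<xi> \<and> g \<in> L2_fun \<and> mulf f g \<in> L2_fun \<and>
        (\<forall>t. t \<notin> Q \<longrightarrow> g t = 0)})"
proof -
  obtain p' where p': "projection_op p'" "\<And>\<xi> \<eta>. (\<xi>, \<eta>) \<in> a \<Longrightarrow> (E B \<xi>, p' \<eta>) \<in> a"
    using spectral_subspace_reduces[OF a B] unfolding E_def by blast
  note P = tproj[OF tens EB_projection Q] and P' = tproj[OF tens p'(1) Q]
  note Pl = bounded_clinearD[OF P(4)] and P'l = bounded_clinearD[OF P'(4)]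
  let ?G = "{(tens \<xi> g, tens \<eta> (mulf f g)) | \<xi> \<eta> g. (\<xi>, \<eta>) \<in> a \<and> E B \<xi> = \<xi> \<and> g \<in> L2_fun \<and> mulf f g \<in> L2_fun \<and>
        (\<forall>t. t \<notin> Q \<longrightarrow> g t = 0)}"
  let ?m = "\<lambda>x. (tproj tens (E B) Q (fst x), tproj tens p' Q (snd x))"
  have gen: "?m (tens \<xi> g, tens \<eta> (mulf f g)) \<in> ?G"
    if g: "(\<xi>, \<eta>) \<in> a" "g \<in> L2_fun" "mulf f g \<in> L2_fun" for \<xi> \<eta> g
  proof -
    have e: "?m (tens \<xi> g, tens \<eta> (mulf f g))
        = (tens (E B \<xi>) (\<lambda>t. indicator Q t * g t), tens (p' \<eta>) (mulf f (\<lambda>t. indicator Q t * g t)))"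
      by (simp add: P(3) P'(3) g mulf_indicator)
    have "(\<lambda>t. indicator Q t * g t) \<in> L2_fun" "mulf f (\<lambda>t. indicator Q t * g t) \<in> L2_fun"
      unfolding mulf_indicator by (intro L2_fun_indicator g Q)+
    moreover have "\<forall>t. t \<notin> Q \<longrightarrow> indicator Q t * g t = 0" by simp
    ultimately show ?thesis
      unfolding e using p'(2)[OF g(1)] projection_opD(3)[OF EB_projection, of \<xi>] by blast
  qed
  have sub: "csubspace {x. ?m x \<in> V}" if V: "csubspace V" for V
    by (rule csubspaceI)
      (use csubspace_pairD[OF V] in \<open>auto simp: Pl P'l scaleC_prod_def zero_prod_def\<close>)
  have "b \<subseteq> {x. ?m x \<in> b}"
  proof (rule tensor_minimal[OF sub[OF tensor_csubspace(1)]])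
    have "continuous_on UNIV ?m"
      by (intro continuous_on_Pair bounded_linear.continuous_on[OF bounded_clinearD(1)[OF P(4)]]
          bounded_linear.continuous_on[OF bounded_clinearD(1)[OF P'(4)]] continuous_on_fst continuous_on_snd continuous_on_id)
    then show "closed {x. ?m x \<in> b}"
      using closed_vimage[OF tensor_csubspace(2), of ?m] by (simp add: vimage_def)
    fix \<xi> \<eta> g assume g: "(\<xi>, \<eta>) \<in> a" "g \<in> L2_fun" "mulf f g \<in> L2_fun"
    have "?G \<subseteq> b" using tensor_gen_subset by (auto simp: tensor_gen_def)
    then show "(tens \<xi> g, tens \<eta> (mulf f g)) \<in> {x. ?m x \<in> b}" using gen[OF g] by blast
  qed
  moreover have "cspan (tensor_gen tens a f) \<subseteq> {x. ?m x \<in> cspan ?G}"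
  proof (rule cspan_minimal[OF _ sub[OF csubspace_cspan]])
    show "tensor_gen tens a f \<subseteq> {x. ?m x \<in> cspan ?G}"
    proof
      fix x assume "x \<in> tensor_gen tens a f"
      then obtain \<xi> \<eta> g where x: "x = (tens \<xi> g, tens \<eta> (mulf f g))" and g: "(\<xi>, \<eta>) \<in> a" "g \<in> L2_fun" "mulf f g \<in> L2_fun"
        by (auto simp: tensor_gen_def)
      show "x \<in> {x. ?m x \<in> cspan ?G}" unfolding x using gen[OF g] cspan_superset[of ?G] by blast
    qed
  qed
  ultimately show ?thesis
    using P'(4) projection_opD(2)[OF P'(1)] by (intro exI[of _ "tproj tens p' Q"]) auto
qed

text \<open>The projection and its companion are self-adjoint and preserve the graph as a pair, so
  the projection commutes with \<open>zop b\<close> and hence with every bounded Borel function of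
  |b|.\<close>

lemma tproj_commute:
  assumes g: "bborel g"
  shows "tproj tens (E B) Q (pint F g v) = pint F g (tproj tens (E B) Q v)"
proof -
  note P = tproj[OF tens EB_projection Q]
  obtain P' where P': "\<And>u v. cinner (P' u) v = cinner u (P' v)" "\<And>u v. (u, v) \<in> b \<Longrightarrow> (tproj tens (E B) Q u, P' v) \<in> b"
    using tensor_reduces by blast
  have "zop b (tproj tens (E B) Q w) = tproj tens (E B) Q (zop b w)" for w
    by (rule zop_intertwine[OF tensor_csubspace P'(2) P'(2) projection_opD(2)[OF P(1)] P'(1)])
      (simp_all add: bounded_clinearD[OF P(4)])
  then show ?thesis
    unfolding F_def by (intro modulus_pint_commute[OF tensor_closed_densely_defined P(4) _ g]) simp
qed

text \<open>Transports \<open>gram_inequality\<close> to the closure: an element of the graph whose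
  first component is fixed by the projection is a limit of compressed elements of the algebraic
  span. The remainder takes values in pairs because it will be a sum of two Gram matrices.\<close>

lemma tensor_norm_inequality:
  fixes A C :: real
  assumes gram: "\<And>\<xi> \<eta> g \<xi>' \<eta>' g'. (\<xi>, \<eta>) \<in> a \<Longrightarrow> E B \<xi> = \<xi> \<Longrightarrow> g \<in> L2_fun \<Longrightarrow> mulf f g \<in> L2_fun \<Longrightarrow>
      (\<forall>t. t \<notin> Q \<longrightarrow> g t = 0) \<Longrightarrow> (\<xi>', \<eta>') \<in> a \<Longrightarrow> E B \<xi>' = \<xi>' \<Longrightarrow> g' \<in> L2_fun \<Longrightarrow> mulf f g' \<in> L2_fun \<Longrightarrow>
      (\<forall>t. t \<notin> Q \<longrightarrow> g' t = 0) \<Longrightarrow>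
      complex_of_real A * cinner (tens \<eta> (mulf f g)) (tens \<eta>' (mulf f g'))
        = complex_of_real C * cinner (tens \<xi> g) (tens \<xi>' g') + cinner (r \<xi> \<eta> g :: 'k \<times> 'k) (r \<xi>' \<eta>' g')"
    and x: "(\<zeta>, \<theta>) \<in> b" "tproj tens (E B) Q \<zeta> = \<zeta>"
  shows "C * (norm \<zeta>)\<^sup>2 \<le> A * (norm \<theta>)\<^sup>2"
proof -
  note P = tproj[OF tens EB_projection Q]
  let ?G = "{(tens \<xi> g, tens \<eta> (mulf f g)) | \<xi> \<eta> g. (\<xi>, \<eta>) \<in> a \<and> E B \<xi> = \<xi> \<and> g \<in> L2_fun \<and> mulf f g \<in> L2_fun \<and>
        (\<forall>t. t \<notin> Q \<longrightarrow> g t = 0)}"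
  obtain P' where P': "bounded_clinear P'" "\<And>u v. (u, v) \<in> b \<Longrightarrow> (tproj tens (E B) Q u, P' v) \<in> b"
    "\<And>x. x \<in> cspan (tensor_gen tens a f) \<Longrightarrow> (tproj tens (E B) Q (fst x), P' (snd x)) \<in> cspan ?G"
    using tensor_reduces by blast
  \<comment> \<open>Single-valuedness of \<open>b\<close> makes the companion fix \<theta>, so
    compression changes neither component.\<close>
  have "(\<zeta>, P' \<theta>) \<in> b" using P'(2)[OF x(1)] x(2) by simp
  then have \<theta>: "P' \<theta> = \<theta>"
    using x(1) cdd_props(3)[OF tensor_closed_densely_defined] by (metis single_valuedD)
  let ?I = "{(\<xi>, \<eta>, g). (\<xi>, \<eta>) \<in> a \<and> E B \<xi> = \<xi> \<and> g \<in> L2_fun \<and> mulf f g \<in> L2_fun \<and> (\<forall>t. t \<notin> Q \<longrightarrow> g t = 0)}"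
  let ?u = "\<lambda>(\<xi>, \<eta>, g). tens \<xi> g" and ?v = "\<lambda>(\<xi>, \<eta>, g). tens \<eta> (mulf f g)" and ?r = "\<lambda>(\<xi>, \<eta>, g). r \<xi> \<eta> g"
  have G: "?G = (\<lambda>i. (?u i, ?v i)) ` ?I"
  proof (intro set_eqI iffI)
    fix x assume "x \<in> ?G"
    then obtain \<xi> \<eta> g where x: "x = (tens \<xi> g, tens \<eta> (mulf f g))" and i: "(\<xi>, \<eta>, g) \<in> ?I" by blast
    show "x \<in> (\<lambda>i. (?u i, ?v i)) ` ?I" by (rule image_eqI[OF _ i]) (simp add: x)
  next
    fix x assume "x \<in> (\<lambda>i. (?u i, ?v i)) ` ?I"
    then show "x \<in> ?G" by (clarsimp) blast
  qed
  have le: "C * (norm (fst y))\<^sup>2 \<le> A * (norm (snd y))\<^sup>2" if "y \<in> cspan ?G" for y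
  proof (rule gram_inequality[where I = ?I and u = ?u and v = ?v and r = ?r])
    show "y \<in> cspan ((\<lambda>i. (?u i, ?v i)) ` ?I)" using that unfolding G .
    fix i j assume "i \<in> ?I" "j \<in> ?I"
    then obtain \<xi> \<eta> g \<xi>' \<eta>' g' where "i = (\<xi>, \<eta>, g)" "j = (\<xi>', \<eta>', g')"
      "(\<xi>, \<eta>) \<in> a" "E B \<xi> = \<xi>" "g \<in> L2_fun" "mulf f g \<in> L2_fun" "\<forall>t. t \<notin> Q \<longrightarrow> g t = 0"
      "(\<xi>', \<eta>') \<in> a" "E B \<xi>' = \<xi>'" "g' \<in> L2_fun" "mulf f g' \<in> L2_fun" "\<forall>t. t \<notin> Q \<longrightarrow> g' t = 0" by blast
    then show "complex_of_real A * cinner (?v i) (?v j) = complex_of_real C * cinner (?u i) (?u j) + cinner (?r i) (?r j)"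
      using gram[of \<xi> \<eta> g \<xi>' \<eta>' g'] by simp
  qed
  obtain X where X: "\<And>n. X n \<in> cspan (tensor_gen tens a f)" "X \<longlonglongrightarrow> (\<zeta>, \<theta>)"
    using x(1) unfolding b_def closure_sequential by blast
  have l: "(\<lambda>n. tproj tens (E B) Q (fst (X n))) \<longlonglongrightarrow> tproj tens (E B) Q \<zeta>" "(\<lambda>n. P' (snd (X n))) \<longlonglongrightarrow> P' \<theta>"
    using bounded_clinear_tendsto[OF P(4) tendsto_fst[OF X(2)]] bounded_clinear_tendsto[OF P'(1) tendsto_snd[OF X(2)]] by auto
  have "C * (norm (tproj tens (E B) Q \<zeta>))\<^sup>2 \<le> A * (norm (P' \<theta>))\<^sup>2"
  proof (rule LIMSEQ_le)
    show "(\<lambda>n. C * (norm (tproj tens (E B) Q (fst (X n))))\<^sup>2) \<longlonglongrightarrow> C * (norm (tproj tens (E B) Q \<zeta>))\<^sup>2"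
      by (intro tendsto_intros l)
    show "(\<lambda>n. A * (norm (P' (snd (X n))))\<^sup>2) \<longlonglongrightarrow> A * (norm (P' \<theta>))\<^sup>2" by (intro tendsto_intros l)
    show "\<exists>N. \<forall>n\<ge>N. C * (norm (tproj tens (E B) Q (fst (X n))))\<^sup>2 \<le> A * (norm (P' (snd (X n))))\<^sup>2"
      using le[OF P'(3)[OF X(1)]] by auto
  qed
  then show ?thesis using \<theta> x(2) by simp
qed

text \<open>On the range of \<open>E B\<close> the square of |a| is a constant plus \<open>k\<close>
  times a square. With \<open>k = 1\<close> or \<open>k = - 1\<close> the square becomes part of the
  remainder in a Gram identity for a lower or an upper bound.\<close>

lemma gram_spectral_part:
  assumes "(\<xi>, \<eta>) \<in> a" "(\<xi>', \<eta>') \<in> a" "E B \<xi>' = \<xi>'"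
    and h: "bborel h" "\<And>s. s \<in> B \<Longrightarrow> s\<^sup>2 = c + k * (h s)\<^sup>2" "\<And>s. s \<notin> B \<Longrightarrow> h s = 0"
  shows "cinner \<eta> \<eta>' = complex_of_real c * cinner \<xi> \<xi>' + complex_of_real k * cinner (pint E h \<xi>) (pint E h \<xi>')"
proof -
  note E = modulus_spectral_pvm(1)[OF a, folded E_def]
  obtain \<eta>'' where e: "(E B \<xi>', \<eta>'') \<in> a" "(\<eta>'', pint E (\<lambda>s. s\<^sup>2 * indicator B s) \<xi>') \<in> adj a"
    using spectral_subspace_domain[OF a B] unfolding E_def by blast
  have "\<eta>'' = \<eta>'" using e(1) assms(2,3) cdd_props(3)[OF a] by (metis single_valuedD)
  then have "cinner \<eta> \<eta>' = cinner \<xi> (pint E (\<lambda>s. s\<^sup>2 * indicator B s) \<xi>')"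
    using e(2) assms(1) unfolding adj_iff by blast
  also have "(\<lambda>s. s\<^sup>2 * indicator B s) = (\<lambda>s. c * indicator B s + k * (h s * h s))"
    using h(2,3) by (auto simp: indicator_def fun_eq_iff power2_eq_square)
  also have "pint E (\<lambda>s. c * indicator B s + k * (h s * h s)) \<xi>' = c *\<^sub>R E B \<xi>' + k *\<^sub>R pint E h (pint E h \<xi>')"
  proof -
    have b: "bborel (\<lambda>s. c * indicator B s)" "bborel (\<lambda>s. h s * h s)" "bborel (\<lambda>s. k * (h s * h s))"
      by (intro bborel_cmult bborel_indicator bborel_mult B h)+
    show ?thesis
      unfolding pint_add[OF E b(1,3)] pint_cmult[OF E bborel_indicator[OF B(1)]] pint_cmult[OF E b(2)]
        pint_mult[OF E h(1) h(1)] pint_indicator[OF E B(1)] ..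
  qed
  finally show ?thesis
    by (simp add: assms(3) cinner_add_right cinner_scaleR_right pint_adjoint[OF E h(1)])
qed

end

end

text \<open>The counterpart of \<open>gram_spectral_part\<close> for the multiplication
  factor.\<close>

lemma integral_mulf_split:
  assumes g: "g \<in> L2_fun" "h \<in> L2_fun" "mulf Y g \<in> L2_fun" "mulf Y h \<in> L2_fun"
    and e: "\<And>t. g t \<noteq> 0 \<Longrightarrow> (f t)\<^sup>2 = d + k * (Y t)\<^sup>2"
  shows "(\<integral>t. cnj (mulf f g t) * mulf f h t \<partial>lborel) = complex_of_real d * (\<integral>t. cnj (g t) * h t \<partial>lborel)
    + complex_of_real k * (\<integral>t. cnj (mulf Y g t) * mulf Y h t \<partial>lborel)"
proof -
  have "cnj (mulf f g t) * mulf f h t = complex_of_real d * (cnj (g t) * h t)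
      + complex_of_real k * (cnj (mulf Y g t) * mulf Y h t)" for t
  proof (cases "g t = 0")
    case False
    have "cnj (mulf f g t) * mulf f h t = complex_of_real ((f t)\<^sup>2) * (cnj (g t) * h t)"
      by (simp add: mulf_def power2_eq_square)
    then show ?thesis unfolding e[OF False] by (simp add: mulf_def power2_eq_square algebra_simps)
  qed (simp add: mulf_def)
  then show ?thesis
    using L2_fun_integrable[OF g(1,2)] L2_fun_integrable[OF g(3,4)] by simp
qed

section \<open>Geometric cells of the positive half-line\<close>

definition geom_pt :: "real \<Rightarrow> nat \<Rightarrow> real" where
  "geom_pt r k = r powr of_int (int_decode k)"

text \<open>\<open>int_decode\<close> enumerates the integer exponents by naturals, so that sums
  over cells are ordinary series.\<close>

definition geom_cell :: "real \<Rightarrow> nat \<Rightarrow> real set" where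
  "geom_cell r k = {x. 0 < x \<and> \<lfloor>log r x\<rfloor> = int_decode k}"

lemma geom_cell_borel: "geom_cell r k \<in> sets borel"
  unfolding geom_cell_def by measurable

lemma geom_pt_pos: "0 < r \<Longrightarrow> 0 < geom_pt r k"
  by (simp add: geom_pt_def)

lemma geom_cell_bounds:
  assumes "1 < r" "x \<in> geom_cell r k"
  shows "geom_pt r k \<le> x" "x \<le> r * geom_pt r k" "0 < x"
proof -
  have x: "0 < x" "of_int (int_decode k) \<le> log r x" "log r x \<le> of_int (int_decode k) + 1"
    using assms(2) by (auto simp: geom_cell_def) linarith+
  show "0 < x" by (rule x)
  show "geom_pt r k \<le> x" using x(2) assms(1) x(1) by (simp add: geom_pt_def le_log_iff)
  have "x \<le> r powr (of_int (int_decode k) + 1)" using x(3) assms(1) x(1) by (simp add: log_le_iff)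
  then show "x \<le> r * geom_pt r k" using assms(1) by (simp add: geom_pt_def powr_add mult.commute)
qed

lemma geom_cell_disjoint: "disjoint_family (geom_cell r)"
  by (auto simp: disjoint_family_on_def geom_cell_def int_decode_eq)

lemma geom_cell_cover: "(\<Union>k. geom_cell r k) = {0<..}"
proof (intro set_eqI iffI)
  fix x :: real assume "x \<in> {0<..}"
  then have "x \<in> geom_cell r (int_encode \<lfloor>log r x\<rfloor>)" by (simp add: geom_cell_def)
  then show "x \<in> (\<Union>k. geom_cell r k)" by blast
qed (auto simp: geom_cell_def)

context
  fixes tens :: "'h::chilbert \<Rightarrow> (real \<Rightarrow> complex) \<Rightarrow> 'k::chilbert" and a :: "'h unbdd" and f :: "real \<Rightarrow> real" and b
    and E :: "real set \<Rightarrow> 'h op"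
  assumes tens: "hilbert_tensor_L2 tens" and a: "closed_densely_defined_op a"
    and f: "f \<in> borel_measurable borel" and f0: "\<And>t. 0 \<le> f t"
  defines "b \<equiv> closure (cspan (tensor_gen tens a f))"
    and "E \<equiv> spectral_measure (modulus a)"
begin

text \<open>The pointwise identity behind it is s^2 f^2 = c^2 d^2 + c^2 (f^2 - d^2) + (s^2 - c^2)
  f^2; the last two terms are the two components of the remainder.\<close>

lemma tensor_lower:
  assumes B: "B \<in> sets borel" "B \<subseteq> {c..real n}" "0 \<le> c" and Q: "Q \<in> sets borel" "Q \<subseteq> {t. d \<le> f t}" "0 \<le> d"
    and x: "(\<zeta>, \<theta>) \<in> b" "tproj tens (E B) Q \<zeta> = \<zeta>"
  shows "(c * d)\<^sup>2 * (norm \<zeta>)\<^sup>2 \<le> (norm \<theta>)\<^sup>2"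
proof -
  have B': "B \<subseteq> {0..real n}" using B by force
  let ?h = "\<lambda>s. sqrt (s\<^sup>2 - c\<^sup>2) * indicator B s" and ?Y = "\<lambda>t. sqrt ((f t)\<^sup>2 - d\<^sup>2)"
  have cs: "c\<^sup>2 \<le> s\<^sup>2" "s\<^sup>2 \<le> (real n)\<^sup>2" if "s \<in> B" for s using that B by (auto intro!: power_mono)
  have h: "bborel ?h"
  proof (rule bborelI[of _ "real n"])
    have [measurable]: "B \<in> sets borel" by (rule B)
    show "?h \<in> borel_measurable borel" by measurable
    show "\<bar>?h s\<bar> \<le> real n" for s
      using cs[of s] by (auto simp: indicator_def real_sqrt_le_iff' intro!: real_le_lsqrt intro: order_trans[of _ "s\<^sup>2"])
  qed
  have dt: "d\<^sup>2 \<le> (f t)\<^sup>2" if "t \<in> Q" for t using that Q by (auto intro!: power_mono)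
  have Ym [measurable]: "?Y \<in> borel_measurable borel" using f by measurable
  have YL: "mulf ?Y g \<in> L2_fun" if g: "g \<in> L2_fun" "mulf f g \<in> L2_fun" "\<forall>t. t \<notin> Q \<longrightarrow> g t = 0" for g
  proof (rule L2_fun_dominated[OF g(2)])
    have [measurable]: "g \<in> borel_measurable borel" by (rule L2_fun_meas[OF g(1)])
    show "mulf ?Y g \<in> borel_measurable borel" unfolding mulf_def by measurable
    show "cmod (mulf ?Y g t) \<le> cmod (mulf f g t)" for t
    proof (cases "g t = 0")
      case False
      then have "t \<in> Q" using g(3) by blast
      have "sqrt ((f t)\<^sup>2 - d\<^sup>2) \<le> sqrt ((f t)\<^sup>2)" by (intro real_sqrt_le_mono) simp
      then have "\<bar>?Y t\<bar> \<le> \<bar>f t\<bar>" using dt[OF \<open>t \<in> Q\<close>] by simp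
      then show ?thesis by (simp add: mulf_def norm_mult mult_right_mono)
    qed (simp add: mulf_def)
  qed
  have "(c * d)\<^sup>2 * (norm \<zeta>)\<^sup>2 \<le> 1 * (norm \<theta>)\<^sup>2"
  proof (rule tensor_norm_inequality[OF tens a f B(1) B' Q(1), folded E_def b_def,
        where r = "\<lambda>\<xi> \<eta> g. (c *\<^sub>R tens \<xi> (mulf ?Y g), tens (pint E ?h \<xi>) (mulf f g))", OF _ x])
    fix \<xi> \<eta> \<xi>' \<eta>' and g g' :: "real \<Rightarrow> complex"
    assume 1: "(\<xi>, \<eta>) \<in> a" "E B \<xi> = \<xi>" "g \<in> L2_fun" "mulf f g \<in> L2_fun" "\<forall>t. t \<notin> Q \<longrightarrow> g t = 0"
      and 2: "(\<xi>', \<eta>') \<in> a" "E B \<xi>' = \<xi>'" "g' \<in> L2_fun" "mulf f g' \<in> L2_fun" "\<forall>t. t \<notin> Q \<longrightarrow> g' t = 0"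
    define X H I J K where "X = cinner \<xi> \<xi>'" and "H = cinner (pint E ?h \<xi>) (pint E ?h \<xi>')"
      and "I = (\<integral>t. cnj (g t) * g' t \<partial>lborel)" and "J = (\<integral>t. cnj (mulf f g t) * mulf f g' t \<partial>lborel)"
      and "K = (\<integral>t. cnj (mulf ?Y g t) * mulf ?Y g' t \<partial>lborel)"
    have e: "cinner \<eta> \<eta>' = complex_of_real (c\<^sup>2) * X + complex_of_real 1 * H"
      unfolding X_def H_def
      by (rule gram_spectral_part[OF tens a f B(1) B' Q(1), folded E_def, OF 1(1) 2(1,2) h])
        (use cs in auto)
    have J: "J = complex_of_real (d\<^sup>2) * I + complex_of_real 1 * K"
      unfolding I_def J_def K_def
      by (rule integral_mulf_split[OF 1(3) 2(3) YL[OF 1(3-5)] YL[OF 2(3-5)]]) (use dt 1(5) in force)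
    have "complex_of_real 1 * (cinner \<eta> \<eta>' * J) = complex_of_real ((c * d)\<^sup>2) * (X * I) + (complex_of_real (c\<^sup>2) * (X * K) + H * J)"
      unfolding e distrib_right by (subst (1) J) (simp add: algebra_simps power_mult_distrib)
    then show "complex_of_real 1 * cinner (tens \<eta> (mulf f g)) (tens \<eta>' (mulf f g'))
        = complex_of_real ((c * d)\<^sup>2) * cinner (tens \<xi> g) (tens \<xi>' g')
          + cinner (c *\<^sub>R tens \<xi> (mulf ?Y g), tens (pint E ?h \<xi>) (mulf f g)) (c *\<^sub>R tens \<xi>' (mulf ?Y g'), tens (pint E ?h \<xi>') (mulf f g'))"
      unfolding cinner_prod_def fst_conv snd_conv cinner_scaleR_left cinner_scaleR_right
        tens_inner[OF tens 1(3) 2(3)] tens_inner[OF tens 1(4) 2(4)] tens_inner[OF tens YL[OF 1(3-5)] YL[OF 2(3-5)]]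
        X_def H_def I_def J_def K_def by (simp add: power2_eq_square mult.assoc)
  qed
  then show ?thesis by simp
qed

text \<open>Here c^2 d^2 - s^2 f^2 = s^2 (d^2 - f^2) + d^2 (c^2 - s^2), so the Gram identity is used
  with negative constants, - 1 and minus the square of \<open>c * d\<close>.\<close>

lemma tensor_upper:
  assumes B: "B \<in> sets borel" "B \<subseteq> {0..c}" and Q: "Q \<in> sets borel" "Q \<subseteq> {t. f t \<le> d}"
    and x: "(\<zeta>, \<theta>) \<in> b" "tproj tens (E B) Q \<zeta> = \<zeta>"
  shows "(norm \<theta>)\<^sup>2 \<le> (c * d)\<^sup>2 * (norm \<zeta>)\<^sup>2"
proof -
  obtain n where "c \<le> real n" using real_arch_simple by blast
  then have B': "B \<subseteq> {0..real n}" using B by force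
  let ?h = "\<lambda>s. sqrt (c\<^sup>2 - s\<^sup>2) * indicator B s" and ?Y = "\<lambda>t. sqrt (d\<^sup>2 - (f t)\<^sup>2)"
  have cs: "s\<^sup>2 \<le> c\<^sup>2" "0 \<le> c" if "s \<in> B" for s using that B by (auto intro!: power_mono)
  have h: "bborel ?h"
  proof (rule bborelI[of _ "\<bar>c\<bar>"])
    have [measurable]: "B \<in> sets borel" by (rule B)
    show "?h \<in> borel_measurable borel" by measurable
    show "\<bar>?h s\<bar> \<le> \<bar>c\<bar>" for s
      using cs[of s] by (auto simp: indicator_def intro!: real_le_lsqrt)
  qed
  have dt: "(f t)\<^sup>2 \<le> d\<^sup>2" "0 \<le> d" if "t \<in> Q" for t
    using that Q f0[of t] by (auto intro!: power_mono intro: order_trans)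
  have Ym [measurable]: "?Y \<in> borel_measurable borel" using f by measurable
  have YL: "mulf ?Y g \<in> L2_fun" if g: "g \<in> L2_fun" "\<forall>t. t \<notin> Q \<longrightarrow> g t = 0" for g
  proof (rule mulf_L2[OF Ym g(1), of "\<bar>d\<bar>"])
    fix t assume "g t \<noteq> 0"
    then have "t \<in> Q" using g(2) by blast
    then show "\<bar>?Y t\<bar> \<le> \<bar>d\<bar>" using dt by (auto intro!: real_le_lsqrt)
  qed simp
  have "- ((c * d)\<^sup>2) * (norm \<zeta>)\<^sup>2 \<le> - 1 * (norm \<theta>)\<^sup>2"
  proof (rule tensor_norm_inequality[OF tens a f B(1) B' Q(1), folded E_def b_def,
        where r = "\<lambda>\<xi> \<eta> g. (tens \<eta> (mulf ?Y g), d *\<^sub>R tens (pint E ?h \<xi>) g)", OF _ x])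
    fix \<xi> \<eta> \<xi>' \<eta>' and g g' :: "real \<Rightarrow> complex"
    assume 1: "(\<xi>, \<eta>) \<in> a" "E B \<xi> = \<xi>" "g \<in> L2_fun" "mulf f g \<in> L2_fun" "\<forall>t. t \<notin> Q \<longrightarrow> g t = 0"
      and 2: "(\<xi>', \<eta>') \<in> a" "E B \<xi>' = \<xi>'" "g' \<in> L2_fun" "mulf f g' \<in> L2_fun" "\<forall>t. t \<notin> Q \<longrightarrow> g' t = 0"
    define X H I J K e where "X = cinner \<xi> \<xi>'" and "H = cinner (pint E ?h \<xi>) (pint E ?h \<xi>')"
      and "I = (\<integral>t. cnj (g t) * g' t \<partial>lborel)" and "J = (\<integral>t. cnj (mulf f g t) * mulf f g' t \<partial>lborel)"
      and "K = (\<integral>t. cnj (mulf ?Y g t) * mulf ?Y g' t \<partial>lborel)" and "e = cinner \<eta> \<eta>'"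
    have e: "e = complex_of_real (c\<^sup>2) * X + complex_of_real (- 1) * H"
      unfolding X_def H_def e_def
      by (rule gram_spectral_part[OF tens a f B(1) B' Q(1), folded E_def, OF 1(1) 2(1,2) h])
        (use cs in auto)
    have J: "J = complex_of_real (d\<^sup>2) * I + complex_of_real (- 1) * K"
      unfolding I_def J_def K_def
      by (rule integral_mulf_split[OF 1(3) 2(3) YL[OF 1(3,5)] YL[OF 2(3,5)]]) (use dt 1(5) in force)
    have "complex_of_real (- 1) * (e * J) = e * K - complex_of_real (d\<^sup>2) * (e * I)"
      unfolding J by (simp add: algebra_simps)
    also have "complex_of_real (d\<^sup>2) * (e * I) = complex_of_real ((c * d)\<^sup>2) * (X * I) - complex_of_real (d\<^sup>2) * (H * I)"
      unfolding e by (simp add: algebra_simps power_mult_distrib)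
    finally have "complex_of_real (- 1) * (e * J) = complex_of_real (- ((c * d)\<^sup>2)) * (X * I) + (e * K + complex_of_real (d\<^sup>2) * (H * I))"
      by simp
    then show "complex_of_real (- 1) * cinner (tens \<eta> (mulf f g)) (tens \<eta>' (mulf f g'))
        = complex_of_real (- ((c * d)\<^sup>2)) * cinner (tens \<xi> g) (tens \<xi>' g')
          + cinner (tens \<eta> (mulf ?Y g), d *\<^sub>R tens (pint E ?h \<xi>) g) (tens \<eta>' (mulf ?Y g'), d *\<^sub>R tens (pint E ?h \<xi>') g')"
      unfolding cinner_prod_def fst_conv snd_conv cinner_scaleR_left cinner_scaleR_right
        tens_inner[OF tens 1(3) 2(3)] tens_inner[OF tens 1(4) 2(4)] tens_inner[OF tens YL[OF 1(3,5)] YL[OF 2(3,5)]]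
        X_def H_def I_def J_def K_def e_def by (simp add: power2_eq_square mult.assoc)
  qed
  then show ?thesis by simp
qed

end

context
  fixes tens :: "'h::chilbert \<Rightarrow> (real \<Rightarrow> complex) \<Rightarrow> 'k::chilbert" and a :: "'h unbdd" and f :: "real \<Rightarrow> real" and b
    and E :: "real set \<Rightarrow> 'h op" and F :: "real set \<Rightarrow> 'k op"
  assumes tens: "hilbert_tensor_L2 tens" and a: "closed_densely_defined_op a"
    and f: "f \<in> borel_measurable borel" and f0: "\<forall>t. 0 \<le> f t"
  defines "b \<equiv> closure (cspan (tensor_gen tens a f))"
    and "E \<equiv> spectral_measure (modulus a)" and "F \<equiv> spectral_measure (modulus b)"
begin

lemma tensor_modulus_pvms: "closed_densely_defined_op b" "supported_pvm {0..} E" "supported_pvm {0..} F"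
    "projection_valued_measure E" "projection_valued_measure F"
proof -
  show b: "closed_densely_defined_op b" unfolding b_def by (rule tensor_closed_densely_defined[OF tens a f])
  show "supported_pvm {0..} E" unfolding E_def by (rule modulus_spectral_pvm(1)[OF a])
  then show "projection_valued_measure E" by (simp add: supported_pvm_def)
  show "supported_pvm {0..} F" unfolding F_def by (rule modulus_spectral_pvm(1)[OF b])
  then show "projection_valued_measure F" by (simp add: supported_pvm_def)
qed

lemma factor_projection: "B \<in> sets borel \<Longrightarrow> projection_op (E B)"
  by (rule pvm_projection[OF tensor_modulus_pvms(4)])

lemma tensor_projection: "B \<in> sets borel \<Longrightarrow> projection_op (F B)"
  by (rule pvm_projection[OF tensor_modulus_pvms(5)])

lemma tproj_spectral_commute:
  assumes "B \<in> sets borel" "B \<subseteq> {0..c}" "Q \<in> sets borel" "X \<in> sets borel"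
  shows "tproj tens (E B) Q (F X v) = F X (tproj tens (E B) Q v)"
proof -
  obtain n where "c \<le> real n" using real_arch_simple by blast
  then have B: "B \<subseteq> {0..real n}" using assms(2) by force
  show ?thesis
    using tproj_commute[OF tens a f assms(1) B assms(3) bborel_indicator[OF assms(4)], of v]
      pint_indicator[OF tensor_modulus_pvms(3) assms(4)]
    by (simp add: E_def F_def b_def)
qed

text \<open>By commutation, the part of \<open>tproj tens (E B) Q v\<close> in the window
  \<open>{0..c'}\<close> stays in the range of the projection. There the norm of \<open>b\<close> is
  at least \<open>c * d\<close> and at most \<open>c'\<close> times that of the vector, so this part
  is 0.\<close>

lemma tproj_above_threshold:
  assumes B: "B \<in> sets borel" "B \<subseteq> {c..m}" "0 \<le> c" and Q: "Q \<in> sets borel" "Q \<subseteq> {t. d \<le> f t}" "0 \<le> d"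
    and c': "0 \<le> c'" "c' < c * d"
  shows "F {c'<..} (tproj tens (E B) Q v) = tproj tens (E B) Q v"
proof -
  obtain n where "m \<le> real n" using real_arch_simple by blast
  then have Bn: "B \<subseteq> {c..real n}" using B by force
  have B0: "B \<subseteq> {0..m}" using B by force
  note P = projection_opD[OF tproj(1)[OF tens factor_projection[OF B(1)] Q(1)]]
  let ?v = "tproj tens (E B) Q v" and ?\<zeta> = "F {0..c'} (tproj tens (E B) Q v)"
  have z: "tproj tens (E B) Q ?\<zeta> = ?\<zeta>"
    by (subst tproj_spectral_commute[OF B(1) B0 Q(1)]) (simp_all add: P(3))
  obtain \<theta> where t: "(?\<zeta>, \<theta>) \<in> b" "(norm \<theta>)\<^sup>2 \<le> c'\<^sup>2 * (norm ?\<zeta>)\<^sup>2"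
    using spectral_subspace_norm[OF tensor_modulus_pvms(1), of "{0..c'}" 0 c' ?v] by (auto simp: F_def)
  have "(c * d)\<^sup>2 * (norm ?\<zeta>)\<^sup>2 \<le> (norm \<theta>)\<^sup>2"
    using tensor_lower[OF tens a f _ B(1) Bn B(3) Q, folded b_def E_def, OF _ t(1) z] f0 by blast
  then have "(c * d)\<^sup>2 * (norm ?\<zeta>)\<^sup>2 \<le> c'\<^sup>2 * (norm ?\<zeta>)\<^sup>2" using t(2) by linarith
  moreover have "c'\<^sup>2 < (c * d)\<^sup>2" using c' by (intro power_strict_mono) auto
  ultimately have "?\<zeta> = 0"
    using mult_strict_right_mono[of "c'\<^sup>2" "(c * d)\<^sup>2" "(norm ?\<zeta>)\<^sup>2"] by fastforce
  moreover have "pint F (\<lambda>s. indicator {0..c'} s + indicator {c'<..} s) = pint F (\<lambda>s. 1)"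
    by (rule pint_cong[OF tensor_modulus_pvms(3) bborel_add[OF bborel_indicator bborel_indicator] bborel_const])
      (auto simp: indicator_def)
  then have "F {0..c'} ?v + F {c'<..} ?v = ?v"
    using pint_add[OF tensor_modulus_pvms(3), of "indicator {0..c'}" "indicator {c'<..}" ?v] pint_one[OF tensor_modulus_pvms(3)]
    by (simp add: pint_indicator[OF tensor_modulus_pvms(3)])
  ultimately show ?thesis by simp
qed

text \<open>The same contradiction with the inequalities reversed. Norm bounds come from bounded
  windows, so \<open>{c'<..h}\<close> is treated first and then \<open>h\<close> grows.\<close>

lemma tproj_below_threshold:
  assumes B: "B \<in> sets borel" "B \<subseteq> {0..c}" and Q: "Q \<in> sets borel" "Q \<subseteq> {t. f t \<le> d}"
    and c': "0 \<le> c * d" "c * d < c'"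
  shows "F {c'<..} (tproj tens (E B) Q v) = 0"
proof -
  note P = projection_opD[OF tproj(1)[OF tens factor_projection[OF B(1)] Q(1)]]
  let ?v = "tproj tens (E B) Q v"
  have "F {c'<..h} ?v = 0" for h
  proof -
    let ?\<zeta> = "F {c'<..h} ?v"
    have z: "tproj tens (E B) Q ?\<zeta> = ?\<zeta>"
      by (subst tproj_spectral_commute[OF B Q(1)]) (simp_all add: P(3))
    have "{c'<..h} \<subseteq> {c'..h}" by auto
    then obtain \<theta> where t: "(?\<zeta>, \<theta>) \<in> b" "c'\<^sup>2 * (norm ?\<zeta>)\<^sup>2 \<le> (norm \<theta>)\<^sup>2"
      using spectral_subspace_norm[OF tensor_modulus_pvms(1), of "{c'<..h}" c' h ?v] c' by (auto simp: F_def)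
    have "(norm \<theta>)\<^sup>2 \<le> (c * d)\<^sup>2 * (norm ?\<zeta>)\<^sup>2"
      using tensor_upper[OF tens a f _ B Q, folded b_def E_def, OF _ t(1) z] f0 by blast
    then have "c'\<^sup>2 * (norm ?\<zeta>)\<^sup>2 \<le> (c * d)\<^sup>2 * (norm ?\<zeta>)\<^sup>2" using t(2) by linarith
    moreover have "(c * d)\<^sup>2 < c'\<^sup>2" using c' by (intro power_strict_mono) auto
    ultimately show ?thesis
      using mult_strict_right_mono[of "(c * d)\<^sup>2" "c'\<^sup>2" "(norm ?\<zeta>)\<^sup>2"] by fastforce
  qed
  then have "(\<lambda>n. F {c'<..real n} ?v) \<longlonglongrightarrow> 0" by simp
  moreover have "(\<lambda>n. pint F (indicator {c'<..real n}) ?v) \<longlonglongrightarrow> pint F (indicator {c'<..}) ?v"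
  proof (rule pint_tendsto[OF tensor_modulus_pvms(3), of _ _ 1])
    fix s
    obtain N where "s \<le> real N" using real_arch_simple by blast
    then have "\<forall>n\<ge>N. indicator {c'<..real n} s = (indicator {c'<..} s :: real)" by (auto simp: indicator_def)
    then show "(\<lambda>n. indicator {c'<..real n} s :: real) \<longlonglongrightarrow> indicator {c'<..} s"
      by (intro tendsto_eventually) (auto simp: eventually_sequentially)
  qed (auto split: split_indicator)
  ultimately show ?thesis by (simp add: pint_indicator[OF tensor_modulus_pvms(3)] LIMSEQ_unique)
qed

text \<open>\<open>f\<close> has no upper bound in general, so the estimate is applied with
  \<open>c = 0\<close> on the sets where \<open>f\<close> is at most \<open>m\<close>; the product
  of the two bounds is 0 for each \<open>m\<close>.\<close>

lemma tproj_kernel_part: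
  assumes "0 < c'" shows "F {c'<..} (tproj tens (E {0}) UNIV v) = 0"
proof -
  define Q where "Q m = {t. f t \<le> real m}" for m
  have Q: "Q m \<in> sets borel" for m unfolding Q_def using f by measurable
  have E0: "projection_op (E {0})" by (rule factor_projection) simp
  have "(\<lambda>m. tproj tens (E {0}) (Q m) v) \<longlonglongrightarrow> tproj tens (E {0}) UNIV v"
  proof (rule tens_operator_tendsto[OF tens tproj(4)[OF tens E0 Q] _ tproj(4)[OF tens E0]])
    show "norm (tproj tens (E {0}) (Q m) u) \<le> norm u" for m u
      by (rule projection_opD[OF tproj(1)[OF tens E0 Q]])
    fix \<xi> and g :: "real \<Rightarrow> complex" assume g: "g \<in> L2_fun"
    have "(\<lambda>m. tens (E {0} \<xi>) (\<lambda>t. indicator (Q m) t * g t)) \<longlonglongrightarrow> tens (E {0} \<xi>) g"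
    proof (rule tens_tendsto_indicator[OF tens g Q])
      fix t
      obtain N where "f t \<le> real N" using real_arch_simple by blast
      then show "\<forall>\<^sub>F m in sequentially. t \<in> Q m"
        by (auto simp: Q_def eventually_sequentially intro!: exI[of _ N])
    qed
    then show "(\<lambda>m. tproj tens (E {0}) (Q m) (tens \<xi> g)) \<longlonglongrightarrow> tproj tens (E {0}) UNIV (tens \<xi> g)"
      by (simp add: tproj(3)[OF tens E0 Q g] tproj(3)[OF tens E0 _ g])
  qed simp
  from bounded_clinear_tendsto[OF projection_opD(1)[OF tensor_projection] this, of "{c'<..}"]
  have "(\<lambda>m. F {c'<..} (tproj tens (E {0}) (Q m) v)) \<longlonglongrightarrow> F {c'<..} (tproj tens (E {0}) UNIV v)" by simp
  moreover have "F {c'<..} (tproj tens (E {0}) (Q m) v) = 0" for m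
    by (rule tproj_below_threshold[of _ 0 _ "real m"]) (use assms Q in \<open>auto simp: Q_def\<close>)
  ultimately show ?thesis by (simp add: LIMSEQ_const_iff)
qed

context
  fixes r e :: real
  assumes r: "1 < r" and e: "0 < e"
begin

definition cell_proj :: "nat \<Rightarrow> 'k op" where
  "cell_proj k = tproj tens (E (geom_cell r k)) {t. e / geom_pt r k < f t}"

lemma cell_sets: "{t. e / geom_pt r k < f t} \<in> sets borel" "{t. f t \<le> e / geom_pt r k} \<in> sets borel"
  using f by measurable

lemma cell_subset: "geom_cell r k \<subseteq> {geom_pt r k..r * geom_pt r k}" "geom_cell r k \<subseteq> {0..r * geom_pt r k}"
  using geom_cell_bounds[OF r, of _ k] by (auto simp: less_imp_le)

lemma cell_proj_projection: "projection_op (cell_proj k)"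
  unfolding cell_proj_def by (rule tproj(1)[OF tens factor_projection[OF geom_cell_borel] cell_sets(1)])

lemma cell_proj_commute: "X \<in> sets borel \<Longrightarrow> cell_proj k (F X v) = F X (cell_proj k v)"
  unfolding cell_proj_def by (rule tproj_spectral_commute[OF geom_cell_borel cell_subset(2) cell_sets(1)])

text \<open>On cell \<open>k\<close> the lower bounds of the two factors are
  \<open>geom_pt r k\<close> and \<open>e / geom_pt r k\<close>, with product \<open>e\<close> for
  every \<open>k\<close>.\<close>

lemma cell_proj_low:
  assumes "0 \<le> c'" "c' < e" shows "F {c'<..} (cell_proj k v) = cell_proj k v"
  unfolding cell_proj_def
  by (rule tproj_above_threshold[OF geom_cell_borel cell_subset(1) _ cell_sets(1), where d = "e / geom_pt r k"])
    (use geom_pt_pos[of r k] r e assms in auto)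

lemma cell_proj_orth: "j \<noteq> k \<Longrightarrow> cell_proj j (cell_proj k v) = 0"
proof -
  assume jk: "j \<noteq> k"
  note P = tproj[OF tens factor_projection[OF geom_cell_borel] cell_sets(1)]
  have "geom_cell r j \<inter> geom_cell r k = {}" using geom_cell_disjoint[of r] jk by (auto simp: disjoint_family_on_def)
  then have Z: "E (geom_cell r j) (E (geom_cell r k) \<xi>) = 0" for \<xi>
    by (simp add: pvm_Int[OF tensor_modulus_pvms(4) geom_cell_borel geom_cell_borel] pvm_empty[OF tensor_modulus_pvms(4)])
  have t0: "tens 0 g = 0" if "g \<in> L2_fun" for g using tens_diff_left[OF tens that, of 0 0] by simp
  have "cell_proj j \<circ> cell_proj k = (\<lambda>v. 0)"
  proof (rule tens_operator_ext[OF tens])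
    show "bounded_clinear (cell_proj j \<circ> cell_proj k)"
      by (intro bounded_clinear_comp projection_opD(1)[OF cell_proj_projection])
    show "(cell_proj j \<circ> cell_proj k) (tens \<xi> g) = 0" if g: "g \<in> L2_fun" for \<xi> g
      unfolding cell_proj_def
      by (simp add: P(3) g L2_fun_indicator cell_sets Z t0)
  qed (rule bounded_clinear_zero)
  then show ?thesis by (auto simp: fun_eq_iff)
qed

text \<open>The identity splits into the kernel part, the cell projections and their complements
  \<open>?P' k\<close> within the cells, on which |b| is at most \<open>r * e\<close>. The first and
  the last are annihilated by \<open>F {c'<..}\<close>.\<close>

lemma cell_proj_sums:
  assumes c': "r * e < c'"
  shows "(\<lambda>k. cell_proj k (F {c'<..} v)) sums F {c'<..} v"
proof -
  define C where "C N = {0} \<union> (\<Union>k<N. geom_cell r k)" for N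
  have CB: "C N \<in> sets borel" for N unfolding C_def using geom_cell_borel by (intro sets.Un sets.finite_UN) auto
  note P = tproj[OF tens factor_projection[OF CB], of UNIV]
  let ?P' = "\<lambda>k. tproj tens (E (geom_cell r k)) {t. f t \<le> e / geom_pt r k}"
  note P' = tproj[OF tens factor_projection[OF geom_cell_borel] cell_sets(2)]
  note P1 = tproj[OF tens factor_projection[OF geom_cell_borel] cell_sets(1)]
  note P0 = tproj[OF tens factor_projection, of "{0}" UNIV]
  have split: "tproj tens (E (C N)) UNIV u = tproj tens (E {0}) UNIV u + (\<Sum>k<N. cell_proj k u + ?P' k u)" for N u
  proof (induction N)
    case 0
    then show ?case by (simp add: C_def)
  next
    case (Suc N)
    have "tproj tens (E (C (Suc N))) UNIV = (\<lambda>u. tproj tens (E (C N)) UNIV u + (cell_proj N u + ?P' N u))"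
    proof (rule tens_operator_ext[OF tens])
      show "bounded_clinear (tproj tens (E (C (Suc N))) UNIV)" by (rule P) simp
      show "bounded_clinear (\<lambda>u. tproj tens (E (C N)) UNIV u + (cell_proj N u + ?P' N u))"
        unfolding cell_proj_def by (intro bounded_clinear_add P(4) P1(4) P'(4)) simp
      fix \<xi> and g :: "real \<Rightarrow> complex" assume g: "g \<in> L2_fun"
      have "C N \<inter> geom_cell r N = {}"
        using geom_cell_disjoint[of r] by (auto simp: C_def disjoint_family_on_def geom_cell_def int_decode_eq)
      moreover have "C (Suc N) = C N \<union> geom_cell r N" by (auto simp: C_def lessThan_Suc)
      ultimately have EC: "E (C (Suc N)) \<xi> = E (C N) \<xi> + E (geom_cell r N) \<xi>"
        using pvm_Un[OF tensor_modulus_pvms(2) CB geom_cell_borel] by simp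
      have "(\<lambda>t. indicator {t. e / geom_pt r N < f t} t * g t + indicator {t. f t \<le> e / geom_pt r N} t * g t) = g"
        by (auto simp: indicator_def)
      then have "tens (E (geom_cell r N) \<xi>) g = cell_proj N (tens \<xi> g) + ?P' N (tens \<xi> g)"
        unfolding cell_proj_def
        using tens_add_right[OF tens L2_fun_indicator[OF g cell_sets(1)[of N]] L2_fun_indicator[OF g cell_sets(2)[of N]], of "E (geom_cell r N) \<xi>"]
        by (simp add: P1(3)[OF g] P'(3)[OF g])
      then show "tproj tens (E (C (Suc N))) UNIV (tens \<xi> g) = tproj tens (E (C N)) UNIV (tens \<xi> g) + (cell_proj N (tens \<xi> g) + ?P' N (tens \<xi> g))"
        by (simp add: P(3)[OF _ g] EC tens_add_left[OF tens g])
    qed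
    then show ?case using Suc by (simp add: add.assoc)
  qed
  have lim: "(\<lambda>N. tproj tens (E (C N)) UNIV u) \<longlonglongrightarrow> u" for u
  proof -
    have "(\<lambda>N. tproj tens (E (C N)) UNIV u) \<longlonglongrightarrow> id u"
    proof (rule tens_operator_tendsto[OF tens _ _ bounded_clinear_id])
      show "bounded_clinear (tproj tens (E (C N)) UNIV)" for N by (rule P) simp
      show "norm (tproj tens (E (C N)) UNIV u) \<le> norm u" for N u by (rule projection_opD[OF P(1)]) simp
      fix \<xi> and g :: "real \<Rightarrow> complex" assume g: "g \<in> L2_fun"
      have "(\<lambda>N. pint E (indicator (C N)) \<xi>) \<longlonglongrightarrow> pint E (\<lambda>s. 1) \<xi>"
      proof (rule pint_tendsto[OF tensor_modulus_pvms(2), of _ _ 1])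
        fix s :: real assume "s \<in> {0..}"
        then have "s \<in> {0} \<union> (\<Union>k. geom_cell r k)" unfolding geom_cell_cover by auto
        then obtain N where "s \<in> C (Suc N)" by (auto simp: C_def)
        then have "\<forall>n\<ge>Suc N. indicator (C n) s = (1::real)" by (force simp: C_def indicator_def)
        then show "(\<lambda>n. indicator (C n) s :: real) \<longlonglongrightarrow> 1"
          by (intro tendsto_eventually) (auto simp: eventually_sequentially)
      qed (use CB in \<open>auto split: split_indicator\<close>)
      then have "(\<lambda>N. E (C N) \<xi>) \<longlonglongrightarrow> \<xi>" by (simp add: pint_indicator[OF tensor_modulus_pvms(2) CB] pint_one[OF tensor_modulus_pvms(2)])
      then show "(\<lambda>N. tproj tens (E (C N)) UNIV (tens \<xi> g)) \<longlonglongrightarrow> id (tens \<xi> g)"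
        by (simp add: P(3)[OF _ g] tens_tendsto_left[OF tens g])
    qed
    then show ?thesis by simp
  qed
  have re: "0 < r * e" using r e by simp
  have z1: "?P' k (F {c'<..} v) = 0" for k
    using tproj_spectral_commute[OF geom_cell_borel[of r k] cell_subset(2)[of k] cell_sets(2)[of k], of "{c'<..}" v]
      tproj_below_threshold[OF geom_cell_borel[of r k] cell_subset(2)[of k] cell_sets(2)[of k], where d = "e / geom_pt r k" and c' = c' and v = v]
      geom_pt_pos[of r k] re r c' by simp
  have z0: "tproj tens (E {0}) UNIV (F {c'<..} v) = 0"
    using tproj_spectral_commute[of "{0}" 0 UNIV "{c'<..}" v] tproj_kernel_part[of c' v] re c' by simp
  have "tproj tens (E (C N)) UNIV (F {c'<..} v) = (\<Sum>k<N. cell_proj k (F {c'<..} v))" for N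
    unfolding split z1 z0 by simp
  then show ?thesis unfolding sums_def using lim[of "F {c'<..} v"] by simp
qed

end

end

section \<open>Orlicz functions\<close>

text \<open>Borel even if an Orlicz function, of which only the values on the half-line matter, is not.\<close>

definition half_line_fun :: "(real \<Rightarrow> ennreal) \<Rightarrow> real \<Rightarrow> ennreal" where
  "half_line_fun \<psi> s = (if s < 0 then 0 else \<psi> s)"

context
  fixes \<psi> :: "real \<Rightarrow> ennreal"
  assumes psi: "orlicz_function \<psi>"
begin

lemma orlicz_convex: "0 \<le> u \<Longrightarrow> 0 \<le> v \<Longrightarrow> 0 \<le> r \<Longrightarrow> r \<le> 1 \<Longrightarrow>
    \<psi> ((1 - r) * u + r * v) \<le> ennreal (1 - r) * \<psi> u + ennreal r * \<psi> v"
  using psi unfolding orlicz_function_def by auto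

lemma orlicz_zero: "\<psi> 0 = 0"
  using psi unfolding orlicz_function_def by blast

lemma orlicz_mono:
  assumes "0 \<le> u" "u \<le> v" shows "\<psi> u \<le> \<psi> v"
proof (cases "v = 0")
  case False
  then have v: "0 < v" using assms by simp
  have "\<psi> u = \<psi> ((1 - u / v) * 0 + u / v * v)" using v by simp
  also have "\<dots> \<le> ennreal (1 - u / v) * \<psi> 0 + ennreal (u / v) * \<psi> v"
    by (rule orlicz_convex) (use v assms in auto)
  also have "\<dots> = ennreal (u / v) * \<psi> v" by (simp add: orlicz_zero)
  also have "\<dots> \<le> 1 * \<psi> v"
    by (rule mult_right_mono) (use v assms in \<open>auto simp: ennreal_le_1\<close>)
  finally show ?thesis by simp
qed (use assms in simp)

text \<open>Inside the domain of finiteness this is convexity; at its end point it is the left continuity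
  required of an Orlicz function.\<close>

lemma orlicz_lower_semicontinuous:
  assumes u: "0 < u" and y: "y < \<psi> u"
  shows "\<exists>u'\<ge>0. u' < u \<and> y < \<psi> u'"
proof (cases "\<exists>v>u. \<psi> v < \<infinity>")
  case True
  then obtain v where v: "u < v" "\<psi> v < \<infinity>" by blast
  obtain c where c: "\<psi> v = ennreal c" "0 \<le> c" using v(2) by (cases "\<psi> v") auto
  have "\<psi> u < \<infinity>" using orlicz_mono[of u v] u v by (auto intro: le_less_trans)
  then obtain d where d: "\<psi> u = ennreal d" "0 \<le> d" by (cases "\<psi> u") auto
  have "y < \<infinity>" using y by (metis d(1) ennreal_less_top infinity_ennreal_def less_trans)
  then obtain Y where Y: "y = ennreal Y" "0 \<le> Y" by (cases y) auto
  have Yd: "Y < d" using y Y d by (simp add: ennreal_less_iff)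
  \<comment> \<open>\<open>u\<close> is written as a convex combination of some \<open>u'\<close>
    and the point \<open>v\<close> of finiteness. The first bound on \<open>r\<close> keeps
    \<open>u'\<close> nonnegative, the second makes \<open>r * c\<close> smaller than the gap
    \<open>d - Y\<close>.\<close>
  define r where "r = min (u / (2 * v)) ((d - Y) / (2 * (c + 1)))"
  have r0: "0 < r" using u v Yd c by (simp add: r_def)
  have ru: "r \<le> u / (2 * v)" unfolding r_def by simp
  then have rv: "r * v < u" using u v by (simp add: field_simps)
  have "u / (2 * v) < 1" using u v by (simp add: field_simps)
  then have r1: "r < 1" using ru by linarith
  have "r * (c + 1) \<le> (d - Y) / (2 * (c + 1)) * (c + 1)" using c by (intro mult_right_mono) (auto simp: r_def)
  also have "\<dots> = (d - Y) / 2" using c by (simp add: field_simps)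
  finally have rc: "r * c < d - Y" using r0 Yd by (simp add: algebra_simps)
  define u' where "u' = (u - r * v) / (1 - r)"
  have u': "(1 - r) * u' + r * v = u" using r1 by (simp add: u'_def)
  have u0: "0 \<le> u'" using rv r1 by (simp add: u'_def)
  have "u * r < v * r" using v r0 by simp
  then have uu: "u' < u" using r1 by (simp add: u'_def pos_divide_less_eq algebra_simps)
  have "y < \<psi> u'"
  proof (rule ccontr)
    assume "\<not> y < \<psi> u'"
    then have le: "\<psi> u' \<le> ennreal Y" using Y by simp
    have "ennreal d \<le> ennreal (1 - r) * \<psi> u' + ennreal r * \<psi> v"
      using orlicz_convex[of u' v r] u0 v u r0 r1 unfolding u' d by simp
    also have "\<dots> \<le> ennreal (1 - r) * ennreal Y + ennreal r * ennreal c"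
      unfolding c(1) by (intro add_right_mono mult_left_mono le) simp
    also have "\<dots> = ennreal ((1 - r) * Y + r * c)"
      using r0 r1 Y c by (simp add: ennreal_mult[symmetric] ennreal_plus[symmetric] del: ennreal_plus)
    finally have "d \<le> (1 - r) * Y + r * c" by (subst (asm) ennreal_le_iff) (use r0 r1 Y c in auto)
    also have "\<dots> \<le> Y + r * c" using r0 Y by (simp add: algebra_simps)
    finally show False using rc by simp
  qed
  then show ?thesis using u0 uu by blast
next
  case False
  define F where "F = {u. 0 < u \<and> \<psi> u < \<infinity>}"
  have Fu: "x \<le> u" if "x \<in> F" for x using that False by (force simp: F_def)
  then have bdd: "bdd_above F" by (rule bdd_aboveI)
  have ne: "F \<noteq> {}" using psi unfolding orlicz_function_def F_def by blast
  have S: "Sup F \<le> u" by (rule cSup_least[OF ne Fu])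
  have S0: "0 < Sup F" using ne cSup_upper[OF _ bdd] by (fastforce simp: F_def)
  show ?thesis
  proof (cases "Sup F = u")
    case True
    have "(\<psi> \<longlongrightarrow> \<psi> (Sup F)) (at_left (Sup F))"
      using psi bdd unfolding orlicz_function_def F_def Let_def by blast
    then have "\<forall>\<^sub>F x in at_left u. y < \<psi> x" using y unfolding True by (rule order_tendstoD)
    then obtain b where b: "b < u" "\<forall>x>b. x < u \<longrightarrow> y < \<psi> x"
      unfolding eventually_at_left[OF u] by blast
    then show ?thesis using u by (intro exI[of _ "(max b 0 + u) / 2"]) auto
  next
    case False
    define u' where "u' = (Sup F + u) / 2"
    have u': "Sup F < u'" "u' < u" "0 < u'" using False S S0 by (auto simp: u'_def)
    have "u' \<notin> F" using cSup_upper[OF _ bdd, of u'] u' by auto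
    then have "\<psi> u' = \<infinity>" using u' by (auto simp: F_def less_top[symmetric])
    moreover have "y < \<infinity>" using y by (rule less_le_trans) simp
    ultimately show ?thesis using u' by (intro exI[of _ u']) auto
  qed
qed

lemma orlicz_inverse_pos_bdd:
  assumes "0 < t"
  shows "0 < orlicz_inverse \<psi> t" "bdd_above {s. 0 \<le> s \<and> \<psi> s \<le> ennreal t}"
proof -
  let ?S = "{s. 0 \<le> s \<and> \<psi> s \<le> ennreal t}"
  have "(\<psi> \<longlongrightarrow> \<infinity>) at_top" using psi unfolding orlicz_function_def by blast
  then have "\<forall>\<^sub>F s in at_top. \<psi> s > ennreal t" by (rule order_tendstoD) simp
  then obtain N where N: "\<And>s. s \<ge> N \<Longrightarrow> \<psi> s > ennreal t"
    by (auto simp: eventually_at_top_linorder)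
  show bdd: "bdd_above ?S"
  proof (rule bdd_aboveI[of _ N])
    fix s assume "s \<in> ?S"
    then show "s \<le> N" using N[of s] by (cases "s \<le> N") auto
  qed
  obtain s where s: "0 < s" "\<psi> s \<le> ennreal t" using orlicz_small[OF psi assms] by blast
  then show "0 < orlicz_inverse \<psi> t"
    unfolding orlicz_inverse_def by (intro less_le_trans[OF s(1)] cSup_upper[OF _ bdd]) auto
qed

text \<open>The strict form is where lower semicontinuity enters: a jump of \<psi> at
  \<open>u\<close> from values at most \<open>t\<close> would make the supremum equal to
  \<open>u\<close> although \<psi> exceeds \<open>t\<close> there.\<close>

lemma orlicz_inverse_less_iff:
  assumes t: "0 < t" and u: "0 < u"
  shows "orlicz_inverse \<psi> t < u \<longleftrightarrow> ennreal t < \<psi> u"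
proof
  assume l: "orlicz_inverse \<psi> t < u"
  show "ennreal t < \<psi> u"
  proof (rule ccontr)
    assume "\<not> ennreal t < \<psi> u"
    then have "u \<le> orlicz_inverse \<psi> t" unfolding orlicz_inverse_def
      using u by (intro cSup_upper orlicz_inverse_pos_bdd[OF t]) auto
    then show False using l by simp
  qed
next
  assume "ennreal t < \<psi> u"
  then obtain u' where u': "0 \<le> u'" "u' < u" "ennreal t < \<psi> u'" using orlicz_lower_semicontinuous[OF u] by blast
  have "orlicz_inverse \<psi> t \<le> u'" unfolding orlicz_inverse_def
  proof (rule cSup_least)
    show "{s. 0 \<le> s \<and> \<psi> s \<le> ennreal t} \<noteq> {}" using orlicz_zero by auto
    fix s assume s: "s \<in> {s. 0 \<le> s \<and> \<psi> s \<le> ennreal t}"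
    show "s \<le> u'"
    proof (rule ccontr)
      assume "\<not> s \<le> u'"
      then have "\<psi> u' \<le> \<psi> s" using u' by (intro orlicz_mono) auto
      also have "\<psi> s \<le> ennreal t" using s by simp
      finally show False using u' by simp
    qed
  qed
  then show "orlicz_inverse \<psi> t < u" using u' by simp
qed

lemma fundamental_function_pos: "0 < t \<Longrightarrow> 0 < fundamental_function \<psi> t"
  using orlicz_inverse_pos_bdd(1)[of "1 / t"] by (simp add: fundamental_function_eq[OF psi])

lemma fundamental_function_greater_iff:
  assumes "0 < t" "0 < u"
  shows "1 / u < fundamental_function \<psi> t \<longleftrightarrow> ennreal (1 / t) < \<psi> u"
proof -
  have "1 / u < fundamental_function \<psi> t \<longleftrightarrow> orlicz_inverse \<psi> (1 / t) < u"
    using assms orlicz_inverse_pos_bdd(1)[of "1 / t"] by (simp add: fundamental_function_eq[OF psi] field_simps)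
  then show ?thesis using orlicz_inverse_less_iff[of "1 / t" u] assms by simp
qed

lemma fundamental_function_exp_measurable: "(\<lambda>t. fundamental_function \<psi> (exp t)) \<in> borel_measurable borel"
proof (rule borel_measurable_mono, rule monoI, rule ccontr)
  fix s t :: real assume st: "s \<le> t" and n: "\<not> fundamental_function \<psi> (exp s) \<le> fundamental_function \<psi> (exp t)"
  define u where "u = 1 / fundamental_function \<psi> (exp t)"
  have u: "0 < u" "1 / u = fundamental_function \<psi> (exp t)" using fundamental_function_pos[of "exp t"] by (auto simp: u_def)
  have "ennreal (1 / exp s) < \<psi> u" using n u by (simp add: fundamental_function_greater_iff[symmetric])
  moreover have "ennreal (1 / exp t) \<le> ennreal (1 / exp s)" using st by (intro ennreal_leI) (simp add: frac_le)
  ultimately have "ennreal (1 / exp t) < \<psi> u" by (rule le_less_trans[rotated])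
  then have "1 / u < fundamental_function \<psi> (exp t)"
    using fundamental_function_greater_iff[of "exp t" u] u(1) by simp
  then show False using u by simp
qed

section \<open>Superlevel sets under the weight exp (- t) dt\<close>

lemma nn_integral_exp_minus_atLeast: "(\<integral>\<^sup>+t. ennreal (exp (- t)) * indicator {x..} t \<partial>lborel) = ennreal (exp (- x))"
proof -
  have "(\<integral>\<^sup>+t. ennreal (exp (- t)) * indicator {x..} t \<partial>lborel) = ennreal (0 - (- exp (- x)))"
  proof (rule nn_integral_FTC_atLeast)
    show "((\<lambda>t::real. - exp (- t)) \<longlongrightarrow> 0) at_top"
      using tendsto_minus[OF filterlim_compose[OF exp_at_bot filterlim_uminus_at_bot_at_top]] by simp
    show "((\<lambda>t. - exp (- t)) has_real_derivative exp (- y)) (at y)" for y :: real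
      by (auto intro!: derivative_eq_intros)
  qed auto
  then show ?thesis by simp
qed

text \<open>For finite positive \<open>w\<close> the set is the open ray beyond minus the logarithm
  of \<open>w\<close>, for \<open>w = 0\<close> it is empty, and for infinite \<open>w\<close> it is
  the whole line, of infinite mass.\<close>

lemma nn_integral_exp_superlevel:
  fixes w :: ennreal
  shows "(\<integral>\<^sup>+t. ennreal (indicator {t. ennreal (exp (- t)) < w} t * exp (- t)) \<partial>lborel) = w"
proof (cases w)
  case (real c)
  show ?thesis
  proof (cases "c = 0")
    case False
    then have c: "0 < c" using real by simp
    have "exp (- t) < c \<longleftrightarrow> - ln c < t" for t :: real
      using exp_less_cancel_iff[of "- t" "ln c"] c by (simp add: minus_less_iff)
    then have "{t. ennreal (exp (- t)) < w} = {- ln c<..}" using real c by (auto simp: ennreal_less_iff)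
    moreover have "AE t in lborel. ennreal (indicator {- ln c<..} t * exp (- t)) = ennreal (exp (- t)) * indicator {- ln c..} t"
      by (rule AE_mp[OF AE_lborel_singleton[of "- ln c"]]) (auto simp: indicator_def intro!: AE_I2)
    ultimately have "(\<integral>\<^sup>+t. ennreal (indicator {t. ennreal (exp (- t)) < w} t * exp (- t)) \<partial>lborel)
        = (\<integral>\<^sup>+t. ennreal (exp (- t)) * indicator {- ln c..} t \<partial>lborel)"
      by (simp only: nn_integral_cong_AE)
    also have "\<dots> = w" unfolding nn_integral_exp_minus_atLeast using c real by simp
    finally show ?thesis .
  qed (use real in simp)
next
  case top
  have "ennreal (real n) \<le> (\<integral>\<^sup>+t. ennreal (indicator {t. ennreal (exp (- t)) < w} t * exp (- t)) \<partial>lborel)" for n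
  proof -
    have "real n \<le> exp (real n)" using exp_ge_add_one_self[of "real n"] by linarith
    then have "ennreal (real n) \<le> ennreal (exp (- (- real n)))" by (simp add: ennreal_leI)
    also have "\<dots> = (\<integral>\<^sup>+t. ennreal (exp (- t)) * indicator {- real n..} t \<partial>lborel)"
      by (rule nn_integral_exp_minus_atLeast[symmetric])
    also have "\<dots> \<le> (\<integral>\<^sup>+t. ennreal (indicator {t. ennreal (exp (- t)) < w} t * exp (- t)) \<partial>lborel)"
      by (intro nn_integral_mono) (auto simp: top indicator_def)
    finally show ?thesis .
  qed
  then show ?thesis
    by (metis ennreal_Ex_less_of_nat ennreal_of_nat_eq_real_of_nat leD top top.not_eq_extremum)
qed

lemma fundamental_function_superlevel_integral:
  assumes u: "0 < u"
  shows "(\<integral>\<^sup>+t. ennreal (indicator {t. 1 / u < fundamental_function \<psi> (exp t)} t * exp (- t)) \<partial>lborel) = \<psi> u"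
proof -
  have "{t. 1 / u < fundamental_function \<psi> (exp t)} = {t. ennreal (exp (- t)) < \<psi> u}"
    using u by (auto simp: fundamental_function_greater_iff exp_minus inverse_eq_divide)
  then show ?thesis using nn_integral_exp_superlevel[of "\<psi> u"] by simp
qed

lemma half_line_fun_mono: "mono (half_line_fun \<psi>)"
  by (rule monoI) (auto simp: half_line_fun_def intro: orlicz_mono)

lemma half_line_fun_lower_semicontinuous:
  assumes y: "y < half_line_fun \<psi> u"
  shows "\<exists>u'\<ge>0. u' < u \<and> y < half_line_fun \<psi> u'"
proof -
  have "0 < u" using y orlicz_zero by (cases "u = 0") (auto simp: half_line_fun_def split: if_splits)
  then obtain u' where "0 \<le> u'" "u' < u" "y < \<psi> u'"
    using orlicz_lower_semicontinuous[of u y] y by (auto simp: half_line_fun_def)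
  then show ?thesis by (intro exI[of _ u']) (simp add: half_line_fun_def)
qed

text \<open>Monotonicity and lower semicontinuity from the left make the superlevel sets
  open.\<close>

lemma half_line_fun_measurable: "half_line_fun \<psi> \<in> borel_measurable borel"
proof (rule borel_measurableI_greater)
  fix y
  have "open {x. y < half_line_fun \<psi> x}"
    unfolding open_dist
  proof (intro ballI)
    fix x assume "x \<in> {x. y < half_line_fun \<psi> x}"
    then obtain u' where u': "u' < x" "y < half_line_fun \<psi> u'" using half_line_fun_lower_semicontinuous by blast
    have "y < half_line_fun \<psi> z" if "dist z x < x - u'" for z
    proof -
      have "u' \<le> z" using that by (simp add: dist_real_def)
      then show ?thesis using monoD[OF half_line_fun_mono] u'(2) less_le_trans by blast
    qed
    then show "\<exists>e>0. \<forall>z. dist z x < e \<longrightarrow> z \<in> {x. y < half_line_fun \<psi> x}"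
      using u' by (intro exI[of _ "x - u'"]) auto
  qed
  then show "{x \<in> space borel. y < half_line_fun \<psi> x} \<in> sets borel" by simp
qed

lemma half_line_fun_antimono:
  assumes "0 < x" "x \<le> y"
  shows "half_line_fun \<psi> (s / y) \<le> half_line_fun \<psi> (s / x)"
proof (cases "s < 0")
  case True
  then have "s / y < 0" using assms by (intro divide_neg_pos) auto
  then show ?thesis by (simp add: half_line_fun_def)
next
  case False
  then show ?thesis using assms by (intro monoD[OF half_line_fun_mono] divide_left_mono) auto
qed

text \<open>Left continuity of \<psi> in the form that monotone convergence uses: shrinking the
  argument by factors tending to 1 loses nothing in the supremum.\<close>

lemma half_line_fun_SUP:
  assumes r: "0 < r"
  shows "(SUP n. half_line_fun \<psi> (s / (r * (1 + 1 / real (Suc n))))) = half_line_fun \<psi> (s / r)"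
proof (rule antisym)
  have "r * 1 \<le> r * (1 + 1 / real (Suc n))" for n using r by (intro mult_left_mono) auto
  then show "(SUP n. half_line_fun \<psi> (s / (r * (1 + 1 / real (Suc n))))) \<le> half_line_fun \<psi> (s / r)"
    using r by (intro SUP_least half_line_fun_antimono) auto
  show "half_line_fun \<psi> (s / r) \<le> (SUP n. half_line_fun \<psi> (s / (r * (1 + 1 / real (Suc n)))))"
    unfolding le_SUP_iff
  proof (intro allI impI)
    fix y assume "y < half_line_fun \<psi> (s / r)"
    then obtain u' where u': "0 \<le> u'" "u' < s / r" "y < half_line_fun \<psi> u'" using half_line_fun_lower_semicontinuous by blast
    define w where "w = u' * r"
    have w: "0 \<le> w" "w < s" using u' r by (auto simp: w_def field_simps)
    \<comment> \<open>Division by \<open>w + 1\<close> instead of \<open>w\<close> covers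
      \<open>w = 0\<close>.\<close>
    then have "0 < (s - w) / (w + 1)" by simp
    then obtain n where n: "inverse (real (Suc n)) < (s - w) / (w + 1)" using reals_Archimedean by blast
    then have "inverse (real (Suc n)) * (w + 1) < s - w" using w by (simp add: pos_less_divide_eq)
    moreover have "inverse (real (Suc n)) * w \<le> inverse (real (Suc n)) * (w + 1)" by (intro mult_left_mono) auto
    ultimately have "w + inverse (real (Suc n)) * w \<le> s" by linarith
    then have "w * (1 + 1 / real (Suc n)) \<le> s" by (simp add: algebra_simps inverse_eq_divide)
    then have "u' * (r * (1 + 1 / real (Suc n))) \<le> s" by (simp add: w_def mult.assoc)
    moreover have "0 < r * (1 + 1 / real (Suc n))" using r by (intro mult_pos_pos add_pos_nonneg) auto
    ultimately have "u' \<le> s / (r * (1 + 1 / real (Suc n)))" by (simp add: pos_le_divide_eq)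
    then have "y < half_line_fun \<psi> (s / (r * (1 + 1 / real (Suc n))))"
      using u'(3) monoD[OF half_line_fun_mono] less_le_trans by blast
    then show "\<exists>n\<in>UNIV. y < half_line_fun \<psi> (s / (r * (1 + 1 / real (Suc n))))" by blast
  qed
qed

end

section \<open>The distribution function of the tensor product\<close>

context
  fixes M :: "'h::chilbert op set" and \<tau>M :: "'h op \<Rightarrow> ennreal"
    and tens :: "'h \<Rightarrow> (real \<Rightarrow> complex) \<Rightarrow> 'k::chilbert" and \<tau>A :: "'k op \<Rightarrow> ennreal"
    and a :: "'h unbdd" and \<psi> :: "real \<Rightarrow> ennreal" and f b N S
    and E :: "real set \<Rightarrow> 'h op" and F :: "real set \<Rightarrow> 'k op"
  assumes M: "von_neumann_algebra M" and tauM: "fns_trace M \<tau>M"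
    and tens: "hilbert_tensor_L2 tens" and tauA: "is_tensor_trace tens M \<tau>M \<tau>A"
    and a: "closed_densely_defined_op a" and aff: "affiliated M a" and psi: "orlicz_function \<psi>"
  defines "f \<equiv> \<lambda>t. fundamental_function \<psi> (exp t)"
    and "b \<equiv> closure (cspan (tensor_gen tens a f))"
    and "N \<equiv> vn_tensor_Linf tens M"
    and "S \<equiv> commutant {y. \<exists>x\<in>M. \<exists>f\<in>Linf_fun. is_tensor_op tens x f y}"
    and "E \<equiv> spectral_measure (modulus a)" and "F \<equiv> spectral_measure (modulus b)"
begin

lemma fundamental_exp: "f \<in> borel_measurable borel" "\<forall>t. 0 \<le> f t"
proof -
  show "f \<in> borel_measurable borel" unfolding f_def by (rule fundamental_function_exp_measurable[OF psi])
  show "\<forall>t. 0 \<le> f t"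
    unfolding f_def using fundamental_function_pos[OF psi, OF exp_gt_zero] by (auto intro: less_imp_le)
qed

lemma modulus_pvms: "supported_pvm {0..} E" "supported_pvm {0..} F"
  using tensor_modulus_pvms(2,3)[OF tens a fundamental_exp] unfolding E_def F_def b_def by blast+

lemma spectral_pint_in_algebra: "\<forall>g. bborel g \<longrightarrow> pint E g \<in> M"
  unfolding E_def using affiliated_pint[OF M a aff] by blast

lemma algebra_eq_commutant: "M = commutant (commutant M)" and commutant_bounded: "\<forall>x\<in>commutant M. bounded_clinear x"
  using von_neumann_algebraD(3)[OF M] by (auto intro: commutantD)

lemma tensor_algebra_eq_commutant: "N = commutant S" and tensor_commutant_bounded: "\<forall>x\<in>S. bounded_clinear x"
  unfolding N_def S_def vn_tensor_Linf_def by (auto intro: commutantD)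

lemma normal_weight_tensor: "normal_weight N \<tau>A" and normal_weight_factor: "normal_weight M \<tau>M"
  using tauA tauM by (auto simp: is_tensor_trace_def fns_trace_def N_def)

lemmas tensor_algebra_facts = tensor_algebra_eq_commutant tensor_commutant_bounded normal_weight_tensor
lemmas algebra_facts = algebra_eq_commutant commutant_bounded normal_weight_factor

context
  fixes r e :: real
  assumes r: "1 < r" and e: "0 < e"
begin

lemmas cell_facts = cell_proj_commute[OF tens a fundamental_exp r e, folded b_def F_def]
  cell_proj_low[OF tens a fundamental_exp r e, folded b_def F_def] cell_proj_sums[OF tens a fundamental_exp r e, folded b_def F_def]
  cell_proj_orth[OF tens a fundamental_exp r e] cell_proj_projection[OF tens a fundamental_exp r e]

text \<open>An elementary tensor of a spectral projection with an indicator, so its trace is a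
  product. The level \<open>e / geom_pt r k\<close> is \<open>1 / u\<close> for
  \<open>u = geom_pt r k / e\<close>, which gives the second factor.\<close>

lemma cell_proj_trace: "cell_proj tens a f r e k \<in> pos_part N" "\<tau>A (cell_proj tens a f r e k) = \<tau>M (E (geom_cell r k)) * \<psi> (geom_pt r k / e)"
proof -
  let ?Q = "{t. e / geom_pt r k < f t}"
  have Q: "?Q \<in> sets borel" using fundamental_exp(1) by measurable
  have u: "0 < geom_pt r k / e" using geom_pt_pos[of r k] r e by simp
  have Ep: "E (geom_cell r k) \<in> pos_part M"
    by (rule pvm_pos_part[OF algebra_facts modulus_pvms(1) spectral_pint_in_algebra geom_cell_borel])
  have "is_tensor_op tens (E (geom_cell r k)) (indicator ?Q) (cell_proj tens a f r e k)"
    unfolding cell_proj_def[OF tens a fundamental_exp r e] E_def[symmetric]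
    by (rule tproj(2)[OF tens pvm_projection[OF _ geom_cell_borel] Q])
      (use modulus_pvms in \<open>simp add: supported_pvm_def\<close>)
  then have t: "is_tensor_op tens (E (geom_cell r k)) (\<lambda>t. complex_of_real (indicator ?Q t)) (cell_proj tens a f r e k)"
    by (simp add: of_real_indicator)
  have "bounded (range (\<lambda>t. complex_of_real (indicator ?Q t)))"
    by (rule boundedI[of _ 1]) (auto simp: indicator_def)
  then have L: "(\<lambda>t. complex_of_real (indicator ?Q t)) \<in> Linf_fun" using Q by (auto simp: Linf_fun_def)
  have "cell_proj tens a f r e k \<in> N" unfolding N_def vn_tensor_Linf_def
  proof (rule commutantI)
    show "bounded_clinear (cell_proj tens a f r e k)" by (rule projection_opD(1)[OF cell_facts(5)])
    fix x v assume "x \<in> commutant {y. \<exists>x\<in>M. \<exists>f\<in>Linf_fun. is_tensor_op tens x f y}"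
    moreover have "cell_proj tens a f r e k \<in> {y. \<exists>x\<in>M. \<exists>f\<in>Linf_fun. is_tensor_op tens x f y}"
      using t L pos_partD(1)[OF Ep] by blast
    ultimately show "cell_proj tens a f r e k (x v) = x (cell_proj tens a f r e k v)" by (rule commutantD(2)[symmetric])
  qed
  then show "cell_proj tens a f r e k \<in> pos_part N" by (rule pos_partI[OF _ projection_op_positive[OF cell_facts(5)]])
  have "bounded (range (indicator ?Q :: real \<Rightarrow> real))"
    by (rule boundedI[of _ 1]) (auto simp: indicator_def)
  then have "\<tau>A (cell_proj tens a f r e k) = \<tau>M (E (geom_cell r k)) * (\<integral>\<^sup>+t. ennreal (indicator ?Q t * exp (- t)) \<partial>lborel)"
    using tauA Ep t Q unfolding is_tensor_trace_def by (simp add: indicator_pos_le)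
  also have "(\<integral>\<^sup>+t. ennreal (indicator ?Q t * exp (- t)) \<partial>lborel) = \<psi> (geom_pt r k / e)"
    using fundamental_function_superlevel_integral[OF psi u] by (simp add: f_def)
  finally show "\<tau>A (cell_proj tens a f r e k) = \<tau>M (E (geom_cell r k)) * \<psi> (geom_pt r k / e)" .
qed

end

lemma tail_projection: "projection_op (F {c<..})"
  using modulus_pvms(2) by (intro pvm_projection) (auto simp: supported_pvm_def)

lemma tail_right_continuous: "(\<lambda>n. F {c + 1 / real (Suc n)<..} v) \<longlonglongrightarrow> F {c<..} v"
proof -
  have "(\<lambda>n. pint F (indicator {c + 1 / real (Suc n)<..}) v) \<longlonglongrightarrow> pint F (indicator {c<..}) v"
  proof (rule pint_tendsto[OF modulus_pvms(2), of _ _ 1])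
    fix s :: real
    show "(\<lambda>n. indicator {c + 1 / real (Suc n)<..} s :: real) \<longlonglongrightarrow> indicator {c<..} s"
    proof (cases "c < s")
      case True
      have "(\<lambda>n. c + 1 / real (Suc n)) \<longlonglongrightarrow> c + 0" by (intro tendsto_add tendsto_const LIMSEQ_Suc[OF lim_1_over_n])
      then have "\<forall>\<^sub>F n in sequentially. c + 1 / real (Suc n) < s" using True by (intro order_tendstoD) auto
      then have "\<forall>\<^sub>F n in sequentially. indicator {c + 1 / real (Suc n)<..} s = (indicator {c<..} s :: real)"
        by eventually_elim (use True in auto)
      then show ?thesis by (rule tendsto_eventually)
    next
      case False
      have "0 \<le> 1 / real (Suc n)" for n by simp
      then have "\<not> c + 1 / real (Suc n) < s" for n using False by (smt (verit))
      then have "(\<lambda>n. indicator {c + 1 / real (Suc n)<..} s :: real) = (\<lambda>n. indicator {c<..} s)"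
        using False by (auto simp: fun_eq_iff indicator_def)
      then show ?thesis by simp
    qed
  qed (auto split: split_indicator)
  then show ?thesis by (simp add: pint_indicator[OF modulus_pvms(2)])
qed

text \<open>The cell projections lie below \<open>F {c<..}\<close> and exhaust \<open>F {c'<..}\<close>, so an operator commuting
  with them maps the range of \<open>F {c'<..}\<close> into that of \<open>F {c<..}\<close>, and the kernel of \<open>F {c<..}\<close> into
  that of \<open>F {c'<..}\<close>; then let \<open>c'\<close> decrease to \<open>c\<close>.\<close>

lemma tail_commute_approx:
  assumes c: "0 < c" "c < c'" and x: "bounded_clinear x" "\<And>r e k v. 1 < r \<Longrightarrow> 0 < e \<Longrightarrow> x (cell_proj tens a f r e k v) = cell_proj tens a f r e k (x v)"
  shows "F {c<..} (x (F {c'<..} v)) = x (F {c'<..} v)" "F {c'<..} (x v) = F {c'<..} (x (F {c<..} v))"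
proof -
  \<comment> \<open>With the cube root, \<open>c < c * r = e\<close> and
    \<open>r * e = c * r ^ 2 < c * r ^ 3 = c'\<close>, which leaves room on both sides.\<close>
  define r where "r = root 3 (c' / c)"
  have r: "1 < r" unfolding r_def using c by simp
  have r3: "r ^ 3 = c' / c" unfolding r_def using c by (intro real_root_pow_pos2) auto
  define e where "e = c * r"
  have e: "0 < e" "c < e" using c r by (auto simp: e_def)
  have "r * e < r * e * r" using r e by simp
  also have "\<dots> = c * r ^ 3" by (simp add: e_def power3_eq_cube)
  also have "\<dots> = c'" using c by (simp add: r3)
  finally have re: "r * e < c'" .
  note low = cell_facts(2)[OF r e(1) less_imp_le[OF c(1)] e(2)]
  note xP = x(2)[OF r e(1)]
  have Fb: "bounded_clinear (F {c<..})" by (rule projection_opD(1)[OF tail_projection])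
  have bl: "bounded_linear x" "bounded_linear (F {c<..})" using x(1) Fb by (auto simp: bounded_clinear_def)
  have "(\<lambda>k. x (cell_proj tens a f r e k (F {c'<..} v))) sums x (F {c'<..} v)"
    by (rule bounded_linear.sums[OF bl(1) cell_facts(3)[OF r e(1) re]])
  moreover from bounded_linear.sums[OF bl(2) this]
  have "(\<lambda>k. x (cell_proj tens a f r e k (F {c'<..} v))) sums F {c<..} (x (F {c'<..} v))" by (simp add: xP low)
  ultimately show "F {c<..} (x (F {c'<..} v)) = x (F {c'<..} v)" using sums_unique2 by blast
  have "cell_proj tens a f r e k (x v) = cell_proj tens a f r e k (x (F {c<..} v))" for k
  proof -
    have "cell_proj tens a f r e k (F {c<..} v) = cell_proj tens a f r e k v" using cell_facts(1)[OF r e(1), of "{c<..}" k v] low by simp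
    then show ?thesis by (metis xP)
  qed
  moreover have lim: "(\<lambda>k. F {c'<..} (cell_proj tens a f r e k w)) sums F {c'<..} w" for w
    using cell_facts(3)[OF r e(1) re, of w] cell_facts(1)[OF r e(1), of "{c'<..}"] by simp
  ultimately have "(\<lambda>k. F {c'<..} (cell_proj tens a f r e k (x v))) sums F {c'<..} (x (F {c<..} v))" by simp
  with lim show "F {c'<..} (x v) = F {c'<..} (x (F {c<..} v))" by (rule sums_unique2)
qed

text \<open>As the upper threshold decreases to \<open>c\<close> in both approximations,
  \<open>x\<close> is seen to map the range and the kernel of \<open>F {c<..}\<close> into
  themselves, hence to commute with it. This takes the place of affiliation of \<open>b\<close> with
  the tensor product algebra.\<close>

lemma tail_in_tensor_algebra:
  assumes c: "0 < c"
  shows "F {c<..} \<in> pos_part N"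
proof (rule pos_partI[OF _ projection_op_positive[OF tail_projection]])
  show "F {c<..} \<in> N" unfolding tensor_algebra_eq_commutant
  proof (rule commutantI)
    show "bounded_clinear (F {c<..})" by (rule projection_opD(1)[OF tail_projection])
    fix x v assume x: "x \<in> S"
    have bx: "bounded_clinear x" using x tensor_commutant_bounded by blast
    have xP: "x (cell_proj tens a f r e k v) = cell_proj tens a f r e k (x v)" if "1 < r" "0 < e" for r e k v
      using commutantD(2)[of "cell_proj tens a f r e k" S x v] pos_partD(1)[OF cell_proj_trace(1)[OF that]] x unfolding tensor_algebra_eq_commutant by simp
    have c': "c < c + 1 / real (Suc n)" for n by simp
    note ap = tail_commute_approx[OF c c' bx xP]
    note lim = tail_right_continuous[of c]
    have "(\<lambda>n. x (F {c + 1 / real (Suc n)<..} v)) \<longlonglongrightarrow> x (F {c<..} v)"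
      by (rule bounded_clinear_tendsto[OF bx lim])
    moreover from bounded_clinear_tendsto[OF projection_opD(1)[OF tail_projection] this, of c]
    have "(\<lambda>n. x (F {c + 1 / real (Suc n)<..} v)) \<longlonglongrightarrow> F {c<..} (x (F {c<..} v))" by (simp only: ap(1))
    ultimately have 1: "F {c<..} (x (F {c<..} v)) = x (F {c<..} v)" using LIMSEQ_unique by blast
    have "F {c + 1 / real (Suc n)<..} (x v) = F {c + 1 / real (Suc n)<..} (x (F {c<..} v))" for n
      by (rule ap(2))
    then have "(\<lambda>n. F {c + 1 / real (Suc n)<..} (x v)) \<longlonglongrightarrow> F {c<..} (x (F {c<..} v))"
      by (simp only: lim)
    then have "F {c<..} (x v) = F {c<..} (x (F {c<..} v))" using lim LIMSEQ_unique by blast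
    then show "F {c<..} (x v) = x (F {c<..} v)" using 1 by simp
  qed
qed

definition cell_sum :: "real \<Rightarrow> real \<Rightarrow> ennreal" where
  "cell_sum r e = (\<Sum>k. \<tau>M (E (geom_cell r k)) * \<psi> (geom_pt r k / e))"

text \<open>Above \<open>c\<close> the tail is the sum of its commuting products with the cell
  projections, each dominated by its cell projection.\<close>

lemma trace_tail_le_cell_sum:
  assumes r: "1 < r" and e: "0 < e" and c: "r * e < c"
  shows "\<tau>A (F {c<..}) \<le> cell_sum r e"
proof -
  have c0: "0 < c" using mult_pos_pos[of r e] r e c by linarith
  note Fp = tail_projection[of c]
  have cm: "cell_proj tens a f r e k (F {c<..} v) = F {c<..} (cell_proj tens a f r e k v)" for k v by (rule cell_facts(1)[OF r e]) simp
  have pr: "projection_op (cell_proj tens a f r e k \<circ> F {c<..})" for k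
    by (rule projection_op_commuting[OF cell_facts(5)[OF r e] Fp]) (rule cm)
  have inN: "cell_proj tens a f r e k \<circ> F {c<..} \<in> pos_part N" for k
  proof (rule pos_partI[OF _ projection_op_positive[OF pr]])
    show "cell_proj tens a f r e k \<circ> F {c<..} \<in> N"
      using pos_partD(1)[OF cell_proj_trace(1)[OF r e, of k]] pos_partD(1)[OF tail_in_tensor_algebra[OF c0]]
      unfolding tensor_algebra_eq_commutant by (rule commutant_mult)
  qed
  have le: "\<tau>A (cell_proj tens a f r e k \<circ> F {c<..}) \<le> \<tau>A (cell_proj tens a f r e k)" for k
    by (rule normal_weight_mono[OF tensor_algebra_facts inN cell_proj_trace(1)[OF r e] projection_op_leI[OF pr cell_facts(5)[OF r e]]])
      (simp add: projection_opD(3)[OF cell_facts(5)[OF r e]])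
  have "\<tau>A (F {c<..}) = (\<Sum>k. \<tau>A (cell_proj tens a f r e k \<circ> F {c<..}))"
    using cell_facts(3)[OF r e c] by (intro normal_weight_countable_sum[OF tensor_algebra_facts inN] pos_partD(1)[OF tail_in_tensor_algebra[OF c0]]) (simp add: o_def)
  also have "\<dots> \<le> (\<Sum>k. \<tau>A (cell_proj tens a f r e k))"
    by (intro suminf_le le) auto
  finally show ?thesis by (simp add: cell_proj_trace(2)[OF r e] cell_sum_def)
qed

text \<open>Finitely many of the orthogonal cell projections add up to a projection below the tail;
  the series is the supremum of these partial sums.\<close>

lemma cell_sum_le_trace_tail:
  assumes r: "1 < r" and c: "0 < c" "c < e"
  shows "cell_sum r e \<le> \<tau>A (F {c<..})"
proof -
  have e: "0 < e" using c by simp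
  have "(\<Sum>k<n. \<tau>A (cell_proj tens a f r e k)) \<le> \<tau>A (F {c<..})" for n
  proof -
    let ?s = "\<lambda>v. \<Sum>k<n. cell_proj tens a f r e k v"
    have s: "?s \<in> pos_part N" "\<tau>A ?s = (\<Sum>k<n. \<tau>A (cell_proj tens a f r e k))"
      using normal_weight_sum[OF tensor_algebra_facts, of "{..<n}" "cell_proj tens a f r e"] cell_proj_trace(1)[OF r e] by auto
    have sp: "projection_op ?s" by (rule projection_op_sum) (auto simp: cell_facts(5)[OF r e] cell_facts(4)[OF r e])
    interpret bounded_linear "F {c<..}" using projection_opD(1)[OF tail_projection] by (simp add: bounded_clinear_def)
    have "F {c<..} (?s v) = ?s v" for v using cell_facts(2)[OF r e, of c] c by (simp add: sum)
    then have "op_le ?s (F {c<..})" by (rule projection_op_leI[OF sp tail_projection])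
    then show ?thesis using normal_weight_mono[OF tensor_algebra_facts s(1) tail_in_tensor_algebra[OF c(1)]] s(2) by simp
  qed
  then show ?thesis
    unfolding cell_sum_def cell_proj_trace(2)[OF r e, symmetric] suminf_eq_SUP by (rule SUP_least)
qed

definition scaled_integral :: "real \<Rightarrow> ennreal" where
  "scaled_integral c = (\<integral>\<^sup>+s. half_line_fun \<psi> (s / c) \<partial>scalar_measure \<tau>M E)"

lemma half_line_fun_scaled_measurable [measurable]: "(\<lambda>s. half_line_fun \<psi> (s / c)) \<in> borel_measurable borel"
  using half_line_fun_measurable[OF psi] by measurable

text \<open>On a cell the left end \<open>geom_pt r k\<close> lies between \<open>s / r\<close> and
  \<open>s\<close>, so by monotonicity the step function lies between the two dilated
  integrands.\<close>

lemma cell_sum_bounds: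
  assumes r: "1 < r" and e: "0 < e"
  shows "scaled_integral (r * e) \<le> cell_sum r e" "cell_sum r e \<le> scaled_integral e"
proof -
  let ?\<mu> = "scalar_measure \<tau>M E" and ?g = "\<lambda>s. \<Sum>k. \<psi> (geom_pt r k / e) * indicator (geom_cell r k) s"
  have [measurable]: "geom_cell r k \<in> sets borel" for k by (rule geom_cell_borel)
  have "cell_sum r e = (\<Sum>k. \<integral>\<^sup>+s. \<psi> (geom_pt r k / e) * indicator (geom_cell r k) s \<partial>?\<mu>)"
    unfolding cell_sum_def
    by (simp add: nn_integral_cmult_indicator emeasure_scalar_measure[OF algebra_facts modulus_pvms(1) spectral_pint_in_algebra] mult.commute[of "\<tau>M _"])
  also have "\<dots> = (\<integral>\<^sup>+s. ?g s \<partial>?\<mu>)" by (rule nn_integral_suminf[symmetric]) measurable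
  finally have eq: "cell_sum r e = (\<integral>\<^sup>+s. ?g s \<partial>?\<mu>)" .
  have pt: "half_line_fun \<psi> (s / (r * e)) \<le> ?g s \<and> ?g s \<le> half_line_fun \<psi> (s / e)" for s
  proof (cases "0 < s")
    case True
    then obtain k where k: "s \<in> geom_cell r k" using geom_cell_cover[of r] by blast
    have g: "?g s = \<psi> (geom_pt r k / e)" by (rule suminf_cmult_indicator[OF geom_cell_disjoint k])
    note b = geom_cell_bounds[OF r k] geom_pt_pos[of r k]
    have "s / (r * e) \<le> geom_pt r k / e" "geom_pt r k / e \<le> s / e"
      using b r e by (auto simp: field_simps)
    then have "half_line_fun \<psi> (s / (r * e)) \<le> half_line_fun \<psi> (geom_pt r k / e)"
      "half_line_fun \<psi> (geom_pt r k / e) \<le> half_line_fun \<psi> (s / e)"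
      by (auto intro: monoD[OF half_line_fun_mono[OF psi]])
    moreover have "half_line_fun \<psi> (geom_pt r k / e) = \<psi> (geom_pt r k / e)"
      using divide_pos_pos[of "geom_pt r k" e] b r e unfolding half_line_fun_def by (smt (verit))
    ultimately show ?thesis by (simp add: g)
  next
    case False
    then have "s \<notin> geom_cell r k" for k by (auto simp: geom_cell_def)
    then have "?g s = 0" by simp
    moreover have "half_line_fun \<psi> (s / (r * e)) \<le> half_line_fun \<psi> 0"
      using False r e by (intro monoD[OF half_line_fun_mono[OF psi]]) (auto simp: divide_nonpos_pos)
    ultimately show ?thesis using orlicz_zero[OF psi] by (simp add: half_line_fun_def)
  qed
  show "scaled_integral (r * e) \<le> cell_sum r e" "cell_sum r e \<le> scaled_integral e"
    unfolding eq scaled_integral_def using pt by (auto intro: nn_integral_mono)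
qed

lemma trace_tail_le_integral:
  assumes c: "0 < c" "c < c'"
  shows "\<tau>A (F {c'<..}) \<le> scaled_integral c"
proof -
  \<comment> \<open>Then \<open>r * c < r * r * c = c'\<close>, the slack demanded by
    \<open>trace_tail_le_cell_sum\<close> with \<open>e = c\<close>.\<close>
  define r where "r = sqrt (c' / c)"
  have r: "1 < r" using c by (simp add: r_def)
  have "r * c < r * c * r" using r c by simp
  also have "\<dots> = r * r * c" by (simp only: mult_ac)
  also have "\<dots> = c'" using c by (simp add: r_def)
  finally have "\<tau>A (F {c'<..}) \<le> cell_sum r c" by (rule trace_tail_le_cell_sum[OF r c(1)])
  also have "\<dots> \<le> scaled_integral c" by (rule cell_sum_bounds[OF r c(1)])
  finally show ?thesis .
qed

lemma integral_le_trace_tail: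
  assumes c: "0 < c" "c < c'"
  shows "scaled_integral c' \<le> \<tau>A (F {c<..})"
proof -
  \<comment> \<open>Here \<open>e = r * c\<close>, so that \<open>c < e\<close> and
    \<open>r * e = c'\<close>.\<close>
  define r where "r = sqrt (c' / c)"
  have r: "1 < r" using c by (simp add: r_def)
  have rr: "r * (r * c) = c'" using c by (simp add: r_def mult.assoc[symmetric])
  have e: "c < r * c" using r c by simp
  then have e0: "0 < r * c" using c by linarith
  have "scaled_integral c' \<le> cell_sum r (r * c)" using cell_sum_bounds(1)[OF r e0] by (simp only: rr)
  also have "\<dots> \<le> \<tau>A (F {c<..})" by (rule cell_sum_le_trace_tail[OF r c(1) e])
  finally show ?thesis .
qed

text \<open>The two estimates miss each other by the slack between \<open>c\<close> and
  \<open>c'\<close>. On one side right continuity of the tails and normality of the trace remove it,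
  on the other \<open>half_line_fun_SUP\<close> and monotone convergence.\<close>

theorem trace_tail_eq_integral:
  assumes c: "0 < c"
  shows "\<tau>A (F {c<..}) = scaled_integral c"
proof (rule antisym)
  have "\<tau>A (F {c<..}) = (SUP n. \<tau>A (F {c + 1 / real (Suc n)<..}))"
  proof (rule normal_weight_seq[OF tensor_algebra_facts])
    show "F {c + 1 / real (Suc n)<..} \<in> pos_part N" for n by (rule tail_in_tensor_algebra) (use c in \<open>simp add: add_pos_pos\<close>)
    show "op_le (F {c + 1 / real (Suc n)<..}) (F {c + 1 / real (Suc (Suc n))<..})" for n
    proof (rule projection_op_leI[OF tail_projection tail_projection])
      have "1 / real (Suc (Suc n)) \<le> 1 / real (Suc n)" by (simp add: frac_le)
      then have "{c + 1 / real (Suc (Suc n))<..} \<inter> {c + 1 / real (Suc n)<..} = {c + 1 / real (Suc n)<..}" by auto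
      then show "F {c + 1 / real (Suc (Suc n))<..} (F {c + 1 / real (Suc n)<..} v) = F {c + 1 / real (Suc n)<..} v" for v
        using pvm_Int[of F "{c + 1 / real (Suc (Suc n))<..}" "{c + 1 / real (Suc n)<..}" v] modulus_pvms(2)
        by (simp add: supported_pvm_def)
    qed
    show "(\<lambda>n. F {c + 1 / real (Suc n)<..} v) \<longlonglongrightarrow> F {c<..} v" for v by (rule tail_right_continuous)
    show "F {c<..} \<in> N" by (rule pos_partD(1)[OF tail_in_tensor_algebra[OF c]])
  qed
  also have "\<dots> \<le> scaled_integral c"
    by (rule SUP_least, rule trace_tail_le_integral[OF c]) simp
  finally show "\<tau>A (F {c<..}) \<le> scaled_integral c" .
  have "scaled_integral c = (\<integral>\<^sup>+s. (SUP n. half_line_fun \<psi> (s / (c * (1 + 1 / real (Suc n))))) \<partial>scalar_measure \<tau>M E)"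
    unfolding scaled_integral_def by (simp only: half_line_fun_SUP[OF psi c])
  also have "\<dots> = (SUP n. scaled_integral (c * (1 + 1 / real (Suc n))))"
    unfolding scaled_integral_def
  proof (rule nn_integral_monotone_convergence_SUP)
    show "incseq (\<lambda>n s. half_line_fun \<psi> (s / (c * (1 + 1 / real (Suc n)))))"
    proof (rule incseq_SucI, rule le_funI)
      fix n s
      have "1 / real (Suc (Suc n)) \<le> 1 / real (Suc n)" by (simp add: frac_le)
      then show "half_line_fun \<psi> (s / (c * (1 + 1 / real (Suc n)))) \<le> half_line_fun \<psi> (s / (c * (1 + 1 / real (Suc (Suc n)))))"
        using c by (intro half_line_fun_antimono[OF psi] mult_left_mono mult_pos_pos add_pos_pos add_left_mono) auto
    qed
    show "(\<lambda>s. half_line_fun \<psi> (s / (c * (1 + 1 / real (Suc n))))) \<in> borel_measurable (scalar_measure \<tau>M E)" for n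
      by measurable
  qed
  also have "\<dots> \<le> \<tau>A (F {c<..})"
  proof (rule SUP_least, rule integral_le_trace_tail[OF c])
    fix n
    have "0 < c * (1 / real (Suc n))" using c by (intro mult_pos_pos) auto
    then show "c < c * (1 + 1 / real (Suc n))" by (simp add: distrib_left)
  qed
  finally show "scaled_integral c \<le> \<tau>A (F {c<..})" .
qed

text \<open>The spectral measure of |a| is carried by the half-line, so for every normal functional
  \<psi> may be replaced by its Borel version, and \<open>ext_weight\<close> consults normal
  functionals only.\<close>

lemma ext_weight_eq_integral:
  assumes c: "0 < c"
  shows "ext_weight M \<tau>M (ext_fun_calc (\<lambda>u. \<psi> (u / c)) (modulus a)) = scaled_integral c"
proof -
  have "(\<integral>\<^sup>+s. \<psi> (s / c) \<partial>scalar_measure \<omega> E) = (\<integral>\<^sup>+s. half_line_fun \<psi> (s / c) \<partial>scalar_measure \<omega> E)"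
    if "normal_functional M \<omega>" for \<omega>
  proof (rule nn_integral_cong_AE, rule AE_mp)
    show "AE s in scalar_measure \<omega> E. s \<in> {0..}"
      by (rule scalar_measure_AE[OF algebra_eq_commutant commutant_bounded _ modulus_pvms(1) spectral_pint_in_algebra])
        (use that in \<open>simp add: normal_functional_def\<close>)
    show "AE s in scalar_measure \<omega> E. s \<in> {0..} \<longrightarrow> \<psi> (s / c) = half_line_fun \<psi> (s / c)"
      using c by (intro AE_I2) (simp add: half_line_fun_def divide_less_0_iff)
  qed
  then have "ext_weight M \<tau>M (ext_fun_calc (\<lambda>u. \<psi> (u / c)) (modulus a))
      = ext_weight M \<tau>M (\<lambda>\<omega>. \<integral>\<^sup>+s. half_line_fun \<psi> (s / c) \<partial>scalar_measure \<omega> E)"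
    unfolding ext_weight_def ext_fun_calc_def E_def[symmetric] by (metis (mono_tags, lifting))
  also have "\<dots> = scaled_integral c" unfolding scaled_integral_def
    by (rule ext_weight_fun_calc[OF M tauM modulus_pvms(1) spectral_pint_in_algebra]) measurable
  finally show ?thesis .
qed

lemma distribution_function_eq:
  assumes "0 < c"
  shows "distribution_function \<tau>A c (tensor_unbdd tens a (\<lambda>t. complex_of_real (fundamental_function \<psi> (exp t))))
    = ext_weight M \<tau>M (ext_fun_calc (\<lambda>u. \<psi> (u / c)) (modulus a))"
  unfolding ext_weight_eq_integral[OF assms] trace_tail_eq_integral[OF assms, symmetric]
  by (simp add: distribution_function_def tensor_unbdd_gen F_def b_def f_def)

end

theorem theorem2p2:
  fixes M :: "'h::chilbert op set"
    and \<tau>M :: "'h op \<Rightarrow> ennreal"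
    and tens :: "'h \<Rightarrow> (real \<Rightarrow> complex) \<Rightarrow> 'k::chilbert"
    and \<tau>A :: "'k op \<Rightarrow> ennreal"
    and a :: "'h unbdd"
    and \<psi> :: "real \<Rightarrow> ennreal"
    and \<epsilon> :: real
  assumes "von_neumann_algebra M"
    and "fns_trace M \<tau>M"
    and "hilbert_tensor_L2 tens"
    and "is_tensor_trace tens M \<tau>M \<tau>A"
    and "closed_densely_defined_op a"
    and "affiliated M a"
    and "orlicz_function \<psi>"
    and "0 < \<epsilon>"
  shows "distribution_function \<tau>A \<epsilon>
           (tensor_unbdd tens a (\<lambda>t. complex_of_real (fundamental_function \<psi> (exp t))))
       = ext_weight M \<tau>M (ext_fun_calc (\<lambda>u. \<psi> (u / \<epsilon>)) (modulus a))"
  using assms by (rule distribution_function_eq)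

end
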